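(* Let $1\le p,q<\infty$, $R>0$ and $0\le\theta\le1$. Consider the inequality $$(\ast)\qquad \|f\|_{L^q(\mathbb{R}^N)}^{1-\theta}\,\|\nabla f\|_{L^p(\mathbb{R}^N)}^{\theta}\le K\,\mathscr{E}_{1,p}(f)\qquad\text{for each } f\in W^{1,p}(\mathbb{R}^N)\text{ supported in }B(0,R).$$ (1) In the case where $q\le p$, $(\ast)$ holds for some finite constant $K=K_{p,q,\theta,R,N}$ if and only if $\theta\le 1/N$. (2) In the case where $q\ge p$, $(\ast)$ holds for some finite constant $K=K_{p,q,\theta,R,N}$ if and only if $$0\le\theta\le\frac{1/N+1/q-1/p}{1+1/q-1/p}.$$
   Context: $N\ge2$ is an integer; $B(0,R)$ is the Euclidean ball of radius $R$ centered at $0$ in $\mathbb{R}^N$; $W^{1,p}(\mathbb{R}^N)$ is the usual Sobolev space of $f\in L^p$ with $\nabla f\in L^p$. With $\mathscr{H}^{N-1}$ the $(N-1)$-dimensional Hausdorff measure and $\sigma_N=\mathscr{H}^{N-1}(\mathbb{S}^{N-1})$, $$\mathscr{E}_{1,p}(f)=\sigma_N^{(N+p)/(Np)}\Big(\int_{\mathbb{S}^{N-1}}\Big(\int_{\mathbb{R}^N}|\nabla f(x)\cdot\xi|^p\,dx\Big)^{-N/p}d\mathscr{H}^{N-1}(\xi)\Big)^{-1/N},$$ with the conventions that a negative power of $0$ is $\infty$ and a negative power of $\infty$ is $0$. *)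

theory Defs
  imports "HOL-Analysis.Analysis"
begin

section \<open>Real powers on the extended nonnegative reals\<close>

text \<open>A negative power of \<open>0\<close> is \<open>\<infinity>\<close> and a negative power of \<open>\<infinity>\<close> is \<open>0\<close>;
  the power with exponent \<open>0\<close> is always \<open>1\<close>.\<close>

definition ennpowr :: "ennreal \<Rightarrow> real \<Rightarrow> ennreal" where
  "ennpowr x a =
    (if a = 0 then 1
     else if x = 0 then (if a < 0 then top else 0)
     else if x = top then (if a < 0 then 0 else top)
     else ennreal (enn2real x powr a))"

section \<open>Hausdorff measure\<close>

text \<open>The normalising factor \<open>unit_ball_vol s / 2 powr s\<close> makes the \<open>n\<close>-dimensional Hausdorff
  measure on an \<open>n\<close>-dimensional Euclidean space agree with Lebesgue measure. The empty set has
  to be singled out because of the case \<open>s = 0\<close>.\<close>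

definition hausdorff_gauge :: "real \<Rightarrow> 'a::metric_space set \<Rightarrow> ennreal" where
  "hausdorff_gauge s C =
    (if C = {} then 0
     else ennreal (unit_ball_vol s / 2 powr s) * ennpowr (ennreal (diameter C)) s)"

text \<open>\<^const>\<open>diameter\<close> is real-valued and meaningless on unbounded sets, so boundedness of the
  covering sets is required explicitly.\<close>

definition hausdorff_covers :: "real \<Rightarrow> 'a::metric_space set \<Rightarrow> (nat \<Rightarrow> 'a set) set" where
  "hausdorff_covers \<delta> A =
    {C. A \<subseteq> (\<Union>i. C i) \<and> (\<forall>i. bounded (C i) \<and> diameter (C i) \<le> \<delta>)}"

definition hausdorff_pre :: "real \<Rightarrow> real \<Rightarrow> 'a::metric_space set \<Rightarrow> ennreal" where
  "hausdorff_pre s \<delta> A = (INF C \<in> hausdorff_covers \<delta> A. \<Sum>i. hausdorff_gauge s (C i))"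

definition hausdorff_outer :: "real \<Rightarrow> 'a::metric_space set \<Rightarrow> ennreal" where
  "hausdorff_outer s A = (SUP \<delta>\<in>{0<..}. hausdorff_pre s \<delta> A)"

text \<open>\<^const>\<open>measure_of\<close> would yield the zero measure if \<open>hausdorff_outer s\<close> were not countably
  additive on the Borel sets; \<open>emeasure_hausdorff\<close> below shows that it is.\<close>

definition hausdorff_measure :: "real \<Rightarrow> 'a::metric_space measure" where
  "hausdorff_measure s = measure_of UNIV (sets borel) (hausdorff_outer s)"

lemma hausdorff_pre_empty:
  assumes "0 < \<delta>"
  shows "hausdorff_pre s \<delta> ({} :: 'a::metric_space set) = 0"
proof -
  have "(\<lambda>_. {} :: 'a set) \<in> hausdorff_covers \<delta> {}"
    using assms by (auto simp: hausdorff_covers_def)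
  then have "hausdorff_pre s \<delta> ({} :: 'a set) \<le> (\<Sum>i. hausdorff_gauge s ({} :: 'a set))"
    unfolding hausdorff_pre_def by (rule INF_lower2) simp
  then show ?thesis by (simp add: hausdorff_gauge_def)
qed

lemma hausdorff_pre_mono: "A \<subseteq> B \<Longrightarrow> hausdorff_pre s \<delta> A \<le> hausdorff_pre s \<delta> B"
  unfolding hausdorff_pre_def
  by (rule INF_superset_mono) (auto simp: hausdorff_covers_def)

lemma hausdorff_pre_antimono: "\<delta> \<le> \<delta>' \<Longrightarrow> hausdorff_pre s \<delta>' A \<le> hausdorff_pre s \<delta> A"
  unfolding hausdorff_pre_def
  by (rule INF_superset_mono) (auto simp: hausdorff_covers_def intro: order_trans)

lemma hausdorff_pre_UN: "hausdorff_pre s \<delta> (\<Union>i. A i) \<le> (\<Sum>n. hausdorff_pre s \<delta> (A n))"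
proof (rule ennreal_le_epsilon)
  fix e :: real assume "0 < e" and fin: "(\<Sum>n. hausdorff_pre s \<delta> (A n)) < top"
  have "\<exists>C. C \<in> hausdorff_covers \<delta> (A n) \<and>
      (\<Sum>i. hausdorff_gauge s (C i)) \<le> hausdorff_pre s \<delta> (A n) + e * (1/2)^Suc n" for n
  proof -
    have "hausdorff_pre s \<delta> (A n) < top"
      using fin by (metis ennreal_suminf_lessD)
    moreover have "0 < e * (1/2)^Suc n" using \<open>0 < e\<close> by simp
    ultimately have "hausdorff_pre s \<delta> (A n) < hausdorff_pre s \<delta> (A n) + ennreal (e * (1/2)^Suc n)"
      by (cases "hausdorff_pre s \<delta> (A n)") (auto simp: ennreal_plus[symmetric] ennreal_less_iff simp del: ennreal_plus)
    then show ?thesis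
      unfolding hausdorff_pre_def INF_less_iff by (meson less_imp_le)
  qed
  then obtain C where C: "\<And>n. C n \<in> hausdorff_covers \<delta> (A n)"
    and le: "\<And>n. (\<Sum>i. hausdorff_gauge s (C n i)) \<le> hausdorff_pre s \<delta> (A n) + e * (1/2)^Suc n"
    by metis
  define D where "D = case_prod C \<circ> prod_decode"
  have "D \<in> hausdorff_covers \<delta> (\<Union>i. A i)"
  proof -
    have "(\<Union>i. A i) \<subseteq> (\<Union>i. D i)"
    proof
      fix x assume "x \<in> (\<Union>i. A i)"
      then obtain n i where "x \<in> C n i" using C unfolding hausdorff_covers_def by blast
      then have "x \<in> D (prod_encode (n, i))" by (simp add: D_def)
      then show "x \<in> (\<Union>i. D i)" by blast
    qed
    then show ?thesis
      using C by (auto simp: hausdorff_covers_def D_def split_beta)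
  qed
  then have "hausdorff_pre s \<delta> (\<Union>i. A i) \<le> (\<Sum>i. hausdorff_gauge s (D i))"
    unfolding hausdorff_pre_def by (rule INF_lower)
  also have "\<dots> = (\<Sum>n. \<Sum>i. hausdorff_gauge s (C n i))"
    using suminf_ennreal_2dimen[of "\<lambda>n. \<Sum>i. hausdorff_gauge s (C n i)" "\<lambda>(n,i). hausdorff_gauge s (C n i)"]
    by (simp add: D_def comp_def split_beta)
  also have "\<dots> \<le> (\<Sum>n. hausdorff_pre s \<delta> (A n) + e * (1/2)^Suc n)"
    using le by (intro suminf_le) auto
  also have "\<dots> = (\<Sum>n. hausdorff_pre s \<delta> (A n)) + (\<Sum>n. ennreal (e * (1/2)^Suc n))"
    by (intro suminf_add[symmetric]) auto
  also have "(\<Sum>n. ennreal (e * (1/2)^Suc n)) = ennreal e"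
  proof -
    have "(\<lambda>n. e * (1/2)^Suc n) sums e"
      using power_half_series[THEN sums_mult[of _ _ e]] by simp
    then show ?thesis
      using \<open>0 < e\<close> by (subst suminf_ennreal_eq) auto
  qed
  finally show "hausdorff_pre s \<delta> (\<Union>i. A i) \<le> (\<Sum>n. hausdorff_pre s \<delta> (A n)) + ennreal e" .
qed

lemma hausdorff_outer_mono: "A \<subseteq> B \<Longrightarrow> hausdorff_outer s A \<le> hausdorff_outer s B"
  by (auto simp: hausdorff_outer_def intro!: SUP_mono' hausdorff_pre_mono)

lemma hausdorff_outer_UN: "hausdorff_outer s (\<Union>i. A i) \<le> (\<Sum>i. hausdorff_outer s (A (i::nat)))"
  unfolding hausdorff_outer_def[of s "\<Union>i. A i"]
proof (rule SUP_least)
  fix \<delta> :: real assume \<delta>: "\<delta> \<in> {0<..}"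
  have "hausdorff_pre s \<delta> (\<Union>i. A i) \<le> (\<Sum>n. hausdorff_pre s \<delta> (A n))"
    by (rule hausdorff_pre_UN)
  also have "\<dots> \<le> (\<Sum>i. hausdorff_outer s (A i))"
    using \<delta> by (intro suminf_le) (auto simp: hausdorff_outer_def intro: SUP_upper)
  finally show "hausdorff_pre s \<delta> (\<Union>i. A i) \<le> (\<Sum>i. hausdorff_outer s (A i))" .
qed

lemma outer_measure_space_hausdorff: "outer_measure_space (Pow UNIV) (hausdorff_outer s)"
  unfolding outer_measure_space_def positive_def increasing_def countably_subadditive_def
  by (auto intro: hausdorff_outer_mono hausdorff_outer_UN
      simp: hausdorff_outer_def[of s "{}"] hausdorff_pre_empty)

lemma hausdorff_outer_empty [simp]: "hausdorff_outer s {} = 0"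
  using outer_measure_space_hausdorff[of s] by (auto simp: outer_measure_space_def positive_def)

lemma hausdorff_outer_Un: "hausdorff_outer s (A \<union> B) \<le> hausdorff_outer s A + hausdorff_outer s B"
proof -
  have "hausdorff_outer s (\<Union>i. binaryset A B i) \<le> (\<Sum>i. hausdorff_outer s (binaryset A B i))"
    by (rule hausdorff_outer_UN)
  then show ?thesis
    by (simp add: UN_binaryset_eq suminf_binaryset_eq)
qed

lemma hausdorff_outer_separated:
  assumes d: "0 < d" and sep: "\<And>x y. x \<in> A \<Longrightarrow> y \<in> B \<Longrightarrow> d \<le> dist x y"
  shows "hausdorff_outer s A + hausdorff_outer s B \<le> hausdorff_outer s (A \<union> B)"
proof -
  have main: "hausdorff_pre s \<delta> A + hausdorff_pre s \<delta> B \<le> hausdorff_pre s \<delta> (A \<union> B)"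
    if "\<delta> < d" for \<delta>
    unfolding hausdorff_pre_def[of s \<delta> "A \<union> B"]
  proof (rule INF_greatest)
    fix C assume C: "C \<in> hausdorff_covers \<delta> (A \<union> B)"
    define CA where "CA i = (if C i \<inter> A = {} then {} else C i)" for i
    define CB where "CB i = (if C i \<inter> B = {} then {} else C i)" for i
    have "0 \<le> \<delta>"
      using C by (auto simp: hausdorff_covers_def intro: order_trans[OF diameter_ge_0])
    have "CA \<in> hausdorff_covers \<delta> A" "CB \<in> hausdorff_covers \<delta> B"
      using C \<open>0 \<le> \<delta>\<close> by (fastforce simp: hausdorff_covers_def CA_def CB_def)+
    then have "hausdorff_pre s \<delta> A + hausdorff_pre s \<delta> B
        \<le> (\<Sum>i. hausdorff_gauge s (CA i)) + (\<Sum>i. hausdorff_gauge s (CB i))"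
      unfolding hausdorff_pre_def by (intro add_mono INF_lower)
    also have "\<dots> = (\<Sum>i. hausdorff_gauge s (CA i) + hausdorff_gauge s (CB i))"
      by (intro suminf_add) auto
    also have "\<dots> \<le> (\<Sum>i. hausdorff_gauge s (C i))"
    proof (intro suminf_le)
      fix i
      have "C i \<inter> A = {} \<or> C i \<inter> B = {}"
      proof (rule ccontr)
        assume "\<not> ?thesis"
        then obtain x y where "x \<in> C i" "x \<in> A" "y \<in> C i" "y \<in> B" by blast
        then have "d \<le> diameter (C i)"
          using sep C diameter_bounded_bound[of "C i" x y]
          by (force simp: hausdorff_covers_def)
        then show False
          using C \<open>\<delta> < d\<close> by (auto simp: hausdorff_covers_def dest!: spec[of _ i])
      qed
      then show "hausdorff_gauge s (CA i) + hausdorff_gauge s (CB i) \<le> hausdorff_gauge s (C i)"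
        by (auto simp: CA_def CB_def hausdorff_gauge_def)
    qed auto
    finally show "hausdorff_pre s \<delta> A + hausdorff_pre s \<delta> B \<le> (\<Sum>i. hausdorff_gauge s (C i))" .
  qed
  have "hausdorff_outer s A + hausdorff_outer s B
      = (SUP \<delta>\<in>{0<..}. hausdorff_pre s \<delta> A + hausdorff_pre s \<delta> B)"
    unfolding hausdorff_outer_def
  proof (rule SUP_add_directed_ennreal[symmetric])
    fix i j :: real assume "i \<in> {0<..}" "j \<in> {0<..}"
    then show "\<exists>k\<in>{0<..}. hausdorff_pre s i A + hausdorff_pre s j B
        \<le> hausdorff_pre s k A + hausdorff_pre s k B"
      by (intro bexI[of _ "min i j"] add_mono hausdorff_pre_antimono) auto
  qed
  also have "\<dots> \<le> hausdorff_outer s (A \<union> B)"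
  proof (rule SUP_least)
    fix \<delta> :: real assume "\<delta> \<in> {0<..}"
    have "hausdorff_pre s \<delta> A + hausdorff_pre s \<delta> B
        \<le> hausdorff_pre s (min \<delta> (d/2)) A + hausdorff_pre s (min \<delta> (d/2)) B"
      by (intro add_mono hausdorff_pre_antimono) auto
    also have "\<dots> \<le> hausdorff_pre s (min \<delta> (d/2)) (A \<union> B)"
      using d by (intro main) auto
    also have "\<dots> \<le> hausdorff_outer s (A \<union> B)"
      unfolding hausdorff_outer_def using d \<open>\<delta> \<in> {0<..}\<close> by (intro SUP_upper) auto
    finally show "hausdorff_pre s \<delta> A + hausdorff_pre s \<delta> B \<le> hausdorff_outer s (A \<union> B)" .
  qed
  finally show ?thesis .
qed


lemma closed_in_hausdorff_lambda_system:
  fixes F :: "'a::metric_space set"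
  assumes "closed F"
  shows "hausdorff_outer s (A \<inter> F) + hausdorff_outer s (A - F) \<le> hausdorff_outer s A"
proof (cases "F = {} \<or> hausdorff_outer s A = top")
  case True
  then show ?thesis by auto
next
  case False
  then have ne: "F \<noteq> {}" and fin: "hausdorff_outer s A < top"
    by (auto simp: less_top)
  define r where "r n = 1 / real (Suc n)" for n
  have r_pos: "0 < r n" for n by (simp add: r_def)
  have r_mono: "m \<le> n \<Longrightarrow> r n \<le> r m" for m n by (simp add: r_def frac_le)
  have r_less: "m < n \<Longrightarrow> r n < r m" for m n by (simp add: r_def frac_less2)
  define G where "G n = {x\<in>A. r n \<le> infdist x F}" for n
  define S where "S n = {x\<in>A. r (Suc n) \<le> infdist x F \<and> infdist x F < r n}" for n
  have S_sep: "r (Suc i) - r j \<le> dist x y" if "x \<in> S i" "infdist y F < r j" for i j x y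
    using infdist_triangle[of x F y] that by (auto simp: S_def dist_commute)
  have bound: "(\<Sum>i<n. hausdorff_outer s (S (2*i+c))) \<le> hausdorff_outer s A" for n c
  proof -
    have "(\<Sum>i<n. hausdorff_outer s (S (2*i+c))) \<le> hausdorff_outer s (\<Union>i<n. S (2*i+c))"
    proof (induction n)
      case 0
      show ?case by simp
    next
      case (Suc n)
      have "hausdorff_outer s (\<Union>i<n. S (2*i+c)) + hausdorff_outer s (S (2*n+c))
          \<le> hausdorff_outer s ((\<Union>i<n. S (2*i+c)) \<union> S (2*n+c))"
      proof (cases n)
        case (Suc m)
        show ?thesis
        proof (rule hausdorff_outer_separated)
          show "0 < r (Suc (2*m+c)) - r (2*n+c)"
            using r_less[of "Suc (2*m+c)" "2*n+c"] Suc by simp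
          fix x y assume "x \<in> (\<Union>i<n. S (2*i+c))" and y: "y \<in> S (2*n+c)"
          then obtain i where i: "i < n" "x \<in> S (2*i+c)" by auto
          have "r (Suc (2*m+c)) \<le> r (Suc (2*i+c))"
            using i Suc by (intro r_mono) auto
          moreover have "r (Suc (2*i+c)) - r (2*n+c) \<le> dist x y"
            using y by (intro S_sep i) (auto simp: S_def)
          ultimately show "r (Suc (2*m+c)) - r (2*n+c) \<le> dist x y" by linarith
        qed
      qed simp
      moreover have "(\<Union>i<n. S (2*i+c)) \<union> S (2*n+c) = (\<Union>i<Suc n. S (2*i+c))"
        by (auto simp: lessThan_Suc)
      ultimately have "hausdorff_outer s (\<Union>i<n. S (2*i+c)) + hausdorff_outer s (S (2*n+c))
          \<le> hausdorff_outer s (\<Union>i<Suc n. S (2*i+c))"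
        by (simp only:)
      with add_right_mono[OF Suc.IH, of "hausdorff_outer s (S (2*n+c))"] show ?case
        unfolding sum.lessThan_Suc by (rule order_trans)
    qed
    also have "\<dots> \<le> hausdorff_outer s A"
      by (rule hausdorff_outer_mono) (auto simp: S_def)
    finally show ?thesis .
  qed
  have "(\<Sum>i<n. hausdorff_outer s (S i)) \<le> hausdorff_outer s A + hausdorff_outer s A" for n
  proof -
    have "(\<Sum>i<n. hausdorff_outer s (S i)) \<le> (\<Sum>i<2*n. hausdorff_outer s (S i))"
      by (intro sum_mono2) auto
    also have "\<dots> = (\<Sum>i<n. hausdorff_outer s (S (2*i+0))) + (\<Sum>i<n. hausdorff_outer s (S (2*i+1)))"
      by (induction n) (auto simp: algebra_simps)
    also have "\<dots> \<le> hausdorff_outer s A + hausdorff_outer s A"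
      by (intro add_mono bound)
    finally show ?thesis .
  qed
  then have "(\<Sum>i. hausdorff_outer s (S i)) \<le> hausdorff_outer s A + hausdorff_outer s A"
    by (intro suminf_le_const summableI)
  then have fin_sum: "(\<Sum>i. hausdorff_outer s (S i)) \<noteq> top"
    using fin by (metis ennreal_add_eq_top less_top neq_top_trans)
  have tail: "(\<lambda>n. \<Sum>i. hausdorff_outer s (S (i + n))) \<longlonglongrightarrow> 0"
  proof -
    define g where "g i = enn2real (hausdorff_outer s (S i))" for i
    have g: "hausdorff_outer s (S i) = ennreal (g i)" for i
      using fin hausdorff_outer_mono[of "S i" A s]
      by (auto simp: g_def S_def ennreal_enn2real_if top_unique)
    have nonneg: "0 \<le> g i" for i by (simp add: g_def)
    have sum: "summable g"
      using fin_sum nonneg unfolding g by (intro summable_suminf_not_top) auto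
    have "(\<lambda>n. ennreal (\<Sum>i. g (i + n))) \<longlonglongrightarrow> ennreal 0"
      by (intro tendsto_ennrealI suminf_exist_split2 sum)
    moreover have "(\<Sum>i. hausdorff_outer s (S (i + n))) = ennreal (\<Sum>i. g (i + n))" for n
      unfolding g using nonneg sum by (intro suminf_ennreal2) (auto simp: summable_iff_shift)
    ultimately show ?thesis by simp
  qed
  have step: "hausdorff_outer s (A \<inter> F) + hausdorff_outer s (A - F)
      \<le> hausdorff_outer s A + (\<Sum>i. hausdorff_outer s (S (i + n)))" for n
  proof -
    have "A - F \<subseteq> G n \<union> (\<Union>i. S (i + n))"
    proof
      fix x assume x: "x \<in> A - F"
      then have pos: "0 < infdist x F"
        using assms ne by (simp add: infdist_pos_not_in_closed)
      show "x \<in> G n \<union> (\<Union>i. S (i + n))"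
      proof (cases "r n \<le> infdist x F")
        case False
        obtain m where "r m < infdist x F"
          using pos by (metis nat_approx_posE r_def)
        then have ex: "r m \<le> infdist x F" by simp
        define k where "k = (LEAST m. r m \<le> infdist x F)"
        have k: "r k \<le> infdist x F" unfolding k_def using ex by (rule LeastI)
        have "n < k" using False k r_mono[of k n] by force
        then obtain j where j: "k = Suc (j + n)" by (metis add.commute less_natE)
        have "\<not> r (j + n) \<le> infdist x F"
          using not_less_Least[of "j + n" "\<lambda>m. r m \<le> infdist x F"] j by (simp add: k_def)
        then have "x \<in> S (j + n)" using k j x by (auto simp: S_def)
        then show ?thesis by blast
      qed (use x in \<open>auto simp: G_def\<close>)
    qed
    then have "hausdorff_outer s (A - F) \<le> hausdorff_outer s (G n \<union> (\<Union>i. S (i + n)))"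
      by (rule hausdorff_outer_mono)
    also have "\<dots> \<le> hausdorff_outer s (G n) + (\<Sum>i. hausdorff_outer s (S (i + n)))"
      by (intro order_trans[OF hausdorff_outer_Un] add_left_mono hausdorff_outer_UN)
    finally have "hausdorff_outer s (A \<inter> F) + hausdorff_outer s (A - F)
        \<le> (hausdorff_outer s (A \<inter> F) + hausdorff_outer s (G n)) + (\<Sum>i. hausdorff_outer s (S (i + n)))"
      by (simp add: add.assoc add_left_mono)
    also have "hausdorff_outer s (A \<inter> F) + hausdorff_outer s (G n)
        \<le> hausdorff_outer s ((A \<inter> F) \<union> G n)"
    proof (rule hausdorff_outer_separated[OF r_pos[of n]])
      fix x y assume "x \<in> A \<inter> F" "y \<in> G n"
      then show "r n \<le> dist x y"
        using infdist_le[of x F y] by (auto simp: G_def dist_commute)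
    qed
    also have "\<dots> \<le> hausdorff_outer s A"
      by (rule hausdorff_outer_mono) (auto simp: G_def)
    finally show ?thesis by (simp add: add_right_mono)
  qed
  have "(\<lambda>n. hausdorff_outer s A + (\<Sum>i. hausdorff_outer s (S (i + n))))
      \<longlonglongrightarrow> hausdorff_outer s A + 0"
    by (intro tendsto_add tail tendsto_const)
  then show ?thesis
    using step by (intro LIMSEQ_le_const[where X = "\<lambda>n. hausdorff_outer s A + (\<Sum>i. hausdorff_outer s (S (i + n)))"]) auto
qed

theorem emeasure_hausdorff:
  fixes A :: "'a::metric_space set"
  assumes "A \<in> sets borel"
  shows "emeasure (hausdorff_measure s) A = hausdorff_outer s A"
proof -
  interpret P: sigma_algebra UNIV "Pow UNIV :: 'a set set" by (rule sigma_algebra_Pow)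
  define L where "L = lambda_system UNIV (Pow UNIV :: 'a set set) (hausdorff_outer s)"
  have L: "measure_space UNIV L (hausdorff_outer s)"
    unfolding L_def by (rule P.caratheodory_lemma[OF outer_measure_space_hausdorff])
  have "F \<in> L" if "closed F" for F
    unfolding L_def P.lambda_system_eq
  proof (clarsimp, intro antisym)
    fix A
    show "hausdorff_outer s (A \<inter> F) + hausdorff_outer s (A - F) \<le> hausdorff_outer s A"
      by (rule closed_in_hausdorff_lambda_system[OF that])
    show "hausdorff_outer s A \<le> hausdorff_outer s (A \<inter> F) + hausdorff_outer s (A - F)"
      using hausdorff_outer_Un[of s "A \<inter> F" "A - F"] by (simp add: Int_Diff_Un)
  qed
  then have "sigma_sets UNIV (Collect closed) \<subseteq> L"
    using L by (intro sigma_algebra.sigma_sets_subset) (auto simp: measure_space_def)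
  then have sub: "sets borel \<subseteq> L"
    by (simp add: borel_eq_closed)
  have "measure_space UNIV (sets (borel :: 'a measure)) (hausdorff_outer s)"
  proof -
    have "sigma_algebra UNIV (sets (borel :: 'a measure))"
      by (metis sets.sigma_algebra_axioms space_borel)
    moreover have "countably_additive (sets (borel :: 'a measure)) (hausdorff_outer s)"
      unfolding countably_additive_def
    proof (intro allI impI)
      fix B :: "nat \<Rightarrow> 'a set"
      assume B: "range B \<subseteq> sets borel" "disjoint_family B" "(\<Union>i. B i) \<in> sets borel"
      then have "range B \<subseteq> L" "(\<Union>i. B i) \<in> L"
        using sub by (blast intro: order_trans, blast)
      then show "(\<Sum>i. hausdorff_outer s (B i)) = hausdorff_outer s (\<Union>i. B i)"
        using L B(2) by (simp add: measure_space_def countably_additive_def)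
    qed
    ultimately show ?thesis
      by (simp add: measure_space_def positive_def)
  qed
  then show ?thesis
    unfolding hausdorff_measure_def
    using assms by (intro emeasure_measure_of_sigma) (auto simp: measure_space_def)
qed

lemma sets_hausdorff_measure [measurable_cong, simp]: "sets (hausdorff_measure s) = sets borel"
  unfolding hausdorff_measure_def by (metis sets.sets_measure_of_eq space_borel)

lemma space_hausdorff_measure [simp]: "space (hausdorff_measure s) = UNIV"
  unfolding hausdorff_measure_def by (simp add: space_measure_of_conv)

section \<open>Lebesgue norms and Sobolev spaces\<close>

definition Lp_norm :: "real \<Rightarrow> ('a::euclidean_space \<Rightarrow> 'b::euclidean_space) \<Rightarrow> ennreal" where
  "Lp_norm p f = ennpowr (\<integral>\<^sup>+x. ennreal (norm (f x) powr p) \<partial>lebesgue) (1 / p)"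

definition Lp_space :: "real \<Rightarrow> ('a::euclidean_space \<Rightarrow> 'b::euclidean_space) set" where
  "Lp_space p = {f \<in> borel_measurable lebesgue. Lp_norm p f < top}"

primrec iter_partial ::
    "'a::euclidean_space list \<Rightarrow> ('a \<Rightarrow> real) \<Rightarrow> 'a \<Rightarrow> real" where
  "iter_partial [] \<phi> = \<phi>"
| "iter_partial (b # bs) \<phi> = (\<lambda>x. frechet_derivative (iter_partial bs \<phi>) (at x) b)"

text \<open>\<open>C\<^sup>\<infinity>\<close> functions: all iterated partial derivatives exist and are differentiable (hence
  continuous).\<close>

definition smooth :: "('a::euclidean_space \<Rightarrow> real) \<Rightarrow> bool" where
  "smooth \<phi> \<longleftrightarrow> (\<forall>bs. set bs \<subseteq> Basis \<longrightarrow> (\<forall>x. iter_partial bs \<phi> differentiable (at x)))"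

definition test_function :: "('a::euclidean_space \<Rightarrow> real) \<Rightarrow> bool" where
  "test_function \<phi> \<longleftrightarrow> smooth \<phi> \<and> compact (closure {x. \<phi> x \<noteq> 0})"

definition locally_integrable :: "('a::euclidean_space \<Rightarrow> 'b::euclidean_space) \<Rightarrow> bool" where
  "locally_integrable f \<longleftrightarrow> (\<forall>K. compact K \<longrightarrow> set_integrable lebesgue K f)"

definition has_weak_gradient :: "('a::euclidean_space \<Rightarrow> real) \<Rightarrow> ('a \<Rightarrow> 'a) \<Rightarrow> bool" where
  "has_weak_gradient f g \<longleftrightarrow>
    locally_integrable f \<and> locally_integrable g \<and>
    (\<forall>\<phi>. test_function \<phi> \<longrightarrow>
      (\<forall>b\<in>Basis. (\<integral>x. f x * frechet_derivative \<phi> (at x) b \<partial>lebesgue)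
                = - (\<integral>x. (g x \<bullet> b) * \<phi> x \<partial>lebesgue)))"

text \<open>The weak gradient is unique up to null sets, so the choice of representative is
  immaterial below.\<close>

definition weak_gradient :: "('a::euclidean_space \<Rightarrow> real) \<Rightarrow> 'a \<Rightarrow> 'a" where
  "weak_gradient f = (SOME g. has_weak_gradient f g)"

definition sobolev_space :: "real \<Rightarrow> ('a::euclidean_space \<Rightarrow> real) set" where
  "sobolev_space p =
    {f \<in> Lp_space p. \<exists>g \<in> Lp_space p. has_weak_gradient f g}"

definition supported_in :: "('a::euclidean_space \<Rightarrow> real) \<Rightarrow> 'a set \<Rightarrow> bool" where
  "supported_in f S \<longleftrightarrow> (AE x in lebesgue. x \<notin> S \<longrightarrow> f x = 0)"

section \<open>The affine energy\<close>

abbreviation sphere_measure :: "'a::euclidean_space measure" where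
  "sphere_measure \<equiv> hausdorff_measure (real (DIM('a)) - 1)"

definition affine_energy :: "real \<Rightarrow> ('a::euclidean_space \<Rightarrow> real) \<Rightarrow> ennreal" where
  "affine_energy p f =
    (let N = real (DIM('a)); \<sigma> = emeasure sphere_measure (sphere (0::'a) 1) in
      ennpowr \<sigma> ((N + p) / (N * p)) *
      ennpowr
        (\<integral>\<^sup>+\<xi> \<in> sphere (0::'a) 1.
           ennpowr (\<integral>\<^sup>+x. ennreal (\<bar>weak_gradient f x \<bullet> \<xi>\<bar> powr p) \<partial>lebesgue) (- N / p)
         \<partial>sphere_measure)
        (- 1 / N))"

end

theory Submission
  imports Defs
begin

text \<open>Write \<open>N\<close> for the dimension and, for a Sobolev function \<open>f\<close>, let \<open>Q \<xi>\<close> be the norm in \<open>Lp\<close> of the derivative of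
  \<open>f\<close> in the direction \<open>\<xi>\<close>. Up to a constant, the affine energy is the integral of \<open>Q\<close> to the power
  \<open>- N\<close> over the unit sphere, raised to the power \<open>- 1 / N\<close>. As \<open>Q\<close> is a norm, this is comparable with the
  volume of its unit ball to the power \<open>- 1 / N\<close>, and hence with the geometric mean of the
  numbers \<open>Q\<close> takes on the axes of a suitable ellipsoid. The axes are found by a greedy choice: minimise \<open>Q\<close>
  over the unit vectors orthogonal to the ones found before (\<open>exists_adapted_rotation\<close>). In the resulting
  orthonormal frame \<open>T b\<close> the energy is at least a multiple of the geometric mean of the numbers
  \<open>Q (T b)\<close> (\<open>affine_energy_ge\<close>).

  Sufficiency. The norm of the gradient is at most a multiple of the largest of these numbers, and the norm of \<open>f\<close> in
  \<open>Lq\<close> is at most a multiple of \<open>(MIN b. Q (T b)) powr (1 - N * s) * (\<Prod>b. Q (T b)) powr s\<close>, where \<open>s = max 0 (1 / p - 1 / q)\<close>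
  (\<open>norm_bound_geometric\<close>). For \<open>q \<le> p\<close> this follows from the Poincare inequality in a single direction. For
  \<open>p \<le> q\<close> it is an anisotropic Gagliardo--Nirenberg inequality, proved for \<open>C1\<close> functions with the
  Loomis--Whitney inequality (\<open>gagliardo_nirenberg_C1\<close>) and extended to Sobolev functions by mollification and
  Fatou's lemma. The largest of \<open>N\<close> positive numbers is at most their product divided by the smallest one to the power \<open>N - 1\<close>, so the
  left side of the inequality is at most a multiple of the geometric mean as soon as \<open>\<theta> * N * (1 - s) \<le> 1 - N * s\<close>
  (\<open>geometric_interpolation\<close>). This is the condition on \<open>\<theta>\<close> in both parts.

  Necessity. The test functions are products of bumps in the coordinates, with \<open>m\<close> bumps of width \<open>1 / k\<close> in one coordinate
  direction \<open>b0\<close> and a single wide bump in every other. Their derivative in the direction \<open>b0\<close> is larger than the others by the factor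
  \<open>k\<close>, but the affine energy hardly sees it: for \<open>\<xi>\<close> in the strip \<open>|\<xi> \<bullet> b0| \<le> 1 / k\<close> of the sphere, of measure about
  \<open>1 / k\<close>, the number \<open>Q \<xi>\<close> is at most a multiple of \<open>(m / k) powr (1 / p)\<close>, so the energy is at most a multiple of
  \<open>(m / k) powr (1 / p) * k powr (1 / N)\<close> (\<open>affine_energy_le\<close>). Letting \<open>k\<close> tend to infinity with \<open>m = k\<close> gives \<open>\<theta> \<le> 1 / N\<close>, and with
  \<open>m = 1\<close> it gives \<open>\<theta> * (1 + 1 / q - 1 / p) \<le> 1 / N + 1 / q - 1 / p\<close> (\<open>affine_inequality_necessary\<close>).

  The surface measure on the sphere is the Hausdorff measure, of which only a comparison up to constants with the volume of
  cones is used (\<open>hausdorff_outer_le_cone\<close>, \<open>cone_le_hausdorff_outer\<close>). Weak gradients are handled through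
  Borel representatives, which are unique up to null sets by the fundamental lemma of the calculus of variations.\<close>

section \<open>Powers of extended nonnegative reals and Hoelder's inequality\<close>

lemma ennpowr_ennreal: "0 < x \<Longrightarrow> ennpowr (ennreal x) a = ennreal (x powr a)"
  by (auto simp: ennpowr_def ennreal_eq_0_iff)

lemma ennpowr_0_pos: "0 < a \<Longrightarrow> ennpowr 0 a = 0" by (simp add: ennpowr_def)
lemma ennpowr_top_pos: "0 < a \<Longrightarrow> ennpowr top a = top" by (simp add: ennpowr_def)
lemma ennpowr_exp_0 [simp]: "ennpowr x 0 = 1" by (simp add: ennpowr_def)

lemma ennpowr_ennreal_pos: "0 \<le> x \<Longrightarrow> 0 < a \<Longrightarrow> ennpowr (ennreal x) a = ennreal (x powr a)"
  by (auto simp: ennpowr_def ennreal_eq_0_iff)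

lemma ennpowr_1 [simp]: "ennpowr x 1 = x"
  by (cases x) (auto simp: ennpowr_def ennreal_eq_0_iff)

lemma ennpowr_mono: assumes "x \<le> y" "0 \<le> a" shows "ennpowr x a \<le> ennpowr y a"
proof (cases "a = 0")
  case False
  then have a: "0 < a" using assms by simp
  show ?thesis
    using assms(1) a
    by (cases x; cases y) (auto simp: ennpowr_ennreal_pos ennpowr_top_pos top_unique intro!: ennreal_leI powr_mono2)
qed simp

lemma ennpowr_antimono: assumes "x \<le> y" "a \<le> 0" shows "ennpowr y a \<le> ennpowr x a"
proof (cases "a = 0 \<or> x = 0 \<or> y = top")
  case True then show ?thesis using assms by (auto simp: ennpowr_def)
next
  case False
  then obtain u v where "x = ennreal u" "y = ennreal v" "0 < u" "0 < v"
    using assms(1) by (cases x; cases y) (auto simp: top_unique ennreal_eq_0_iff)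
  then show ?thesis using assms
    by (auto simp: ennpowr_ennreal intro!: ennreal_leI powr_mono2')
qed

lemma ennpowr_mult: assumes "0 \<le> a" shows "ennpowr (x * y) a = ennpowr x a * ennpowr y a"
proof (cases "a = 0")
  case False
  then have a: "0 < a" using assms by simp
  show ?thesis
  proof (cases "x = 0 \<or> y = 0 \<or> x = top \<or> y = top")
    case True then show ?thesis using a
      by (auto simp: ennpowr_def ennreal_mult_eq_top_iff ennreal_mult_top ennreal_top_mult enn2real_eq_0_iff)
  next
    case False
    then obtain u v where "x = ennreal u" "y = ennreal v" "0 < u" "0 < v"
      by (cases x; cases y) (auto simp: top_unique ennreal_eq_0_iff)
    then show ?thesis
      by (simp add: ennpowr_ennreal powr_mult flip: ennreal_mult')
  qed
qed simp

lemma ennpowr_ennpowr: assumes "0 < a" "0 < b" shows "ennpowr (ennpowr x a) b = ennpowr x (a * b)"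
  using assms by (cases x) (auto simp: ennpowr_ennreal_pos ennpowr_top_pos powr_powr)

lemma ennpowr_add: assumes "0 < a" "0 < b" shows "ennpowr x (a + b) = ennpowr x a * ennpowr x b"
  using assms by (cases x) (auto simp: ennpowr_ennreal_pos ennpowr_top_pos powr_add ennreal_mult')

lemma ennpowr_measurable [measurable]: "(\<lambda>x. ennpowr x a) \<in> borel_measurable borel"
  unfolding ennpowr_def by measurable

lemma ennpowr_eq_0_iff: "0 < a \<Longrightarrow> ennpowr x a = 0 \<longleftrightarrow> x = 0"
  by (cases x) (auto simp: ennpowr_ennreal_pos ennpowr_top_pos)

lemma ennpowr_less_top: "0 < a \<Longrightarrow> x < top \<Longrightarrow> ennpowr x a < top"
  by (cases x) (auto simp: ennpowr_ennreal_pos ennpowr_top_pos)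

text \<open>Convexity of the exponential function, applied to the logarithms.\<close>

lemma weighted_am_gm:
  fixes x a :: "'i \<Rightarrow> real"
  assumes "finite I" "\<And>i. i \<in> I \<Longrightarrow> 0 \<le> x i" "\<And>i. i \<in> I \<Longrightarrow> 0 < a i" "(\<Sum>i\<in>I. a i) = 1"
  shows "(\<Prod>i\<in>I. x i powr a i) \<le> (\<Sum>i\<in>I. a i * x i)"
proof (cases "\<exists>i\<in>I. x i = 0")
  case True
  then have "(\<Prod>i\<in>I. x i powr a i) = 0" using assms(1) by auto
  also have "\<dots> \<le> (\<Sum>i\<in>I. a i * x i)" using assms by (auto intro!: sum_nonneg simp: less_imp_le)
  finally show ?thesis .
next
  case False
  then have pos: "\<And>i. i \<in> I \<Longrightarrow> 0 < x i" using assms(2) by (metis order_le_less)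
  have ne: "I \<noteq> {}" using assms(4) by auto
  have "(\<Prod>i\<in>I. x i powr a i) = exp (\<Sum>i\<in>I. a i * ln (x i))"
    using assms(1) pos by (simp add: exp_sum powr_def less_imp_neq[symmetric])
  also have "\<dots> = exp (\<Sum>i\<in>I. a i *\<^sub>R ln (x i))" by simp
  also have "\<dots> \<le> (\<Sum>i\<in>I. a i * exp (ln (x i)))"
    using assms ne by (intro convex_on_sum[OF _ _ exp_convex]) (auto simp: less_imp_le)
  also have "\<dots> = (\<Sum>i\<in>I. a i * x i)" using pos by (intro sum.cong) auto
  finally show ?thesis .
qed

lemma ennreal_weighted_am_gm:
  assumes "finite I" "\<And>i. i \<in> I \<Longrightarrow> 0 < a i" "(\<Sum>i\<in>I. a i) = 1"
  shows "(\<Prod>i\<in>I. ennpowr (x i) (a i)) \<le> (\<Sum>i\<in>I. ennreal (a i) * x i)"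
proof (cases "\<exists>i\<in>I. x i = top")
  case True
  then obtain j where j: "j \<in> I" "x j = top" by auto
  have "ennreal (a j) * x j \<le> (\<Sum>i\<in>I. ennreal (a i) * x i)"
    using assms j by (intro member_le_sum) auto
  moreover have "ennreal (a j) * x j = top" using j assms(2)[of j] by (simp add: ennreal_mult_top)
  ultimately show ?thesis by (simp add: top_unique)
next
  case False
  define y where "y i = enn2real (x i)" for i
  have x: "x i = ennreal (y i)" "0 \<le> y i" if "i \<in> I" for i
    using False that by (auto simp: y_def less_top)
  have "(\<Prod>i\<in>I. ennpowr (x i) (a i)) = (\<Prod>i\<in>I. ennreal (y i powr a i))"
    using assms x by (intro prod.cong) (auto simp: ennpowr_ennreal_pos)
  also have "\<dots> = ennreal (\<Prod>i\<in>I. y i powr a i)" by (simp add: prod_ennreal)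
  also have "\<dots> \<le> ennreal (\<Sum>i\<in>I. a i * y i)"
    using assms x by (intro ennreal_leI weighted_am_gm) auto
  also have "\<dots> = (\<Sum>i\<in>I. ennreal (a i * y i))"
    using assms x by (intro sum_ennreal[symmetric]) (auto simp: less_imp_le)
  also have "\<dots> = (\<Sum>i\<in>I. ennreal (a i) * x i)"
    using assms x by (intro sum.cong) (auto simp: ennreal_mult' less_imp_le)
  finally show ?thesis .
qed

text \<open>Hoelder's inequality for several factors, with exponents that add up to one. After each factor is
  normalised to integral one it is the integral of the weighted arithmetic-geometric mean inequality;
  the factors of integral \<open>0\<close> or \<open>\<infinity>\<close> have to be treated apart.\<close>

lemma nn_integral_prod_Holder:
  fixes h :: "'i \<Rightarrow> 'b \<Rightarrow> ennreal"
  assumes I: "finite I" and a: "\<And>i. i \<in> I \<Longrightarrow> 0 < a i" "(\<Sum>i\<in>I. a i) = 1"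
    and [measurable]: "\<And>i. i \<in> I \<Longrightarrow> h i \<in> borel_measurable M"
  shows "(\<integral>\<^sup>+x. (\<Prod>i\<in>I. ennpowr (h i x) (a i)) \<partial>M) \<le> (\<Prod>i\<in>I. ennpowr (\<integral>\<^sup>+x. h i x \<partial>M) (a i))"
proof (cases "\<exists>i\<in>I. (\<integral>\<^sup>+x. h i x \<partial>M) = 0")
  case True
  then obtain i where i: "i \<in> I" "(\<integral>\<^sup>+x. h i x \<partial>M) = 0" by auto
  then have "AE x in M. h i x = 0" by (subst nn_integral_0_iff_AE[symmetric]) auto
  then have "AE x in M. (\<Prod>i\<in>I. ennpowr (h i x) (a i)) = 0"
    by eventually_elim (use i I a in \<open>auto intro!: prod_zero bexI[of _ i] simp: ennpowr_0_pos\<close>)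
  then have "(\<integral>\<^sup>+x. (\<Prod>i\<in>I. ennpowr (h i x) (a i)) \<partial>M) = (\<integral>\<^sup>+x. 0 \<partial>M)"
    by (intro nn_integral_cong_AE)
  then show ?thesis by simp
next
  case nz: False
  show ?thesis
  proof (cases "\<exists>i\<in>I. (\<integral>\<^sup>+x. h i x \<partial>M) = top")
    case True
    then obtain j where j: "j \<in> I" "(\<integral>\<^sup>+x. h j x \<partial>M) = top" by auto
    have "(\<Prod>i\<in>I. ennpowr (\<integral>\<^sup>+x. h i x \<partial>M) (a i)) = top"
      using j nz a I by (auto simp: ennreal_prod_eq_top ennpowr_top_pos ennpowr_eq_0_iff intro!: bexI[of _ j])
    then show ?thesis by simp
  next
    case False
    define H where "H i = enn2real (\<integral>\<^sup>+x. h i x \<partial>M)" for i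
    have H: "(\<integral>\<^sup>+x. h i x \<partial>M) = ennreal (H i)" "0 < H i" if "i \<in> I" for i
    proof -
      show e: "(\<integral>\<^sup>+x. h i x \<partial>M) = ennreal (H i)" using False that by (auto simp: H_def less_top)
      have "0 \<le> H i" "H i \<noteq> 0" using nz that e by (auto simp: H_def)
      then show "0 < H i" by simp
    qed
    define g where "g i x = ennreal (1 / H i) * h i x" for i x
    have hg: "h i x = ennreal (H i) * g i x" if "i \<in> I" for i x
      using H[OF that] by (simp add: g_def mult.assoc[symmetric] flip: ennreal_mult')
    have ig: "(\<integral>\<^sup>+x. g i x \<partial>M) = 1" if "i \<in> I" for i
      using H[OF that] that by (simp add: g_def nn_integral_cmult flip: ennreal_mult')
    have [measurable]: "\<And>i. i \<in> I \<Longrightarrow> g i \<in> borel_measurable M" unfolding g_def by measurable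
    let ?C = "\<Prod>i\<in>I. ennpowr (ennreal (H i)) (a i)"
    have "(\<integral>\<^sup>+x. (\<Prod>i\<in>I. ennpowr (h i x) (a i)) \<partial>M) = (\<integral>\<^sup>+x. ?C * (\<Prod>i\<in>I. ennpowr (g i x) (a i)) \<partial>M)"
      using a by (auto intro!: nn_integral_cong simp: hg ennpowr_mult less_imp_le prod.distrib)
    also have "\<dots> = ?C * (\<integral>\<^sup>+x. (\<Prod>i\<in>I. ennpowr (g i x) (a i)) \<partial>M)"
      by (intro nn_integral_cmult) measurable
    also have "\<dots> \<le> ?C * (\<integral>\<^sup>+x. (\<Sum>i\<in>I. ennreal (a i) * g i x) \<partial>M)"
      by (intro mult_left_mono nn_integral_mono ennreal_weighted_am_gm I a) auto
    also have "(\<integral>\<^sup>+x. (\<Sum>i\<in>I. ennreal (a i) * g i x) \<partial>M) = (\<Sum>i\<in>I. ennreal (a i))"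
      by (subst nn_integral_sum) (auto simp: nn_integral_cmult ig)
    also have "\<dots> = 1" using a by (subst sum_ennreal) (auto simp: less_imp_le)
    finally show ?thesis using H by simp
  qed
qed

lemma nn_integral_Holder:
  assumes [measurable]: "f \<in> borel_measurable M" "g \<in> borel_measurable M" and a: "0 < a" "a < 1"
  shows "(\<integral>\<^sup>+x. ennpowr (f x) a * ennpowr (g x) (1 - a) \<partial>M)
    \<le> ennpowr (\<integral>\<^sup>+x. f x \<partial>M) a * ennpowr (\<integral>\<^sup>+x. g x \<partial>M) (1 - a)"
  using nn_integral_prod_Holder[of "UNIV :: bool set" "\<lambda>b. if b then a else 1 - a" "\<lambda>b. if b then f else g" M] a
  by (simp add: UNIV_bool mult.commute)

text \<open>Used with Lebesgue measure on a segment or a ball, and with the probability measure of a mollifier;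
  in the last case this is Jensen's inequality for \<open>t \<mapsto> t powr p\<close>.\<close>

lemma nn_integral_power_mean:
  assumes [measurable]: "h \<in> borel_measurable M" and p: "1 \<le> p"
  shows "ennpowr (\<integral>\<^sup>+x. h x \<partial>M) p \<le> ennpowr (emeasure M (space M)) (p - 1) * (\<integral>\<^sup>+x. ennpowr (h x) p \<partial>M)"
proof (cases "p = 1")
  case False
  then have p1: "1 < p" using p by simp
  have e1: "ennpowr 1 a = 1" for a using ennpowr_ennreal[of 1 a] by simp
  have "(\<integral>\<^sup>+x. h x \<partial>M) = (\<integral>\<^sup>+x. ennpowr (ennpowr (h x) p) (1/p) * ennpowr 1 (1 - 1/p) \<partial>M)"
    using p1 by (simp add: ennpowr_ennpowr e1)
  also have "\<dots> \<le> ennpowr (\<integral>\<^sup>+x. ennpowr (h x) p \<partial>M) (1/p) * ennpowr (\<integral>\<^sup>+x. 1 \<partial>M) (1 - 1/p)"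
    using p1 by (intro nn_integral_Holder) auto
  finally have "ennpowr (\<integral>\<^sup>+x. h x \<partial>M) p \<le> ennpowr (ennpowr (\<integral>\<^sup>+x. ennpowr (h x) p \<partial>M) (1/p) * ennpowr (emeasure M (space M)) (1 - 1/p)) p"
    using p1 by (intro ennpowr_mono) auto
  also have "\<dots> = (\<integral>\<^sup>+x. ennpowr (h x) p \<partial>M) * ennpowr (emeasure M (space M)) ((1 - 1/p) * p)"
    using p1 by (simp add: ennpowr_mult ennpowr_ennpowr)
  also have "(1 - 1/p) * p = p - 1" using p1 by (simp add: field_simps)
  finally show ?thesis by (simp add: mult.commute)
qed simp

lemma nn_integral_interpolate:
  assumes [measurable]: "h \<in> borel_measurable M" and pq: "0 < p" "0 < q" and a: "0 \<le> a" "a \<le> 1"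
  shows "(\<integral>\<^sup>+x. ennpowr (h x) ((1 - a) * p + a * q) \<partial>M)
    \<le> ennpowr (\<integral>\<^sup>+x. ennpowr (h x) p \<partial>M) (1 - a) * ennpowr (\<integral>\<^sup>+x. ennpowr (h x) q \<partial>M) a"
proof (cases "a = 0 \<or> a = 1")
  case False
  then have a: "0 < a" "a < 1" using assms by auto
  have "(\<integral>\<^sup>+x. ennpowr (h x) ((1 - a) * p + a * q) \<partial>M) =
    (\<integral>\<^sup>+x. ennpowr (ennpowr (h x) p) (1 - a) * ennpowr (ennpowr (h x) q) (1 - (1 - a)) \<partial>M)"
    using a pq by (simp add: ennpowr_ennpowr ennpowr_add mult.commute)
  also have "\<dots> \<le> ennpowr (\<integral>\<^sup>+x. ennpowr (h x) p \<partial>M) (1 - a) * ennpowr (\<integral>\<^sup>+x. ennpowr (h x) q \<partial>M) (1 - (1 - a))"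
    using a by (intro nn_integral_Holder) auto
  finally show ?thesis by simp
qed auto

lemma prod_mono_ennreal:
  fixes f g :: "'i \<Rightarrow> ennreal"
  shows "(\<And>i. i \<in> I \<Longrightarrow> f i \<le> g i) \<Longrightarrow> prod f I \<le> prod g I"
  by (induction I rule: infinite_finite_induct) (auto intro!: mult_mono)

lemma sum_powr_le:
  fixes y :: "'i \<Rightarrow> real"
  assumes I: "finite I" and y: "\<And>i. i \<in> I \<Longrightarrow> 0 \<le> y i" and p: "0 < p"
  shows "(\<Sum>i\<in>I. y i) powr p \<le> real (card I) powr p * (\<Sum>i\<in>I. y i powr p)"
proof (cases "I = {}")
  case False
  have "Max (y ` I) \<in> y ` I" using I False by simp
  then obtain i where i0: "Max (y ` I) = y i" "i \<in> I" by (rule imageE)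
  then have i: "i \<in> I" "\<And>j. j \<in> I \<Longrightarrow> y j \<le> y i"
    using I by (auto simp flip: i0(1))
  have "(\<Sum>i\<in>I. y i) powr p \<le> (real (card I) * y i) powr p"
    using i y p by (intro powr_mono2 sum_bounded_above sum_nonneg) auto
  also have "\<dots> = real (card I) powr p * y i powr p" using y i by (simp add: powr_mult)
  also have "\<dots> \<le> real (card I) powr p * (\<Sum>i\<in>I. y i powr p)"
    using i I by (intro mult_left_mono member_le_sum) auto
  finally show ?thesis .
qed simp

section \<open>Hausdorff measure on the sphere and volumes of cones\<close>

text \<open>The part of the cone over \<open>A\<close> that lies in an annulus. Spherical measure is comparable with the volume
  of the cone over a set, and volumes of cones scale exactly; this is how all estimates of Hausdorff
  measure on the sphere are reduced to estimates of Lebesgue measure.\<close>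

definition cone_part :: "'a::euclidean_space set \<Rightarrow> real \<Rightarrow> real \<Rightarrow> 'a set" where
  "cone_part A a b = {x. a < norm x \<and> norm x \<le> b \<and> sgn x \<in> A}"

lemma borel_measurable_sgn [measurable]: "sgn \<in> borel_measurable (borel :: 'a::euclidean_space measure)"
proof -
  have "(\<lambda>x::'a. x /\<^sub>R norm x) \<in> borel_measurable borel" by measurable
  then show ?thesis by (simp add: sgn_div_norm[abs_def])
qed

lemma cone_part_borel [measurable]: assumes [measurable]: "A \<in> sets borel" shows "cone_part A a b \<in> sets borel"
proof -
  have "cone_part A a b = sgn -` A \<inter> {x. a < norm x \<and> norm x \<le> b}" by (auto simp: cone_part_def)
  also have "\<dots> \<in> sets borel" by measurable
  finally show ?thesis .
qed

lemma powr_DIM_minus_1: "0 < x \<Longrightarrow> x powr (real DIM('a::euclidean_space) - 1) = x ^ (DIM('a) - 1)"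
proof -
  assume "0 < x"
  moreover have "real DIM('a) - 1 = real (DIM('a) - 1)" by (simp add: of_nat_diff Suc_leI)
  ultimately show ?thesis by (metis powr_realpow)
qed

lemma emeasure_cone_part_finite:
  fixes A :: "'a::euclidean_space set"
  shows "emeasure lborel (cone_part A a b) < \<infinity>"
proof -
  have "emeasure lborel (cone_part A a b) \<le> emeasure lborel (cball (0::'a) b)"
    by (intro emeasure_mono) (auto simp: cone_part_def)
  also have "\<dots> < \<infinity>" by (rule emeasure_lborel_cball_finite)
  finally show ?thesis .
qed

lemma emeasure_cone_part: "emeasure lborel (cone_part A a b) = ennreal (measure lborel (cone_part A a b))"
  using emeasure_cone_part_finite[of A a b] by (intro emeasure_eq_ennreal_measure) auto

lemma measure_cone_part_scale:
  assumes A[measurable]: "A \<in> sets (borel :: 'a::euclidean_space measure)" and r: "0 < r"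
  shows "measure lborel (cone_part A 0 r) = r ^ DIM('a) * measure lborel (cone_part A 0 1)"
proof -
  have "emeasure lborel (cone_part A 0 r)
      = emeasure (density (distr lborel borel (\<lambda>x. 0 + r *\<^sub>R x)) (\<lambda>_. \<bar>r\<bar>^DIM('a))) (cone_part A 0 r)"
    using r by (subst lborel_affine[of r 0]) auto
  also have "\<dots> = ennreal (r^DIM('a)) * emeasure lborel ((\<lambda>x. r *\<^sub>R x) -` cone_part A 0 r)"
    using r by (simp add: emeasure_density emeasure_distr nn_integral_cmult)
  also have "(\<lambda>x. r *\<^sub>R x) -` cone_part A 0 r = cone_part A 0 1"
    using r by (auto simp: cone_part_def sgn_scaleR)
  finally show ?thesis using r
    by (simp add: emeasure_cone_part flip: ennreal_mult')
qed

lemma measure_cone_part: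
  assumes A[measurable]: "A \<in> sets (borel :: 'a::euclidean_space measure)" and r: "0 < a" "a \<le> b"
  shows "measure lborel (cone_part A a b) = (b ^ DIM('a) - a ^ DIM('a)) * measure lborel (cone_part A 0 1)"
proof -
  have "cone_part A a b = cone_part A 0 b - cone_part A 0 a" using r by (auto simp: cone_part_def)
  also have "measure lborel \<dots> = measure lborel (cone_part A 0 b) - measure lborel (cone_part A 0 a)"
  proof (rule measure_Diff)
    show "emeasure lborel (cone_part A 0 b) \<noteq> \<infinity>"
      using emeasure_cone_part_finite[of A 0 b] by (rule less_imp_neq)
    show "cone_part A 0 a \<subseteq> cone_part A 0 b"
      using order_trans[OF _ r(2)] unfolding cone_part_def by blast
    show "cone_part A 0 a \<in> sets lborel" "cone_part A 0 b \<in> sets lborel" by simp_all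
  qed
  finally show ?thesis
    using r measure_cone_part_scale[OF A, of a] measure_cone_part_scale[OF A, of b]
    by (simp only: left_diff_distrib)
qed

lemma power_diff_le:
  fixes a b :: real assumes "0 \<le> a" "a \<le> b"
  shows "b ^ n - a ^ n \<le> real n * b ^ (n - 1) * (b - a)"
proof (cases n)
  case (Suc m)
  have "b ^ n - a ^ n = (b - a) * (\<Sum>i<n. a ^ (n - Suc i) * b ^ i)"
    by (metis mult.commute power_diff_sumr2)
  also have "\<dots> \<le> (b - a) * (\<Sum>i<n. b ^ m)"
  proof (intro mult_left_mono sum_mono)
    fix i assume i: "i \<in> {..<n}"
    have "a ^ (n - Suc i) * b ^ i \<le> b ^ (n - Suc i) * b ^ i"
      using assms by (intro mult_right_mono power_mono) auto
    also have "\<dots> = b ^ m" using i Suc by (simp flip: power_add)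
    finally show "a ^ (n - Suc i) * b ^ i \<le> b ^ m" .
  qed (use assms in auto)
  finally show ?thesis using Suc by (simp add: mult_ac)
qed simp

lemma power_diff_ge:
  fixes d :: real assumes "0 \<le> d" shows "real n * d \<le> (1 + d) ^ n - 1"
  using Bernoulli_inequality[of d n] assms by simp

text \<open>A separated subset of maximal cardinality is automatically a net.\<close>

lemma maximal_separated_set:
  fixes A :: "'a::metric_space set"
  assumes d: "0 < d" and bnd: "\<And>F. finite F \<Longrightarrow> F \<subseteq> A \<Longrightarrow> (\<forall>x\<in>F. \<forall>y\<in>F. x \<noteq> y \<longrightarrow> d \<le> dist x y) \<Longrightarrow> card F \<le> m"
  obtains F where "finite F" "F \<subseteq> A" "\<forall>x\<in>F. \<forall>y\<in>F. x \<noteq> y \<longrightarrow> d \<le> dist x y" "A \<subseteq> (\<Union>x\<in>F. cball x d)"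
proof -
  define P where "P F \<longleftrightarrow> finite F \<and> F \<subseteq> A \<and> (\<forall>x\<in>F. \<forall>y\<in>F. x \<noteq> y \<longrightarrow> d \<le> dist x y)" for F
  have "P {}" by (simp add: P_def)
  moreover have "\<forall>G. P G \<longrightarrow> card G \<le> m" using bnd by (simp add: P_def)
  ultimately have "\<exists>F. P F \<and> (\<forall>G. P G \<longrightarrow> card G \<le> card F)"
    using ex_has_greatest_nat[of P "{}" card "Suc m"] by (simp add: less_Suc_eq_le)
  then obtain F where F: "P F" and max: "\<And>G. P G \<Longrightarrow> card G \<le> card F" by blast
  have "A \<subseteq> (\<Union>x\<in>F. cball x d)"
  proof
    fix y assume y: "y \<in> A"
    show "y \<in> (\<Union>x\<in>F. cball x d)"
    proof (rule ccontr)
      assume n: "y \<notin> (\<Union>x\<in>F. cball x d)"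
      then have "\<forall>x\<in>F. d < dist x y" by (simp add: not_le)
      then have "P (insert y F)" using F y by (simp add: P_def dist_commute less_imp_le)
      moreover have "y \<notin> F" using n d by auto
      ultimately show False using max[of "insert y F"] F by (auto simp: P_def)
    qed
  qed
  then show ?thesis using F that by (auto simp: P_def)
qed

text \<open>Take a maximal \<open>d\<close>-separated set in \<open>A\<close>. The balls of radius \<open>d/2\<close> around its points are disjoint
  and lie in the cone over the neighbourhood \<open>A'\<close>, inside an annulus of width \<open>2 * d\<close>, whose volume is
  of order \<open>d\<close> times that of the cone. This bounds the number of points by a multiple of
  \<open>d\<close> to the power \<open>1 - N\<close>, and the balls of radius \<open>d\<close> cover \<open>A\<close>.\<close>

lemma hausdorff_outer_le_cone:
  fixes A A' :: "'a::euclidean_space set"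
  assumes A: "A \<subseteq> sphere 0 1" and A'[measurable]: "A' \<in> sets borel" and \<delta>0: "0 < \<delta>0"
    and near: "\<And>x y. x \<in> A \<Longrightarrow> dist x y < \<delta>0 \<Longrightarrow> sgn y \<in> A'"
  shows "hausdorff_outer (real DIM('a) - 1) A \<le>
    ennreal (unit_ball_vol (real DIM('a) - 1) * real DIM('a) * 4 ^ DIM('a) / unit_ball_vol (real DIM('a))
       * measure lborel (cone_part A' 0 1))" (is "_ \<le> ennreal (?K * ?W)")
  unfolding hausdorff_outer_def
proof (rule SUP_least)
  fix \<delta> :: real assume "\<delta> \<in> {0<..}"
  let ?N = "DIM('a)" let ?V = "unit_ball_vol (real ?N)" let ?v = "unit_ball_vol (real ?N - 1)"
  have N: "0 < ?N" by simp
  have V: "0 < ?V" by simp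
  have v: "0 < ?v" using N by (intro unit_ball_vol_pos) linarith
  \<comment> \<open>Small enough for diameters at most \<open>\<delta>\<close>, for the neighbourhood of \<open>A\<close>, and for \<open>1 + d \<le> 2\<close>.\<close>
  define d where "d = min (min \<delta> \<delta>0) 1 / 2"
  have d: "0 < d" "2 * d \<le> \<delta>" "d < \<delta>0" "d \<le> 1/2" using \<open>\<delta> \<in> {0<..}\<close> \<delta>0 by (auto simp: d_def)
  let ?D = "cone_part A' (1 - d) (1 + d)"
  have D: "measure lborel ?D \<le> d * (real ?N * 2 ^ ?N) * ?W"
  proof -
    have "measure lborel ?D = ((1+d)^?N - (1-d)^?N) * ?W" using d by (intro measure_cone_part) auto
    also have "\<dots> \<le> (real ?N * (1+d)^(?N-1) * ((1+d) - (1-d))) * ?W"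
      using d by (intro mult_right_mono power_diff_le) auto
    also have "\<dots> \<le> (real ?N * 2^(?N-1) * ((1+d) - (1-d))) * ?W"
      using d by (intro mult_right_mono mult_left_mono power_mono) auto
    also have "\<dots> = d * (real ?N * 2 ^ ?N) * ?W" using N
      by (cases ?N) (auto simp: algebra_simps)
    finally show ?thesis .
  qed
  have count: "real (card F) * (?V * (d/2)^?N) \<le> d * (real ?N * 2 ^ ?N) * ?W"
    if F: "finite F" "F \<subseteq> A" "\<forall>x\<in>F. \<forall>y\<in>F. x \<noteq> y \<longrightarrow> d \<le> dist x y" for F
  proof -
    have "disjoint_family_on (\<lambda>x. ball x (d/2)) F"
      unfolding disjoint_family_on_def
    proof (intro ballI impI)
      fix x y assume "x \<in> F" "y \<in> F" "x \<noteq> y"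
      then have "d \<le> dist x y" using F by auto
      then show "ball x (d/2) \<inter> ball y (d/2) = {}"
        using disjoint_ballI[of "d/2" "d/2" x y] by simp
    qed
    then have "(\<Sum>x\<in>F. measure lborel (ball x (d/2))) = measure lborel (\<Union>x\<in>F. ball x (d/2))"
      using F by (intro measure_finite_Union[symmetric]) (simp_all add: image_subset_iff emeasure_lborel_ball_finite[THEN less_imp_neq, simplified])
    also have "\<dots> \<le> measure lborel ?D"
    proof -
      have "(\<Union>x\<in>F. ball x (d/2)) \<subseteq> ?D"
      proof safe
        fix x y assume x: "x \<in> F" and y: "y \<in> ball x (d/2)"
        have "norm x = 1" using x F A by auto
        moreover have "\<bar>norm x - norm y\<bar> \<le> dist x y" by (simp add: dist_norm norm_triangle_ineq3)
        moreover have "sgn y \<in> A'" using near[of x y] x F d y by auto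
        ultimately show "y \<in> ?D" using y d by (auto simp: cone_part_def)
      qed
      moreover have "?D \<in> fmeasurable lborel"
        using emeasure_cone_part_finite[of A' "1 - d" "1 + d"] by (simp add: fmeasurable_def)
      ultimately show ?thesis
        using F(1) by (intro measure_mono_fmeasurable) auto
    qed
    also note D
    finally show ?thesis using d by (simp add: content_ball)
  qed
  \<comment> \<open>Separated sets have bounded cardinality, so a maximal one exists.\<close>
  define m where "m = nat \<lceil>d * (real ?N * 2 ^ ?N) * ?W / (?V * (d/2)^?N)\<rceil>"
  obtain F where F: "finite F" "F \<subseteq> A" "\<forall>x\<in>F. \<forall>y\<in>F. x \<noteq> y \<longrightarrow> d \<le> dist x y" "A \<subseteq> (\<Union>x\<in>F. cball x d)"
  proof (rule maximal_separated_set[of d A m])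
    fix F assume "finite F" "F \<subseteq> A" "\<forall>x\<in>F. \<forall>y\<in>F. x \<noteq> y \<longrightarrow> d \<le> dist x y"
    then have "real (card F) \<le> d * (real ?N * 2 ^ ?N) * ?W / (?V * (d/2)^?N)"
      using count[of F] V d by (subst pos_le_divide_eq) auto
    then show "card F \<le> m" unfolding m_def by linarith
  qed (use d in auto)
  obtain f :: "nat \<Rightarrow> 'a" where f: "bij_betw f {..<card F} F"
    using ex_bij_betw_nat_finite[OF F(1)] by (auto simp: atLeast0LessThan)
  define C where "C i = (if i < card F then cball (f i) d else {})" for i
  have "C \<in> hausdorff_covers \<delta> A"
    unfolding hausdorff_covers_def
  proof (intro CollectI conjI allI)
    show "A \<subseteq> (\<Union>i. C i)"
    proof
      fix x assume "x \<in> A"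
      then obtain y where "y \<in> F" "x \<in> cball y d" using F(4) by auto
      moreover then obtain i where "i < card F" "f i = y" using f by (metis bij_betw_iff_bijections lessThan_iff)
      ultimately have "x \<in> C i" by (auto simp: C_def)
      then show "x \<in> (\<Union>i. C i)" by blast
    qed
    fix i show "bounded (C i)" "diameter (C i) \<le> \<delta>" using d by (auto simp: C_def)
  qed
  then have "hausdorff_pre (real ?N - 1) \<delta> A \<le> (\<Sum>i. hausdorff_gauge (real ?N - 1) (C i))"
    unfolding hausdorff_pre_def by (rule INF_lower)
  also have "\<dots> = (\<Sum>i<card F. hausdorff_gauge (real ?N - 1) (C i))"
    by (intro suminf_finite) (auto simp: C_def hausdorff_gauge_def)
  also have "\<dots> = (\<Sum>i<card F. ennreal (?v * d ^ (?N - 1)))"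
  proof (intro sum.cong refl)
    fix i assume i: "i \<in> {..<card F}"
    have "hausdorff_gauge (real ?N - 1) (C i) = ennreal (?v / 2 powr (real ?N - 1)) * ennreal ((2*d) powr (real ?N - 1))"
      using i d by (simp add: hausdorff_gauge_def C_def ennpowr_ennreal)
    also have "\<dots> = ennreal (?v * d powr (real ?N - 1))"
      using d v by (simp add: powr_mult flip: ennreal_mult')
    also have "d powr (real ?N - 1) = d ^ (?N - 1)"
      using d by (rule_tac powr_DIM_minus_1)
    finally show "hausdorff_gauge (real ?N - 1) (C i) = ennreal (?v * d ^ (?N - 1))" .
  qed
  also have "\<dots> = ennreal (real (card F) * (?v * d ^ (?N - 1)))"
    using d v by (simp add: ennreal_of_nat_eq_real_of_nat flip: ennreal_mult')
  also have "\<dots> \<le> ennreal (?K * ?W)"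
  proof (rule ennreal_leI)
    have dN: "d ^ ?N = d * d ^ (?N - 1)" using N by (cases ?N) auto
    have "real (card F) * (d * d^(?N-1)) * ?V \<le> d * (real ?N * 4 ^ ?N) * ?W"
    proof -
      have "real (card F) * (?V * (d/2)^?N) * 2^?N \<le> (d * (real ?N * 2 ^ ?N) * ?W) * 2^?N"
        using count[OF F(1-3)] by (intro mult_right_mono) auto
      moreover have "(4::real)^?N = 2^?N * 2^?N" by (simp flip: power_mult_distrib)
      ultimately show ?thesis by (simp add: power_divide dN mult_ac)
    qed
    then have "d * (real (card F) * d^(?N-1) * ?V) \<le> d * (real ?N * 4 ^ ?N * ?W)"
      by (simp only: mult_ac)
    then have "real (card F) * d^(?N-1) * ?V \<le> real ?N * 4 ^ ?N * ?W"
      using d by (simp only: mult_le_cancel_left_pos)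
    then have "?v * (real (card F) * d^(?N-1)) \<le> ?v * (real ?N * 4 ^ ?N * ?W / ?V)"
      using v V by (intro mult_left_mono) (auto simp: pos_le_divide_eq)
    then show "real (card F) * (?v * d ^ (?N - 1)) \<le> ?K * ?W"
      by (simp add: mult_ac)
  qed
  finally show "hausdorff_pre (real ?N - 1) \<delta> A \<le> ennreal (?K * ?W)" .
qed

text \<open>The layer of thickness \<open>e\<close> above \<open>D\<close> has volume at least \<open>N * e\<close> times that of the cone, and it is
  contained in a ball of radius \<open>2 * e\<close>.\<close>

lemma measure_cone_small_diameter:
  fixes D :: "'a::euclidean_space set"
  assumes D[measurable]: "D \<in> sets borel" and S: "D \<subseteq> sphere 0 1" and e: "0 < e"
    and diam: "\<And>x y. x \<in> D \<Longrightarrow> y \<in> D \<Longrightarrow> dist x y \<le> e"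
  shows "measure lborel (cone_part D 0 1) \<le> unit_ball_vol (real DIM('a)) * 2 ^ DIM('a) * e ^ (DIM('a) - 1)"
proof (cases "D = {}")
  case True then show ?thesis using e by (simp add: cone_part_def)
next
  case False
  then obtain x where x: "x \<in> D" by auto
  let ?N = "DIM('a)"
  let ?W = "measure lborel (cone_part D 0 1)"
  have sub: "cone_part D 1 (1 + e) \<subseteq> cball x (2 * e)"
  proof
    fix y assume y: "y \<in> cone_part D 1 (1 + e)"
    have "y - sgn y = (norm y - 1) *\<^sub>R sgn y"
      by (cases "y = 0") (auto simp: sgn_div_norm algebra_simps)
    moreover have "y \<noteq> 0" using y by (auto simp: cone_part_def)
    ultimately have "dist (sgn y) y = \<bar>norm y - 1\<bar>"
      by (metis dist_commute dist_norm mult.right_neutral norm_scaleR norm_sgn)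
    moreover have "dist x y \<le> dist x (sgn y) + dist (sgn y) y" by (rule dist_triangle)
    moreover have "dist x (sgn y) \<le> e" using diam[OF x] y by (auto simp: cone_part_def)
    ultimately show "y \<in> cball x (2 * e)" using y by (auto simp: cone_part_def)
  qed
  have "(e * ?N) * ?W \<le> ((1 + e)^?N - 1^?N) * ?W"
    using power_diff_ge[of e ?N] e by (intro mult_right_mono) (auto simp: mult_ac)
  also have "\<dots> = measure lborel (cone_part D 1 (1 + e))"
    using e by (intro measure_cone_part[symmetric]) auto
  also have "\<dots> \<le> measure lborel (cball x (2 * e))"
    by (intro measure_mono_fmeasurable sub) (simp_all add: fmeasurable_compact)
  also have "\<dots> = unit_ball_vol (real ?N) * (2 * e)^?N" using e by (simp add: content_cball)
  also have "\<dots> = e * (unit_ball_vol (real ?N) * 2^?N * e^(?N-1))"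
    by (cases ?N) (auto simp: power_mult_distrib mult_ac)
  finally have "real ?N * ?W \<le> unit_ball_vol (real ?N) * 2^?N * e^(?N-1)"
    using e by (simp add: mult.assoc)
  moreover have "1 * ?W \<le> real ?N * ?W" by (intro mult_right_mono) (auto simp: Suc_leI)
  ultimately show ?thesis by simp
qed

lemma ennreal_le_cmult_INF:
  fixes x :: ennreal
  assumes K: "0 < K" and le: "\<And>i. i \<in> I \<Longrightarrow> x \<le> ennreal K * f i"
  shows "x \<le> ennreal K * (INF i\<in>I. f i)"
proof -
  have K1: "ennreal (1 / K) * (ennreal K * y) = y" "ennreal K * (ennreal (1 / K) * y) = y" for y
    using K by (simp_all add: mult.assoc[symmetric] flip: ennreal_mult')
  have "ennreal (1 / K) * x \<le> (INF i\<in>I. f i)"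
  proof (rule INF_greatest)
    fix i assume "i \<in> I"
    then have "ennreal (1 / K) * x \<le> ennreal (1 / K) * (ennreal K * f i)"
      by (intro mult_left_mono le) auto
    then show "ennreal (1 / K) * x \<le> f i" by (simp only: K1)
  qed
  then have "ennreal K * (ennreal (1 / K) * x) \<le> ennreal K * (INF i\<in>I. f i)"
    by (intro mult_left_mono) auto
  then show ?thesis by (simp only: K1)
qed

text \<open>Every set of a countable cover of \<open>A\<close> is replaced by its closure intersected with the sphere, to make
  it measurable without increasing the diameter; then \<open>measure_cone_small_diameter\<close> bounds the volume of the
  cone over it by a multiple of its gauge. Covers by sets of diameter at most one suffice for a lower bound.\<close>

lemma cone_le_hausdorff_outer:
  fixes A :: "'a::euclidean_space set"
  assumes A: "A \<subseteq> sphere 0 1" and A'[measurable]: "A \<in> sets borel" and N2: "2 \<le> DIM('a)"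
  shows "emeasure lborel (cone_part A 0 1) \<le>
    ennreal (unit_ball_vol (real DIM('a)) * 4 ^ DIM('a) / unit_ball_vol (real DIM('a) - 1))
      * hausdorff_outer (real DIM('a) - 1) A" (is "_ \<le> ennreal ?K * _")
proof -
  let ?N = "DIM('a)" let ?V = "unit_ball_vol (real ?N)" let ?v = "unit_ball_vol (real ?N - 1)"
  have v: "0 < ?v" using N2 by (intro unit_ball_vol_pos) linarith
  have K: "0 < ?K" using v by auto
  have vn: "?v \<noteq> 0" using v by linarith
  have one: "emeasure lborel (cone_part (closure C \<inter> sphere 0 1) 0 1) \<le> ennreal ?K * hausdorff_gauge (real ?N - 1) C"
    if C: "bounded C" for C :: "'a set"
  proof (cases "C = {}")
    case True then show ?thesis by (simp add: cone_part_def)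
  next
    case False
    let ?D = "closure C \<inter> sphere 0 1" let ?W = "measure lborel (cone_part ?D 0 1)"
    have dist: "dist x y \<le> diameter C" if "x \<in> ?D" "y \<in> ?D" for x y
      using diameter_bounded_bound[of "closure C" x y] C that by (simp add: diameter_closure bounded_closure)
    have b: "?W \<le> ?V * 2^?N * e^(?N-1)" if "0 < e" "diameter C \<le> e" for e
    proof (rule measure_cone_small_diameter)
      show "?D \<in> sets borel" by (intro borel_closed) auto
      show "dist x y \<le> e" if "x \<in> ?D" "y \<in> ?D" for x y using dist[OF that] \<open>diameter C \<le> e\<close> by linarith
    qed (use that in auto)
    show ?thesis
    proof (cases "diameter C = 0")
      case True
      have "?W \<le> 0"
      proof (rule ccontr)
        assume "\<not> ?W \<le> 0"
        then have W: "0 < ?W" by simp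
        define c where "c = ?V * 2^?N"
        have c: "0 < c" by (simp add: c_def)
        define e where "e = min 1 (?W / (2 * c))"
        have e: "0 < e" "e \<le> 1" "c * e \<le> ?W / 2" using W c by (auto simp: e_def min_def field_simps)
        have "e^(?N-1) \<le> e^1" using e N2 by (intro power_decreasing) auto
        then have "c * e^(?N-1) \<le> c * e" using c by simp
        moreover have "?W \<le> c * e^(?N-1)" using b[of e] e True by (simp add: c_def)
        ultimately show False using e W by linarith
      qed
      then show ?thesis by (simp add: emeasure_cone_part measure_le_0_iff)
    next
      case d0: False
      then have d: "0 < diameter C" using diameter_ge_0[OF C] by linarith
      let ?d = "diameter C"
      note pw = powr_DIM_minus_1[where 'a='a]
      have "hausdorff_gauge (real ?N - 1) C = ennreal (?v / 2^(?N-1)) * ennreal (?d^(?N-1))"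
        using False d by (simp add: hausdorff_gauge_def ennpowr_ennreal pw)
      also have "\<dots> = ennreal (?v / 2^(?N-1) * ?d^(?N-1))" using v by (intro ennreal_mult'[symmetric]) simp
      finally have "ennreal ?K * hausdorff_gauge (real ?N - 1) C = ennreal (?K * (?v / 2^(?N-1) * ?d^(?N-1)))"
        using K by (simp only: ennreal_mult'[OF less_imp_le])
      also have "?K * (?v / 2^(?N-1) * ?d^(?N-1)) = ?V * (4^?N / 2^(?N-1)) * ?d^(?N-1)"
        using vn by simp
      finally have eq: "ennreal ?K * hausdorff_gauge (real ?N - 1) C = ennreal (?V * (4^?N / 2^(?N-1)) * ?d^(?N-1))" .
      have "(2::real)^?N * 2^(?N-1) \<le> 2^?N * 2^?N" by (intro mult_left_mono power_increasing) auto
      also have "\<dots> = 4^?N" by (simp flip: power_mult_distrib)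
      finally have "(2::real)^?N \<le> 4^?N / 2^(?N-1)" by (simp add: field_simps)
      then have "?V * 2^?N * ?d^(?N-1) \<le> ?V * (4^?N / 2^(?N-1)) * ?d^(?N-1)"
        using d by (intro mult_right_mono mult_left_mono) auto
      then show ?thesis unfolding eq emeasure_cone_part using b[of ?d] d by (intro ennreal_leI) auto
    qed
  qed
  have "emeasure lborel (cone_part A 0 1) \<le> ennreal ?K * hausdorff_pre (real ?N - 1) 1 A"
    unfolding hausdorff_pre_def
  proof (rule ennreal_le_cmult_INF[OF K])
    have "emeasure lborel (cone_part A 0 1) \<le> ennreal ?K * (\<Sum>i. hausdorff_gauge (real ?N - 1) (C i))"
      if C: "C \<in> hausdorff_covers 1 A" for C
    proof -
      have "emeasure lborel (cone_part A 0 1) \<le> emeasure lborel (\<Union>i. cone_part (closure (C i) \<inter> sphere 0 1) 0 1)"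
      proof (rule emeasure_mono)
        show "cone_part A 0 1 \<subseteq> (\<Union>i. cone_part (closure (C i) \<inter> sphere 0 1) 0 1)"
        proof
          fix x assume x: "x \<in> cone_part A 0 1"
          then have "sgn x \<in> A" by (simp add: cone_part_def)
          then obtain i where "sgn x \<in> C i" using C by (auto simp: hausdorff_covers_def)
          then have "sgn x \<in> closure (C i) \<inter> sphere 0 1"
            using A \<open>sgn x \<in> A\<close> closure_subset by fastforce
          then show "x \<in> (\<Union>i. cone_part (closure (C i) \<inter> sphere 0 1) 0 1)"
            using x by (auto simp: cone_part_def)
        qed
        have "\<And>i. closure (C i) \<inter> sphere 0 1 \<in> sets borel" by (intro borel_closed) auto
        then show "(\<Union>i. cone_part (closure (C i) \<inter> sphere 0 1) 0 1) \<in> sets lborel"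
          by (auto intro: cone_part_borel)
      qed
      also have "\<dots> \<le> (\<Sum>i. emeasure lborel (cone_part (closure (C i) \<inter> sphere 0 1) 0 1))"
        by (intro emeasure_subadditive_countably) (simp add: image_subset_iff cone_part_borel borel_closed closed_Int)
      also have "\<dots> \<le> (\<Sum>i. ennreal ?K * hausdorff_gauge (real ?N - 1) (C i))"
        using C by (intro suminf_le one) (auto simp: hausdorff_covers_def)
      also have "\<dots> = ennreal ?K * (\<Sum>i. hausdorff_gauge (real ?N - 1) (C i))" by simp
      finally show ?thesis .
    qed
    then show "\<And>C. C \<in> hausdorff_covers 1 A \<Longrightarrow> emeasure lborel (cone_part A 0 1) \<le> ennreal ?K * (\<Sum>i. hausdorff_gauge (real ?N - 1) (C i))" .
  qed
  also have "\<dots> \<le> ennreal ?K * hausdorff_outer (real ?N - 1) A"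
    unfolding hausdorff_outer_def by (intro mult_left_mono SUP_upper) auto
  finally show ?thesis .
qed

section \<open>Rotation invariance of Lebesgue measure\<close>

lemma nn_integral_lborel_shift:
  fixes f :: "'a::euclidean_space \<Rightarrow> ennreal"
  assumes [measurable]: "f \<in> borel_measurable borel"
  shows "(\<integral>\<^sup>+x. f (x + c) \<partial>lborel) = (\<integral>\<^sup>+x. f x \<partial>lborel)"
proof -
  have "(\<integral>\<^sup>+x. f x \<partial>lborel) = (\<integral>\<^sup>+x. f x \<partial>distr lborel borel ((+) c))" by (simp add: lborel_distr_plus)
  also have "\<dots> = (\<integral>\<^sup>+x. f (c + x) \<partial>lborel)" by (simp add: nn_integral_distr)
  finally show ?thesis by (simp add: add.commute)
qed

lemma orthogonal_transformation_measurable: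
  "orthogonal_transformation T \<Longrightarrow> T \<in> borel_measurable (borel :: 'a::euclidean_space measure)"
  by (intro borel_measurable_continuous_onI linear_continuous_on linear_conv_bounded_linear[THEN iffD1]
      orthogonal_transformation_linear)

text \<open>With \<open>m\<close> the volume of the unit ball, both sides times \<open>m\<close> are obtained from one double integral:
  integrate \<open>f (T x + y)\<close> against the indicator of the unit ball in \<open>y\<close>, and use that the unit ball is
  invariant under \<open>T\<close>. Translation invariance and Fubini's theorem are the only ingredients, so that
  no determinant occurs.\<close>

lemma nn_integral_lborel_orthogonal:
  fixes T :: "'a::euclidean_space \<Rightarrow> 'a"
  assumes T: "orthogonal_transformation T" and f[measurable]: "f \<in> borel_measurable borel"
  shows "(\<integral>\<^sup>+x. f (T x) \<partial>lborel) = (\<integral>\<^sup>+x. f x \<partial>lborel)"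
proof -
  note [measurable] = orthogonal_transformation_measurable[OF T]
  define m where "m = emeasure lborel (ball (0::'a) 1)"
  have mball: "emeasure lborel (ball (y::'a) 1) = m" for y by (simp add: m_def emeasure_ball)
  have m: "m \<noteq> 0" "m \<noteq> top" using unit_ball_vol_pos[of "real DIM('a)"] by (auto simp: m_def emeasure_ball ennreal_eq_0_iff simp del: unit_ball_vol_pos)
  define g where "g = (indicator (ball (0::'a) 1) :: 'a \<Rightarrow> ennreal)"
  have [measurable]: "g \<in> borel_measurable borel"
    unfolding g_def by (intro borel_measurable_indicator) simp
  have lin: "linear T" using T by (rule orthogonal_transformation_linear)
  have surj: "surj T" using T by (rule orthogonal_transformation_surj)
  have g1: "(\<integral>\<^sup>+y. g y \<partial>lborel) = m" by (simp add: g_def m_def)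
  have g2: "(\<integral>\<^sup>+x. g (y - T x) \<partial>lborel) = m" for y
  proof -
    obtain z where z: "y = T z" using surj by auto
    have "(y - T x \<in> ball 0 1) = (x \<in> ball z 1)" for x
      using orthogonal_transformation_norm[OF T, of "z - x"] by (simp add: z linear_diff[OF lin] dist_norm norm_minus_commute)
    then have "(\<integral>\<^sup>+x. g (y - T x) \<partial>lborel) = (\<integral>\<^sup>+x. indicator (ball z 1) x \<partial>lborel)"
      by (intro nn_integral_cong) (auto simp: g_def indicator_def)
    then show ?thesis by (simp add: mball)
  qed
  have shift: "(\<integral>\<^sup>+x. f (T x + y) \<partial>lborel) = (\<integral>\<^sup>+x. f (T x) \<partial>lborel)" for y
  proof -
    obtain z where z: "y = T z" using surj by auto
    show ?thesis using nn_integral_lborel_shift[of "\<lambda>x. f (T x)" z] by (simp add: z linear_add[OF lin])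
  qed
  have "(\<integral>\<^sup>+x. f (T x) \<partial>lborel) * m = (\<integral>\<^sup>+y. (\<integral>\<^sup>+x. f (T x + y) \<partial>lborel) * g y \<partial>lborel)"
    by (simp add: shift nn_integral_cmult g1)
  also have "\<dots> = (\<integral>\<^sup>+y. (\<integral>\<^sup>+x. f (T x + y) * g y \<partial>lborel) \<partial>lborel)"
    by (simp add: nn_integral_multc)
  also have "\<dots> = (\<integral>\<^sup>+x. (\<integral>\<^sup>+y. f (T x + y) * g y \<partial>lborel) \<partial>lborel)"
    by (rule lborel_pair.Fubini') measurable
  also have "\<dots> = (\<integral>\<^sup>+x. (\<integral>\<^sup>+y. f y * g (y - T x) \<partial>lborel) \<partial>lborel)"
  proof (rule nn_integral_cong)
    fix x show "(\<integral>\<^sup>+y. f (T x + y) * g y \<partial>lborel) = (\<integral>\<^sup>+y. f y * g (y - T x) \<partial>lborel)"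
      using nn_integral_lborel_shift[of "\<lambda>y. f y * g (y - T x)" "T x"] by (simp add: add.commute)
  qed
  also have "\<dots> = (\<integral>\<^sup>+y. (\<integral>\<^sup>+x. f y * g (y - T x) \<partial>lborel) \<partial>lborel)"
    by (rule lborel_pair.Fubini') measurable
  also have "\<dots> = (\<integral>\<^sup>+y. f y \<partial>lborel) * m"
    by (simp add: nn_integral_cmult g2 nn_integral_multc)
  finally have "(\<integral>\<^sup>+x. f (T x) \<partial>lborel) * m / m = (\<integral>\<^sup>+y. f y \<partial>lborel) * m / m" by simp
  then show ?thesis using m by (simp add: ennreal_mult_divide_eq)
qed

lemma emeasure_rotated_box:
  fixes T :: "'a::euclidean_space \<Rightarrow> 'a"
  assumes T: "orthogonal_transformation T" and a: "\<And>b. b \<in> Basis \<Longrightarrow> 0 \<le> a b"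
  shows "emeasure lborel {x. \<forall>b\<in>Basis. \<bar>x \<bullet> T b\<bar> \<le> a b} = ennreal (\<Prod>b\<in>Basis. 2 * a b)"
proof -
  let ?S = "{x. \<forall>b\<in>Basis. \<bar>x \<bullet> T b\<bar> \<le> a b}"
  have S[measurable]: "?S \<in> sets borel" by measurable
  define l where "l b = - a b" for b
  have absl: "\<bar>t\<bar> \<le> a b \<longleftrightarrow> l b \<le> t \<and> t \<le> a b" for t b by (auto simp: l_def)
  have la: "b \<in> Basis \<Longrightarrow> l b \<le> a b" for b using a[of b] by (simp add: l_def)
  have "emeasure lborel ?S = (\<integral>\<^sup>+x. indicator ?S x \<partial>lborel)" by simp
  also have "\<dots> = (\<integral>\<^sup>+x. indicator ?S (T x) \<partial>lborel)"
    by (rule nn_integral_lborel_orthogonal[OF T, symmetric]) measurable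
  also have "\<dots> = (\<integral>\<^sup>+x. indicator (cbox (\<Sum>b\<in>Basis. l b *\<^sub>R b) (\<Sum>b\<in>Basis. a b *\<^sub>R b)) x \<partial>lborel)"
    using T by (intro nn_integral_cong)
      (simp add: indicator_def mem_box orthogonal_transformation_def absl)
  also have "\<dots> = ennreal (\<Prod>b\<in>Basis. a b - l b)"
    using la by (simp add: emeasure_lborel_cbox_eq inner_diff_left)
  also have "(\<Prod>b\<in>Basis. a b - l b) = (\<Prod>b\<in>Basis. 2 * a b)" by (simp add: l_def)
  finally show ?thesis .
qed

section \<open>Slabs and strips on the sphere\<close>

definition slab :: "('a::euclidean_space \<Rightarrow> 'a) \<Rightarrow> 'a \<Rightarrow> ('a \<Rightarrow> real) \<Rightarrow> 'a set" where
  "slab T b0 a = sphere 0 1 \<inter> {\<xi>. \<forall>b\<in>Basis - {b0}. \<bar>\<xi> \<bullet> T b\<bar> \<le> a b}"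

lemma slab_borel [measurable]: "slab T b0 a \<in> sets borel"
  unfolding slab_def by measurable

definition slab_const :: "'a::euclidean_space itself \<Rightarrow> real" where
  "slab_const _ = unit_ball_vol (real DIM('a) - 1) * real DIM('a) * 4 ^ DIM('a) / unit_ball_vol (real DIM('a))
     * (2 * 8 ^ (DIM('a) - 1))"

lemma slab_const_pos: "0 < slab_const TYPE('a::euclidean_space)"
proof -
  have "0 < DIM('a)" by simp
  then have "0 < unit_ball_vol (real DIM('a) - 1)" by (intro unit_ball_vol_pos) linarith
  then show ?thesis by (simp add: slab_const_def)
qed

text \<open>The cone over the slab lies in a rotated box with sides proportional to the numbers \<open>a b\<close> and a side
  of fixed length in the direction \<open>T b0\<close>. The factor \<open>4\<close> in the enlarged slab absorbs the passage to a
  neighbourhood that \<open>hausdorff_outer_le_cone\<close> requires.\<close>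

lemma hausdorff_outer_slab:
  fixes T :: "'a::euclidean_space \<Rightarrow> 'a"
  assumes T: "orthogonal_transformation T" and b0: "b0 \<in> Basis"
    and a: "\<And>b. b \<in> Basis \<Longrightarrow> b \<noteq> b0 \<Longrightarrow> 0 < a b"
  shows "hausdorff_outer (real DIM('a) - 1) (slab T b0 a)
    \<le> ennreal (slab_const TYPE('a) * (\<Prod>b\<in>Basis - {b0}. a b))"
proof -
  let ?N = "DIM('a)"
  let ?A' = "slab T b0 (\<lambda>b. 4 * a b)"
  have "0 < ?N" by simp
  then have v: "0 < unit_ball_vol (real ?N - 1)" by (intro unit_ball_vol_pos) linarith
  define \<delta> where "\<delta> = Min (insert (1/2) (a ` (Basis - {b0})))"
  have \<delta>: "0 < \<delta>" "\<delta> \<le> 1/2" "\<And>b. b \<in> Basis \<Longrightarrow> b \<noteq> b0 \<Longrightarrow> \<delta> \<le> a b"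
  proof -
    show "0 < \<delta>" using a by (auto simp: \<delta>_def)
    show "\<delta> \<le> 1/2" unfolding \<delta>_def by (intro Min_le) auto
    show "\<And>b. b \<in> Basis \<Longrightarrow> b \<noteq> b0 \<Longrightarrow> \<delta> \<le> a b" unfolding \<delta>_def by (intro Min_le) auto
  qed
  have near: "sgn y \<in> ?A'" if x: "x \<in> slab T b0 a" and y: "dist x y < \<delta>" for x y
  proof -
    have "norm x = 1" using x by (simp add: slab_def)
    moreover have "\<bar>norm x - norm y\<bar> \<le> dist x y" by (simp add: dist_norm norm_triangle_ineq3)
    ultimately have ny: "1/2 \<le> norm y" using y \<delta> by linarith
    have "\<bar>sgn y \<bullet> T b\<bar> \<le> 4 * a b" if b: "b \<in> Basis" "b \<noteq> b0" for b
    proof -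
      have nT: "norm (T b) = 1" using b orthogonal_transformation_norm[OF T, of b] by simp
      have "\<bar>y \<bullet> T b\<bar> \<le> \<bar>x \<bullet> T b\<bar> + \<bar>(x - y) \<bullet> T b\<bar>" by (simp add: inner_diff_left)
      also have "\<bar>(x - y) \<bullet> T b\<bar> \<le> dist x y"
        using Cauchy_Schwarz_ineq2[of "x - y" "T b"] nT by (simp add: dist_norm)
      also have "\<bar>x \<bullet> T b\<bar> \<le> a b" using x b by (simp add: slab_def)
      finally have "\<bar>y \<bullet> T b\<bar> \<le> 2 * a b" using y \<delta>(3)[OF b] by linarith
      also have "\<dots> \<le> 4 * a b * norm y" using ny a[OF b] by (simp add: field_simps)
      finally have "\<bar>y \<bullet> T b\<bar> / norm y \<le> 4 * a b" using ny by (subst pos_divide_le_eq) auto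
      moreover have "\<bar>sgn y \<bullet> T b\<bar> = \<bar>y \<bullet> T b\<bar> / norm y"
        by (simp add: sgn_div_norm abs_mult divide_inverse_commute)
      ultimately show ?thesis by simp
    qed
    moreover have "y \<noteq> 0" using ny by auto
    ultimately show ?thesis by (auto simp: slab_def norm_sgn)
  qed
  have "hausdorff_outer (real ?N - 1) (slab T b0 a) \<le>
    ennreal (unit_ball_vol (real ?N - 1) * real ?N * 4 ^ ?N / unit_ball_vol (real ?N)
       * measure lborel (cone_part ?A' 0 1))"
    by (rule hausdorff_outer_le_cone[OF _ _ \<delta>(1) near]) (auto simp: slab_def[of T b0 a])
  also have "\<dots> \<le> ennreal (slab_const TYPE('a) * (\<Prod>b\<in>Basis - {b0}. a b))"
  proof (rule ennreal_leI)
    define a' where "a' b = (if b = b0 then 1 else 4 * a b)" for b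
    have "cone_part ?A' 0 1 \<subseteq> {x. \<forall>b\<in>Basis. \<bar>x \<bullet> T b\<bar> \<le> a' b}"
    proof safe
      fix x b assume x: "x \<in> cone_part ?A' 0 1" and b: "b \<in> (Basis :: 'a set)"
      have nT: "norm (T b) = 1" using b orthogonal_transformation_norm[OF T, of b] by simp
      have nx: "0 < norm x" "norm x \<le> 1" using x by (auto simp: cone_part_def)
      show "\<bar>x \<bullet> T b\<bar> \<le> a' b"
      proof (cases "b = b0")
        case True
        then show ?thesis using Cauchy_Schwarz_ineq2[of x "T b"] nT nx by (simp add: a'_def)
      next
        case False
        have "sgn x \<in> slab T b0 (\<lambda>b. 4 * a b)" using x by (simp add: cone_part_def)
        then have "\<bar>sgn x \<bullet> T b\<bar> \<le> 4 * a b" using b False by (simp add: slab_def)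
        moreover have "\<bar>x \<bullet> T b\<bar> = norm x * \<bar>sgn x \<bullet> T b\<bar>"
          using nx by (simp add: sgn_div_norm abs_mult)
        moreover have "norm x * \<bar>sgn x \<bullet> T b\<bar> \<le> 1 * \<bar>sgn x \<bullet> T b\<bar>"
          using nx by (intro mult_right_mono) auto
        ultimately show ?thesis using False by (simp add: a'_def)
      qed
    qed
    then have "emeasure lborel (cone_part ?A' 0 1) \<le> emeasure lborel {x. \<forall>b\<in>Basis. \<bar>x \<bullet> T b\<bar> \<le> a' b}"
      by (intro emeasure_mono) measurable
    also have "\<dots> = ennreal (\<Prod>b\<in>Basis. 2 * a' b)"
      using a by (intro emeasure_rotated_box[OF T]) (auto simp: a'_def less_imp_le)
    also have "(\<Prod>b\<in>Basis. 2 * a' b) = 2 * (\<Prod>b\<in>Basis-{b0}. 8 * a b)"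
    proof -
      have "(\<Prod>b\<in>Basis. 2 * a' b) = 2 * a' b0 * (\<Prod>b\<in>Basis-{b0}. 2 * a' b)"
        using b0 by (intro prod.remove) auto
      also have "(\<Prod>b\<in>Basis-{b0}. 2 * a' b) = (\<Prod>b\<in>Basis-{b0}. 8 * a b)"
        by (intro prod.cong) (auto simp: a'_def)
      finally show ?thesis by (simp add: a'_def)
    qed
    finally have "ennreal (measure lborel (cone_part ?A' 0 1)) \<le> ennreal (2 * (\<Prod>b\<in>Basis-{b0}. 8 * a b))"
      by (simp only: emeasure_cone_part)
    moreover have "0 \<le> 2 * (\<Prod>b\<in>Basis-{b0}. 8 * a b)"
      using a by (intro mult_nonneg_nonneg prod_nonneg) (auto simp: less_imp_le)
    ultimately have "measure lborel (cone_part ?A' 0 1) \<le> 2 * (\<Prod>b\<in>Basis-{b0}. 8 * a b)"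
      by (simp only: ennreal_le_iff)
    also have "\<dots> = 2 * 8 ^ (?N - 1) * (\<Prod>b\<in>Basis-{b0}. a b)"
      using b0 by (simp add: prod.distrib card_Diff_singleton)
    finally have W: "measure lborel (cone_part ?A' 0 1) \<le> 2 * 8 ^ (?N - 1) * (\<Prod>b\<in>Basis-{b0}. a b)" .
    have "unit_ball_vol (real ?N - 1) * real ?N * 4 ^ ?N / unit_ball_vol (real ?N) * measure lborel (cone_part ?A' 0 1)
      \<le> unit_ball_vol (real ?N - 1) * real ?N * 4 ^ ?N / unit_ball_vol (real ?N) * (2 * 8 ^ (?N - 1) * (\<Prod>b\<in>Basis-{b0}. a b))"
      using v by (intro mult_left_mono W) (auto intro!: divide_nonneg_nonneg mult_nonneg_nonneg less_imp_le)
    then show "unit_ball_vol (real ?N - 1) * real ?N * 4 ^ ?N / unit_ball_vol (real ?N) * measure lborel (cone_part ?A' 0 1)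
      \<le> slab_const TYPE('a) * (\<Prod>b\<in>Basis - {b0}. a b)"
      by (simp add: slab_const_def mult_ac)
  qed
  finally show ?thesis .
qed

text \<open>The cone over the strip contains a box of side \<open>\<delta> / N\<close> in the direction \<open>b0\<close> and of fixed side lengths in
  the other directions. The box is kept away from the origin by the lower bound on the other coordinates.\<close>

lemma hausdorff_outer_equatorial_strip:
  fixes b0 :: "'a::euclidean_space"
  assumes N2: "2 \<le> DIM('a)" and b0: "b0 \<in> Basis"
  shows "\<exists>c>0. \<forall>\<delta>. 0 < \<delta> \<longrightarrow> \<delta> \<le> 1 \<longrightarrow>
    ennreal (c * \<delta>) \<le> hausdorff_outer (real DIM('a) - 1) (sphere (0::'a) 1 \<inter> {\<xi>. \<bar>\<xi> \<bullet> b0\<bar> \<le> \<delta>})"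
proof -
  let ?N = "DIM('a)"
  define K where "K = unit_ball_vol (real ?N) * 4 ^ ?N / unit_ball_vol (real ?N - 1)"
  have v: "0 < unit_ball_vol (real ?N - 1)" using N2 by (intro unit_ball_vol_pos) linarith
  have K: "0 < K" using v by (simp add: K_def)
  define w where "w = (1 / real ?N) * (1 / (2 * real ?N)) ^ (?N - 1)"
  have w: "0 < w" by (simp add: w_def)
  show ?thesis
  proof (intro exI[of _ "w / K"] conjI allI impI)
    show "0 < w / K" using w K by simp
    fix \<delta> :: real assume \<delta>: "0 < \<delta>" "\<delta> \<le> 1"
    let ?A = "sphere (0::'a) 1 \<inter> {\<xi>. \<bar>\<xi> \<bullet> b0\<bar> \<le> \<delta>}"
    have A[measurable]: "?A \<in> sets borel" by measurable
    define l u where "l b = (if b = b0 then - \<delta> / (2 * real ?N) else 1 / (2 * real ?N))"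
      and "u b = (if b = b0 then \<delta> / (2 * real ?N) else 1 / real ?N)" for b :: 'a
    have lu: "l b \<le> u b" for b using \<delta> by (auto simp: l_def u_def field_simps)
    have "cbox (\<Sum>b\<in>Basis. l b *\<^sub>R b) (\<Sum>b\<in>Basis. u b *\<^sub>R b) \<subseteq> cone_part ?A 0 1"
    proof
      fix x :: 'a assume "x \<in> cbox (\<Sum>b\<in>Basis. l b *\<^sub>R b) (\<Sum>b\<in>Basis. u b *\<^sub>R b)"
      then have x: "l b \<le> x \<bullet> b" "x \<bullet> b \<le> u b" if "b \<in> Basis" for b using that by (auto simp: mem_box)
      have "norm x \<le> (\<Sum>b\<in>Basis. \<bar>x \<bullet> b\<bar>)" by (rule norm_le_l1)
      also have "\<dots> \<le> (\<Sum>b\<in>(Basis::'a set). 1 / real ?N)"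
      proof (rule sum_mono)
        fix b :: 'a assume "b \<in> Basis"
        then have "\<bar>x \<bullet> b\<bar> \<le> u b" using x[of b] by (auto simp: l_def u_def abs_le_iff split: if_splits)
        also have "\<dots> \<le> 1 / real ?N" using \<delta> by (auto simp: u_def field_simps)
        finally show "\<bar>x \<bullet> b\<bar> \<le> 1 / real ?N" .
      qed
      also have "\<dots> = 1" by simp
      finally have n1: "norm x \<le> 1" .
      have "card (Basis - {b0}) \<noteq> 0" using N2 b0 by (simp add: card_Diff_singleton)
      then obtain b1 where b1: "b1 \<in> Basis" "b1 \<noteq> b0" by (metis Diff_iff card.empty ex_in_conv insertI1)
      have "1 / (2 * real ?N) \<le> x \<bullet> b1" using x(1)[OF b1(1)] b1 by (simp add: l_def)
      also have "\<dots> \<le> norm x" using b1 Basis_le_norm[of b1 x] by simp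
      finally have n2: "1 / (2 * real ?N) \<le> norm x" .
      moreover have "0 < 1 / (2 * real ?N)" by simp
      ultimately have n3: "0 < norm x" by linarith
      have "\<bar>x \<bullet> b0\<bar> \<le> \<delta> * (1 / (2 * real ?N))" using x[OF b0] by (auto simp: l_def u_def abs_le_iff)
      also have "\<dots> \<le> \<delta> * norm x" using n2 \<delta> by (intro mult_left_mono) auto
      finally have "\<bar>x \<bullet> b0\<bar> / norm x \<le> \<delta>" using n3 by (simp add: pos_divide_le_eq)
      then have "\<bar>sgn x \<bullet> b0\<bar> \<le> \<delta>" by (simp add: sgn_div_norm abs_mult divide_inverse_commute)
      then show "x \<in> cone_part ?A 0 1" using n1 n3 by (auto simp: cone_part_def norm_sgn)
    qed
    then have "emeasure lborel (cbox (\<Sum>b\<in>Basis. l b *\<^sub>R b) (\<Sum>b\<in>Basis. u b *\<^sub>R b :: 'a)) \<le> emeasure lborel (cone_part ?A 0 1)"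
      by (intro emeasure_mono) measurable
    moreover have "emeasure lborel (cbox (\<Sum>b\<in>Basis. l b *\<^sub>R b) (\<Sum>b\<in>Basis. u b *\<^sub>R b :: 'a)) = ennreal (\<Prod>b\<in>(Basis::'a set). u b - l b)"
      using lu by (simp add: emeasure_lborel_cbox_eq inner_diff_left)
    moreover have "(\<Prod>b\<in>(Basis::'a set). u b - l b) = w * \<delta>"
    proof -
      have "(\<Prod>b\<in>(Basis::'a set). u b - l b) = (u b0 - l b0) * (\<Prod>b\<in>Basis-{b0}. u b - l b)"
        using b0 by (intro prod.remove) auto
      also have "(\<Prod>b\<in>Basis-{b0}. u b - l b) = (\<Prod>b\<in>Basis-{b0}. 1 / (2 * real ?N))"
        by (intro prod.cong) (auto simp: u_def l_def field_simps)
      also have "\<dots> = (1 / (2 * real ?N)) ^ (?N - 1)" using b0 by (simp add: card_Diff_singleton)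
      also have "u b0 - l b0 = \<delta> / real ?N" by (simp add: u_def l_def)
      finally show ?thesis by (simp add: w_def)
    qed
    ultimately have "ennreal (w * \<delta>) \<le> emeasure lborel (cone_part ?A 0 1)" by simp
    also have "\<dots> \<le> ennreal K * hausdorff_outer (real ?N - 1) ?A"
      unfolding K_def by (intro cone_le_hausdorff_outer N2) auto
    finally have "ennreal (1 / K) * ennreal (w * \<delta>) \<le> ennreal (1 / K) * (ennreal K * hausdorff_outer (real ?N - 1) ?A)"
      by (intro mult_left_mono) auto
    also have "\<dots> = hausdorff_outer (real ?N - 1) ?A"
      using K by (simp add: mult.assoc[symmetric] flip: ennreal_mult')
    finally show "ennreal (w / K * \<delta>) \<le> hausdorff_outer (real ?N - 1) ?A"
      using K by (simp flip: ennreal_mult')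
  qed
qed

section \<open>Orthonormal frames adapted to a quasi-norm\<close>

lemma power_bracket:
  fixes x :: real assumes "1 \<le> x"
  obtains k :: nat where "2 ^ k \<le> x" "x < 2 ^ Suc k"
proof -
  obtain n where n: "x < 2 ^ n" using real_arch_pow[of 2 x] by auto
  define m where "m = (LEAST n. x < (2::real) ^ n)"
  have m: "x < 2 ^ m" unfolding m_def using n by (rule LeastI)
  have "m \<noteq> 0" using m assms by (intro notI) simp
  then obtain k where k: "m = Suc k" by (cases m) auto
  have "\<not> x < 2 ^ k" using not_less_Least[of k "\<lambda>n. x < (2::real) ^ n"] k by (simp add: m_def)
  then show ?thesis using that[of k] m k by simp
qed

text \<open>Each new vector minimises \<open>Q\<close> among the unit vectors orthogonal to the previous ones. Then \<open>Q\<close> of the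
  new vector, times the norm, is a lower bound for \<open>Q\<close> on that orthogonal complement, and the
  quasi-triangle inequality shows that projecting to the complement of one more vector increases \<open>Q\<close>
  by at most the factor \<open>4\<close>.\<close>

lemma exists_greedy_orthonormal:
  fixes Q :: "'a::euclidean_space \<Rightarrow> real"
  assumes cont: "continuous_on UNIV Q" and hom: "\<And>t x. Q (t *\<^sub>R x) = \<bar>t\<bar> * Q x"
    and quasi: "\<And>x y. Q (x + y) \<le> 2 * (Q x + Q y)" and nonneg: "\<And>x. 0 \<le> Q x"
    and k: "k \<le> DIM('a)"
  shows "\<exists>e :: nat \<Rightarrow> 'a. (\<forall>i<k. norm (e i) = 1) \<and> (\<forall>i<k. \<forall>j<k. i \<noteq> j \<longrightarrow> e i \<bullet> e j = 0) \<and>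
    (\<forall>i<k. \<forall>x. Q (e i) * \<bar>x \<bullet> e i\<bar> \<le> 4 ^ i * Q x) \<and>
    (\<forall>x. Q (x - (\<Sum>i<k. (x \<bullet> e i) *\<^sub>R e i)) \<le> 4 ^ k * Q x)"
  using k
proof (induction k)
  case 0 then show ?case by simp
next
  case (Suc k)
  have "k \<le> DIM('a)" using Suc.prems by simp
  from Suc.IH[OF this] obtain e :: "nat \<Rightarrow> 'a" where e: "(\<forall>i<k. norm (e i) = 1) \<and>
    (\<forall>i<k. \<forall>j<k. i \<noteq> j \<longrightarrow> e i \<bullet> e j = 0) \<and>
    (\<forall>i<k. \<forall>x. Q (e i) * \<bar>x \<bullet> e i\<bar> \<le> 4 ^ i * Q x) \<and>
    (\<forall>x. Q (x - (\<Sum>i<k. (x \<bullet> e i) *\<^sub>R e i)) \<le> 4 ^ k * Q x)"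
    by (rule exE)
  note n1 = e[THEN conjunct1, rule_format]
    and orth = e[THEN conjunct2, THEN conjunct1, rule_format]
    and Qe = e[THEN conjunct2, THEN conjunct2, THEN conjunct1, rule_format]
    and QP = e[THEN conjunct2, THEN conjunct2, THEN conjunct2, rule_format]
  define V where "V = sphere (0::'a) 1 \<inter> (\<Inter>i<k. {x. x \<bullet> e i = 0})"
  have "compact V" unfolding V_def
    by (intro compact_Int_closed compact_sphere closed_INT) (auto intro!: closed_Collect_eq continuous_intros)
  moreover have "V \<noteq> {}"
  proof -
    have "dim (e ` {..<k}) \<le> card (e ` {..<k})" by (intro dim_le_card') simp
    also have "\<dots> \<le> k" using card_image_le[of "{..<k}" e] by simp
    also have "\<dots> < DIM('a)" using Suc.prems by simp
    finally obtain x where x: "x \<noteq> 0" "\<And>y. y \<in> span (e ` {..<k}) \<Longrightarrow> orthogonal x y"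
      using orthogonal_to_subspace_exists by blast
    have "sgn x \<bullet> e i = 0" if "i < k" for i
    proof -
      have "orthogonal x (e i)" using that by (intro x(2) span_base) auto
      then show ?thesis by (simp add: orthogonal_def sgn_div_norm)
    qed
    then have "sgn x \<in> V" using x(1) by (auto simp: V_def norm_sgn)
    then show ?thesis by auto
  qed
  ultimately obtain v where v: "v \<in> V" "\<And>y. y \<in> V \<Longrightarrow> Q v \<le> Q y"
    using continuous_attains_inf[of V Q] continuous_on_subset[OF cont] by auto
  have nv: "norm v = 1" and vo: "\<And>i. i < k \<Longrightarrow> v \<bullet> e i = 0" using v(1) by (auto simp: V_def)
  let ?P = "\<lambda>x. x - (\<Sum>i<k. (x \<bullet> e i) *\<^sub>R e i)"
  have Po: "?P x \<bullet> e j = 0" if j: "j < k" for x j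
  proof -
    have "(\<Sum>i<k. (x \<bullet> e i) * (e i \<bullet> e j)) = (\<Sum>i<k. if i = j then x \<bullet> e j else 0)"
      using j n1[OF j] orth[of _ j] by (intro sum.cong) (auto simp: dot_square_norm)
    then show ?thesis using j by (simp add: inner_diff_left inner_sum_left)
  qed
  have Pv: "?P x \<bullet> v = x \<bullet> v" for x
    using vo by (simp add: inner_diff_left inner_sum_left inner_commute[of "e _" v])
  have low: "Q v * norm y \<le> Q y" if y: "\<And>i. i < k \<Longrightarrow> y \<bullet> e i = 0" for y
  proof (cases "y = 0")
    case True then show ?thesis using nonneg by simp
  next
    case False
    then have "sgn y \<in> V" using y by (auto simp: V_def norm_sgn sgn_div_norm)
    then have "Q v \<le> Q (sgn y)" by (rule v(2))
    also have "\<dots> = Q y / norm y" by (simp add: sgn_div_norm hom divide_inverse_commute)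
    finally show ?thesis using False by (simp add: field_simps)
  qed
  have Qv: "Q v * \<bar>x \<bullet> v\<bar> \<le> 4 ^ k * Q x" for x
  proof -
    have "\<bar>x \<bullet> v\<bar> \<le> norm (?P x)" using Cauchy_Schwarz_ineq2[of "?P x" v] nv by (simp only: Pv)
    then have "Q v * \<bar>x \<bullet> v\<bar> \<le> Q v * norm (?P x)" using nonneg by (intro mult_left_mono) auto
    also have "\<dots> \<le> Q (?P x)" by (intro low Po)
    also have "\<dots> \<le> 4 ^ k * Q x" by (rule QP)
    finally show ?thesis .
  qed
  let ?e = "e(k := v)"
  have sum_eq: "x - (\<Sum>i<Suc k. (x \<bullet> ?e i) *\<^sub>R ?e i) = ?P x + (- (x \<bullet> v)) *\<^sub>R v" for x by simp
  show ?case
  proof (intro exI[of _ ?e] conjI allI impI)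
    fix i assume "i < Suc k" then show "norm (?e i) = 1" using n1 nv by (auto simp: less_Suc_eq)
  next
    fix i j assume "i < Suc k" "j < Suc k" "i \<noteq> j"
    then show "?e i \<bullet> ?e j = 0" using orth vo by (auto simp: less_Suc_eq inner_commute)
  next
    fix i x assume "i < Suc k"
    then show "Q (?e i) * \<bar>x \<bullet> ?e i\<bar> \<le> 4 ^ i * Q x" using Qe Qv by (auto simp: less_Suc_eq)
  next
    fix x
    have "Q (?P x + (- (x \<bullet> v)) *\<^sub>R v) \<le> 2 * (Q (?P x) + Q ((- (x \<bullet> v)) *\<^sub>R v))" by (rule quasi)
    also have "Q ((- (x \<bullet> v)) *\<^sub>R v) = Q v * \<bar>x \<bullet> v\<bar>" by (simp only: hom abs_minus_cancel mult.commute)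
    also have "2 * (Q (?P x) + Q v * \<bar>x \<bullet> v\<bar>) \<le> 2 * (4 ^ k * Q x + 4 ^ k * Q x)"
      by (intro mult_left_mono add_mono QP Qv) simp
    also have "\<dots> = 4 ^ Suc k * Q x" by simp
    finally show "Q (x - (\<Sum>i<Suc k. (x \<bullet> ?e i) *\<^sub>R ?e i)) \<le> 4 ^ Suc k * Q x"
      unfolding sum_eq .
  qed
qed

text \<open>Up to constants, the unit ball of \<open>Q\<close> is a box in the frame \<open>T b\<close>: it is contained in the box with
  half-sides \<open>4 ^ N / Q (T b)\<close>. This replaces the John ellipsoid of that ball.\<close>

lemma exists_adapted_rotation:
  fixes Q :: "'a::euclidean_space \<Rightarrow> real"
  assumes cont: "continuous_on UNIV Q" and hom: "\<And>t x. Q (t *\<^sub>R x) = \<bar>t\<bar> * Q x"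
    and quasi: "\<And>x y. Q (x + y) \<le> 2 * (Q x + Q y)" and nonneg: "\<And>x. 0 \<le> Q x"
  obtains T :: "'a \<Rightarrow> 'a" where "orthogonal_transformation T"
    "\<And>b x. b \<in> Basis \<Longrightarrow> Q (T b) * \<bar>x \<bullet> T b\<bar> \<le> 4 ^ DIM('a) * Q x"
proof -
  from exists_greedy_orthonormal[OF cont hom quasi nonneg order_refl]
  obtain e :: "nat \<Rightarrow> 'a" where e: "(\<forall>i<DIM('a). norm (e i) = 1) \<and>
    (\<forall>i<DIM('a). \<forall>j<DIM('a). i \<noteq> j \<longrightarrow> e i \<bullet> e j = 0) \<and>
    (\<forall>i<DIM('a). \<forall>x. Q (e i) * \<bar>x \<bullet> e i\<bar> \<le> 4 ^ i * Q x) \<and>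
    (\<forall>x. Q (x - (\<Sum>i<DIM('a). (x \<bullet> e i) *\<^sub>R e i)) \<le> 4 ^ DIM('a) * Q x)"
    by (rule exE)
  note n1 = e[THEN conjunct1, rule_format]
    and orth = e[THEN conjunct2, THEN conjunct1, rule_format]
    and Qe = e[THEN conjunct2, THEN conjunct2, THEN conjunct1, rule_format]
  obtain h where h: "bij_betw h (Basis :: 'a set) {..<DIM('a)}"
    using ex_bij_betw_finite_nat[OF finite_Basis] by (auto simp: atLeast0LessThan)
  have hi: "h b < DIM('a)" if "b \<in> Basis" for b :: 'a using h that by (auto simp: bij_betw_def)
  have hinj: "h b = h c \<longleftrightarrow> b = c" if "b \<in> Basis" "c \<in> Basis" for b c :: 'a
    using h that by (auto simp: bij_betw_def inj_on_def)
  define T where "T x = (\<Sum>b\<in>Basis. (x \<bullet> b) *\<^sub>R e (h b))" for x :: 'a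
  have Tb: "T b = e (h b)" if "b \<in> Basis" for b
  proof -
    have "T b = (\<Sum>c\<in>Basis. if c = b then e (h b) else 0)"
      unfolding T_def using that by (intro sum.cong) (auto simp: inner_Basis)
    then show ?thesis using that by simp
  qed
  have ee: "e (h b) \<bullet> e (h c) = (if b = c then 1 else 0)" if "b \<in> Basis" "c \<in> Basis" for b c
    using that n1[OF hi] orth[OF hi hi] hinj by (auto simp: dot_square_norm)
  have "linear T" unfolding T_def by (intro linearI) (simp_all add: inner_add_left scaleR_add_left sum.distrib scaleR_sum_right)
  moreover have "T v \<bullet> T w = v \<bullet> w" for v w
  proof -
    have "T v \<bullet> T w = (\<Sum>c\<in>Basis. \<Sum>b\<in>Basis. (v \<bullet> b) * ((w \<bullet> c) * (e (h b) \<bullet> e (h c))))"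
      unfolding T_def by (simp add: inner_sum_left inner_sum_right sum_distrib_left mult_ac)
    also have "\<dots> = (\<Sum>c\<in>Basis. \<Sum>b\<in>Basis. if b = c then (v \<bullet> c) * (w \<bullet> c) else 0)"
      by (intro sum.cong) (auto simp: ee)
    also have "\<dots> = v \<bullet> w" by (simp add: euclidean_inner[of v w])
    finally show ?thesis .
  qed
  ultimately have oT: "orthogonal_transformation T" by (simp add: orthogonal_transformation_def)
  have QT: "Q (T b) * \<bar>x \<bullet> T b\<bar> \<le> 4 ^ DIM('a) * Q x" if b: "b \<in> Basis" for b x
  proof -
    have "Q (T b) * \<bar>x \<bullet> T b\<bar> \<le> 4 ^ h b * Q x" using Qe[OF hi[OF b]] Tb[OF b] by simp
    also have "\<dots> \<le> 4 ^ DIM('a) * Q x"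
      using hi[OF b] nonneg by (intro mult_right_mono power_increasing) auto
    finally show ?thesis .
  qed
  show ?thesis by (rule that[OF oT]) (rule QT)
qed

section \<open>Two-sided bounds for the affine energy\<close>

lemma emeasure_sphere_measure:
  "A \<in> sets borel \<Longrightarrow> emeasure (sphere_measure :: 'a::euclidean_space measure) A = hausdorff_outer (real DIM('a) - 1) A"
  by (rule emeasure_hausdorff)

text \<open>Split the sphere dyadically according to the size of \<open>Q\<close>. The part where \<open>Q\<close> is about \<open>2 ^ k * t0\<close> is
  contained in a slab whose measure is at most a multiple of \<open>(2 ^ k * t0) ^ (N - 1)\<close> divided by the product
  of the numbers \<open>Q (T b)\<close>, \<open>b \<noteq> b0\<close>, while the integrand is at most \<open>(2 ^ k * t0)\<close> to the power \<open>- N\<close>. The resulting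
  series is geometric with ratio \<open>1 / 2\<close>, and the lower bound \<open>t0\<close> for \<open>Q\<close> on the sphere, of order \<open>Q (T b0)\<close>,
  supplies the missing factor of the product.\<close>

lemma sphere_integral_le:
  fixes T :: "'a::euclidean_space \<Rightarrow> 'a" and Q :: "'a \<Rightarrow> real"
  assumes T: "orthogonal_transformation T" and c: "0 < c"
    and Q: "\<And>b x. b \<in> Basis \<Longrightarrow> Q (T b) * \<bar>x \<bullet> T b\<bar> \<le> c * Q x"
    and pos: "\<And>b. b \<in> Basis \<Longrightarrow> 0 < Q (T b)"
  shows "(\<integral>\<^sup>+\<xi>\<in>sphere (0::'a) 1. ennreal (Q \<xi> powr (- real DIM('a))) \<partial>sphere_measure)
    \<le> ennreal (slab_const TYPE('a) * (2 * c) ^ (DIM('a) - 1) * (2 * c * real DIM('a)) / (\<Prod>b\<in>Basis. Q (T b)))"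
proof -
  let ?N = "DIM('a)"
  let ?n = "real ?N"
  have "(Basis :: 'a set) \<noteq> {}" by simp
  then obtain b0 where b0: "b0 \<in> Basis" "\<And>b. b \<in> Basis \<Longrightarrow> Q (T b0) \<le> Q (T b)"
    using ex_is_arg_min_if_finite[OF finite_Basis, of "\<lambda>b. Q (T b)"] by (auto simp: is_arg_min_linorder)
  \<comment> \<open>A unit vector has a component of size at least \<open>1 / N\<close> along some \<open>T b\<close>, hence \<open>Q\<close> is at least \<open>t0\<close> on the sphere.\<close>
  define t0 where "t0 = Q (T b0) / (c * ?n)"
  have t0: "0 < t0" using pos[OF b0(1)] c by (simp add: t0_def)
  have low: "t0 \<le> Q \<xi>" if \<xi>: "\<xi> \<in> sphere 0 1" for \<xi>
  proof -
    have ex: "\<exists>b\<in>Basis. 1 / ?n \<le> \<bar>\<xi> \<bullet> T b\<bar>"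
    proof (rule ccontr)
      assume "\<not> ?thesis"
      then have lt: "\<bar>\<xi> \<bullet> T b\<bar> < 1 / ?n" if "b \<in> Basis" for b using that by (auto simp: not_le)
      obtain z where z: "\<xi> = T z" using orthogonal_transformation_surj[OF T] by auto
      have "1 = norm z" using \<xi> orthogonal_transformation_norm[OF T, of z] z by simp
      also have "\<dots> \<le> (\<Sum>b\<in>Basis. \<bar>z \<bullet> b\<bar>)" by (rule norm_le_l1)
      also have "\<dots> = (\<Sum>b\<in>Basis. \<bar>\<xi> \<bullet> T b\<bar>)" using T by (simp add: z orthogonal_transformation_def)
      also have "\<dots> < (\<Sum>b\<in>(Basis::'a set). 1 / ?n)" by (intro sum_strict_mono lt) auto
      also have "\<dots> = 1" by simp
      finally show False by simp
    qed
    then obtain b where b: "b \<in> Basis" "1 / ?n \<le> \<bar>\<xi> \<bullet> T b\<bar>" by auto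
    have "Q (T b0) * (1 / ?n) \<le> Q (T b) * \<bar>\<xi> \<bullet> T b\<bar>"
      using b b0 pos[OF b(1)] pos[OF b0(1)] by (intro mult_mono) (auto simp: less_imp_le)
    also have "\<dots> \<le> c * Q \<xi>" by (rule Q[OF b(1)])
    finally show ?thesis using c by (simp add: t0_def field_simps)
  qed
  define a where "a k b = c * (2 ^ Suc k * t0) / Q (T b)" for k :: nat and b
  define h where "h k \<xi> = ennreal ((2 ^ k * t0) powr (- ?n)) * indicator (slab T b0 (a k)) \<xi>" for k \<xi>
  have apos: "0 < a k b" if "b \<in> Basis" for k b using that pos c t0 by (simp add: a_def)
  have pt: "ennreal (Q \<xi> powr (- ?n)) * indicator (sphere 0 1) \<xi> \<le> (\<Sum>k. h k \<xi>)" for \<xi>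
  proof (cases "\<xi> \<in> sphere 0 1")
    case True
    have "1 \<le> Q \<xi> / t0" using low[OF True] t0 by simp
    then obtain k :: nat where k: "2 ^ k \<le> Q \<xi> / t0" "Q \<xi> / t0 < 2 ^ Suc k" by (rule power_bracket)
    have k1: "2 ^ k * t0 \<le> Q \<xi>" "Q \<xi> \<le> 2 ^ Suc k * t0" using k t0 by (simp_all add: field_simps)
    have "\<xi> \<in> slab T b0 (a k)"
    proof -
      have "\<bar>\<xi> \<bullet> T b\<bar> \<le> a k b" if b: "b \<in> Basis" for b
      proof -
        have "Q (T b) * \<bar>\<xi> \<bullet> T b\<bar> \<le> c * Q \<xi>" by (rule Q[OF b])
        also have "\<dots> \<le> c * (2 ^ Suc k * t0)" using k1 c by (intro mult_left_mono) auto
        finally show ?thesis using pos[OF b] by (simp add: a_def field_simps)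
      qed
      then show ?thesis using True by (auto simp: slab_def)
    qed
    then have "ennreal (Q \<xi> powr (- ?n)) * indicator (sphere 0 1) \<xi> \<le> h k \<xi>"
      using True k1 t0 by (auto simp: h_def intro!: ennreal_leI powr_mono2')
    also have "\<dots> \<le> (\<Sum>k. h k \<xi>)"
      using sum_le_suminf[of "\<lambda>k. h k \<xi>" "{k}"] by simp
    finally show ?thesis .
  qed simp
  have [measurable]: "h k \<in> borel_measurable (sphere_measure)" for k
    unfolding h_def by measurable
  let ?C = "slab_const TYPE('a)"
  let ?P = "\<Prod>b\<in>Basis - {b0}. Q (T b)"
  have P: "0 < ?P" using pos by (intro prod_pos) auto
  have hk: "(\<integral>\<^sup>+\<xi>. h k \<xi> \<partial>sphere_measure) \<le> ennreal (?C * (2 * c) ^ (?N - 1) / (t0 * ?P) * (1/2)^k)" for k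
  proof -
    have "(\<integral>\<^sup>+\<xi>. h k \<xi> \<partial>sphere_measure) = ennreal ((2 ^ k * t0) powr (- ?n)) * hausdorff_outer (?n - 1) (slab T b0 (a k))"
      unfolding h_def by (subst nn_integral_cmult_indicator) (auto simp: emeasure_sphere_measure)
    also have "\<dots> \<le> ennreal ((2 ^ k * t0) powr (- ?n)) * ennreal (?C * (\<Prod>b\<in>Basis - {b0}. a k b))"
      using apos by (intro mult_left_mono hausdorff_outer_slab[OF T b0(1)]) auto
    also have "\<dots> = ennreal ((2 ^ k * t0) powr (- ?n) * (?C * (\<Prod>b\<in>Basis - {b0}. a k b)))"
      by (intro ennreal_mult'[symmetric]) simp
    also have "(\<Prod>b\<in>Basis - {b0}. a k b) = (2 * c) ^ (?N - 1) * (2 ^ k * t0) ^ (?N - 1) / ?P"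
    proof -
      have "(\<Prod>b\<in>Basis - {b0}. a k b) = (c * (2 ^ Suc k * t0)) ^ (?N - 1) / ?P"
        using b0(1) by (simp add: a_def prod_dividef card_Diff_singleton)
      also have "c * (2 ^ Suc k * t0) = (2 * c) * (2 ^ k * t0)" by simp
      finally show ?thesis by (simp only: power_mult_distrib)
    qed
    also have "(2 ^ k * t0) powr (- ?n) = 1 / ((2 ^ k * t0) * (2 ^ k * t0) ^ (?N - 1))"
    proof -
      have "(2 ^ k * t0) ^ ?N = (2 ^ k * t0) * (2 ^ k * t0) ^ (?N - 1)" by (cases ?N) auto
      then show ?thesis using t0 by (simp add: powr_minus powr_realpow divide_inverse)
    qed
    also have "1 / ((2 ^ k * t0) * (2 ^ k * t0) ^ (?N - 1)) * (?C * ((2 * c) ^ (?N - 1) * (2 ^ k * t0) ^ (?N - 1) / ?P))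
       = ?C * (2 * c) ^ (?N - 1) / (t0 * ?P) * (1/2)^k"
      using t0 P by (simp add: field_simps power_one_over)
    finally show ?thesis .
  qed
  have C0: "0 \<le> ?C * (2 * c) ^ (?N - 1) / (t0 * ?P)" using slab_const_pos[where 'a='a] c t0 P
    by (intro divide_nonneg_nonneg mult_nonneg_nonneg) (auto simp: less_imp_le)
  have "(\<integral>\<^sup>+\<xi>\<in>sphere (0::'a) 1. ennreal (Q \<xi> powr (- ?n)) \<partial>sphere_measure) \<le> (\<integral>\<^sup>+\<xi>. (\<Sum>k. h k \<xi>) \<partial>sphere_measure)"
    by (intro nn_integral_mono pt)
  also have "\<dots> = (\<Sum>k. \<integral>\<^sup>+\<xi>. h k \<xi> \<partial>sphere_measure)" by (intro nn_integral_suminf) measurable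
  also have "\<dots> \<le> (\<Sum>k. ennreal (?C * (2 * c) ^ (?N - 1) / (t0 * ?P) * (1/2)^k))"
    by (intro suminf_le hk) auto
  also have "\<dots> = ennreal (?C * (2 * c) ^ (?N - 1) / (t0 * ?P) * 2)"
  proof (rule suminf_ennreal_eq)
    show "(\<lambda>k. ?C * (2 * c) ^ (?N - 1) / (t0 * ?P) * (1/2)^k) sums (?C * (2 * c) ^ (?N - 1) / (t0 * ?P) * 2)"
      using geometric_sums[of "1/2 :: real"] by (intro sums_mult) simp
    show "0 \<le> ?C * (2 * c) ^ (?N - 1) / (t0 * ?P) * (1/2)^k" for k
      using C0 by (rule mult_nonneg_nonneg) simp
  qed
  also have "?C * (2 * c) ^ (?N - 1) / (t0 * ?P) * 2 = ?C * (2 * c) ^ (?N - 1) * (2 * c * ?n) / (\<Prod>b\<in>Basis. Q (T b))"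
  proof -
    have "(\<Prod>b\<in>Basis. Q (T b)) = Q (T b0) * ?P" using b0(1) by (intro prod.remove) auto
    then show ?thesis using pos[OF b0(1)] c P by (simp add: t0_def field_simps)
  qed
  finally show ?thesis .
qed

lemma sphere_measure_finite_pos:
  assumes "2 \<le> DIM('a::euclidean_space)"
  obtains s where "0 < s" "emeasure sphere_measure (sphere (0::'a) 1) = ennreal s"
proof -
  obtain b0 :: 'a where b0: "b0 \<in> Basis" using nonempty_Basis by blast
  obtain c where c: "0 < c" "\<forall>\<delta>. 0 < \<delta> \<longrightarrow> \<delta> \<le> 1 \<longrightarrow>
    ennreal (c * \<delta>) \<le> hausdorff_outer (real DIM('a) - 1) (sphere (0::'a) 1 \<inter> {\<xi>. \<bar>\<xi> \<bullet> b0\<bar> \<le> \<delta>})"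
    using hausdorff_outer_equatorial_strip[OF assms b0] by auto
  let ?h = "hausdorff_outer (real DIM('a) - 1) (sphere (0::'a) 1)"
  have "ennreal c \<le> ?h"
    using c(2)[rule_format, of 1] hausdorff_outer_mono[of "sphere (0::'a) 1 \<inter> {\<xi>. \<bar>\<xi> \<bullet> b0\<bar> \<le> 1}" "sphere 0 1"]
    by (force intro: order_trans)
  moreover have "?h \<le> hausdorff_outer (real DIM('a) - 1) (slab (\<lambda>x. x) b0 (\<lambda>_. 1))"
    by (intro hausdorff_outer_mono) (auto simp: slab_def intro: order_trans[OF Basis_le_norm])
  moreover have "\<dots> \<le> ennreal (slab_const TYPE('a) * (\<Prod>b\<in>(Basis::'a set) - {b0}. 1))"
    using b0 by (intro hausdorff_outer_slab) auto
  ultimately have h: "ennreal c \<le> ?h" "?h < top"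
    by (blast, blast intro: le_less_trans order_trans ennreal_less_top)
  then obtain s where s: "?h = ennreal s" "0 \<le> s" by (cases ?h) auto
  then have "c \<le> s" using h(1) c(1) by (simp add: ennreal_le_iff)
  then show ?thesis using s c(1) that[of s] by (simp add: emeasure_sphere_measure)
qed

definition grad_energy :: "real \<Rightarrow> ('a::euclidean_space \<Rightarrow> 'a) \<Rightarrow> 'a \<Rightarrow> ennreal" where
  "grad_energy p G \<xi> = (\<integral>\<^sup>+x. ennreal (\<bar>G x \<bullet> \<xi>\<bar> powr p) \<partial>lebesgue)"

text \<open>The affine energy is at least a multiple of the geometric mean of the directional norms along an adapted
  frame. The constant does not depend on \<open>f\<close>.\<close>

lemma affine_energy_ge:
  assumes N2: "2 \<le> DIM('a::euclidean_space)" and p: "1 \<le> p"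
  obtains c where "0 < c" "\<And>(f :: 'a \<Rightarrow> real) Q (T :: 'a \<Rightarrow> 'a).
    \<lbrakk>\<And>\<xi>. \<xi> \<noteq> 0 \<Longrightarrow> grad_energy p (weak_gradient f) \<xi> = ennreal (Q \<xi> powr p); \<And>\<xi>. \<xi> \<noteq> 0 \<Longrightarrow> 0 < Q \<xi>;
     orthogonal_transformation T; \<And>b x. b \<in> Basis \<Longrightarrow> Q (T b) * \<bar>x \<bullet> T b\<bar> \<le> 4 ^ DIM('a) * Q x\<rbrakk> \<Longrightarrow>
     ennreal (c * (\<Prod>b\<in>Basis. Q (T b)) powr (1 / real DIM('a))) \<le> affine_energy p f"
proof -
  let ?N = "DIM('a)"
  let ?n = "real ?N"
  obtain s where s: "0 < s" "emeasure sphere_measure (sphere (0::'a) 1) = ennreal s"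
    using sphere_measure_finite_pos[OF N2] .
  define C where "C = slab_const TYPE('a) * (2 * 4 ^ ?N) ^ (?N - 1) * (2 * 4 ^ ?N * ?n)"
  have C: "0 < C" using slab_const_pos[where 'a='a] by (simp add: C_def)
  define c where "c = s powr ((?n + p) / (?n * p)) * C powr (- 1 / ?n)"
  have "0 < c" using s C by (simp add: c_def)
  moreover have "ennreal (c * (\<Prod>b\<in>Basis. Q (T b)) powr (1 / ?n)) \<le> affine_energy p f"
    if J: "\<And>\<xi>. \<xi> \<noteq> 0 \<Longrightarrow> grad_energy p (weak_gradient f) \<xi> = ennreal (Q \<xi> powr p)" and pos: "\<And>\<xi>. \<xi> \<noteq> 0 \<Longrightarrow> 0 < Q \<xi>"
      and T: "orthogonal_transformation T" and Q: "\<And>b x. b \<in> Basis \<Longrightarrow> Q (T b) * \<bar>x \<bullet> T b\<bar> \<le> 4 ^ ?N * Q x"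
    for f :: "'a \<Rightarrow> real" and Q and T :: "'a \<Rightarrow> 'a"
  proof -
    have posT: "0 < Q (T b)" if "b \<in> Basis" for b
      using that orthogonal_transformation_norm[OF T, of b] by (intro pos) force
    let ?P = "\<Prod>b\<in>Basis. Q (T b)"
    have P: "0 < ?P" using posT by (intro prod_pos) auto
    let ?I = "\<integral>\<^sup>+\<xi>\<in>sphere (0::'a) 1. ennpowr (grad_energy p (weak_gradient f) \<xi>) (- ?n / p) \<partial>sphere_measure"
    have "?I = (\<integral>\<^sup>+\<xi>\<in>sphere (0::'a) 1. ennreal (Q \<xi> powr (- ?n)) \<partial>sphere_measure)"
    proof (intro nn_integral_cong)
      fix \<xi> :: 'a
      show "ennpowr (grad_energy p (weak_gradient f) \<xi>) (- ?n / p) * indicator (sphere 0 1) \<xi>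
        = ennreal (Q \<xi> powr (- ?n)) * indicator (sphere 0 1) \<xi>"
      proof (cases "\<xi> \<in> sphere 0 1")
        case True
        then have "\<xi> \<noteq> 0" by auto
        then show ?thesis using pos[of \<xi>] J[of \<xi>] p by (simp add: ennpowr_ennreal powr_powr)
      qed simp
    qed
    also have "\<dots> \<le> ennreal (C / ?P)"
      unfolding C_def by (rule sphere_integral_le[of T "4 ^ ?N" Q, OF T _ Q posT]) auto
    finally have I: "?I \<le> ennreal (C / ?P)" .
    have "ennreal (c * ?P powr (1 / ?n)) = ennreal (s powr ((?n + p) / (?n * p))) * ennreal ((C / ?P) powr (- 1 / ?n))"
      using C P by (simp add: c_def powr_divide powr_minus_divide mult.assoc flip: ennreal_mult')
    also have "\<dots> = ennpowr (ennreal s) ((?n + p) / (?n * p)) * ennpowr (ennreal (C / ?P)) (- 1 / ?n)"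
      using s C P by (simp add: ennpowr_ennreal)
    also have "\<dots> \<le> ennpowr (ennreal s) ((?n + p) / (?n * p)) * ennpowr ?I (- 1 / ?n)"
      using I by (intro mult_left_mono ennpowr_antimono) auto
    also have "\<dots> = affine_energy p f"
      by (simp add: affine_energy_def grad_energy_def s Let_def)
    finally show ?thesis .
  qed
  ultimately show ?thesis using that by blast
qed

text \<open>Only the directions in a strip around the equator orthogonal to \<open>b0\<close> are kept in the integral over the
  sphere; the strip has measure at least a multiple of \<open>\<delta>\<close>. Since the integral enters with a negative power,
  this bounds the energy from above.\<close>

lemma affine_energy_le:
  fixes b0 :: "'a::euclidean_space"
  assumes N2: "2 \<le> DIM('a)" and p: "1 \<le> p" and b0: "b0 \<in> Basis"
  obtains C where "0 < C" "\<And>(f :: 'a \<Rightarrow> real) \<delta> \<Lambda>.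
    \<lbrakk>0 < \<delta>; \<delta> \<le> 1; 0 < \<Lambda>;
     \<And>\<xi>. norm \<xi> = 1 \<Longrightarrow> \<bar>\<xi> \<bullet> b0\<bar> \<le> \<delta> \<Longrightarrow> grad_energy p (weak_gradient f) \<xi> \<le> ennreal (\<Lambda> powr p)\<rbrakk> \<Longrightarrow>
     affine_energy p f \<le> ennreal (C * \<Lambda> * \<delta> powr (- 1 / real DIM('a)))"
proof -
  let ?n = "real DIM('a)"
  obtain s where s: "0 < s" "emeasure sphere_measure (sphere (0::'a) 1) = ennreal s"
    using sphere_measure_finite_pos[OF N2] .
  obtain c where c: "0 < c" "\<And>\<delta>. 0 < \<delta> \<Longrightarrow> \<delta> \<le> 1 \<Longrightarrow>
    ennreal (c * \<delta>) \<le> hausdorff_outer (?n - 1) (sphere (0::'a) 1 \<inter> {\<xi>. \<bar>\<xi> \<bullet> b0\<bar> \<le> \<delta>})"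
    using hausdorff_outer_equatorial_strip[OF N2 b0] by auto
  define C where "C = s powr ((?n + p) / (?n * p)) * c powr (- 1 / ?n)"
  have "0 < C" using s c by (simp add: C_def)
  moreover have "affine_energy p f \<le> ennreal (C * \<Lambda> * \<delta> powr (- 1 / ?n))"
    if \<delta>: "0 < \<delta>" "\<delta> \<le> 1" and \<Lambda>: "0 < \<Lambda>"
     and J: "\<And>\<xi>. norm \<xi> = 1 \<Longrightarrow> \<bar>\<xi> \<bullet> b0\<bar> \<le> \<delta> \<Longrightarrow> grad_energy p (weak_gradient f) \<xi> \<le> ennreal (\<Lambda> powr p)"
    for f :: "'a \<Rightarrow> real" and \<delta> \<Lambda>
  proof -
    let ?A = "sphere (0::'a) 1 \<inter> {\<xi>. \<bar>\<xi> \<bullet> b0\<bar> \<le> \<delta>}"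
    have A: "?A \<in> sets borel" by measurable
    let ?I = "\<integral>\<^sup>+\<xi>\<in>sphere (0::'a) 1. ennpowr (grad_energy p (weak_gradient f) \<xi>) (- ?n / p) \<partial>sphere_measure"
    have "ennreal (\<Lambda> powr (- ?n) * (c * \<delta>)) = ennreal (\<Lambda> powr (- ?n)) * ennreal (c * \<delta>)"
      by (intro ennreal_mult') simp
    also have "\<dots> \<le> ennreal (\<Lambda> powr (- ?n)) * hausdorff_outer (?n - 1) ?A"
      using \<delta> by (intro mult_left_mono c) auto
    also have "\<dots> = (\<integral>\<^sup>+\<xi>. ennreal (\<Lambda> powr (- ?n)) * indicator ?A \<xi> \<partial>sphere_measure)"
      using A by (subst nn_integral_cmult_indicator) (auto simp: emeasure_sphere_measure)
    also have "\<dots> \<le> ?I"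
    proof (intro nn_integral_mono)
      fix \<xi> :: 'a
      show "ennreal (\<Lambda> powr (- ?n)) * indicator ?A \<xi> \<le> ennpowr (grad_energy p (weak_gradient f) \<xi>) (- ?n / p) * indicator (sphere 0 1) \<xi>"
      proof (cases "\<xi> \<in> ?A")
        case True
        have "ennreal (\<Lambda> powr (- ?n)) = ennpowr (ennreal (\<Lambda> powr p)) (- ?n / p)"
          using \<Lambda> p by (simp add: ennpowr_ennreal powr_powr)
        also have "\<dots> \<le> ennpowr (grad_energy p (weak_gradient f) \<xi>) (- ?n / p)"
          using True p by (intro ennpowr_antimono J) auto
        finally show ?thesis using True by simp
      qed simp
    qed
    finally have I: "ennreal (\<Lambda> powr (- ?n) * (c * \<delta>)) \<le> ?I" .
    have "affine_energy p f = ennpowr (ennreal s) ((?n + p) / (?n * p)) * ennpowr ?I (- 1 / ?n)"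
      by (simp add: affine_energy_def grad_energy_def s Let_def)
    also have "\<dots> \<le> ennpowr (ennreal s) ((?n + p) / (?n * p)) * ennpowr (ennreal (\<Lambda> powr (- ?n) * (c * \<delta>))) (- 1 / ?n)"
      using I by (intro mult_left_mono ennpowr_antimono) auto
    also have "\<dots> = ennreal (s powr ((?n + p) / (?n * p)) * (\<Lambda> powr (- ?n) * (c * \<delta>)) powr (- 1 / ?n))"
    proof -
      have "0 < \<Lambda> powr (- ?n) * (c * \<delta>)" using \<delta> \<Lambda> c(1) by simp
      then have "ennpowr (ennreal (\<Lambda> powr (- ?n) * (c * \<delta>))) (- 1 / ?n) = ennreal ((\<Lambda> powr (- ?n) * (c * \<delta>)) powr (- 1 / ?n))"
        by (rule ennpowr_ennreal)
      moreover have "ennpowr (ennreal s) ((?n + p) / (?n * p)) = ennreal (s powr ((?n + p) / (?n * p)))"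
        using s(1) by (rule ennpowr_ennreal)
      ultimately show ?thesis by (simp only: ennreal_mult'[OF powr_ge_zero, symmetric])
    qed
    also have "(\<Lambda> powr (- ?n) * (c * \<delta>)) powr (- 1 / ?n) = \<Lambda> * (c powr (- 1 / ?n) * \<delta> powr (- 1 / ?n))"
      using \<delta> \<Lambda> c by (simp add: powr_mult powr_powr)
    also have "s powr ((?n + p) / (?n * p)) * (\<Lambda> * (c powr (- 1 / ?n) * \<delta> powr (- 1 / ?n))) = C * \<Lambda> * \<delta> powr (- 1 / ?n)"
      by (simp add: C_def mult_ac)
    finally show ?thesis .
  qed
  ultimately show ?thesis using that by blast
qed

section \<open>Line integrals and the Loomis--Whitney inequality\<close>

definition line_int :: "'a::euclidean_space \<Rightarrow> ('a \<Rightarrow> ennreal) \<Rightarrow> 'a \<Rightarrow> ennreal" where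
  "line_int b u x = (\<integral>\<^sup>+t. u (x + t *\<^sub>R b) \<partial>lborel)"

lemma line_int_measurable [measurable]:
  fixes u :: "'a::euclidean_space \<Rightarrow> ennreal"
  assumes [measurable]: "u \<in> borel_measurable borel"
  shows "line_int b u \<in> borel_measurable borel"
  unfolding line_int_def[abs_def] by measurable

lemma line_int_commute:
  fixes u :: "'a::euclidean_space \<Rightarrow> ennreal"
  assumes [measurable]: "u \<in> borel_measurable borel"
  shows "line_int b (line_int c u) = line_int c (line_int b u)"
proof
  fix x
  have "line_int b (line_int c u) x = (\<integral>\<^sup>+s. (\<integral>\<^sup>+t. u (x + s *\<^sub>R b + t *\<^sub>R c) \<partial>lborel) \<partial>lborel)"
    by (simp add: line_int_def)
  also have "\<dots> = (\<integral>\<^sup>+t. (\<integral>\<^sup>+s. u (x + s *\<^sub>R b + t *\<^sub>R c) \<partial>lborel) \<partial>lborel)"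
    by (rule lborel_pair.Fubini') measurable
  also have "\<dots> = line_int c (line_int b u) x"
    by (simp add: line_int_def add_ac)
  finally show "line_int b (line_int c u) x = line_int c (line_int b u) x" .
qed

lemma line_int_shift:
  fixes u :: "'a::euclidean_space \<Rightarrow> ennreal"
  assumes [measurable]: "u \<in> borel_measurable borel"
  shows "line_int b u (x + s *\<^sub>R b) = line_int b u x"
  using nn_integral_lborel_shift[of "\<lambda>t. u (x + t *\<^sub>R b)" s]
  by (simp add: line_int_def scaleR_add_left add_ac)

text \<open>Integrals along lines in several directions, one after the other. The point of evaluation is kept, so that
  directions over which one has not yet integrated remain variables; this makes an induction over the
  coordinate directions possible in a space without named coordinates.\<close>

primrec iter_int :: "'a::euclidean_space list \<Rightarrow> ('a \<Rightarrow> ennreal) \<Rightarrow> 'a \<Rightarrow> ennreal" where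
  "iter_int [] u = u"
| "iter_int (b # bs) u = line_int b (iter_int bs u)"

lemma iter_int_measurable [measurable]:
  "u \<in> borel_measurable borel \<Longrightarrow> iter_int bs u \<in> borel_measurable borel"
  by (induction bs) auto

lemma iter_int_line_int_commute:
  assumes [measurable]: "u \<in> borel_measurable borel"
  shows "iter_int bs (line_int b u) = line_int b (iter_int bs u)"
  by (induction bs) (simp_all add: line_int_commute[of "iter_int _ u"])

lemma iter_int_eq_PiM:
  fixes u :: "'a::euclidean_space \<Rightarrow> ennreal"
  assumes [measurable]: "u \<in> borel_measurable borel" and "distinct bs"
  shows "iter_int bs u x = (\<integral>\<^sup>+f. u (x + (\<Sum>b\<in>set bs. f b *\<^sub>R b)) \<partial>(\<Pi>\<^sub>M b\<in>set bs. lborel))"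
  using assms(2)
proof (induction bs arbitrary: x)
  case Nil
  interpret product_sigma_finite "\<lambda>_::'a. lborel :: real measure" by standard
  have "(\<integral>\<^sup>+f. u (x + (\<Sum>b\<in>{}. f b *\<^sub>R b)) \<partial>(\<Pi>\<^sub>M b\<in>{}. (lborel :: real measure))) = u (x + 0)"
    by (subst nn_integral_empty) auto
  then show ?case by (simp only: iter_int.simps list.set add_0_right)
next
  case (Cons a bs)
  interpret product_sigma_finite "\<lambda>_::'a. lborel :: real measure" by standard
  have [measurable]: "(\<lambda>f. u (x + (\<Sum>b\<in>insert a (set bs). f b *\<^sub>R b))) \<in> borel_measurable (\<Pi>\<^sub>M b\<in>insert a (set bs). (lborel::real measure))"
    by measurable
  have "(\<integral>\<^sup>+f. u (x + (\<Sum>b\<in>set (a # bs). f b *\<^sub>R b)) \<partial>(\<Pi>\<^sub>M b\<in>set (a # bs). lborel))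
     = (\<integral>\<^sup>+t. (\<integral>\<^sup>+f. u (x + (\<Sum>b\<in>insert a (set bs). (f(a := t)) b *\<^sub>R b)) \<partial>(\<Pi>\<^sub>M b\<in>set bs. lborel)) \<partial>lborel)"
    using Cons.prems by (simp only: list.set) (rule product_nn_integral_insert_rev, auto)
  also have "\<dots> = (\<integral>\<^sup>+t. iter_int bs u (x + t *\<^sub>R a) \<partial>lborel)"
  proof (rule nn_integral_cong)
    fix t :: real
    have "(\<Sum>b\<in>insert a (set bs). (f(a := t)) b *\<^sub>R b) = t *\<^sub>R a + (\<Sum>b\<in>set bs. f b *\<^sub>R b)" for f :: "'a \<Rightarrow> real"
    proof -
      have "(\<Sum>b\<in>set bs. (f(a := t)) b *\<^sub>R b) = (\<Sum>b\<in>set bs. f b *\<^sub>R b)"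
        using Cons.prems by (intro sum.cong) auto
      then show ?thesis using Cons.prems by simp
    qed
    then show "(\<integral>\<^sup>+f. u (x + (\<Sum>b\<in>insert a (set bs). (f(a := t)) b *\<^sub>R b)) \<partial>(\<Pi>\<^sub>M b\<in>set bs. lborel)) = iter_int bs u (x + t *\<^sub>R a)"
      using Cons by (simp add: add.assoc)
  qed
  finally show ?case by (simp add: line_int_def)
qed

lemma iter_int_Basis:
  fixes u :: "'a::euclidean_space \<Rightarrow> ennreal"
  assumes [measurable]: "u \<in> borel_measurable borel" and "distinct bs" "set bs = Basis"
  shows "iter_int bs u 0 = (\<integral>\<^sup>+x. u x \<partial>lborel)"
proof -
  have "(\<integral>\<^sup>+x. u x \<partial>lborel) = (\<integral>\<^sup>+x. u x \<partial>distr (\<Pi>\<^sub>M b\<in>Basis. lborel) borel (\<lambda>f. \<Sum>b\<in>Basis. f b *\<^sub>R b))"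
    by (subst lborel_eq) simp
  also have "\<dots> = (\<integral>\<^sup>+f. u (\<Sum>b\<in>Basis. f b *\<^sub>R b) \<partial>(\<Pi>\<^sub>M b\<in>Basis. lborel))"
    by (subst nn_integral_distr) auto
  finally show ?thesis using assms by (simp add: iter_int_eq_PiM)
qed

lemma line_int_mono: "(\<And>x. u x \<le> v x) \<Longrightarrow> line_int b u x \<le> line_int b v x"
  unfolding line_int_def by (intro nn_integral_mono)

text \<open>The Loomis--Whitney inequality in the form of Gagliardo. One integrates in the coordinate directions one
  after the other: the factor that is already an integral in the current direction is constant along it
  and leaves the integral, and Hoelder's inequality with \<open>N - 1\<close> equal exponents applies to the others.\<close>

lemma loomis_whitney:
  fixes u :: "'a::euclidean_space \<Rightarrow> 'a \<Rightarrow> ennreal"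
  assumes N2: "2 \<le> DIM('a)" and [measurable]: "\<And>b. u b \<in> borel_measurable borel"
  shows "(\<integral>\<^sup>+x. (\<Prod>b\<in>Basis. ennpowr (line_int b (u b) x) (1 / (real DIM('a) - 1))) \<partial>lborel)
    \<le> (\<Prod>b\<in>Basis. ennpowr (\<integral>\<^sup>+x. u b x \<partial>lborel) (1 / (real DIM('a) - 1)))"
proof -
  define \<alpha> where "\<alpha> = 1 / (real DIM('a) - 1)"
  have \<alpha>: "0 < \<alpha>" using N2 by (simp add: \<alpha>_def)
  define F where "F x = (\<Prod>b\<in>Basis. ennpowr (line_int b (u b) x) \<alpha>)" for x
  have [measurable]: "F \<in> borel_measurable borel" unfolding F_def by measurable
  \<comment> \<open>The factor \<open>u b\<close> is integrated in the direction \<open>b\<close> exactly once, whether or not \<open>b\<close> is in the list.\<close>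
  define H where "H bs b = (if b \<in> set bs then iter_int bs (u b) else iter_int bs (line_int b (u b)))" for bs b
  have [measurable]: "H bs b \<in> borel_measurable borel" for bs b
    by (cases "b \<in> set bs") (simp_all add: H_def iter_int_measurable line_int_measurable)
  have main: "iter_int bs F x \<le> (\<Prod>b\<in>Basis. ennpowr (H bs b x) \<alpha>)"
    if "distinct bs" "set bs \<subseteq> Basis" for bs x
    using that
  proof (induction bs arbitrary: x)
    case Nil then show ?case by (simp add: H_def F_def)
  next
    case (Cons a bs)
    have a: "a \<in> Basis" "a \<notin> set bs" using Cons.prems by auto
    have Ha: "H bs a (x + t *\<^sub>R a) = H (a # bs) a x" for t
      using a by (simp add: H_def iter_int_line_int_commute line_int_shift)
    have Hb: "line_int a (H bs b) x = H (a # bs) b x" if "b \<noteq> a" for b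
      using that by (simp add: H_def)
    have "iter_int (a # bs) F x \<le> line_int a (\<lambda>y. \<Prod>b\<in>Basis. ennpowr (H bs b y) \<alpha>) x"
      using Cons by (auto intro!: line_int_mono)
    also have "\<dots> = (\<integral>\<^sup>+t. ennpowr (H (a # bs) a x) \<alpha> * (\<Prod>b\<in>Basis - {a}. ennpowr (H bs b (x + t *\<^sub>R a)) \<alpha>) \<partial>lborel)"
      unfolding line_int_def using a by (intro nn_integral_cong) (simp add: prod.remove[of Basis a] Ha)
    also have "\<dots> = ennpowr (H (a # bs) a x) \<alpha> * (\<integral>\<^sup>+t. (\<Prod>b\<in>Basis - {a}. ennpowr (H bs b (x + t *\<^sub>R a)) \<alpha>) \<partial>lborel)"
      by (intro nn_integral_cmult) measurable
    also have "\<dots> \<le> ennpowr (H (a # bs) a x) \<alpha> * (\<Prod>b\<in>Basis - {a}. ennpowr (\<integral>\<^sup>+t. H bs b (x + t *\<^sub>R a) \<partial>lborel) \<alpha>)"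
    proof (intro mult_left_mono nn_integral_prod_Holder)
      show "(\<Sum>i\<in>Basis - {a}. \<alpha>) = 1" using a N2 by (simp add: \<alpha>_def card_Diff_singleton of_nat_diff)
    qed (use \<alpha> in auto)
    also have "(\<Prod>b\<in>Basis - {a}. ennpowr (\<integral>\<^sup>+t. H bs b (x + t *\<^sub>R a) \<partial>lborel) \<alpha>) = (\<Prod>b\<in>Basis - {a}. ennpowr (H (a # bs) b x) \<alpha>)"
      using Hb by (intro prod.cong) (auto simp: line_int_def)
    also have "ennpowr (H (a # bs) a x) \<alpha> * \<dots> = (\<Prod>b\<in>Basis. ennpowr (H (a # bs) b x) \<alpha>)"
      using a by (simp add: prod.remove[of Basis a])
    finally show ?case .
  qed
  obtain bs :: "'a list" where bs: "set bs = Basis" "distinct bs"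
    using finite_distinct_list[OF finite_Basis] by auto
  have "(\<integral>\<^sup>+x. F x \<partial>lborel) = iter_int bs F 0" using bs by (simp add: iter_int_Basis)
  also have "\<dots> \<le> (\<Prod>b\<in>Basis. ennpowr (H bs b 0) \<alpha>)" using bs by (intro main) auto
  also have "\<dots> = (\<Prod>b\<in>Basis. ennpowr (\<integral>\<^sup>+x. u b x \<partial>lborel) \<alpha>)"
    using bs by (intro prod.cong) (auto simp: H_def iter_int_Basis)
  finally show ?thesis unfolding F_def \<alpha>_def .
qed

section \<open>Poincare and Gagliardo--Nirenberg inequalities for smooth functions\<close>

text \<open>Continuous functions that vanish off a ball are bounded, hence in every Lebesgue space.\<close>

lemma compact_support_powr_finite:
  fixes u :: "'a::euclidean_space \<Rightarrow> 'b::real_normed_vector"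
  assumes c: "continuous_on UNIV u" and z: "\<And>x. R < norm x \<Longrightarrow> u x = 0" and a: "0 < a"
  shows "(\<integral>\<^sup>+x. ennreal (norm (u x) powr a) \<partial>lborel) < top"
proof -
  have "bounded (u ` cball 0 R)"
    by (intro compact_imp_bounded compact_continuous_image continuous_on_subset[OF c]) auto
  then have "\<exists>M. \<forall>x\<in>cball 0 R. norm (u x) \<le> M" by (simp add: bounded_iff)
  then obtain M where M: "\<forall>x\<in>cball 0 R. norm (u x) \<le> M" ..
  have "(\<integral>\<^sup>+x. ennreal (norm (u x) powr a) \<partial>lborel) \<le> (\<integral>\<^sup>+x. ennreal (M powr a) * indicator (cball (0::'a) R) x \<partial>lborel)"
  proof (rule nn_integral_mono)
    fix x
    show "ennreal (norm (u x) powr a) \<le> ennreal (M powr a) * indicator (cball (0::'a) R) x"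
    proof (cases "x \<in> cball 0 R")
      case True then show ?thesis using bspec[OF M True] a by (auto intro!: ennreal_leI powr_mono2)
    next
      case False then show ?thesis using z[of x] by simp
    qed
  qed
  also have "\<dots> = ennreal (M powr a) * emeasure lborel (cball (0::'a) R)" by (simp add: nn_integral_cmult_indicator)
  also have "\<dots> < top" using emeasure_lborel_cball_finite[of "0::'a" R] by (simp add: ennreal_mult_less_top)
  finally show ?thesis .
qed

lemma compact_support_integrable:
  fixes u :: "'a::euclidean_space \<Rightarrow> real"
  assumes c: "continuous_on UNIV u" and z: "\<And>x. R < norm x \<Longrightarrow> u x = 0"
  shows "integrable lborel u"
proof -
  have "integrable lborel (\<lambda>x. indicator (cball 0 R) x *\<^sub>R u x)"
    by (intro borel_integrable_compact continuous_on_subset[OF c]) auto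
  moreover have "indicator (cball 0 R) x *\<^sub>R u x = u x" for x using z[of x] by (auto simp: indicator_def)
  ultimately show ?thesis by (simp only:)
qed

text \<open>Continuously differentiable functions with support in a ball, together with their gradient. The
  derivative is only required along lines, which is what the integral inequalities use and
  what mollification provides most directly.\<close>

definition C1_supported :: "real \<Rightarrow> ('a::euclidean_space \<Rightarrow> real) \<Rightarrow> ('a \<Rightarrow> 'a) \<Rightarrow> bool" where
  "C1_supported R f g \<longleftrightarrow> continuous_on UNIV f \<and> continuous_on UNIV g \<and>
    (\<forall>x b t. ((\<lambda>t. f (x + t *\<^sub>R b)) has_real_derivative g (x + t *\<^sub>R b) \<bullet> b) (at t)) \<and>
    (\<forall>x. R \<le> norm x \<longrightarrow> f x = 0)"

lemma C1_supportedD: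
  assumes "C1_supported R f g"
  shows "continuous_on UNIV f" "continuous_on UNIV g"
    "((\<lambda>t. f (x + t *\<^sub>R b)) has_real_derivative g (x + t *\<^sub>R b) \<bullet> b) (at t)"
    "R \<le> norm x \<Longrightarrow> f x = 0"
    "f \<in> borel_measurable borel" "g \<in> borel_measurable borel"
  using assms by (auto simp: C1_supported_def intro: borel_measurable_continuous_onI)

lemma abs_le_nn_integral_deriv:
  fixes \<phi> \<phi>' :: "real \<Rightarrow> real"
  assumes T: "0 \<le> T" and d: "\<And>t. (\<phi> has_real_derivative \<phi>' t) (at t)" and c: "continuous_on UNIV \<phi>'" and z: "\<phi> T = 0"
  shows "ennreal \<bar>\<phi> 0\<bar> \<le> (\<integral>\<^sup>+t. ennreal \<bar>\<phi>' t\<bar> * indicator {0..T} t \<partial>lborel)"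
proof -
  have c': "isCont \<phi>' t" for t using c by (simp add: continuous_on_eq_continuous_at)
  have e: "(\<integral>t. \<phi>' t * indicator {0..T} t \<partial>lborel) = \<phi> T - \<phi> 0"
    using T d c' by (intro integral_FTC_Icc_real) auto
  have "integrable lborel (\<lambda>t. \<phi>' t * indicator {0..T} t)"
    using c' by (intro borel_integrable_atLeastAtMost) auto
  from integral_norm_bound_ennreal[OF this] e z
  have "ennreal \<bar>\<phi> 0\<bar> \<le> (\<integral>\<^sup>+t. ennreal (norm (\<phi>' t * indicator {0..T} t)) \<partial>lborel)" by simp
  also have "\<dots> = (\<integral>\<^sup>+t. ennreal \<bar>\<phi>' t\<bar> * indicator {0..T} t \<partial>lborel)"
    by (intro nn_integral_cong) (auto simp: indicator_def)
  finally show ?thesis .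
qed

lemma C1_line_continuous:
  assumes "C1_supported R f g"
  shows "continuous_on UNIV (\<lambda>t. g (x + t *\<^sub>R b) \<bullet> b)" "continuous_on UNIV (\<lambda>t. f (x + t *\<^sub>R b))"
  by (intro continuous_intros continuous_on_compose2[OF C1_supportedD(2)[OF assms]], auto)
    (intro continuous_intros continuous_on_compose2[OF C1_supportedD(1)[OF assms]], auto)

lemma norm_ge_after_translation:
  fixes x b :: "'a::euclidean_space"
  assumes "norm b = 1" "norm x \<le> R" "2 * R \<le> t"
  shows "R \<le> norm (x + t *\<^sub>R b)"
proof -
  have "0 \<le> t" using assms norm_ge_zero[of x] by linarith
  then have "t = norm ((x + t *\<^sub>R b) - x)" using assms by simp
  also have "\<dots> \<le> norm (x + t *\<^sub>R b) + norm x" by (rule norm_triangle_ineq4)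
  finally show ?thesis using assms by linarith
qed

text \<open>Along each line in the direction \<open>b\<close> the function vanishes after a distance of at most \<open>2 * R\<close>, so it is
  bounded by the integral of its derivative over a segment of this length. The inequality is for a single
  directional derivative, as required for the anisotropic estimates.\<close>

lemma poincare_directional:
  fixes f :: "'a::euclidean_space \<Rightarrow> real"
  assumes f: "C1_supported R f g" and b: "norm b = 1" and p: "1 \<le> p" and R: "0 < R"
  shows "(\<integral>\<^sup>+x. ennreal (\<bar>f x\<bar> powr p) \<partial>lborel)
    \<le> ennreal ((2 * R) powr p) * (\<integral>\<^sup>+x. ennreal (\<bar>g x \<bullet> b\<bar> powr p) \<partial>lborel)"
proof -
  note [measurable] = C1_supportedD(5,6)[OF f]
  define K where "K x = ennreal (\<bar>g x \<bullet> b\<bar> powr p)" for x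
  have [measurable]: "K \<in> borel_measurable borel" unfolding K_def by measurable
  define M where "M = density lborel (indicator {0..2*R} :: real \<Rightarrow> ennreal)"
  have M: "emeasure M (space M) = ennreal (2 * R)"
    using R by (simp add: M_def emeasure_density)
  have pt: "ennreal (\<bar>f x\<bar> powr p) \<le> ennreal ((2*R) powr (p - 1)) * (\<integral>\<^sup>+t. indicator {0..2*R} t * K (x + t *\<^sub>R b) \<partial>lborel)" for x
  proof (cases "R \<le> norm x")
    case True then show ?thesis using C1_supportedD(4)[OF f] by simp
  next
    case False
    have "ennreal \<bar>f (x + 0 *\<^sub>R b)\<bar> \<le> (\<integral>\<^sup>+t. ennreal \<bar>g (x + t *\<^sub>R b) \<bullet> b\<bar> * indicator {0..2*R} t \<partial>lborel)"
    proof (rule abs_le_nn_integral_deriv[where \<phi> = "\<lambda>t. f (x + t *\<^sub>R b)"])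
      show "f (x + (2 * R) *\<^sub>R b) = 0"
        using False b by (intro C1_supportedD(4)[OF f] norm_ge_after_translation) auto
    qed (use R C1_supportedD(3)[OF f] C1_line_continuous[OF f] in auto)
    also have "\<dots> = (\<integral>\<^sup>+t. ennreal \<bar>g (x + t *\<^sub>R b) \<bullet> b\<bar> \<partial>M)"
      unfolding M_def by (subst nn_integral_density) (auto simp: mult.commute)
    finally have "ennpowr (ennreal \<bar>f x\<bar>) p \<le> ennpowr (\<integral>\<^sup>+t. ennreal \<bar>g (x + t *\<^sub>R b) \<bullet> b\<bar> \<partial>M) p"
      using p by (intro ennpowr_mono) auto
    also have "\<dots> \<le> ennpowr (emeasure M (space M)) (p - 1) * (\<integral>\<^sup>+t. ennpowr (ennreal \<bar>g (x + t *\<^sub>R b) \<bullet> b\<bar>) p \<partial>M)"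
      using p by (intro nn_integral_power_mean) (auto simp: M_def)
    also have "\<dots> = ennreal ((2*R) powr (p - 1)) * (\<integral>\<^sup>+t. K (x + t *\<^sub>R b) \<partial>M)"
      using p R by (simp add: M ennpowr_ennreal ennpowr_ennreal_pos K_def)
    also have "(\<integral>\<^sup>+t. K (x + t *\<^sub>R b) \<partial>M) = (\<integral>\<^sup>+t. indicator {0..2*R} t * K (x + t *\<^sub>R b) \<partial>lborel)"
      unfolding M_def by (subst nn_integral_density) auto
    finally show ?thesis using p by (simp add: ennpowr_ennreal_pos)
  qed
  have "(\<integral>\<^sup>+x. ennreal (\<bar>f x\<bar> powr p) \<partial>lborel)
     \<le> (\<integral>\<^sup>+x. ennreal ((2*R) powr (p - 1)) * (\<integral>\<^sup>+t. indicator {0..2*R} t * K (x + t *\<^sub>R b) \<partial>lborel) \<partial>lborel)"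
    by (intro nn_integral_mono pt)
  also have "\<dots> = ennreal ((2*R) powr (p - 1)) * (\<integral>\<^sup>+x. (\<integral>\<^sup>+t. indicator {0..2*R} t * K (x + t *\<^sub>R b) \<partial>lborel) \<partial>lborel)"
    by (intro nn_integral_cmult) measurable
  also have "(\<integral>\<^sup>+x. (\<integral>\<^sup>+t. indicator {0..2*R} t * K (x + t *\<^sub>R b) \<partial>lborel) \<partial>lborel)
    = (\<integral>\<^sup>+t. (\<integral>\<^sup>+x. indicator {0..2*R} t * K (x + t *\<^sub>R b) \<partial>lborel) \<partial>lborel)"
    by (rule lborel_pair.Fubini') measurable
  also have "\<dots> = (\<integral>\<^sup>+t. indicator {0..2*R} t * (\<integral>\<^sup>+x. K x \<partial>lborel) \<partial>lborel)"
    by (intro nn_integral_cong) (simp add: nn_integral_cmult nn_integral_lborel_shift)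
  also have "\<dots> = ennreal (2 * R) * (\<integral>\<^sup>+x. K x \<partial>lborel)"
    using R by (simp add: nn_integral_multc)
  also have "ennreal ((2*R) powr (p - 1)) * (ennreal (2 * R) * (\<integral>\<^sup>+x. K x \<partial>lborel)) = ennreal ((2*R) powr (p - 1) * (2 * R)) * (\<integral>\<^sup>+x. K x \<partial>lborel)"
    using R by (simp add: ennreal_mult' mult.assoc)
  also have "(2*R) powr (p - 1) * (2 * R) = (2 * R) powr p" using R by (simp add: powr_diff)
  finally show ?thesis unfolding K_def .
qed

lemma DERIV_max_powr:
  fixes s :: real assumes \<gamma>: "1 < \<gamma>"
  shows "((\<lambda>s. (max s 0) powr \<gamma>) has_real_derivative \<gamma> * (max s 0) powr (\<gamma> - 1)) (at s)"
proof -
  consider "s > 0" | "s < 0" | "s = 0" by linarith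
  then show ?thesis
  proof cases
    case 1
    have "((\<lambda>s. s powr \<gamma>) has_real_derivative \<gamma> * s powr (\<gamma> - 1)) (at s)"
      using 1 by (intro has_real_derivative_powr)
    moreover have "eventually (\<lambda>u. u powr \<gamma> = (max u 0) powr \<gamma>) (nhds s)"
      using eventually_nhds_in_open[of "{0<..}" s] 1 by (auto elim!: eventually_mono)
    ultimately show ?thesis using 1 by (subst DERIV_cong_ev[OF refl _ refl, of _ "\<lambda>s. s powr \<gamma>"]) (auto elim: eventually_mono)
  next
    case 2
    have "((\<lambda>s. 0 :: real) has_real_derivative 0) (at s)" by simp
    moreover have "eventually (\<lambda>u. (max u 0) powr \<gamma> = 0) (nhds s)"
      using eventually_nhds_in_open[of "{..<0}" s] 2 by (auto elim!: eventually_mono)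
    ultimately show ?thesis using 2 \<gamma> by (subst DERIV_cong_ev[OF refl _ refl, of _ "\<lambda>s. 0"]) auto
  next
    case 3
    have "((\<lambda>h. \<bar>h\<bar> powr (\<gamma> - 1)) \<longlongrightarrow> \<bar>0::real\<bar> powr (\<gamma> - 1)) (at 0)"
      using \<gamma> by (intro tendsto_powr' tendsto_intros) auto
    then have lim: "((\<lambda>h. \<bar>h\<bar> powr (\<gamma> - 1)) \<longlongrightarrow> 0) (at (0::real))" using \<gamma> by simp
    have "((\<lambda>h::real. ((max h 0) powr \<gamma>) / h) \<longlongrightarrow> 0) (at 0)"
    proof (rule Lim_null_comparison[OF _ lim])
      show "\<forall>\<^sub>F h in at (0::real). norm ((max h 0) powr \<gamma> / h) \<le> \<bar>h\<bar> powr (\<gamma> - 1)"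
      proof (intro always_eventually allI)
        fix h :: real
        show "norm ((max h 0) powr \<gamma> / h) \<le> \<bar>h\<bar> powr (\<gamma> - 1)"
        proof (cases "h \<le> 0")
          case False then show ?thesis by (simp add: powr_diff)
        qed (simp add: max_def)
      qed
    qed
    then show ?thesis using 3 \<gamma> by (simp add: DERIV_def)
  qed
qed

lemma abs_powr_split: "0 < \<gamma> \<Longrightarrow> \<bar>s\<bar> powr \<gamma> = (max s 0) powr \<gamma> + (max (- s) 0) powr \<gamma>" for s :: real
  by (cases "0 \<le> s") (auto simp: max_def)

text \<open>The fundamental theorem of calculus for \<open>|f| powr \<gamma>\<close>. Positive and negative parts are differentiated
  separately since \<open>|f|\<close> is not differentiable. The exponent \<open>\<gamma> = 1\<close> is a case of its own because
  \<open>0 powr 0 = 0\<close>.\<close>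

lemma C1_powr_le_line_int:
  fixes f :: "'a::euclidean_space \<Rightarrow> real"
  assumes f: "C1_supported R f g" and b: "norm b = 1" and \<gamma>: "1 \<le> \<gamma>" and R: "0 < R"
  shows "ennreal (\<bar>f x\<bar> powr \<gamma>)
    \<le> line_int b (\<lambda>y. ennreal (\<gamma> * (if \<gamma> = 1 then 1 else \<bar>f y\<bar> powr (\<gamma> - 1)) * \<bar>g y \<bullet> b\<bar>)) x"
proof -
  define T where "T = 2 * max R (norm x)"
  have T: "0 \<le> T" "f (x + T *\<^sub>R b) = 0"
  proof -
    have "max R (norm x) \<le> norm (x + T *\<^sub>R b)"
      using b by (intro norm_ge_after_translation) (auto simp: T_def)
    then show "f (x + T *\<^sub>R b) = 0" by (intro C1_supportedD(4)[OF f]) auto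
  qed (use R in \<open>auto simp: T_def\<close>)
  note df = C1_supportedD(3)[OF f, of x b]
  let ?k = "\<lambda>t. \<gamma> * (if \<gamma> = 1 then 1 else \<bar>f (x + t *\<^sub>R b)\<bar> powr (\<gamma> - 1)) * \<bar>g (x + t *\<^sub>R b) \<bullet> b\<bar>"
  have "ennreal (\<bar>f x\<bar> powr \<gamma>) \<le> (\<integral>\<^sup>+t. ennreal (?k t) * indicator {0..T} t \<partial>lborel)"
  proof (cases "\<gamma> = 1")
    case True
    have "ennreal \<bar>f (x + 0 *\<^sub>R b)\<bar> \<le> (\<integral>\<^sup>+t. ennreal \<bar>g (x + t *\<^sub>R b) \<bullet> b\<bar> * indicator {0..T} t \<partial>lborel)"
      using T df C1_line_continuous[OF f] by (intro abs_le_nn_integral_deriv[where \<phi> = "\<lambda>t. f (x + t *\<^sub>R b)"]) auto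
    then show ?thesis using True by simp
  next
    case False
    then have g1: "1 < \<gamma>" using \<gamma> by simp
    let ?m = "\<lambda>s. (max s 0) powr (\<gamma> - 1) - (max (- s) 0) powr (\<gamma> - 1)"
    let ?d = "\<lambda>t. \<gamma> * ?m (f (x + t *\<^sub>R b)) * (g (x + t *\<^sub>R b) \<bullet> b)"
    have 1: "((\<lambda>t. \<bar>f (x + t *\<^sub>R b)\<bar> powr \<gamma>) has_real_derivative ?d t) (at t)" for t
    proof -
      have A: "((\<lambda>t. (max (f (x + t *\<^sub>R b)) 0) powr \<gamma>) has_real_derivative
          (\<gamma> * (max (f (x + t *\<^sub>R b)) 0) powr (\<gamma> - 1)) * (g (x + t *\<^sub>R b) \<bullet> b)) (at t)"
        using DERIV_chain2[OF DERIV_max_powr[OF g1] df] .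
      have B: "((\<lambda>t. (max (- f (x + t *\<^sub>R b)) 0) powr \<gamma>) has_real_derivative
          (\<gamma> * (max (- f (x + t *\<^sub>R b)) 0) powr (\<gamma> - 1)) * (- (g (x + t *\<^sub>R b) \<bullet> b))) (at t)"
        using DERIV_chain2[OF DERIV_max_powr[OF g1] DERIV_minus[OF df]] .
      show ?thesis using DERIV_add[OF A B] g1
        by (simp add: abs_powr_split[of \<gamma>] algebra_simps)
    qed
    have 2: "continuous_on UNIV ?d"
      using g1 by (intro continuous_intros C1_line_continuous[OF f] continuous_on_powr') auto
    have "ennreal \<bar>\<bar>f (x + 0 *\<^sub>R b)\<bar> powr \<gamma>\<bar> \<le> (\<integral>\<^sup>+t. ennreal \<bar>?d t\<bar> * indicator {0..T} t \<partial>lborel)"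
      using T by (intro abs_le_nn_integral_deriv[OF T(1) 1 2]) simp
    moreover have "\<bar>?d t\<bar> = ?k t" for t
    proof -
      have "\<bar>?m s\<bar> = \<bar>s\<bar> powr (\<gamma> - 1)" for s using g1 by (cases "0 \<le> s") (auto simp: max_def)
      then show ?thesis using g1 by (simp add: abs_mult)
    qed
    ultimately show ?thesis by simp
  qed
  also have "\<dots> \<le> (\<integral>\<^sup>+t. ennreal (?k t) \<partial>lborel)"
    by (intro nn_integral_mono) (auto simp: indicator_def)
  finally show ?thesis by (simp add: line_int_def)
qed

lemma C1_supported_powr_finite:
  fixes f :: "'a::euclidean_space \<Rightarrow> real"
  assumes f: "C1_supported R f g" and a: "0 < a"
  shows "(\<integral>\<^sup>+x. ennreal (\<bar>f x\<bar> powr a) \<partial>lborel) < top"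
  using compact_support_powr_finite[OF C1_supportedD(1)[OF f] _ a, of R] C1_supportedD(4)[OF f] by simp

text \<open>The exponent \<open>\<gamma>\<close> for which \<open>|f| powr \<gamma>\<close> is estimated along lines: \<open>\<gamma> * n / (n - 1)\<close> is the larger one
  of \<open>q\<close> and \<open>p * n / (n - 1)\<close>.\<close>

definition gn_exponent :: "real \<Rightarrow> real \<Rightarrow> real \<Rightarrow> real" where
  "gn_exponent n p q = max q (p * n / (n - 1)) * (n - 1) / n"

text \<open>An anisotropic Gagliardo--Nirenberg inequality in which the directional norms enter through their
  product. Let \<open>X\<close> be the integral of \<open>|f| powr Q\<close> for \<open>Q = \<gamma> * n / (n - 1)\<close>, and \<open>Y\<close> that of \<open>|f| powr p\<close>.
  The bounds for \<open>|f| powr \<gamma>\<close> by line integrals in all coordinate directions, combined by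
  the Loomis--Whitney inequality, estimate \<open>X\<close> by integrals of \<open>|f| powr (\<gamma> - 1) * |g \<bullet> b|\<close>; by Hoelder's
  inequality and interpolation these are at most products of powers of \<open>Y\<close>, \<open>X\<close> and \<open>l b\<close>. The power of \<open>X\<close>
  on the right is smaller than one and is absorbed, after which one interpolates between \<open>p\<close> and
  \<open>Q\<close> to reach \<open>q\<close>. Taking \<open>Q\<close> larger than \<open>q\<close> if necessary makes the exponents of Hoelder's inequality
  admissible; the hypothesis on \<open>1 / p - 1 / q\<close> says that they are.\<close>

lemma gagliardo_nirenberg_C1:
  fixes f :: "'a::euclidean_space \<Rightarrow> real" and l :: "'a \<Rightarrow> real"
  assumes f: "C1_supported R f g" and R: "0 < R" and N2: "2 \<le> DIM('a)" and p: "1 \<le> p" and pq: "p \<le> q"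
    and s: "1 / p - 1 / q \<le> 1 / real DIM('a)"
    and Y: "(\<integral>\<^sup>+x. ennreal (\<bar>f x\<bar> powr p) \<partial>lborel) = ennreal Y" "0 < Y"
    and l: "\<And>b. b \<in> Basis \<Longrightarrow> (\<integral>\<^sup>+x. ennreal (\<bar>g x \<bullet> b\<bar> powr p) \<partial>lborel) = ennreal (l b)" "\<And>b. b \<in> Basis \<Longrightarrow> 0 < l b"
  shows "(\<integral>\<^sup>+x. ennreal (\<bar>f x\<bar> powr q) \<partial>lborel)
    \<le> ennreal (gn_exponent (real DIM('a)) p q powr (real DIM('a) * ((q - p) / p)) *
        Y powr (1 + (1 - real DIM('a) / p) * ((q - p) / p)) * (\<Prod>b\<in>Basis. l b powr (1 / p)) powr ((q - p) / p))"
proof -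
  note [measurable] = C1_supportedD(5,6)[OF f]
  define n where "n = real DIM('a)"
  have n: "2 \<le> n" using N2 by (simp add: n_def)
  define Q where "Q = max q (p * n / (n - 1))"
  define \<gamma> where "\<gamma> = Q * (n - 1) / n"
  have \<gamma>_eq: "gn_exponent n p q = \<gamma>" by (simp add: gn_exponent_def \<gamma>_def Q_def)
  have pQ: "p * n / (n - 1) \<le> Q" "q \<le> Q" by (auto simp: Q_def)
  have "p < p * n / (n - 1)" using n p by (simp add: field_simps)
  then have pQ': "p < Q" using pQ by linarith
  have p\<gamma>: "p \<le> \<gamma>" using pQ(1) n by (simp add: \<gamma>_def field_simps)
  have \<gamma>1: "1 \<le> \<gamma>" using p\<gamma> p by simp
  have sQ: "1 / p - 1 / n \<le> 1 / Q"
  proof (cases "p * n / (n - 1) \<le> q")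
    case True then show ?thesis using s by (simp add: Q_def n_def)
  next
    case False
    then have "Q = p * n / (n - 1)" by (simp add: Q_def)
    then have "1 / Q = (n - 1) / (p * n)" by simp
    also have "\<dots> = 1 / p - 1 / (p * n)" using n p by (simp add: diff_divide_distrib)
    finally have "1 / Q = 1 / p - 1 / (p * n)" .
    moreover have "1 / (p * n) \<le> 1 / n" using n p by (simp add: field_simps)
    ultimately show ?thesis by linarith
  qed
  define e2 where "e2 = (\<gamma> - p) / (Q - p)"
  define e1 where "e1 = (1 - 1 / p) - e2"
  have p1: "\<gamma> = 1" "e2 = 0" "e1 = 0" if "p = 1"
  proof -
    have "1 - 1 / n \<le> 1 / Q" using sQ that by simp
    then have "Q * (n - 1) \<le> n" using pQ' p n by (simp add: field_simps)
    then have "\<gamma> \<le> 1" using n by (simp add: \<gamma>_def field_simps)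
    then show "\<gamma> = 1" using \<gamma>1 by simp
    then show "e2 = 0" "e1 = 0" using that by (auto simp: e2_def e1_def)
  qed
  obtain X where X: "(\<integral>\<^sup>+x. ennreal (\<bar>f x\<bar> powr Q) \<partial>lborel) = ennreal X" "0 \<le> X"
    using C1_supported_powr_finite[OF f, of Q] pQ' p by (cases "\<integral>\<^sup>+x. ennreal (\<bar>f x\<bar> powr Q) \<partial>lborel") auto
  have X0: "0 < X"
  proof (rule ccontr)
    assume "\<not> 0 < X"
    then have "(\<integral>\<^sup>+x. ennreal (\<bar>f x\<bar> powr Q) \<partial>lborel) = 0" using X by simp
    then have "AE x in lborel. ennreal (\<bar>f x\<bar> powr Q) = 0" by (subst (asm) nn_integral_0_iff_AE) auto
    then have "AE x in lborel. ennreal (\<bar>f x\<bar> powr p) = 0" by (auto simp: ennreal_eq_0_iff)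
    then have "(\<integral>\<^sup>+x. ennreal (\<bar>f x\<bar> powr p) \<partial>lborel) = 0" by (subst nn_integral_0_iff_AE) auto
    then show False using Y by simp
  qed
  \<comment> \<open>For \<open>\<gamma> = 1\<close> the weight is \<open>1\<close> also at the zeros of \<open>f\<close>, where \<open>0 powr 0 = 0\<close> would be wrong.\<close>
  define w where "w y = (if \<gamma> = 1 then 1 else \<bar>f y\<bar> powr (\<gamma> - 1))" for y
  have [measurable]: "w \<in> borel_measurable borel" unfolding w_def by measurable
  have w0: "0 \<le> w y" for y by (simp add: w_def)
  define u where "u b y = ennreal (\<gamma> * w y * \<bar>g y \<bullet> b\<bar>)" for b y
  have [measurable]: "u b \<in> borel_measurable borel" for b unfolding u_def by measurable
  have U: "(\<integral>\<^sup>+y. u b y \<partial>lborel) \<le> ennreal (\<gamma> * (Y powr e1 * X powr e2 * l b powr (1 / p)))" if b: "b \<in> Basis" for b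
  proof -
    have eq: "(\<integral>\<^sup>+y. u b y \<partial>lborel) = ennreal \<gamma> * (\<integral>\<^sup>+y. ennreal (w y * \<bar>g y \<bullet> b\<bar>) \<partial>lborel)"
      unfolding u_def using \<gamma>1 by (subst nn_integral_cmult[symmetric]) (auto simp: ennreal_mult' mult.assoc)
    have "(\<integral>\<^sup>+y. ennreal (w y * \<bar>g y \<bullet> b\<bar>) \<partial>lborel) \<le> ennreal (Y powr e1 * X powr e2 * l b powr (1 / p))"
    proof (cases "p = 1")
      case True
      then have "(\<integral>\<^sup>+y. ennreal (w y * \<bar>g y \<bullet> b\<bar>) \<partial>lborel) = (\<integral>\<^sup>+y. ennreal (\<bar>g y \<bullet> b\<bar> powr p) \<partial>lborel)"
        by (simp add: w_def p1)
      then show ?thesis using True l[OF b] X0 Y p1 by simp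
    next
      case False
      then have pp: "1 < p" using p by simp
      have gg: "1 < \<gamma>" using p\<gamma> pp by simp
      \<comment> \<open>\<open>t\<close> is chosen such that the interpolation between \<open>p\<close> and \<open>Q\<close> with weight \<open>t\<close> gives the exponent that is conjugate in Hoelder's inequality.\<close>
      define t where "t = e2 / (1 - 1 / p)"
      have t0: "0 \<le> t" using pp p\<gamma> pQ' by (simp add: t_def e2_def)
      have t1: "t \<le> 1"
      proof -
        have "Q * (1 / p - 1 / n) \<le> Q * (1 / Q)" using sQ pQ' p by (intro mult_left_mono) auto
        then have "Q / p - Q / n \<le> 1" using pQ' p by (simp add: right_diff_distrib)
        moreover have "\<gamma> = Q - Q / n" using n by (simp add: \<gamma>_def field_simps)
        moreover have "(Q - p) * (1 - 1 / p) = Q - p - Q / p + 1" using pp by (simp add: field_simps)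
        ultimately have "\<gamma> - p \<le> (Q - p) * (1 - 1 / p)" by linarith
        then have "e2 \<le> 1 - 1 / p" using pQ' by (simp add: e2_def pos_divide_le_eq mult.commute)
        then show ?thesis using pp by (simp add: t_def)
      qed
      define r where "r = (1 - t) * p + t * Q"
      have r: "r * (1 - 1 / p) = \<gamma> - 1"
      proof -
        have "r * (1 - 1 / p) = p * (1 - 1 / p) + (t * (1 - 1 / p)) * (Q - p)"
          using pp by (simp add: r_def field_simps)
        also have "t * (1 - 1 / p) = e2" using pp by (simp add: t_def)
        also have "e2 * (Q - p) = \<gamma> - p" using pQ' by (simp add: e2_def)
        also have "p * (1 - 1 / p) = p - 1" using pp by (simp add: field_simps)
        finally show ?thesis by simp
      qed
      have r0: "0 < r"
      proof (rule ccontr)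
        assume "\<not> 0 < r"
        then have "r * (1 - 1 / p) \<le> 0" using pp by (intro mult_nonpos_nonneg) auto
        then show False using r gg by linarith
      qed
      have "(\<integral>\<^sup>+y. ennreal (w y * \<bar>g y \<bullet> b\<bar>) \<partial>lborel)
        = (\<integral>\<^sup>+y. ennpowr (ennreal (\<bar>g y \<bullet> b\<bar> powr p)) (1 / p) * ennpowr (ennreal (\<bar>f y\<bar> powr r)) (1 - 1 / p) \<partial>lborel)"
        using pp gg by (intro nn_integral_cong)
          (simp add: w_def ennpowr_ennreal_pos powr_powr r mult.commute flip: ennreal_mult')
      also have "\<dots> \<le> ennpowr (\<integral>\<^sup>+y. ennreal (\<bar>g y \<bullet> b\<bar> powr p) \<partial>lborel) (1 / p) * ennpowr (\<integral>\<^sup>+y. ennreal (\<bar>f y\<bar> powr r) \<partial>lborel) (1 - 1 / p)"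
        using pp by (intro nn_integral_Holder) auto
      also have "\<dots> \<le> ennreal (l b powr (1 / p)) * ennreal ((Y powr (1 - t) * X powr t) powr (1 - 1 / p))"
      proof (intro mult_mono)
        show "ennpowr (\<integral>\<^sup>+y. ennreal (\<bar>g y \<bullet> b\<bar> powr p) \<partial>lborel) (1 / p) \<le> ennreal (l b powr (1 / p))"
          using l[OF b] by (simp add: ennpowr_ennreal)
        have "(\<integral>\<^sup>+y. ennreal (\<bar>f y\<bar> powr r) \<partial>lborel) = (\<integral>\<^sup>+y. ennpowr (ennreal \<bar>f y\<bar>) ((1 - t) * p + t * Q) \<partial>lborel)"
          using r0 by (simp add: ennpowr_ennreal_pos r_def)
        also have "\<dots> \<le> ennpowr (\<integral>\<^sup>+y. ennpowr (ennreal \<bar>f y\<bar>) p \<partial>lborel) (1 - t) * ennpowr (\<integral>\<^sup>+y. ennpowr (ennreal \<bar>f y\<bar>) Q \<partial>lborel) t"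
          using p pQ' t0 t1 by (intro nn_integral_interpolate) auto
        also have "\<dots> = ennreal (Y powr (1 - t) * X powr t)"
          using p pQ' X0 Y X by (simp add: ennpowr_ennreal_pos ennpowr_ennreal ennreal_mult')
        finally have "ennpowr (\<integral>\<^sup>+y. ennreal (\<bar>f y\<bar> powr r) \<partial>lborel) (1 - 1 / p) \<le> ennpowr (ennreal (Y powr (1 - t) * X powr t)) (1 - 1 / p)"
          using pp by (intro ennpowr_mono) auto
        then show "ennpowr (\<integral>\<^sup>+y. ennreal (\<bar>f y\<bar> powr r) \<partial>lborel) (1 - 1 / p) \<le> ennreal ((Y powr (1 - t) * X powr t) powr (1 - 1 / p))"
          using pp by (simp add: ennpowr_ennreal_pos)
      qed auto
      also have "\<dots> = ennreal (Y powr e1 * X powr e2 * l b powr (1 / p))"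
      proof -
        have "t * (1 - 1 / p) = e2" using pp by (simp add: t_def)
        moreover have "(1 - t) * (1 - 1 / p) = e1" using calculation by (simp add: e1_def left_diff_distrib)
        ultimately have "(Y powr (1 - t) * X powr t) powr (1 - 1 / p) = Y powr e1 * X powr e2"
          by (simp add: powr_mult powr_powr)
        then show ?thesis by (simp add: mult.commute flip: ennreal_mult')
      qed
      finally show ?thesis .
    qed
    then have "ennreal \<gamma> * (\<integral>\<^sup>+y. ennreal (w y * \<bar>g y \<bullet> b\<bar>) \<partial>lborel) \<le> ennreal \<gamma> * ennreal (Y powr e1 * X powr e2 * l b powr (1 / p))"
      by (intro mult_left_mono) auto
    also have "\<dots> = ennreal (\<gamma> * (Y powr e1 * X powr e2 * l b powr (1 / p)))"
      using \<gamma>1 by (intro ennreal_mult'[symmetric]) auto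
    finally show ?thesis unfolding eq .
  qed
  define A where "A b = \<gamma> * (Y powr e1 * X powr e2 * l b powr (1 / p))" for b
  have A0: "0 < A b" if "b \<in> Basis" for b using \<gamma>1 Y X0 l(2)[OF that] by (simp add: A_def)
  define \<alpha> where "\<alpha> = 1 / (n - 1)"
  have \<alpha>: "0 < \<alpha>" using n by (simp add: \<alpha>_def)
  have "ennreal X = (\<integral>\<^sup>+x. (\<Prod>b\<in>(Basis::'a set). ennpowr (ennreal (\<bar>f x\<bar> powr \<gamma>)) \<alpha>) \<partial>lborel)"
  proof -
    have "ennreal (\<bar>f x\<bar> powr Q) = (\<Prod>b\<in>(Basis::'a set). ennpowr (ennreal (\<bar>f x\<bar> powr \<gamma>)) \<alpha>)" for x
    proof (cases "f x = 0")
      case True then show ?thesis using \<alpha> by (simp add: ennpowr_0_pos)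
    next
      case False
      have "(\<Prod>b\<in>(Basis::'a set). ennpowr (ennreal (\<bar>f x\<bar> powr \<gamma>)) \<alpha>) = ennreal ((\<bar>f x\<bar> powr (\<gamma> * \<alpha>)) ^ DIM('a))"
        using \<alpha> by (simp add: ennpowr_ennreal_pos powr_powr ennreal_power)
      also have "(\<bar>f x\<bar> powr (\<gamma> * \<alpha>)) ^ DIM('a) = (\<bar>f x\<bar> powr (\<gamma> * \<alpha>)) powr n"
        using False by (simp add: n_def powr_realpow)
      also have "\<dots> = \<bar>f x\<bar> powr Q" using n by (simp add: powr_powr \<alpha>_def \<gamma>_def)
      finally show ?thesis by simp
    qed
    then show ?thesis using X(1) by simp
  qed
  also have "\<dots> \<le> (\<integral>\<^sup>+x. (\<Prod>b\<in>Basis. ennpowr (line_int b (u b) x) \<alpha>) \<partial>lborel)"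
  proof (rule nn_integral_mono)
    fix x
    have "ennpowr (ennreal (\<bar>f x\<bar> powr \<gamma>)) \<alpha> \<le> ennpowr (line_int b (u b) x) \<alpha>" if b: "b \<in> Basis" for b
    proof -
    have "ennreal (\<bar>f x\<bar> powr \<gamma>) \<le> line_int b (u b) x"
      using C1_powr_le_line_int[OF f _ \<gamma>1 R, of b x] b unfolding u_def[abs_def] w_def[abs_def] by simp
    then show ?thesis using \<alpha> by (intro ennpowr_mono) auto
    qed
    then show "(\<Prod>b\<in>(Basis::'a set). ennpowr (ennreal (\<bar>f x\<bar> powr \<gamma>)) \<alpha>)
        \<le> (\<Prod>b\<in>Basis. ennpowr (line_int b (u b) x) \<alpha>)"
      by (intro prod_mono_ennreal) auto
  qed
  also have "\<dots> \<le> (\<Prod>b\<in>Basis. ennpowr (\<integral>\<^sup>+x. u b x \<partial>lborel) \<alpha>)"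
    unfolding \<alpha>_def n_def by (rule loomis_whitney[OF N2]) measurable
  also have "\<dots> \<le> (\<Prod>b\<in>Basis. ennpowr (ennreal (A b)) \<alpha>)"
    using \<alpha> U by (intro prod_mono_ennreal ennpowr_mono) (auto simp: A_def)
  also have "\<dots> = (\<Prod>b\<in>Basis. ennreal (A b powr \<alpha>))"
    using A0 by (intro prod.cong) (auto simp: ennpowr_ennreal)
  also have "\<dots> = ennreal (\<Prod>b\<in>Basis. A b powr \<alpha>)" by (intro prod_ennreal) auto
  finally have "X \<le> (\<Prod>b\<in>Basis. A b powr \<alpha>)" by (simp add: prod_nonneg)
  then have "ln X \<le> ln (\<Prod>b\<in>Basis. A b powr \<alpha>)" using X0 by simp
  also have "\<dots> = (\<Sum>b\<in>Basis. ln (A b powr \<alpha>))" using A0 by (intro ln_prod) (auto simp: less_imp_neq[symmetric])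
  also have "\<dots> = (\<Sum>b\<in>Basis. \<alpha> * (ln \<gamma> + e1 * ln Y + e2 * ln X + 1 / p * ln (l b)))"
  proof (intro sum.cong refl)
    fix b :: 'a assume b: "b \<in> Basis"
    show "ln (A b powr \<alpha>) = \<alpha> * (ln \<gamma> + e1 * ln Y + e2 * ln X + 1 / p * ln (l b))"
      using A0[OF b] \<gamma>1 Y X0 l(2)[OF b] by (simp add: ln_powr A_def ln_mult)
  qed
  also have "\<dots> = \<alpha> * (n * (ln \<gamma> + e1 * ln Y + e2 * ln X) + (\<Sum>b\<in>Basis. 1 / p * ln (l b)))"
    by (simp add: sum.distrib n_def flip: sum_distrib_left)
  finally have main: "(n - 1) * ln X \<le> n * (ln \<gamma> + e1 * ln Y + e2 * ln X) + (\<Sum>b\<in>Basis. 1 / p * ln (l b))"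
    using n by (simp add: \<alpha>_def pos_le_divide_eq mult.commute)
  define \<pi> where "\<pi> = (\<Sum>b\<in>(Basis::'a set). 1 / p * ln (l b))"
  define P where "P = (\<Prod>b\<in>(Basis::'a set). l b powr (1 / p))"
  have lne: "l b \<noteq> 0" if "b \<in> Basis" for b using l(2)[OF that] by simp
  have P0: "0 < P" unfolding P_def using lne by (intro prod_pos) auto
  have lnP: "ln P = \<pi>"
  proof -
    have "ln P = (\<Sum>b\<in>(Basis::'a set). ln (l b powr (1 / p)))"
      unfolding P_def using lne by (intro ln_prod) auto
    also have "\<dots> = \<pi>" unfolding \<pi>_def using lne by (intro sum.cong) (auto simp: ln_powr)
    finally show ?thesis .
  qed
  define D where "D = Q - p"
  have D: "0 < D" using pQ' by (simp add: D_def)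
  define k where "k = (q - p) / p"
  have k: "0 \<le> k" using pq p by (simp add: k_def)
  define w' where "w' = (q - p) / (Q - p)"
  have w': "0 \<le> w'" "w' \<le> 1" using pq pQ pQ' by (auto simp: w'_def)
  have kw: "k * (p / D) = w'" using p by (simp add: k_def w'_def D_def)
  have ne2: "n * e2 = n - 1 - p / D"
  proof -
    have "n * \<gamma> = Q * (n - 1)" using n by (simp add: \<gamma>_def)
    then have "n * (\<gamma> - p) = (n - 1) * D - p" by (simp add: D_def algebra_simps)
    then show ?thesis using D by (simp add: e2_def D_def[symmetric] field_simps)
  qed
  have ne1: "n * e1 = 1 - n / p + p / D"
    using ne2 by (simp add: e1_def algebra_simps)
  have "(n - 1) * ln X \<le> n * ln \<gamma> + (n * e1) * ln Y + (n * e2) * ln X + \<pi>"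
    using main by (simp add: \<pi>_def algebra_simps)
  \<comment> \<open>The power of \<open>X\<close> on the right is absorbed: its coefficient \<open>n * e2\<close> is \<open>n - 1 - p / D\<close>.\<close>
  then have "p / D * ln X \<le> n * ln \<gamma> + (1 - n / p + p / D) * ln Y + \<pi>"
    unfolding ne1 ne2 by (simp add: algebra_simps)
  then have "k * (p / D * ln X) \<le> k * (n * ln \<gamma> + (1 - n / p + p / D) * ln Y + \<pi>)"
    using k by (intro mult_left_mono)
  then have "w' * ln X \<le> n * k * ln \<gamma> + k * (1 - n / p) * ln Y + w' * ln Y + k * \<pi>"
    unfolding kw[symmetric] by (simp add: algebra_simps)
  then have logle: "(1 - w') * ln Y + w' * ln X \<le> n * k * ln \<gamma> + (1 + (1 - n / p) * k) * ln Y + k * ln P"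
    by (simp add: lnP algebra_simps)
  have "(\<integral>\<^sup>+x. ennreal (\<bar>f x\<bar> powr q) \<partial>lborel) = (\<integral>\<^sup>+x. ennpowr (ennreal \<bar>f x\<bar>) ((1 - w') * p + w' * Q) \<partial>lborel)"
  proof -
    have "(1 - w') * p + w' * Q = p + w' * (Q - p)" by (simp add: algebra_simps)
    also have "\<dots> = q" using pQ' by (simp add: w'_def)
    finally show ?thesis using p pq by (simp add: ennpowr_ennreal_pos)
  qed
  also have "\<dots> \<le> ennpowr (\<integral>\<^sup>+y. ennpowr (ennreal \<bar>f y\<bar>) p \<partial>lborel) (1 - w') * ennpowr (\<integral>\<^sup>+y. ennpowr (ennreal \<bar>f y\<bar>) Q \<partial>lborel) w'"
    using p pQ' w' by (intro nn_integral_interpolate) auto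
  also have "\<dots> = ennreal (Y powr (1 - w') * X powr w')"
    using p pQ' X0 Y X by (simp add: ennpowr_ennreal_pos ennpowr_ennreal ennreal_mult')
  also have "\<dots> \<le> ennreal (\<gamma> powr (n * k) * Y powr (1 + (1 - n / p) * k) * P powr k)"
  proof (rule ennreal_leI)
    have "ln (Y powr (1 - w') * X powr w') \<le> ln (\<gamma> powr (n * k) * Y powr (1 + (1 - n / p) * k) * P powr k)"
      using logle \<gamma>1 Y X0 P0 by (simp add: ln_mult ln_powr)
    then show "Y powr (1 - w') * X powr w' \<le> \<gamma> powr (n * k) * Y powr (1 + (1 - n / p) * k) * P powr k"
      using \<gamma>1 Y X0 P0 by (subst (asm) ln_le_cancel_iff) auto
  qed
  finally show ?thesis unfolding n_def[symmetric] \<gamma>_eq k_def P_def .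
qed

section \<open>Smooth bump functions\<close>

text \<open>Infinite differentiability on the line in coinductive form: the function belongs to a family closed under
  taking derivatives. Families can be combined directly, without induction on the order of differentiation.\<close>

definition smooth_line :: "(real \<Rightarrow> real) \<Rightarrow> bool" where
  "smooth_line u \<longleftrightarrow> (\<exists>F. u \<in> F \<and> (\<forall>v\<in>F. \<exists>v'\<in>F. \<forall>x. (v has_real_derivative v' x) (at x)))"

lemma smooth_lineE:
  assumes "smooth_line u"
  obtains F d where "u \<in> F" "\<forall>v\<in>F. d v \<in> F" "\<forall>v\<in>F. \<forall>x. (v has_real_derivative d v x) (at x)"
proof -
  obtain F where F: "u \<in> F \<and> (\<forall>v\<in>F. \<exists>v'\<in>F. \<forall>x. (v has_real_derivative v' x) (at x))"
    using assms unfolding smooth_line_def by (rule exE)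
  from F[THEN conjunct2] have "\<forall>v\<in>F. \<exists>v'. v' \<in> F \<and> (\<forall>x. (v has_real_derivative v' x) (at x))"
    by (simp only: Bex_def)
  from bchoice[OF this] obtain d where d: "\<forall>v\<in>F. d v \<in> F \<and> (\<forall>x. (v has_real_derivative d v x) (at x))" ..
  show ?thesis
  proof (rule that)
    show "u \<in> F" using F by (rule conjunct1)
    show "\<forall>v\<in>F. d v \<in> F" using d unfolding ball_conj_distrib by (rule conjunct1)
    show "\<forall>v\<in>F. \<forall>x. (v has_real_derivative d v x) (at x)"
      using d unfolding ball_conj_distrib by (rule conjunct2)
  qed
qed

lemma smooth_lineI:
  assumes i: "i \<in> I" and d: "\<And>i. i \<in> I \<Longrightarrow> d i \<in> I"
    and der: "\<And>i x. i \<in> I \<Longrightarrow> (g i has_real_derivative g (d i) x) (at x)"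
  shows "smooth_line (g i)"
  unfolding smooth_line_def
proof (intro exI conjI ballI)
  show "g i \<in> g ` I" using i by (rule imageI)
  fix v assume "v \<in> g ` I"
  then obtain j where j: "v = g j" "j \<in> I" by (rule imageE)
  show "\<exists>v'\<in>g ` I. \<forall>x. (v has_real_derivative v' x) (at x)"
    unfolding j(1) using der[OF j(2)] by (intro bexI[OF _ imageI[OF d[OF j(2)]]] allI)
qed

lemma smooth_line_mult:
  assumes "smooth_line u" "smooth_line v"
  shows "smooth_line (\<lambda>x. u x * v x)"
proof -
  from assms(1) obtain F d where F: "u \<in> F" "\<forall>v\<in>F. d v \<in> F" "\<forall>v\<in>F. \<forall>x. (v has_real_derivative d v x) (at x)"
    by (rule smooth_lineE)
  from assms(2) obtain G e where G: "v \<in> G" "\<forall>v\<in>G. e v \<in> G" "\<forall>v\<in>G. \<forall>x. (v has_real_derivative e v x) (at x)"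
    by (rule smooth_lineE)
  define S where "S xs = (\<lambda>x. \<Sum>(a, b)\<leftarrow>xs. a x * b x)" for xs :: "((real \<Rightarrow> real) \<times> (real \<Rightarrow> real)) list"
  \<comment> \<open>Sums of products are represented by lists of pairs of factors; the product rule acts on lists.\<close>
  define D where "D xs = concat (map (\<lambda>(a, b). [(d a, b), (a, e b)]) xs)" for xs
  have D: "set (D xs) \<subseteq> F \<times> G" if "set xs \<subseteq> F \<times> G" for xs
    using that F(2) G(2) by (auto simp: D_def)
  have der: "(S xs has_real_derivative S (D xs) x) (at x)" if "set xs \<subseteq> F \<times> G" for xs x
    using that
  proof (induction xs)
    case Nil then show ?case by (simp add: S_def D_def)
  next
    case (Cons ab xs)
    obtain a b where ab: "ab = (a, b)" by (cases ab)
    have A: "(a has_real_derivative d a x) (at x)" "(b has_real_derivative e b x) (at x)"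
      using Cons.prems F(3) G(3) by (auto simp: ab)
    have "((\<lambda>x. a x * b x + S xs x) has_real_derivative (d a x * b x + e b x * a x) + S (D xs) x) (at x)"
      using Cons by (intro DERIV_add DERIV_mult A) auto
    then show ?case by (simp add: S_def D_def ab algebra_simps)
  qed
  have "smooth_line (S [(u, v)])"
    using F(1) G(1) D der by (intro smooth_lineI[where I = "{xs. set xs \<subseteq> F \<times> G}" and d = D]) auto
  then show ?thesis by (simp add: S_def)
qed

lemma smooth_line_affine:
  assumes "smooth_line u"
  shows "smooth_line (\<lambda>x. u (c * x + k))"
proof -
  from assms obtain F d where F: "u \<in> F" "\<forall>v\<in>F. d v \<in> F" "\<forall>v\<in>F. \<forall>x. (v has_real_derivative d v x) (at x)"
    by (rule smooth_lineE)
  define S where "S av = (\<lambda>x. fst av * snd av (c * x + k))" for av :: "real \<times> (real \<Rightarrow> real)"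
  have "(S (a, v) has_real_derivative S (a * c, d v) x) (at x)" if v: "v \<in> F" for a v x
  proof -
    have "((\<lambda>x. c * x + k) has_real_derivative c) (at x)" by (auto intro!: derivative_eq_intros)
    from DERIV_cmult[OF DERIV_chain2[OF F(3)[rule_format, OF v] this], of a] show ?thesis
      by (simp add: S_def mult_ac)
  qed
  then have "smooth_line (S (1, u))"
    using F(1,2) by (intro smooth_lineI[where I = "UNIV \<times> F" and d = "\<lambda>(a, v). (a * c, d v)"]) auto
  then show ?thesis by (simp add: S_def)
qed

text \<open>The standard smooth function that vanishes exactly on the closed negative half line.\<close>

definition flat_exp :: "real \<Rightarrow> real" where
  "flat_exp t = (if 0 < t then exp (- 1 / t) else 0)"

lemma poly_over_exp_tendsto_0: "((\<lambda>y::real. poly P y * exp (- y)) \<longlongrightarrow> 0) at_top"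
proof -
  have "((\<lambda>y::real. \<Sum>i\<le>degree P. coeff P i * (y ^ i / exp y)) \<longlongrightarrow> (\<Sum>i\<le>degree P. coeff P i * 0)) at_top"
    by (intro tendsto_sum tendsto_mult tendsto_const tendsto_power_div_exp_0)
  moreover have "(\<Sum>i\<le>degree P. coeff P i * (y ^ i / exp y)) = poly P y * exp (- y)" for y
    by (simp add: poly_altdef sum_distrib_right exp_minus divide_inverse mult.assoc)
  ultimately show ?thesis by simp
qed

text \<open>All derivatives have the form of a polynomial in \<open>1 / t\<close> times \<open>exp (- 1 / t)\<close>, and this class is closed
  under differentiation.\<close>

lemma smooth_line_flat_exp: "smooth_line flat_exp"
proof -
  define S where "S P t = (if 0 < t then poly P (1 / t) * exp (- (1 / t)) else 0)" for P :: "real poly" and t :: real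
  have der: "(S P has_real_derivative S ([:0, 0, 1:] * (P - pderiv P)) t) (at t)" for P t
  proof -
    consider "0 < t" | "t < 0" | "t = 0" by linarith
    then show ?thesis
    proof cases
      case 1
      have "((\<lambda>t. 1 / t) has_real_derivative - (1 / t ^ 2)) (at t)"
        using 1 by (auto intro!: derivative_eq_intros simp: power2_eq_square)
      note inv = this
      have "((\<lambda>t. poly P (1 / t) * exp (- (1 / t))) has_real_derivative
          (poly (pderiv P) (1 / t) * - (1 / t ^ 2)) * exp (- (1 / t)) + (exp (- (1 / t)) * - (- (1 / t ^ 2))) * poly P (1 / t)) (at t)"
        by (intro DERIV_mult DERIV_chain2[OF poly_DERIV inv] DERIV_chain2[OF DERIV_exp DERIV_minus[OF inv]])
      moreover have "eventually (\<lambda>s. S P s = poly P (1 / s) * exp (- (1 / s))) (nhds t)"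
        using eventually_nhds_in_open[of "{0<..}" t] 1 by (auto elim!: eventually_mono simp: S_def)
      ultimately show ?thesis using 1
        by (subst DERIV_cong_ev[OF refl _ refl]) (auto simp: S_def algebra_simps power2_eq_square)
    next
      case 2
      have "((\<lambda>t. 0 :: real) has_real_derivative 0) (at t)" by simp
      moreover have "eventually (\<lambda>s. S P s = 0) (nhds t)"
        using eventually_nhds_in_open[of "{..<0}" t] 2 by (auto elim!: eventually_mono simp: S_def)
      ultimately show ?thesis using 2
        by (subst DERIV_cong_ev[OF refl _ refl, of _ "\<lambda>s. 0"]) (auto simp: S_def)
    next
      case 3
      have "((\<lambda>y. poly (pCons 0 P) y * exp (- y)) \<longlongrightarrow> 0) at_top" by (rule poly_over_exp_tendsto_0)
      then have "((\<lambda>h. poly (pCons 0 P) (inverse h) * exp (- inverse h)) \<longlongrightarrow> 0) (at_right (0::real))"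
        by (rule filterlim_compose) (rule filterlim_inverse_at_top_right)
      then have "((\<lambda>h. S P h / h) \<longlongrightarrow> 0) (at_right 0)"
        by (rule Lim_transform_eventually)
          (auto simp: S_def eventually_at_right_less divide_inverse mult_ac intro!: eventually_mono[OF eventually_at_right_less[of 0]])
      moreover have "((\<lambda>h. S P h / h) \<longlongrightarrow> 0) (at_left 0)"
        by (rule Lim_transform_eventually[OF tendsto_const])
          (auto simp: S_def eventually_at_left_field intro!: exI[of _ "-1"])
      ultimately have "((\<lambda>h. S P h / h) \<longlongrightarrow> 0) (at 0)" by (intro filterlim_split_at)
      then show ?thesis using 3 by (simp add: DERIV_def S_def)
    qed
  qed
  have "flat_exp = S 1" by (auto simp: S_def flat_exp_def)
  moreover have "smooth_line (S 1)"
    using der by (intro smooth_lineI[where I = UNIV and d = "\<lambda>P. [:0, 0, 1:] * (P - pderiv P)"]) auto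
  ultimately show ?thesis by simp
qed

lemma flat_exp_bounds: "0 \<le> flat_exp t" "flat_exp t \<le> 1" "flat_exp t \<noteq> 0 \<longleftrightarrow> 0 < t"
  by (auto simp: flat_exp_def)

lemma smooth_line_continuous: "smooth_line u \<Longrightarrow> continuous_on UNIV u"
  by (erule smooth_lineE) (auto intro!: continuous_at_imp_continuous_on DERIV_isCont)

lemma flat_exp_measurable [measurable]: "flat_exp \<in> borel_measurable borel"
  by (intro borel_measurable_continuous_onI smooth_line_continuous smooth_line_flat_exp)

lemma has_derivative_product_function:
  fixes u u' :: "'a::euclidean_space \<Rightarrow> real \<Rightarrow> real"
  assumes "\<And>b t. b \<in> Basis \<Longrightarrow> (u b has_real_derivative u' b t) (at t)"
  shows "((\<lambda>x. \<Prod>b\<in>Basis. u b (x \<bullet> b)) has_derivative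
    (\<lambda>y. \<Sum>b\<in>Basis. (y \<bullet> b) * (\<Prod>c\<in>Basis. (u(b := u' b)) c (x \<bullet> c)))) (at x)"
proof -
  have "((\<lambda>x. \<Prod>b\<in>Basis. u b (x \<bullet> b)) has_derivative
    (\<lambda>y. \<Sum>b\<in>Basis. (u' b (x \<bullet> b) * (y \<bullet> b)) * (\<Prod>c\<in>Basis - {b}. u c (x \<bullet> c)))) (at x)"
  proof (rule has_derivative_prod)
    fix b :: 'a assume "b \<in> Basis"
    have "((\<lambda>x. x \<bullet> b) has_derivative (\<lambda>y. y \<bullet> b)) (at x)" by (auto intro!: derivative_eq_intros)
    moreover have "(u b has_derivative (\<lambda>h. u' b (x \<bullet> b) * h)) (at (x \<bullet> b))"
      using assms[OF \<open>b \<in> Basis\<close>] by (simp add: has_field_derivative_def)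
    ultimately show "((\<lambda>x. u b (x \<bullet> b)) has_derivative (\<lambda>y. u' b (x \<bullet> b) * (y \<bullet> b))) (at x)"
      by (rule has_derivative_compose)
  qed
  moreover have "(\<Sum>b\<in>Basis. (u' b (x \<bullet> b) * (y \<bullet> b)) * (\<Prod>c\<in>Basis - {b}. u c (x \<bullet> c)))
     = (\<Sum>b\<in>Basis. (y \<bullet> b) * (\<Prod>c\<in>Basis. (u(b := u' b)) c (x \<bullet> c)))" for y
  proof (intro sum.cong refl)
    fix b :: 'a assume b: "b \<in> Basis"
    have "(\<Prod>c\<in>Basis. (u(b := u' b)) c (x \<bullet> c)) = u' b (x \<bullet> b) * (\<Prod>c\<in>Basis - {b}. (u(b := u' b)) c (x \<bullet> c))"
      using b by (simp add: prod.remove[of Basis b])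
    also have "(\<Prod>c\<in>Basis - {b}. (u(b := u' b)) c (x \<bullet> c)) = (\<Prod>c\<in>Basis - {b}. u c (x \<bullet> c))"
      by (intro prod.cong) auto
    finally show "(u' b (x \<bullet> b) * (y \<bullet> b)) * (\<Prod>c\<in>Basis - {b}. u c (x \<bullet> c)) = (y \<bullet> b) * (\<Prod>c\<in>Basis. (u(b := u' b)) c (x \<bullet> c))"
      by simp
  qed
  ultimately show ?thesis by simp
qed

text \<open>The functions \<open>x \<mapsto> k * (\<Prod>b\<in>Basis. w b (x \<bullet> b))\<close> with factors from families closed under derivatives are
  themselves closed under partial derivatives: one factor is differentiated.\<close>

lemma smooth_product:
  fixes u :: "'a::euclidean_space \<Rightarrow> real \<Rightarrow> real"
  assumes "\<And>b. b \<in> Basis \<Longrightarrow> smooth_line (u b)"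
  shows "smooth (\<lambda>x. k * (\<Prod>b\<in>Basis. u b (x \<bullet> b)))"
proof -
  have "\<forall>b\<in>Basis. \<exists>Fd. u b \<in> fst Fd \<and> (\<forall>v\<in>fst Fd. snd Fd v \<in> fst Fd) \<and>
      (\<forall>v\<in>fst Fd. \<forall>x. (v has_real_derivative snd Fd v x) (at x))"
  proof
    fix b :: 'a assume "b \<in> Basis"
    then obtain G e where G: "u b \<in> G" "\<forall>v\<in>G. e v \<in> G" "\<forall>v\<in>G. \<forall>x. (v has_real_derivative e v x) (at x)"
      by (rule smooth_lineE[OF assms])
    show "\<exists>Fd. u b \<in> fst Fd \<and> (\<forall>v\<in>fst Fd. snd Fd v \<in> fst Fd) \<and>
      (\<forall>v\<in>fst Fd. \<forall>x. (v has_real_derivative snd Fd v x) (at x))"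
      using G by (intro exI[of _ "(G, e)"]) simp
  qed
  from bchoice[OF this] obtain Fd where Fd: "\<forall>b\<in>Basis. u b \<in> fst (Fd b) \<and> (\<forall>v\<in>fst (Fd b). snd (Fd b) v \<in> fst (Fd b)) \<and>
      (\<forall>v\<in>fst (Fd b). \<forall>x. (v has_real_derivative snd (Fd b) v x) (at x))" ..
  define F d where "F b = fst (Fd b)" and "d b = snd (Fd b)" for b
  have F: "u b \<in> F b" "v \<in> F b \<Longrightarrow> d b v \<in> F b" "v \<in> F b \<Longrightarrow> (v has_real_derivative d b v x) (at x)"
    if "b \<in> Basis" for b v x
    using bspec[OF Fd that] by (simp_all add: F_def d_def)
  define \<Phi> where "\<Phi> = {\<lambda>x::'a. k * (\<Prod>b\<in>Basis. w b (x \<bullet> b)) | w. \<forall>b\<in>Basis. w b \<in> F b}"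
  have step: "(\<forall>x. \<phi> differentiable (at x)) \<and> (\<forall>b\<in>Basis. (\<lambda>x. frechet_derivative \<phi> (at x) b) \<in> \<Phi>)" if \<phi>: "\<phi> \<in> \<Phi>" for \<phi>
  proof -
    obtain w where w: "\<phi> = (\<lambda>x. k * (\<Prod>b\<in>Basis. w b (x \<bullet> b)))" "\<forall>b\<in>Basis. w b \<in> F b"
      using \<phi> by (auto simp: \<Phi>_def)
    define w' where "w' b = d b (w b)" for b
    have w': "b \<in> Basis \<Longrightarrow> w' b \<in> F b"
      "b \<in> Basis \<Longrightarrow> (w b has_real_derivative w' b x) (at x)" for b x
      using w(2) F(2,3) by (simp_all add: w'_def)
    have der: "(\<phi> has_derivative (\<lambda>y. k * (\<Sum>b\<in>Basis. (y \<bullet> b) * (\<Prod>c\<in>Basis. (w(b := w' b)) c (x \<bullet> c))))) (at x)" for x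
      unfolding w(1) by (intro has_derivative_mult_right has_derivative_product_function w')
    have "(\<lambda>x. frechet_derivative \<phi> (at x) b) \<in> \<Phi>" if b: "b \<in> Basis" for b
    proof -
      have "frechet_derivative \<phi> (at x) b = k * (\<Prod>c\<in>Basis. (w(b := w' b)) c (x \<bullet> c))" for x
      proof -
        have "(\<Sum>b'\<in>Basis. (b \<bullet> b') * (\<Prod>c\<in>Basis. (w(b' := w' b')) c (x \<bullet> c)))
           = (\<Sum>b'\<in>Basis. if b' = b then (\<Prod>c\<in>Basis. (w(b := w' b)) c (x \<bullet> c)) else 0)"
          using b by (intro sum.cong) (auto simp: inner_Basis)
        also have "\<dots> = (\<Prod>c\<in>Basis. (w(b := w' b)) c (x \<bullet> c))" using b by simp
        finally have e: "(\<Sum>b'\<in>Basis. (b \<bullet> b') * (\<Prod>c\<in>Basis. (w(b' := w' b')) c (x \<bullet> c)))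
          = (\<Prod>c\<in>Basis. (w(b := w' b)) c (x \<bullet> c))" .
        show ?thesis by (subst frechet_derivative_at[OF der[of x], symmetric]) (simp only: e)
      qed
      then show ?thesis unfolding \<Phi>_def using w(2) w'(1) b by (intro CollectI exI[of _ "w(b := w' b)"]) auto
    qed
    then have "\<forall>b\<in>Basis. (\<lambda>x. frechet_derivative \<phi> (at x) b) \<in> \<Phi>" by (rule ballI)
    moreover have "\<phi> differentiable (at x)" for x using der[of x] by (rule differentiableI)
    then have "\<forall>x. \<phi> differentiable (at x)" by (rule allI)
    ultimately show ?thesis by (intro conjI)
  qed
  have start: "(\<lambda>x. k * (\<Prod>b\<in>Basis. u b (x \<bullet> b))) \<in> \<Phi>" using F(1) by (auto simp: \<Phi>_def)
  have "iter_partial bs (\<lambda>x. k * (\<Prod>b\<in>Basis. u b (x \<bullet> b))) \<in> \<Phi>" if "set bs \<subseteq> Basis" for bs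
    using that
  proof (induction bs)
    case Nil then show ?case using start by simp
  next
    case (Cons b bs)
    then show ?case using step by simp
  qed
  from step[OF this, THEN conjunct1] show ?thesis unfolding smooth_def by (intro allI impI) (rule spec)
qed

text \<open>Smooth functions that are positive exactly on the box and increase to its indicator as \<open>k\<close> tends to
  infinity.\<close>

definition box_bump :: "real \<Rightarrow> 'a::euclidean_space \<Rightarrow> 'a \<Rightarrow> 'a \<Rightarrow> real" where
  "box_bump k a c x = (\<Prod>b\<in>Basis. flat_exp (k * (x \<bullet> b - a \<bullet> b)) * flat_exp (k * (c \<bullet> b - x \<bullet> b)))"

lemma box_bump_pos_iff: "0 < k \<Longrightarrow> box_bump k a c x \<noteq> 0 \<longleftrightarrow> x \<in> box a c"
  by (auto simp: box_bump_def flat_exp_bounds(3) mem_box zero_less_mult_iff)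

lemma box_bump_bounds: "0 \<le> box_bump k a c x" "box_bump k a c x \<le> 1"
  unfolding box_bump_def by (auto intro!: prod_nonneg prod_le_1 mult_nonneg_nonneg mult_le_one flat_exp_bounds)

lemma box_bump_measurable [measurable]: "box_bump k a c \<in> borel_measurable borel"
  unfolding box_bump_def[abs_def] by measurable

lemma test_function_box_bump:
  assumes k: "0 < k" shows "test_function (\<lambda>x. m * box_bump k a c x)"
proof -
  have "smooth (\<lambda>x. m * box_bump k a c x)"
    unfolding box_bump_def
  proof (rule smooth_product)
    fix b :: 'a
    have "smooth_line (\<lambda>t. flat_exp (k * t + - k * (a \<bullet> b)) * flat_exp (- k * t + k * (c \<bullet> b)))"
      by (intro smooth_line_mult smooth_line_affine smooth_line_flat_exp)
    then show "smooth_line (\<lambda>t. flat_exp (k * (t - a \<bullet> b)) * flat_exp (k * (c \<bullet> b - t)))"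
      by (simp add: algebra_simps)
  qed
  moreover have "bounded {x. m * box_bump k a c x \<noteq> 0}"
    using box_bump_pos_iff[OF k, of a c] by (intro bounded_subset[OF bounded_box[of a c]]) auto
  ultimately show ?thesis by (simp add: test_function_def compact_closure)
qed

lemma box_bump_tendsto_indicator:
  "(\<lambda>n. box_bump (real (Suc n)) a c x) \<longlonglongrightarrow> indicator (box a c) x"
proof (cases "x \<in> box a c")
  case False
  then have "box_bump (real (Suc n)) a c x = 0" for n using box_bump_pos_iff[of "real (Suc n)" a c x] by auto
  then show ?thesis using False by simp
next
  case True
  have one: "(\<lambda>n. flat_exp (real (Suc n) * s)) \<longlonglongrightarrow> 1" if s: "0 < s" for s
  proof -
    have "(\<lambda>n. exp (- ((1 / s) * inverse (real (Suc n))))) \<longlonglongrightarrow> exp (- ((1 / s) * 0))"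
      by (intro tendsto_intros LIMSEQ_inverse_real_of_nat)
    moreover have "exp (- ((1 / s) * inverse (real (Suc n)))) = flat_exp (real (Suc n) * s)" for n
      using s by (simp add: flat_exp_def divide_inverse mult.commute)
    ultimately show ?thesis by simp
  qed
  have "(\<lambda>n. box_bump (real (Suc n)) a c x) \<longlonglongrightarrow> (\<Prod>b\<in>(Basis::'a set). 1 * 1)"
    unfolding box_bump_def using True by (intro tendsto_prod tendsto_mult one) (auto simp: mem_box)
  then show ?thesis using True by simp
qed

section \<open>The fundamental lemma of the calculus of variations\<close>

text \<open>The measures with densities \<open>max h 0\<close> and \<open>max (- h) 0\<close> agree on boxes, which generate the Borel sets and
  are stable under intersection.\<close>

lemma AE_zero_if_box_integrals_zero:
  fixes h :: "'a::euclidean_space \<Rightarrow> real"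
  assumes [measurable]: "h \<in> borel_measurable borel"
    and int: "\<And>a c. integrable lborel (\<lambda>x. h x * indicator (box a c) x)"
    and zero: "\<And>a c. (\<integral>x. h x * indicator (box a c) x \<partial>lborel) = 0"
  shows "AE x in lborel. h x = 0"
proof -
  \<comment> \<open>\<open>ennreal\<close> sends negative numbers to \<open>0\<close>, so these are the positive and the negative part.\<close>
  define pos where "pos = density lborel (\<lambda>x. ennreal (h x))"
  define neg where "neg = density lborel (\<lambda>x. ennreal (- h x))"
  have ep: "emeasure pos (box a c) = (\<integral>\<^sup>+x. ennreal (h x * indicator (box a c) x) \<partial>lborel)" for a c
    unfolding pos_def by (subst emeasure_density) (auto intro!: nn_integral_cong simp: indicator_def)
  have en: "emeasure neg (box a c) = (\<integral>\<^sup>+x. ennreal (- (h x * indicator (box a c) x)) \<partial>lborel)" for a c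
    unfolding neg_def by (subst emeasure_density) (auto intro!: nn_integral_cong simp: indicator_def)
  have fin: "emeasure pos (box a c) < top" "emeasure neg (box a c) < top" for a c
    using int[of a c] unfolding ep en real_integrable_def by (auto simp: less_top)
  have eq: "emeasure pos (box a c) = emeasure neg (box a c)" for a c
  proof -
    have "enn2real (emeasure pos (box a c)) = enn2real (emeasure neg (box a c))"
      using real_lebesgue_integral_def[OF int[of a c]] zero[of a c] by (simp add: ep en)
    then show ?thesis using fin[of a c] by (cases "emeasure pos (box a c)"; cases "emeasure neg (box a c)") auto
  qed
  have "pos = neg"
  proof (rule measure_eqI_generator_eq[where E = "range (\<lambda>(a, b). box a b :: 'a set)" and \<Omega> = UNIV
        and A = "\<lambda>n::nat. box (- (real n *\<^sub>R One)) (real n *\<^sub>R One)"])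
    show "Int_stable (range (\<lambda>(a, b). box a b :: 'a set))"
      by (auto simp: Int_stable_def box_Int_box)
    show "sets pos = sigma_sets UNIV (range (\<lambda>(a, b). box a b))" "sets neg = sigma_sets UNIV (range (\<lambda>(a, b). box a b))"
      by (simp_all add: pos_def neg_def borel_eq_box)
    show "(\<Union>n::nat. box (- (real n *\<^sub>R One)) (real n *\<^sub>R One) :: 'a set) = UNIV" by (rule UN_box_eq_UNIV)
    show "emeasure pos X = emeasure neg X" if "X \<in> range (\<lambda>(a, b). box a b)" for X using that eq by auto
    show "emeasure pos (box (- (real n *\<^sub>R One)) (real n *\<^sub>R One)) \<noteq> \<infinity>" for n
      using fin(1)[of "- (real n *\<^sub>R One)" "real n *\<^sub>R One"] by simp
  qed auto
  then have "AE x in lborel. ennreal (h x) = ennreal (- h x)"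
    unfolding pos_def neg_def by (intro sigma_finite_measure.density_unique[OF sigma_finite_lborel]) auto
  then show ?thesis
  proof eventually_elim
    case (elim x)
    then show ?case by (cases "0 \<le> h x") (auto simp: ennreal_neg)
  qed
qed

text \<open>Box bumps are test functions that converge to indicators of boxes, so all integrals over boxes vanish.\<close>

lemma fundamental_lemma_variations:
  fixes h :: "'a::euclidean_space \<Rightarrow> real"
  assumes [measurable]: "h \<in> borel_measurable borel"
    and int: "\<And>a c. integrable lborel (\<lambda>x. h x * indicator (box a c) x)"
    and zero: "\<And>\<phi>. test_function \<phi> \<Longrightarrow> (\<integral>x. h x * \<phi> x \<partial>lborel) = 0"
  shows "AE x in lborel. h x = 0"
proof (rule AE_zero_if_box_integrals_zero[OF assms(1) int])
  fix a c :: 'a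
  have "(\<lambda>n. \<integral>x. h x * box_bump (real (Suc n)) a c x \<partial>lborel) \<longlonglongrightarrow> (\<integral>x. h x * indicator (box a c) x \<partial>lborel)"
  proof (rule integral_dominated_convergence[where w = "\<lambda>x. \<bar>h x * indicator (box a c) x\<bar>"])
    show "integrable lborel (\<lambda>x. \<bar>h x * indicator (box a c) x\<bar>)" using int by (rule integrable_abs)
    show "AE x in lborel. (\<lambda>n. h x * box_bump (real (Suc n)) a c x) \<longlonglongrightarrow> h x * indicator (box a c) x"
      by (intro AE_I2 tendsto_mult tendsto_const box_bump_tendsto_indicator)
    show "AE x in lborel. norm (h x * box_bump (real (Suc n)) a c x) \<le> \<bar>h x * indicator (box a c) x\<bar>" for n
    proof (rule AE_I2)
      fix x
      show "norm (h x * box_bump (real (Suc n)) a c x) \<le> \<bar>h x * indicator (box a c) x\<bar>"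
        using box_bump_bounds[of "real (Suc n)" a c x] box_bump_pos_iff[of "real (Suc n)" a c x]
        by (cases "x \<in> box a c") (auto simp: abs_mult intro!: mult_left_le)
    qed
  qed measurable
  moreover have "(\<integral>x. h x * box_bump (real (Suc n)) a c x \<partial>lborel) = 0" for n
    using zero[OF test_function_box_bump[of "real (Suc n)" 1 a c]] by simp
  ultimately show "(\<integral>x. h x * indicator (box a c) x \<partial>lborel) = 0" by (simp add: LIMSEQ_const_iff)
qed

section \<open>Continuity of translations in L1\<close>

lemma lborel_shift_integrable:
  fixes f :: "'a::euclidean_space \<Rightarrow> 'b::{banach, second_countable_topology}"
  assumes "integrable lborel f"
  shows "integrable lborel (\<lambda>x. f (x + c))" "(\<integral>x. f (x + c) \<partial>lborel) = (\<integral>x. f x \<partial>lborel)"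
proof -
  have [measurable]: "f \<in> borel_measurable borel" using assms by (simp add: borel_measurable_integrable)
  have "integrable (distr lborel borel ((+) c)) f" using assms by (simp add: lborel_distr_plus)
  then show "integrable lborel (\<lambda>x. f (x + c))" by (subst (asm) integrable_distr_eq) (auto simp: add.commute)
  have "(\<integral>x. f x \<partial>lborel) = (\<integral>x. f x \<partial>distr lborel borel ((+) c))" by (simp add: lborel_distr_plus)
  also have "\<dots> = (\<integral>x. f (c + x) \<partial>lborel)" by (subst integral_distr) auto
  finally show "(\<integral>x. f (x + c) \<partial>lborel) = (\<integral>x. f x \<partial>lborel)" by (simp add: add.commute)
qed

lemma nn_integral_lborel_reflect:
  fixes k :: "'a::euclidean_space \<Rightarrow> ennreal"
  assumes [measurable]: "k \<in> borel_measurable borel"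
  shows "(\<integral>\<^sup>+y. k (x - y) \<partial>lborel) = (\<integral>\<^sup>+z. k z \<partial>lborel)"
proof -
  have "orthogonal_transformation (uminus :: 'a \<Rightarrow> 'a)"
    by (simp add: orthogonal_transformation_def linear_uminus)
  then have "(\<integral>\<^sup>+y. (\<lambda>z. k (z + x)) (- y) \<partial>lborel) = (\<integral>\<^sup>+z. k (z + x) \<partial>lborel)"
    by (intro nn_integral_lborel_orthogonal) measurable
  also have "\<dots> = (\<integral>\<^sup>+z. k z \<partial>lborel)" by (intro nn_integral_lborel_shift) measurable
  finally show ?thesis by simp
qed

text \<open>The modulus of continuity of a function in \<open>L1\<close> under translation.\<close>

definition shift_diff :: "('a::euclidean_space \<Rightarrow> real) \<Rightarrow> 'a \<Rightarrow> real" where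
  "shift_diff f z = (\<integral>x. \<bar>f (x + z) - f x\<bar> \<partial>lborel)"

lemma shift_diff_integrable:
  fixes f :: "'a::euclidean_space \<Rightarrow> real"
  assumes "integrable lborel f"
  shows "integrable lborel (\<lambda>x. \<bar>f (x + z) - f x\<bar>)"
  using lborel_shift_integrable(1)[OF assms, of z] assms
  by (intro integrable_abs Bochner_Integration.integrable_diff)

lemma shift_diff_triangle:
  assumes f: "integrable lborel f" and g: "integrable lborel g"
  shows "shift_diff f z \<le> shift_diff g z + 2 * (\<integral>x. \<bar>f x - g x\<bar> \<partial>lborel)"
proof -
  have d: "integrable lborel (\<lambda>x. \<bar>f x - g x\<bar>)" using f g by auto
  note d' = lborel_shift_integrable[OF d, of z]
  have "shift_diff f z \<le> (\<integral>x. \<bar>g (x + z) - g x\<bar> + (\<bar>f (x + z) - g (x + z)\<bar> + \<bar>f x - g x\<bar>) \<partial>lborel)"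
    unfolding shift_diff_def using shift_diff_integrable[OF f] shift_diff_integrable[OF g] d d'
    by (intro integral_mono) auto
  also have "\<dots> = shift_diff g z + ((\<integral>x. \<bar>f (x + z) - g (x + z)\<bar> \<partial>lborel) + (\<integral>x. \<bar>f x - g x\<bar> \<partial>lborel))"
    unfolding shift_diff_def using shift_diff_integrable[OF g] d d' by simp
  finally show ?thesis using d' by simp
qed

lemma shift_diff_closed:
  assumes f: "integrable lborel f"
    and approx: "\<And>e. 0 < e \<Longrightarrow> \<exists>g. integrable lborel g \<and> (\<lambda>n. shift_diff g (z n)) \<longlonglongrightarrow> 0 \<and> (\<integral>x. \<bar>f x - g x\<bar> \<partial>lborel) \<le> e"
  shows "(\<lambda>n. shift_diff f (z n)) \<longlonglongrightarrow> 0"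
proof (rule LIMSEQ_I)
  fix e :: real assume e: "0 < e"
  then obtain g where g: "integrable lborel g" "(\<lambda>n. shift_diff g (z n)) \<longlonglongrightarrow> 0" "(\<integral>x. \<bar>f x - g x\<bar> \<partial>lborel) \<le> e / 4"
    using approx[of "e / 4"] by auto
  obtain n0 where n0: "\<And>n. n0 \<le> n \<Longrightarrow> norm (shift_diff g (z n) - 0) < e / 2"
    using LIMSEQ_D[OF g(2), of "e / 2"] e by auto
  show "\<exists>n0. \<forall>n\<ge>n0. norm (shift_diff f (z n) - 0) < e"
  proof (intro exI[of _ n0] allI impI)
    fix n assume "n0 \<le> n"
    then have "shift_diff f (z n) < e" using n0[of n] shift_diff_triangle[OF f g(1), of "z n"] g(3) by auto
    moreover have "0 \<le> shift_diff f (z n)" by (simp add: shift_diff_def)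
    ultimately show "norm (shift_diff f (z n) - 0) < e" by simp
  qed
qed

text \<open>For indicators of open sets the positive part of the difference converges pointwise, by openness. The
  negative part has the same integral, because Lebesgue measure is translation invariant.\<close>

lemma shift_diff_open:
  fixes U :: "'a::euclidean_space set"
  assumes U: "open U" "emeasure lborel U < \<infinity>" and z: "z \<longlonglongrightarrow> 0"
  shows "(\<lambda>n. shift_diff (indicator U) (z n)) \<longlonglongrightarrow> 0"
proof -
  have [measurable]: "U \<in> sets borel" using U by simp
  have iU: "integrable lborel (indicator U :: 'a \<Rightarrow> real)" using U(2) by simp
  define D where "D n x = indicator U x - (indicator U (x + z n) :: real)" for n x
  have iD: "integrable lborel (D n)" "(\<integral>x. D n x \<partial>lborel) = 0" for n
    unfolding D_def using iU lborel_shift_integrable[OF iU, of "z n"] by auto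
  have "(\<lambda>n. \<integral>x. max (D n x) 0 \<partial>lborel) \<longlonglongrightarrow> (\<integral>x. 0 \<partial>(lborel :: 'a measure))"
  proof (rule integral_dominated_convergence[where w = "indicator U"])
    show "AE x in lborel. (\<lambda>n. max (D n x) 0) \<longlonglongrightarrow> 0"
    proof (rule AE_I2)
      fix x
      show "(\<lambda>n. max (D n x) 0) \<longlonglongrightarrow> 0"
      proof (cases "x \<in> U")
        case True
        have "(\<lambda>n. x + z n) \<longlonglongrightarrow> x + 0" by (intro tendsto_intros z)
        then have "eventually (\<lambda>n. x + z n \<in> U) sequentially"
          using U(1) True by (auto dest: topological_tendstoD)
        then have "eventually (\<lambda>n. max (D n x) 0 = 0) sequentially"
          by eventually_elim (use True in \<open>simp add: D_def\<close>)
        then show ?thesis by (rule tendsto_eventually)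
      next
        case False
        then have "max (D n x) 0 = 0" for n by (simp add: D_def indicator_def)
        then show ?thesis by simp
      qed
    qed
    show "AE x in lborel. norm (max (D n x) 0) \<le> indicator U x" for n
      by (rule AE_I2) (simp add: D_def indicator_def)
  qed (use iU iD in \<open>auto simp: D_def\<close>)
  then have "(\<lambda>n. 2 * (\<integral>x. max (D n x) 0 \<partial>lborel)) \<longlonglongrightarrow> 2 * 0" by (intro tendsto_mult tendsto_const) simp
  moreover have "2 * (\<integral>x. max (D n x) 0 \<partial>lborel) = shift_diff (indicator U) (z n)" for n
  proof -
    have "shift_diff (indicator U) (z n) = (\<integral>x. 2 * max (D n x) 0 - D n x \<partial>lborel)"
      unfolding shift_diff_def by (intro Bochner_Integration.integral_cong) (auto simp: D_def max_def abs_real_def)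
    also have "\<dots> = (\<integral>x. 2 * max (D n x) 0 \<partial>lborel) - (\<integral>x. D n x \<partial>lborel)"
      using iD by (intro Bochner_Integration.integral_diff integrable_mult_right integrable_max) auto
    finally show ?thesis using iD by simp
  qed
  ultimately show ?thesis by simp
qed

lemma shift_diff_cmult: "shift_diff (\<lambda>x. c * f x) z = \<bar>c\<bar> * shift_diff f z"
proof -
  have "\<bar>c * f (x + z) - c * f x\<bar> = \<bar>c\<bar> * \<bar>f (x + z) - f x\<bar>" for x
    by (simp add: abs_mult flip: right_diff_distrib)
  then show ?thesis by (simp add: shift_diff_def)
qed

text \<open>Indicators of open sets approximate indicators of Borel sets in \<open>L1\<close> by outer regularity, and linear
  combinations of the latter approximate integrable functions; \<open>shift_diff_closed\<close> carries the claim over.\<close>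

lemma shift_diff_tendsto_0:
  fixes f :: "'a::euclidean_space \<Rightarrow> real"
  assumes "integrable lborel f" and z: "z \<longlonglongrightarrow> 0"
  shows "(\<lambda>n. shift_diff f (z n)) \<longlonglongrightarrow> 0"
  using assms(1)
proof (induction rule: integrable_induct)
  case (base A c)
  have A[measurable]: "A \<in> sets borel" using base by simp
  have iA: "integrable lborel (indicator A :: 'a \<Rightarrow> real)" using base by simp
  have "(\<lambda>n. shift_diff (indicator A) (z n)) \<longlonglongrightarrow> 0"
  proof (rule shift_diff_closed[OF iA])
    fix e :: real assume e: "0 < e"
    obtain U where U: "open U" "A \<subseteq> U" "emeasure lborel (U - A) < e"
      using outer_regular_lborel[OF A e] .
    have [measurable]: "U \<in> sets borel" using U by simp
    have "emeasure lborel U = emeasure lborel A + emeasure lborel (U - A)"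
      using U(2) by (subst plus_emeasure) (auto intro!: arg_cong2[where f = emeasure])
    also have "\<dots> < \<infinity>" using base(2) U(3) by (auto simp: less_top[symmetric])
    finally have fU: "emeasure lborel U < \<infinity>" .
    have "(\<integral>x. \<bar>indicator A x - indicator U x :: real\<bar> \<partial>lborel) = (\<integral>x. indicator (U - A) x \<partial>lborel)"
      using U(2) by (intro Bochner_Integration.integral_cong) (auto simp: indicator_def)
    also have "\<dots> = measure lborel (U - A)" by simp
    also have "\<dots> \<le> e" using U(3) e by (simp add: measure_def enn2real_leI)
    finally show "\<exists>g. integrable lborel g \<and> (\<lambda>n. shift_diff g (z n)) \<longlonglongrightarrow> 0 \<and> (\<integral>x. \<bar>indicator A x - g x\<bar> \<partial>lborel) \<le> e"
      using shift_diff_open[OF U(1) fU z] fU by (intro exI[of _ "indicator U"]) simp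
  qed
  then have "(\<lambda>n. \<bar>c\<bar> * shift_diff (indicator A) (z n)) \<longlonglongrightarrow> \<bar>c\<bar> * 0" by (intro tendsto_intros)
  then show ?case by (simp add: mult.commute flip: shift_diff_cmult)
next
  case (add f g)
  have fi: "integrable lborel f" and gi: "integrable lborel g" by fact+
  have Pf: "(\<lambda>n. shift_diff f (z n)) \<longlonglongrightarrow> 0" by fact
  have Pg: "(\<lambda>n. shift_diff g (z n)) \<longlonglongrightarrow> 0" by fact
  have "(\<lambda>n. shift_diff f (z n) + shift_diff g (z n)) \<longlonglongrightarrow> 0 + 0" by (intro tendsto_add Pf Pg)
  then have lim: "(\<lambda>n. shift_diff f (z n) + shift_diff g (z n)) \<longlonglongrightarrow> 0" by simp
  show ?case
  proof (rule Lim_null_comparison[OF _ lim], intro always_eventually allI)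
    fix n
    have "shift_diff (\<lambda>x. f x + g x) (z n) \<le> (\<integral>x. \<bar>f (x + z n) - f x\<bar> + \<bar>g (x + z n) - g x\<bar> \<partial>lborel)"
      unfolding shift_diff_def
      using shift_diff_integrable[OF fi] shift_diff_integrable[OF gi]
        shift_diff_integrable[OF Bochner_Integration.integrable_add[OF fi gi]]
      by (intro integral_mono) auto
    also have "\<dots> = shift_diff f (z n) + shift_diff g (z n)"
      unfolding shift_diff_def using shift_diff_integrable[OF fi] shift_diff_integrable[OF gi] by simp
    finally show "norm (shift_diff (\<lambda>x. f x + g x) (z n)) \<le> shift_diff f (z n) + shift_diff g (z n)"
      by (simp add: shift_diff_def)
  qed
next
  case (lim f s)
  have fi: "integrable lborel f" by fact
  have si: "\<And>i. integrable lborel (s i)" by fact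
  have Ps: "\<And>i. (\<lambda>n. shift_diff (s i) (z n)) \<longlonglongrightarrow> 0" by fact
  have cv: "\<And>x. x \<in> space lborel \<Longrightarrow> (\<lambda>i. s i x) \<longlonglongrightarrow> f x" by fact
  have dom: "\<And>i x. x \<in> space lborel \<Longrightarrow> norm (s i x) \<le> 2 * norm (f x)" by fact
  have [measurable]: "f \<in> borel_measurable borel" "\<And>i. s i \<in> borel_measurable borel"
    using borel_measurable_integrable[OF fi] borel_measurable_integrable[OF si] by simp_all
  have "(\<lambda>i. \<integral>x. \<bar>f x - s i x\<bar> \<partial>lborel) \<longlonglongrightarrow> (\<integral>x. 0 \<partial>(lborel :: 'a measure))"
  proof (rule integral_dominated_convergence[where w = "\<lambda>x. 3 * norm (f x)"])
    show "integrable lborel (\<lambda>x. 3 * norm (f x))" using fi by auto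
    show "AE x in lborel. (\<lambda>i. \<bar>f x - s i x\<bar>) \<longlonglongrightarrow> 0"
    proof (rule AE_I2)
      fix x
      have "(\<lambda>i. \<bar>f x - s i x\<bar>) \<longlonglongrightarrow> \<bar>f x - f x\<bar>" using cv[of x] by (intro tendsto_intros) auto
      then show "(\<lambda>i. \<bar>f x - s i x\<bar>) \<longlonglongrightarrow> 0" by simp
    qed
    show "AE x in lborel. norm \<bar>f x - s i x\<bar> \<le> 3 * norm (f x)" for i
    proof (rule AE_I2)
      fix x show "norm \<bar>f x - s i x\<bar> \<le> 3 * norm (f x)" using dom[of x i] by simp
    qed
  qed measurable
  then have conv: "(\<lambda>i. \<integral>x. \<bar>f x - s i x\<bar> \<partial>lborel) \<longlonglongrightarrow> 0" by simp
  show ?case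
  proof (rule shift_diff_closed)
    show "integrable lborel f" by (rule fi)
    fix e :: real assume "0 < e"
    then obtain i where "norm ((\<integral>x. \<bar>f x - s i x\<bar> \<partial>lborel) - 0) < e" using LIMSEQ_D[OF conv, of e] by blast
    then show "\<exists>g. integrable lborel g \<and> (\<lambda>n. shift_diff g (z n)) \<longlonglongrightarrow> 0 \<and> (\<integral>x. \<bar>f x - g x\<bar> \<partial>lborel) \<le> e"
      using si[of i] Ps[of i] by (intro exI[of _ "s i"]) simp
  qed
qed

lemma shift_diff_uniform:
  fixes f :: "'a::euclidean_space \<Rightarrow> real"
  assumes "integrable lborel f" "0 < e"
  obtains d where "0 < d" "\<And>z. norm z < d \<Longrightarrow> shift_diff f z \<le> e"
proof -
  have "\<exists>d>0. \<forall>z. norm z < d \<longrightarrow> shift_diff f z \<le> e"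
  proof (rule ccontr)
    assume "\<not> ?thesis"
    then have "\<forall>n. \<exists>z. norm z < inverse (real (Suc n)) \<and> e < shift_diff f z"
      by (metis inverse_positive_iff_positive not_le of_nat_0_less_iff zero_less_Suc)
    then obtain z where z: "\<forall>n. norm (z n) < inverse (real (Suc n)) \<and> e < shift_diff f (z n)" by (rule choice[THEN exE])
    have "z \<longlonglongrightarrow> 0"
      by (rule Lim_null_comparison[OF _ LIMSEQ_inverse_real_of_nat]) (use z in \<open>auto intro!: always_eventually less_imp_le\<close>)
    then have "(\<lambda>n. shift_diff f (z n)) \<longlonglongrightarrow> 0" by (rule shift_diff_tendsto_0[OF assms(1)])
    then obtain n where "norm (shift_diff f (z n) - 0) < e" using LIMSEQ_D[of _ 0 e] assms(2) by blast
    then show False using z[rule_format, of n] by auto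
  qed
  then show ?thesis using that by blast
qed

section \<open>Test functions\<close>

lemma smooth_differentiable: "smooth \<phi> \<Longrightarrow> \<phi> differentiable (at x)"
  unfolding smooth_def by (drule spec[of _ "[]"]) simp

lemma smooth_continuous: "smooth \<phi> \<Longrightarrow> continuous_on UNIV \<phi>"
  by (intro continuous_at_imp_continuous_on ballI differentiable_imp_continuous_within smooth_differentiable)

lemma smooth_partial_continuous:
  "smooth \<phi> \<Longrightarrow> b \<in> Basis \<Longrightarrow> continuous_on UNIV (\<lambda>x. frechet_derivative \<phi> (at x) b)"
proof (intro continuous_at_imp_continuous_on ballI differentiable_imp_continuous_within)
  fix x assume "smooth \<phi>" "b \<in> Basis"
  then have "iter_partial [b] \<phi> differentiable (at x)" unfolding smooth_def by (elim allE[of _ "[b]"]) simp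
  then show "(\<lambda>x. frechet_derivative \<phi> (at x) b) differentiable (at x)" by simp
qed

lemma smooth_has_derivative:
  fixes \<phi> :: "'a::euclidean_space \<Rightarrow> real"
  assumes "smooth \<phi>"
  shows "(\<phi> has_derivative (\<lambda>w. \<Sum>b\<in>Basis. (w \<bullet> b) * frechet_derivative \<phi> (at x) b)) (at x)"
proof -
  have d: "(\<phi> has_derivative frechet_derivative \<phi> (at x)) (at x)"
    using smooth_differentiable[OF assms] by (simp add: frechet_derivative_works)
  then have lin: "linear (frechet_derivative \<phi> (at x))" by (rule has_derivative_linear)
  have "frechet_derivative \<phi> (at x) w = (\<Sum>b\<in>Basis. (w \<bullet> b) * frechet_derivative \<phi> (at x) b)" for w
  proof -
    have "frechet_derivative \<phi> (at x) w = frechet_derivative \<phi> (at x) (\<Sum>b\<in>Basis. (w \<bullet> b) *\<^sub>R b)"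
      by (simp add: euclidean_representation)
    also have "\<dots> = (\<Sum>b\<in>Basis. (w \<bullet> b) * frechet_derivative \<phi> (at x) b)"
      using lin by (simp add: linear_sum linear_scale)
    finally show ?thesis .
  qed
  then have "frechet_derivative \<phi> (at x) = (\<lambda>w. \<Sum>b\<in>Basis. (w \<bullet> b) * frechet_derivative \<phi> (at x) b)" by (rule ext)
  from has_derivative_eq_rhs[OF d this] show ?thesis .
qed

lemma test_function_bounded:
  fixes \<phi> :: "'a::euclidean_space \<Rightarrow> real"
  assumes "test_function \<phi>"
  obtains M where "0 < M" "\<forall>x. \<bar>\<phi> x\<bar> \<le> M" "\<forall>b\<in>Basis. \<forall>x. \<bar>frechet_derivative \<phi> (at x) b\<bar> \<le> M"
proof -
  let ?K = "closure {x. \<phi> x \<noteq> 0}"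
  have s: "smooth \<phi>" and K: "compact ?K" using assms by (auto simp: test_function_def)
  have off: "\<phi> x = 0" "b \<in> Basis \<Longrightarrow> frechet_derivative \<phi> (at x) b = 0" if x: "x \<notin> ?K" for x b
  proof -
    have z: "\<phi> y = 0" if "y \<notin> ?K" for y using that subsetD[OF closure_subset, of y "{x. \<phi> x \<noteq> 0}"] by blast
    show "\<phi> x = 0" using x by (rule z)
    have "((\<lambda>x. 0 :: real) has_derivative (\<lambda>w. 0)) (at x)" by simp
    then have "(\<phi> has_derivative (\<lambda>w. 0)) (at x)"
    proof (rule has_derivative_transform_within_open[of _ _ _ UNIV "- ?K"])
      show "open (- ?K)" "x \<in> - ?K" using x by auto
      fix y assume "y \<in> - ?K" then show "0 = \<phi> y" using z[of y] by simp
    qed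
    from frechet_derivative_at[OF this, symmetric] show "frechet_derivative \<phi> (at x) b = 0" by simp
  qed
  have bd: "\<exists>M. \<forall>x\<in>?K. norm (h x) \<le> M" if "continuous_on UNIV h" for h :: "'a \<Rightarrow> real"
    using compact_imp_bounded[OF compact_continuous_image[OF continuous_on_subset[OF that] K]] by (auto simp: bounded_iff)
  obtain M0 where M0: "\<forall>x\<in>?K. norm (\<phi> x) \<le> M0" using bd[OF smooth_continuous[OF s]] ..
  have "\<forall>b\<in>Basis. \<exists>M. \<forall>x\<in>?K. norm (frechet_derivative \<phi> (at x) b) \<le> M"
    using bd[OF smooth_partial_continuous[OF s]] by (rule ballI)
  from bchoice[OF this] obtain m where m: "\<forall>b\<in>Basis. \<forall>x\<in>?K. norm (frechet_derivative \<phi> (at x) b) \<le> m b" ..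
  define M where "M = 1 + \<bar>M0\<bar> + (\<Sum>b\<in>Basis. \<bar>m b\<bar>)"
  have S0: "0 \<le> (\<Sum>b\<in>(Basis::'a set). \<bar>m b\<bar>)" by (intro sum_nonneg) auto
  have M1: "0 < M" using S0 unfolding M_def by linarith
  moreover have "\<bar>\<phi> x\<bar> \<le> M" for x
  proof (cases "x \<in> ?K")
    case True
    then have "\<bar>\<phi> x\<bar> \<le> M0" using bspec[OF M0 True] by simp
    then show ?thesis using S0 unfolding M_def by linarith
  next
    case False
    show ?thesis using off(1)[OF False] M1 by linarith
  qed
  moreover have "\<bar>frechet_derivative \<phi> (at x) b\<bar> \<le> M" if b: "b \<in> Basis" for x b
  proof (cases "x \<in> ?K")
    case True
    have "\<bar>m b\<bar> \<le> (\<Sum>b\<in>Basis. \<bar>m b\<bar>)" using b by (intro member_le_sum) auto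
    moreover have "\<bar>frechet_derivative \<phi> (at x) b\<bar> \<le> m b" using bspec[OF bspec[OF m b] True] by simp
    ultimately show ?thesis unfolding M_def by linarith
  next
    case False
    show ?thesis using off(2)[OF False b] M1 by linarith
  qed
  ultimately show ?thesis by (intro that[of M]) auto
qed

lemma test_function_lipschitz:
  fixes \<phi> :: "'a::euclidean_space \<Rightarrow> real"
  assumes t: "test_function \<phi>"
  obtains L where "0 < L" "\<forall>x y. \<bar>\<phi> x - \<phi> y\<bar> \<le> L * norm (x - y)"
proof -
  obtain M where M: "0 < M" "\<forall>b\<in>Basis. \<forall>x. \<bar>frechet_derivative \<phi> (at x) b\<bar> \<le> M"
    using test_function_bounded[OF t] by metis
  have s: "smooth \<phi>" using t by (simp add: test_function_def)
  have "norm (\<phi> x - \<phi> y) \<le> (real DIM('a) * M) * norm (x - y)" for x y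
  proof (rule differentiable_bound[of UNIV])
    fix x
    show "(\<phi> has_derivative (\<lambda>w. \<Sum>b\<in>Basis. (w \<bullet> b) * frechet_derivative \<phi> (at x) b)) (at x within UNIV)"
      using smooth_has_derivative[OF s] by simp
    show "onorm (\<lambda>w. \<Sum>b\<in>Basis. (w \<bullet> b) * frechet_derivative \<phi> (at x) b) \<le> real DIM('a) * M"
    proof (rule onorm_le)
      fix w
      have "norm (\<Sum>b\<in>Basis. (w \<bullet> b) * frechet_derivative \<phi> (at x) b) \<le> (\<Sum>b\<in>(Basis::'a set). norm w * M)"
        using M by (intro sum_norm_le) (auto simp: abs_mult intro!: mult_mono Basis_le_norm)
      then show "norm (\<Sum>b\<in>Basis. (w \<bullet> b) * frechet_derivative \<phi> (at x) b) \<le> real DIM('a) * M * norm w"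
        by (simp add: mult_ac)
    qed
  qed auto
  then show ?thesis using M(1) by (intro that[of "real DIM('a) * M"]) auto
qed

lemma iter_partial_reflect:
  fixes \<rho> :: "'a::euclidean_space \<Rightarrow> real"
  assumes "smooth \<rho>" "set bs \<subseteq> Basis"
  shows "iter_partial bs (\<lambda>y. \<rho> (x - y)) = (\<lambda>y. (-1) ^ length bs * iter_partial bs \<rho> (x - y))"
  using assms(2)
proof (induction bs)
  case Nil then show ?case by simp
next
  case (Cons b bs)
  have "frechet_derivative (\<lambda>y. (-1) ^ length bs * iter_partial bs \<rho> (x - y)) (at y) b
    = - ((-1) ^ length bs * frechet_derivative (iter_partial bs \<rho>) (at (x - y)) b)" for y
  proof -
    have diff: "iter_partial bs \<rho> differentiable (at (x - y))" using assms(1) Cons.prems by (simp add: smooth_def)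
    then have d: "(iter_partial bs \<rho> has_derivative frechet_derivative (iter_partial bs \<rho>) (at (x - y))) (at (x - y))"
      by (simp add: frechet_derivative_works)
    have "((\<lambda>y. x - y) has_derivative (\<lambda>w. - w)) (at y)" by (auto intro!: derivative_eq_intros)
    from has_derivative_mult_right[OF has_derivative_compose[OF this d], of "(-1) ^ length bs"]
    have "frechet_derivative (\<lambda>y. (-1) ^ length bs * iter_partial bs \<rho> (x - y)) (at y)
      = (\<lambda>w. (-1) ^ length bs * frechet_derivative (iter_partial bs \<rho>) (at (x - y)) (- w))"
      by (rule frechet_derivative_at[symmetric])
    then show ?thesis using linear_neg[OF has_derivative_linear[OF d]] by simp
  qed
  then show ?case using Cons by simp
qed

lemma test_function_reflect:
  fixes \<rho> :: "'a::euclidean_space \<Rightarrow> real"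
  assumes "test_function \<rho>"
  shows "test_function (\<lambda>y. \<rho> (x - y))"
    and "b \<in> Basis \<Longrightarrow> frechet_derivative (\<lambda>y. \<rho> (x - y)) (at y) b = - frechet_derivative \<rho> (at (x - y)) b"
proof -
  have s: "smooth \<rho>" and K: "bounded {x. \<rho> x \<noteq> 0}" using assms by (auto simp: test_function_def compact_closure)
  have "smooth (\<lambda>y. \<rho> (x - y))"
    unfolding smooth_def
  proof (intro allI impI)
    fix bs :: "'a list" and y assume bs: "set bs \<subseteq> Basis"
    have 1: "(\<lambda>y. x - y) differentiable (at y)"
      by (intro differentiable_diff differentiable_const differentiable_ident)
    have 2: "iter_partial bs \<rho> differentiable (at (x - y))"
      using s bs by (simp add: smooth_def)
    have "(\<lambda>y. iter_partial bs \<rho> (x - y)) differentiable (at y)"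
      using differentiable_chain_at[of "\<lambda>y. x - y" y "iter_partial bs \<rho>"] 1 2 by (simp add: o_def)
    then show "iter_partial bs (\<lambda>y. \<rho> (x - y)) differentiable (at y)"
      unfolding iter_partial_reflect[OF s bs] by (intro differentiable_mult differentiable_const)
  qed
  moreover have "bounded {y. \<rho> (x - y) \<noteq> 0}"
  proof -
    obtain B where B: "\<And>z. \<rho> z \<noteq> 0 \<Longrightarrow> norm z \<le> B" using K by (auto simp: bounded_iff)
    have "norm y \<le> norm x + B" if "\<rho> (x - y) \<noteq> 0" for y
      using B[OF that] norm_triangle_ineq4[of x "x - y"] by simp
    then show ?thesis by (auto simp: bounded_iff)
  qed
  ultimately show "test_function (\<lambda>y. \<rho> (x - y))" by (simp add: test_function_def compact_closure)
  assume "b \<in> Basis"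
  then show "frechet_derivative (\<lambda>y. \<rho> (x - y)) (at y) b = - frechet_derivative \<rho> (at (x - y)) b"
    using fun_cong[OF iter_partial_reflect[OF s, of "[b]" x], of y] by simp
qed

section \<open>Mollification\<close>

definition mollifier :: "real \<Rightarrow> ('a::euclidean_space \<Rightarrow> real) \<Rightarrow> bool" where
  "mollifier \<epsilon> \<rho> \<longleftrightarrow> test_function \<rho> \<and> (\<forall>z. 0 \<le> \<rho> z) \<and> (\<integral>\<^sup>+z. ennreal (\<rho> z) \<partial>lborel) = 1 \<and>
    (\<forall>z. \<epsilon> \<le> norm z \<longrightarrow> \<rho> z = 0)"

lemma exists_mollifier:
  assumes \<epsilon>: "0 < \<epsilon>"
  shows "\<exists>\<rho> :: 'a::euclidean_space \<Rightarrow> real. mollifier \<epsilon> \<rho>"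
proof -
  define \<delta> where "\<delta> = \<epsilon> / real DIM('a)"
  have \<delta>: "0 < \<delta>" using \<epsilon> by (simp add: \<delta>_def)
  let ?a = "- (\<delta> *\<^sub>R One) :: 'a" and ?c = "\<delta> *\<^sub>R One :: 'a"
  let ?\<beta> = "box_bump 1 ?a ?c"
  have box: "norm x < \<epsilon>" if x: "x \<in> box ?a ?c" for x
  proof -
    have "norm x \<le> (\<Sum>b\<in>Basis. \<bar>x \<bullet> b\<bar>)" by (rule norm_le_l1)
    also have "\<dots> < (\<Sum>b\<in>(Basis::'a set). \<delta>)"
      using x by (intro sum_strict_mono) (auto simp: mem_box abs_less_iff inner_Basis minus_less_iff)
    also have "\<dots> = \<epsilon>" by (simp add: \<delta>_def)
    finally show ?thesis .
  qed
  have "(\<integral>\<^sup>+z. ennreal (?\<beta> z) \<partial>lborel) \<le> (\<integral>\<^sup>+z. indicator (box ?a ?c) z \<partial>lborel)"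
  proof (rule nn_integral_mono)
    fix z show "ennreal (?\<beta> z) \<le> indicator (box ?a ?c) z"
      using box_bump_bounds(2)[of 1 ?a ?c z] box_bump_pos_iff[of 1 ?a ?c z]
      by (cases "z \<in> box ?a ?c") (auto simp: ennreal_le_1)
  qed
  also have "\<dots> < top" using emeasure_lborel_box_finite[of ?a ?c] by simp
  finally obtain m where m: "(\<integral>\<^sup>+z. ennreal (?\<beta> z) \<partial>lborel) = ennreal m" "0 \<le> m"
    by (cases "\<integral>\<^sup>+z. ennreal (?\<beta> z) \<partial>lborel") auto
  have "m \<noteq> 0"
  proof
    assume "m = 0"
    then have "(\<integral>\<^sup>+z. ennreal (?\<beta> z) \<partial>lborel) = 0" using m(1) by simp
    then have "AE z in lborel. ennreal (?\<beta> z) = 0" by (subst (asm) nn_integral_0_iff_AE) auto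
    then have "AE z in lborel. z \<notin> box ?a ?c"
    proof eventually_elim
      case (elim z)
      then have "?\<beta> z = 0" using box_bump_bounds(1)[of 1 ?a ?c z] by (simp add: ennreal_eq_0_iff)
      then show ?case using box_bump_pos_iff[of 1 ?a ?c z] by simp
    qed
    then have "emeasure lborel (box ?a ?c) = 0" by (subst (asm) AE_iff_measurable[of "box ?a ?c"]) auto
    moreover have "emeasure lborel (box ?a ?c) = ennreal (\<Prod>b\<in>(Basis::'a set). (?c - ?a) \<bullet> b)"
      using \<delta> by (intro emeasure_lborel_box) simp
    moreover have "(\<Prod>b\<in>(Basis::'a set). (?c - ?a) \<bullet> b) = (\<Prod>b\<in>(Basis::'a set). 2 * \<delta>)"
      by (intro prod.cong) (simp_all add: inner_add_left)
    ultimately have "ennreal (\<Prod>b\<in>(Basis::'a set). 2 * \<delta>) = 0" by (simp only:)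
    moreover have "0 < (\<Prod>b\<in>(Basis::'a set). 2 * \<delta>)" using \<delta> by (intro prod_pos) auto
    ultimately show False by (simp only: ennreal_eq_0_iff)
  qed
  then have m0: "0 < m" using m(2) by simp
  define \<rho> where "\<rho> z = 1 / m * ?\<beta> z" for z
  have "mollifier \<epsilon> \<rho>"
    unfolding mollifier_def
  proof (intro conjI allI impI)
    show "test_function \<rho>" unfolding \<rho>_def[abs_def] by (rule test_function_box_bump) simp
    show "0 \<le> \<rho> z" for z using m0 box_bump_bounds(1)[of 1 ?a ?c z] by (simp add: \<rho>_def)
    have "(\<integral>\<^sup>+z. ennreal (\<rho> z) \<partial>lborel) = ennreal (1 / m) * (\<integral>\<^sup>+z. ennreal (?\<beta> z) \<partial>lborel)"
    proof -
      have "ennreal (\<rho> z) = ennreal (1 / m) * ennreal (?\<beta> z)" for z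
        unfolding \<rho>_def using m0 by (intro ennreal_mult') simp
      then show ?thesis by (simp only:) (intro nn_integral_cmult, measurable)
    qed
    then show "(\<integral>\<^sup>+z. ennreal (\<rho> z) \<partial>lborel) = 1" using m0 by (simp add: m(1) flip: ennreal_mult')
    show "\<rho> z = 0" if "\<epsilon> \<le> norm z" for z
      using box[of z] that box_bump_pos_iff[of 1 ?a ?c z] by (auto simp: \<rho>_def)
  qed
  then show ?thesis by (rule exI[of _ \<rho>])
qed

lemma mollifierD:
  assumes "mollifier \<epsilon> \<rho>"
  shows "test_function \<rho>" "0 \<le> \<rho> z" "(\<integral>\<^sup>+z. ennreal (\<rho> z) \<partial>lborel) = 1" "\<epsilon> \<le> norm z \<Longrightarrow> \<rho> z = 0"
    "smooth \<rho>" "continuous_on UNIV \<rho>" "\<rho> \<in> borel_measurable borel"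
proof -
  show "test_function \<rho>" "0 \<le> \<rho> z" "(\<integral>\<^sup>+z. ennreal (\<rho> z) \<partial>lborel) = 1" "\<epsilon> \<le> norm z \<Longrightarrow> \<rho> z = 0"
    using assms by (auto simp: mollifier_def)
  then show "smooth \<rho>" by (simp add: test_function_def)
  then show "continuous_on UNIV \<rho>" by (rule smooth_continuous)
  then show "\<rho> \<in> borel_measurable borel" by (rule borel_measurable_continuous_onI)
qed

definition mollify :: "('a::euclidean_space \<Rightarrow> real) \<Rightarrow> ('a \<Rightarrow> 'b::euclidean_space) \<Rightarrow> 'a \<Rightarrow> 'b" where
  "mollify \<rho> h x = (\<integral>y. \<rho> (x - y) *\<^sub>R h y \<partial>lborel)"

definition loc_int :: "('a::euclidean_space \<Rightarrow> 'b::euclidean_space) \<Rightarrow> bool" where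
  "loc_int h \<longleftrightarrow> h \<in> borel_measurable borel \<and> (\<forall>K. compact K \<longrightarrow> integrable lborel (\<lambda>y. indicator K y *\<^sub>R h y))"

text \<open>A dominating function that is uniform for \<open>x\<close> in a ball; it yields integrability and continuity of
  the mollification.\<close>

lemma mollify_dominated:
  fixes h :: "'a::euclidean_space \<Rightarrow> 'b::euclidean_space"
  assumes \<rho>: "mollifier \<epsilon> \<rho>"
  obtains M where "\<forall>B x y. norm x \<le> B \<longrightarrow> norm (\<rho> (x - y) *\<^sub>R h y) \<le> M * norm (indicator (cball 0 (B + \<epsilon>)) y *\<^sub>R h y)"
proof -
  obtain M where M: "0 < M" "\<forall>z. \<bar>\<rho> z\<bar> \<le> M" using test_function_bounded[OF mollifierD(1)[OF \<rho>]] by metis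
  have "norm (\<rho> (x - y) *\<^sub>R h y) \<le> M * norm (indicator (cball 0 (B + \<epsilon>)) y *\<^sub>R h y)" if x: "norm x \<le> B" for B x y
  proof (cases "norm y \<le> B + \<epsilon>")
    case True
    then show ?thesis using M(2) by (simp add: mult_right_mono)
  next
    case False
    then have "\<epsilon> \<le> norm (x - y)" using x norm_triangle_ineq2[of y x] by (simp add: norm_minus_commute)
    then show ?thesis using mollifierD(4)[OF \<rho>] M(1) by (simp add: less_imp_le)
  qed
  then show ?thesis by (intro that[of M]) auto
qed

lemma mollify_integrable:
  assumes \<rho>: "mollifier \<epsilon> \<rho>" and h: "loc_int h"
  shows "integrable lborel (\<lambda>y. \<rho> (x - y) *\<^sub>R h y)"
proof -
  note [measurable] = mollifierD(7)[OF \<rho>] h[unfolded loc_int_def, THEN conjunct1]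
  obtain M where M: "\<forall>B x y. norm x \<le> B \<longrightarrow> norm (\<rho> (x - y) *\<^sub>R h y) \<le> M * norm (indicator (cball 0 (B + \<epsilon>)) y *\<^sub>R h y)"
    by (rule mollify_dominated[OF \<rho>])
  have "integrable lborel (\<lambda>y. M * norm (indicator (cball 0 (norm x + \<epsilon>)) y *\<^sub>R h y))"
    using h by (intro integrable_mult_right integrable_norm) (auto simp: loc_int_def)
  then show ?thesis
    by (rule Bochner_Integration.integrable_bound) (use M in \<open>auto intro!: AE_I2 intro: order_trans[OF _ abs_ge_self]\<close>)
qed

lemma mollify_continuous:
  assumes \<rho>: "mollifier \<epsilon> \<rho>" and h: "loc_int h"
  shows "continuous_on UNIV (mollify \<rho> h)"
  unfolding continuous_on_sequentially
proof (intro ballI allI impI)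
  note [measurable] = mollifierD(7)[OF \<rho>] h[unfolded loc_int_def, THEN conjunct1]
  fix X :: "nat \<Rightarrow> 'a" and x assume "(\<forall>n. X n \<in> UNIV) \<and> X \<longlonglongrightarrow> x"
  then have X: "X \<longlonglongrightarrow> x" by simp
  obtain B where B: "\<forall>n. norm (X n) \<le> B" using convergent_imp_Bseq[of X] X by (auto simp: convergent_def Bseq_def)
  obtain M where M: "\<forall>B x y. norm x \<le> B \<longrightarrow> norm (\<rho> (x - y) *\<^sub>R h y) \<le> M * norm (indicator (cball 0 (B + \<epsilon>)) y *\<^sub>R h y)"
    by (rule mollify_dominated[OF \<rho>])
  have "(\<lambda>n. \<integral>y. \<rho> (X n - y) *\<^sub>R h y \<partial>lborel) \<longlonglongrightarrow> (\<integral>y. \<rho> (x - y) *\<^sub>R h y \<partial>lborel)"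
  proof (rule integral_dominated_convergence[where w = "\<lambda>y. M * norm (indicator (cball 0 (B + \<epsilon>)) y *\<^sub>R h y)"])
    show "integrable lborel (\<lambda>y. M * norm (indicator (cball 0 (B + \<epsilon>)) y *\<^sub>R h y))"
      using h by (intro integrable_mult_right integrable_norm) (auto simp: loc_int_def)
    show "AE y in lborel. (\<lambda>n. \<rho> (X n - y) *\<^sub>R h y) \<longlonglongrightarrow> \<rho> (x - y) *\<^sub>R h y"
      by (intro AE_I2 tendsto_scaleR tendsto_const continuous_on_tendsto_compose[OF mollifierD(6)[OF \<rho>]] tendsto_diff X) auto
    show "AE y in lborel. norm (\<rho> (X n - y) *\<^sub>R h y) \<le> M * norm (indicator (cball 0 (B + \<epsilon>)) y *\<^sub>R h y)" for n
      using M B by (intro AE_I2) blast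
  qed measurable
  then show "(mollify \<rho> h \<circ> X) \<longlonglongrightarrow> mollify \<rho> h x" by (simp add: mollify_def o_def)
qed

text \<open>The weak gradient identity for Lebesgue measure on Borel sets, where product measures and Fubini's theorem
  are available, instead of its completion.\<close>

definition borel_weak_gradient :: "('a::euclidean_space \<Rightarrow> real) \<Rightarrow> ('a \<Rightarrow> 'a) \<Rightarrow> bool" where
  "borel_weak_gradient f G \<longleftrightarrow> (\<forall>\<phi>. test_function \<phi> \<longrightarrow> (\<forall>b\<in>Basis.
      (\<integral>x. f x * frechet_derivative \<phi> (at x) b \<partial>lborel) = - (\<integral>x. (G x \<bullet> b) * \<phi> x \<partial>lborel)))"

text \<open>Differentiation under the integral puts the derivative on the mollifier; the reflected mollifier
  \<open>\<rho> (u - y)\<close> is a test function in \<open>y\<close>, so the definition of the weak gradient moves the derivative to \<open>f\<close>.\<close>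

lemma mollify_derivative:
  fixes f :: "'a::euclidean_space \<Rightarrow> real" and G :: "'a \<Rightarrow> 'a"
  assumes \<rho>: "mollifier \<epsilon> \<rho>" and f: "integrable lborel f" and G: "loc_int G" and w: "borel_weak_gradient f G"
  shows "((\<lambda>t. mollify \<rho> f (x + t *\<^sub>R b)) has_real_derivative mollify \<rho> G (x + t *\<^sub>R b) \<bullet> b) (at t)"
proof -
  define u where "u = x + t *\<^sub>R b"
  have [measurable]: "f \<in> borel_measurable borel" using borel_measurable_integrable[OF f] by simp
  note [measurable] = mollifierD(7)[OF \<rho>]
  note tf = mollifierD(1)[OF \<rho>] and sm = mollifierD(5)[OF \<rho>]
  let ?D = "\<lambda>c z. frechet_derivative \<rho> (at z) c"
  obtain L where L: "0 < L" "\<forall>x y. \<bar>\<rho> x - \<rho> y\<bar> \<le> L * norm (x - y)" using test_function_lipschitz[OF tf] .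
  obtain M where M: "0 < M" "\<forall>c\<in>Basis. \<forall>z. \<bar>?D c z\<bar> \<le> M" using test_function_bounded[OF tf] by metis
  have Dm[measurable]: "?D c \<in> borel_measurable borel" if "c \<in> Basis" for c
    by (intro borel_measurable_continuous_onI smooth_partial_continuous[OF sm that])
  have fi: "integrable lborel (\<lambda>y. \<rho> (v - y) * f y)" for v
  proof -
    obtain M' where M': "\<forall>z. \<bar>\<rho> z\<bar> \<le> M'" using test_function_bounded[OF tf] by metis
    have "integrable lborel (\<lambda>y. M' * \<bar>f y\<bar>)" using f by auto
    then show ?thesis
    proof (rule Bochner_Integration.integrable_bound)
      show "AE y in lborel. norm (\<rho> (v - y) * f y) \<le> norm (M' * \<bar>f y\<bar>)"
      proof (rule AE_I2)
        fix y
        have "\<bar>\<rho> (v - y)\<bar> \<le> \<bar>M'\<bar>" using M'[rule_format, of "v - y"] by linarith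
        then show "norm (\<rho> (v - y) * f y) \<le> norm (M' * \<bar>f y\<bar>)" by (simp add: abs_mult mult_right_mono)
      qed
    qed measurable
  qed
  have Di: "integrable lborel (\<lambda>y. ?D c (u - y) * f y)" if c: "c \<in> Basis" for c
  proof -
    note [measurable] = Dm[OF c]
    have "integrable lborel (\<lambda>y. M * \<bar>f y\<bar>)" using f by auto
    then show ?thesis
      by (rule Bochner_Integration.integrable_bound)
        (use M c in \<open>auto intro!: AE_I2 mult_right_mono simp: abs_mult\<close>)
  qed
  have val: "(\<integral>y. ?D c (u - y) * f y \<partial>lborel) = mollify \<rho> G u \<bullet> c" if c: "c \<in> Basis" for c
  proof -
    have "(\<integral>y. f y * frechet_derivative (\<lambda>y. \<rho> (u - y)) (at y) c \<partial>lborel) = - (\<integral>y. (G y \<bullet> c) * \<rho> (u - y) \<partial>lborel)"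
      using w test_function_reflect(1)[OF tf, of u] c by (simp add: borel_weak_gradient_def)
    then have "(\<integral>y. ?D c (u - y) * f y \<partial>lborel) = (\<integral>y. (\<rho> (u - y) *\<^sub>R G y) \<bullet> c \<partial>lborel)"
      by (simp add: test_function_reflect(2)[OF tf c] mult.commute)
    also have "\<dots> = mollify \<rho> G u \<bullet> c"
      unfolding mollify_def by (intro integral_inner_left mollify_integrable[OF \<rho> G])
    finally show ?thesis .
  qed
  have "((\<lambda>h. (mollify \<rho> f (u + h *\<^sub>R b) - mollify \<rho> f u) / h) \<longlongrightarrow> mollify \<rho> G u \<bullet> b) (at 0)"
    unfolding tendsto_at_iff_sequentially
  proof (intro allI impI)
    fix X :: "nat \<Rightarrow> real" assume X: "\<forall>i. X i \<in> UNIV - {0}" and X0: "X \<longlonglongrightarrow> 0"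
    let ?q = "\<lambda>n y. (\<rho> (u - y + X n *\<^sub>R b) - \<rho> (u - y)) / X n"
    have "(\<lambda>n. \<integral>y. ?q n y * f y \<partial>lborel) \<longlonglongrightarrow> (\<integral>y. (\<Sum>c\<in>Basis. (b \<bullet> c) * ?D c (u - y)) * f y \<partial>lborel)"
    proof (rule integral_dominated_convergence[where w = "\<lambda>y. (L * norm b) * \<bar>f y\<bar>"])
      show "integrable lborel (\<lambda>y. (L * norm b) * \<bar>f y\<bar>)" using f by auto
      show "AE y in lborel. (\<lambda>n. ?q n y * f y) \<longlonglongrightarrow> (\<Sum>c\<in>Basis. (b \<bullet> c) * ?D c (u - y)) * f y"
      proof (intro AE_I2 tendsto_mult tendsto_const)
        fix y
        have "((\<lambda>h. (u - y) + h *\<^sub>R b) has_derivative (\<lambda>h. h *\<^sub>R b)) (at 0)" by (auto intro!: derivative_eq_intros)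
        moreover have "(\<rho> has_derivative (\<lambda>w. \<Sum>c\<in>Basis. (w \<bullet> c) * ?D c (u - y))) (at ((u - y) + 0 *\<^sub>R b))"
          using smooth_has_derivative[OF sm, of "u - y"] by simp
        ultimately have "((\<lambda>h. \<rho> ((u - y) + h *\<^sub>R b)) has_derivative (\<lambda>h. \<Sum>c\<in>Basis. ((h *\<^sub>R b) \<bullet> c) * ?D c (u - y))) (at 0)"
          by (rule has_derivative_compose)
        moreover have "(\<lambda>h. \<Sum>c\<in>Basis. ((h *\<^sub>R b) \<bullet> c) * ?D c (u - y)) = (*) (\<Sum>c\<in>Basis. (b \<bullet> c) * ?D c (u - y))"
          by (auto simp: fun_eq_iff sum_distrib_left sum_distrib_right mult_ac)
        ultimately have "((\<lambda>h. \<rho> ((u - y) + h *\<^sub>R b)) has_real_derivative (\<Sum>c\<in>Basis. (b \<bullet> c) * ?D c (u - y))) (at 0)"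
          by (simp add: has_field_derivative_def)
        then have "((\<lambda>h. (\<rho> (u - y + h *\<^sub>R b) - \<rho> (u - y)) / h) \<longlongrightarrow> (\<Sum>c\<in>Basis. (b \<bullet> c) * ?D c (u - y))) (at 0)"
          by (simp add: DERIV_def)
        then show "(\<lambda>n. ?q n y) \<longlonglongrightarrow> (\<Sum>c\<in>Basis. (b \<bullet> c) * ?D c (u - y))"
          unfolding tendsto_at_iff_sequentially using X X0 by (auto simp: o_def)
      qed
      show "AE y in lborel. norm (?q n y * f y) \<le> (L * norm b) * \<bar>f y\<bar>" for n
      proof (rule AE_I2)
        fix y
        have "\<bar>\<rho> (u - y + X n *\<^sub>R b) - \<rho> (u - y)\<bar> \<le> L * norm (u - y + X n *\<^sub>R b - (u - y))" using L(2) by blast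
        then have "\<bar>?q n y\<bar> \<le> L * norm b" using X[rule_format, of n] by (simp add: pos_divide_le_eq mult_ac)
        then have "\<bar>?q n y\<bar> * \<bar>f y\<bar> \<le> (L * norm b) * \<bar>f y\<bar>" by (intro mult_right_mono) auto
        then show "norm (?q n y * f y) \<le> (L * norm b) * \<bar>f y\<bar>" by (simp only: abs_mult real_norm_def)
      qed
    qed (use Dm in measurable)
    moreover have "(\<integral>y. ?q n y * f y \<partial>lborel) = (mollify \<rho> f (u + X n *\<^sub>R b) - mollify \<rho> f u) / X n" for n
    proof -
      have "(\<integral>y. ?q n y * f y \<partial>lborel) = (\<integral>y. (\<rho> (u + X n *\<^sub>R b - y) * f y - \<rho> (u - y) * f y) / X n \<partial>lborel)"
        by (intro Bochner_Integration.integral_cong) (auto simp: algebra_simps diff_divide_distrib)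
      then show ?thesis using fi by (simp add: mollify_def)
    qed
    moreover have "(\<integral>y. (\<Sum>c\<in>Basis. (b \<bullet> c) * ?D c (u - y)) * f y \<partial>lborel) = mollify \<rho> G u \<bullet> b"
    proof -
      have "(\<integral>y. (\<Sum>c\<in>Basis. (b \<bullet> c) * ?D c (u - y)) * f y \<partial>lborel) = (\<integral>y. (\<Sum>c\<in>Basis. (b \<bullet> c) * (?D c (u - y) * f y)) \<partial>lborel)"
        by (simp add: sum_distrib_right mult.assoc)
      also have "\<dots> = (\<Sum>c\<in>Basis. (b \<bullet> c) * (mollify \<rho> G u \<bullet> c))"
        using Di val by (subst Bochner_Integration.integral_sum) auto
      also have "\<dots> = mollify \<rho> G u \<bullet> b" by (simp add: euclidean_inner[of "mollify \<rho> G u" b] mult.commute)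
      finally show ?thesis .
    qed
    ultimately show "((\<lambda>h. (mollify \<rho> f (u + h *\<^sub>R b) - mollify \<rho> f u) / h) \<circ> X) \<longlonglongrightarrow> mollify \<rho> G u \<bullet> b"
      by (simp only: o_def)
  qed
  then show ?thesis by (simp add: DERIV_def u_def scaleR_add_left add.assoc)
qed

text \<open>Mollification is averaging with respect to a probability measure, hence does not increase any
  directional norm. That this holds for every direction, with constant one, is essential for the
  anisotropic inequalities.\<close>

lemma mollify_Young:
  fixes G :: "'a::euclidean_space \<Rightarrow> 'a"
  assumes \<rho>: "mollifier \<epsilon> \<rho>" and G: "loc_int G" and p: "1 \<le> p"
  shows "(\<integral>\<^sup>+x. ennreal (\<bar>mollify \<rho> G x \<bullet> b\<bar> powr p) \<partial>lborel) \<le> (\<integral>\<^sup>+x. ennreal (\<bar>G x \<bullet> b\<bar> powr p) \<partial>lborel)"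
proof -
  note [measurable] = mollifierD(7)[OF \<rho>] G[unfolded loc_int_def, THEN conjunct1]
  note \<rho>0 = mollifierD(2)[OF \<rho>]
  let ?k = "\<lambda>y. ennreal (\<bar>G y \<bullet> b\<bar> powr p)"
  have mass: "(\<integral>\<^sup>+y. ennreal (\<rho> (x - y)) \<partial>lborel) = 1" for x
    using nn_integral_lborel_reflect[of "\<lambda>z. ennreal (\<rho> z)" x] mollifierD(3)[OF \<rho>] by simp
  have mass': "(\<integral>\<^sup>+x. ennreal (\<rho> (x - y)) \<partial>lborel) = 1" for y
    using nn_integral_lborel_shift[of "\<lambda>z. ennreal (\<rho> z)" "- y"] mollifierD(3)[OF \<rho>] by simp
  have pt: "ennreal (\<bar>mollify \<rho> G x \<bullet> b\<bar> powr p) \<le> (\<integral>\<^sup>+y. ennreal (\<rho> (x - y)) * ?k y \<partial>lborel)" for x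
  proof -
    define M where "M = density lborel (\<lambda>y. ennreal (\<rho> (x - y)))"
    have "mollify \<rho> G x \<bullet> b = (\<integral>y. (\<rho> (x - y) *\<^sub>R G y) \<bullet> b \<partial>lborel)"
      unfolding mollify_def by (intro integral_inner_left[symmetric] mollify_integrable[OF \<rho> G])
    also have "ennreal \<bar>\<dots>\<bar> \<le> (\<integral>\<^sup>+y. ennreal (norm ((\<rho> (x - y) *\<^sub>R G y) \<bullet> b)) \<partial>lborel)"
      using integral_norm_bound_ennreal[of lborel "\<lambda>y. (\<rho> (x - y) *\<^sub>R G y) \<bullet> b"] integrable_inner_left[OF mollify_integrable[OF \<rho> G, of x], of b]
      by simp
    also have "\<dots> = (\<integral>\<^sup>+y. ennreal (\<rho> (x - y)) * ennreal \<bar>G y \<bullet> b\<bar> \<partial>lborel)"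
      using \<rho>0 by (intro nn_integral_cong) (simp add: abs_mult ennreal_mult')
    also have "\<dots> = (\<integral>\<^sup>+y. ennreal \<bar>G y \<bullet> b\<bar> \<partial>M)"
      unfolding M_def by (subst nn_integral_density) auto
    finally have "ennpowr (ennreal \<bar>mollify \<rho> G x \<bullet> b\<bar>) p \<le> ennpowr (\<integral>\<^sup>+y. ennreal \<bar>G y \<bullet> b\<bar> \<partial>M) p"
      using p by (intro ennpowr_mono) auto
    also have "\<dots> \<le> ennpowr (emeasure M (space M)) (p - 1) * (\<integral>\<^sup>+y. ennpowr (ennreal \<bar>G y \<bullet> b\<bar>) p \<partial>M)"
      using p by (intro nn_integral_power_mean) (auto simp: M_def)
    also have "emeasure M (space M) = 1" by (simp add: M_def emeasure_density mass)
    also have "ennpowr 1 (p - 1) = 1" using ennpowr_ennreal[of 1 "p - 1"] by simp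
    also have "(\<integral>\<^sup>+y. ennpowr (ennreal \<bar>G y \<bullet> b\<bar>) p \<partial>M) = (\<integral>\<^sup>+y. ?k y \<partial>M)"
      using p by (simp add: ennpowr_ennreal_pos)
    also have "\<dots> = (\<integral>\<^sup>+y. ennreal (\<rho> (x - y)) * ?k y \<partial>lborel)"
      unfolding M_def by (subst nn_integral_density) auto
    finally show ?thesis using p by (simp add: ennpowr_ennreal_pos)
  qed
  have "(\<integral>\<^sup>+x. ennreal (\<bar>mollify \<rho> G x \<bullet> b\<bar> powr p) \<partial>lborel) \<le> (\<integral>\<^sup>+x. (\<integral>\<^sup>+y. ennreal (\<rho> (x - y)) * ?k y \<partial>lborel) \<partial>lborel)"
    by (intro nn_integral_mono pt)
  also have "\<dots> = (\<integral>\<^sup>+y. (\<integral>\<^sup>+x. ennreal (\<rho> (x - y)) * ?k y \<partial>lborel) \<partial>lborel)"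
    by (rule lborel_pair.Fubini') measurable
  also have "\<dots> = (\<integral>\<^sup>+y. ?k y \<partial>lborel)"
    by (simp add: nn_integral_multc mass')
  finally show ?thesis .
qed

lemma mollify_L1_close:
  fixes f :: "'a::euclidean_space \<Rightarrow> real"
  assumes \<rho>: "mollifier \<epsilon> \<rho>" and f: "integrable lborel f" and m: "mollify \<rho> f \<in> borel_measurable borel"
    and close: "\<And>z. norm z < \<epsilon> \<Longrightarrow> shift_diff f z \<le> e" and e: "0 \<le> e"
  shows "(\<integral>\<^sup>+x. ennreal \<bar>mollify \<rho> f x - f x\<bar> \<partial>lborel) \<le> ennreal e"
proof -
  have [measurable]: "f \<in> borel_measurable borel" using borel_measurable_integrable[OF f] by simp
  note [measurable] = mollifierD(7)[OF \<rho>]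
  note \<rho>0 = mollifierD(2)[OF \<rho>]
  have mass: "(\<integral>\<^sup>+y. ennreal (\<rho> (x - y)) \<partial>lborel) = 1" for x
    using nn_integral_lborel_reflect[of "\<lambda>z. ennreal (\<rho> z)" x] mollifierD(3)[OF \<rho>] by simp
  have "loc_int f" unfolding loc_int_def using f
    by (auto intro!: integrable_mult_indicator borel_closed compact_imp_closed simp del: real_scaleR_def)
  note if' = mollify_integrable[OF \<rho> this]
  have i1: "integrable lborel (\<lambda>y. \<rho> (x - y))" for x
    by (rule integrableI_nonneg) (use \<rho>0 mass in auto)
  have one: "(\<integral>y. \<rho> (x - y) \<partial>lborel) = 1" for x
    using mass[of x] \<rho>0 by (subst integral_eq_nn_integral) auto
  have pt: "ennreal \<bar>mollify \<rho> f x - f x\<bar> \<le> (\<integral>\<^sup>+z. ennreal (\<rho> z) * ennreal \<bar>f (x - z) - f x\<bar> \<partial>lborel)" for x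
  proof -
    have "mollify \<rho> f x - f x = (\<integral>y. \<rho> (x - y) * (f y - f x) \<partial>lborel)"
      using if'[of x] i1[of x] one[of x] by (simp add: mollify_def right_diff_distrib)
    also have "ennreal \<bar>\<dots>\<bar> \<le> (\<integral>\<^sup>+y. ennreal (norm (\<rho> (x - y) * (f y - f x))) \<partial>lborel)"
      using integral_norm_bound_ennreal[of lborel "\<lambda>y. \<rho> (x - y) * (f y - f x)"] if'[of x] i1[of x]
      by (simp add: right_diff_distrib)
    also have "\<dots> = (\<integral>\<^sup>+y. (\<lambda>z. ennreal (\<rho> z) * ennreal \<bar>f (x - z) - f x\<bar>) (x - y) \<partial>lborel)"
      using \<rho>0 by (intro nn_integral_cong) (simp add: abs_mult ennreal_mult')
    also have "\<dots> = (\<integral>\<^sup>+z. ennreal (\<rho> z) * ennreal \<bar>f (x - z) - f x\<bar> \<partial>lborel)"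
      by (rule nn_integral_lborel_reflect) measurable
    finally show ?thesis .
  qed
  have "(\<integral>\<^sup>+x. ennreal \<bar>mollify \<rho> f x - f x\<bar> \<partial>lborel)
    \<le> (\<integral>\<^sup>+x. (\<integral>\<^sup>+z. ennreal (\<rho> z) * ennreal \<bar>f (x - z) - f x\<bar> \<partial>lborel) \<partial>lborel)"
    by (intro nn_integral_mono pt)
  also have "\<dots> = (\<integral>\<^sup>+z. (\<integral>\<^sup>+x. ennreal (\<rho> z) * ennreal \<bar>f (x - z) - f x\<bar> \<partial>lborel) \<partial>lborel)"
    by (rule lborel_pair.Fubini') measurable
  also have "\<dots> \<le> (\<integral>\<^sup>+z. ennreal (\<rho> z) * ennreal e \<partial>lborel)"
  proof (rule nn_integral_mono)
    fix z
    have "(\<integral>\<^sup>+x. ennreal (\<rho> z) * ennreal \<bar>f (x - z) - f x\<bar> \<partial>lborel) = ennreal (\<rho> z) * (\<integral>\<^sup>+x. ennreal \<bar>f (x - z) - f x\<bar> \<partial>lborel)"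
      by (intro nn_integral_cmult) measurable
    also have "(\<integral>\<^sup>+x. ennreal \<bar>f (x - z) - f x\<bar> \<partial>lborel) = ennreal (shift_diff f (- z))"
      unfolding shift_diff_def using shift_diff_integrable[OF f, of "- z"]
      by (subst nn_integral_eq_integral) auto
    also have "ennreal (\<rho> z) * ennreal (shift_diff f (- z)) \<le> ennreal (\<rho> z) * ennreal e"
    proof (cases "norm z < \<epsilon>")
      case True
      then show ?thesis using close[of "- z"] by (intro mult_left_mono ennreal_leI) auto
    next
      case False
      then show ?thesis using mollifierD(4)[OF \<rho>, of z] by simp
    qed
    finally show "(\<integral>\<^sup>+x. ennreal (\<rho> z) * ennreal \<bar>f (x - z) - f x\<bar> \<partial>lborel) \<le> ennreal (\<rho> z) * ennreal e" .
  qed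
  also have "\<dots> = ennreal e" using mollifierD(3)[OF \<rho>] by (simp add: nn_integral_multc)
  finally show ?thesis .
qed

text \<open>The mollified functions converge in \<open>L1\<close>, and a subsequence converges almost everywhere; almost everywhere
  convergence is all that Fatou's lemma needs.\<close>

lemma C1_approximation:
  fixes f :: "'a::euclidean_space \<Rightarrow> real" and G :: "'a \<Rightarrow> 'a"
  assumes f: "integrable lborel f" and supp: "\<And>x. R \<le> norm x \<Longrightarrow> f x = 0"
    and G: "loc_int G" and w: "borel_weak_gradient f G"
  obtains F :: "nat \<Rightarrow> 'a \<Rightarrow> real" and H :: "nat \<Rightarrow> 'a \<Rightarrow> 'a" where
    "\<forall>n. C1_supported (R + 1) (F n) (H n)" "AE x in lborel. (\<lambda>n. F n x) \<longlonglongrightarrow> f x"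
    "\<forall>n p b. 1 \<le> p \<longrightarrow> (\<integral>\<^sup>+x. ennreal (\<bar>H n x \<bullet> b\<bar> powr p) \<partial>lborel) \<le> (\<integral>\<^sup>+x. ennreal (\<bar>G x \<bullet> b\<bar> powr p) \<partial>lborel)"
proof -
  have [measurable]: "f \<in> borel_measurable borel" using borel_measurable_integrable[OF f] by simp
  have "\<forall>n. \<exists>\<rho> :: 'a \<Rightarrow> real. mollifier (inverse (real (Suc n))) \<rho>" by (intro allI exists_mollifier) simp
  from choice[OF this] obtain \<rho> :: "nat \<Rightarrow> 'a \<Rightarrow> real" where \<rho>: "\<forall>n. mollifier (inverse (real (Suc n))) (\<rho> n)" ..
  have lf: "loc_int f" unfolding loc_int_def using f
    by (auto intro!: integrable_mult_indicator borel_closed compact_imp_closed simp del: real_scaleR_def)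
  have C1: "C1_supported (R + 1) (mollify (\<rho> n) f) (mollify (\<rho> n) G)" for n
    unfolding C1_supported_def
  proof (intro conjI allI impI)
    note \<rho>n = \<rho>[rule_format, of n]
    show "continuous_on UNIV (mollify (\<rho> n) f)" "continuous_on UNIV (mollify (\<rho> n) G)"
      by (intro mollify_continuous[OF \<rho>n] lf G)+
    show "((\<lambda>t. mollify (\<rho> n) f (x + t *\<^sub>R b)) has_real_derivative mollify (\<rho> n) G (x + t *\<^sub>R b) \<bullet> b) (at t)" for x b t
      by (rule mollify_derivative[OF \<rho>n f G w])
    fix x :: 'a assume x: "R + 1 \<le> norm x"
    have "\<rho> n (x - y) * f y = 0" for y
    proof (cases "R \<le> norm y")
      case True then show ?thesis using supp by simp
    next
      case False
      have "inverse (real (Suc n)) \<le> 1" by (simp add: inverse_le_1_iff)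
      moreover have "1 \<le> norm (x - y)" using x False norm_triangle_ineq2[of x y] by linarith
      ultimately have "inverse (real (Suc n)) \<le> norm (x - y)" by linarith
      then show ?thesis using mollifierD(4)[OF \<rho>n] by simp
    qed
    then have "(\<lambda>y. \<rho> n (x - y) * f y) = (\<lambda>y. 0)" by (rule ext)
    then show "mollify (\<rho> n) f x = 0" by (simp only: mollify_def real_scaleR_def) simp
  qed
  have int: "integrable lborel (mollify (\<rho> n) f)" for n
    using C1_supportedD(1,4)[OF C1] by (intro compact_support_integrable[where R = "R + 1"]) auto
  have "(\<lambda>n. \<integral>x. norm (mollify (\<rho> n) f x - f x) \<partial>lborel) \<longlonglongrightarrow> 0"
  proof (rule LIMSEQ_I)
    fix e :: real assume e: "0 < e"
    obtain d where d: "0 < d" "\<forall>z. norm z < d \<longrightarrow> shift_diff f z \<le> e / 2"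
      using shift_diff_uniform[OF f, of "e / 2"] e by (metis half_gt_zero)
    obtain n0 where n0: "inverse (real (Suc n0)) < d" using reals_Archimedean[OF d(1)] by auto
    show "\<exists>n0. \<forall>n\<ge>n0. norm ((\<integral>x. norm (mollify (\<rho> n) f x - f x) \<partial>lborel) - 0) < e"
    proof (intro exI[of _ n0] allI impI)
      fix n assume n: "n0 \<le> n"
      have "inverse (real (Suc n)) \<le> inverse (real (Suc n0))" using n by (intro le_imp_inverse_le) auto
      then have "norm z < d" if "norm z < inverse (real (Suc n))" for z :: 'a using n0 that by linarith
      then have "(\<integral>\<^sup>+x. ennreal \<bar>mollify (\<rho> n) f x - f x\<bar> \<partial>lborel) \<le> ennreal (e / 2)"
        using d(2) e by (intro mollify_L1_close[OF \<rho>[rule_format] f C1_supportedD(5)[OF C1]]) simp_all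
      moreover have "(\<integral>\<^sup>+x. ennreal \<bar>mollify (\<rho> n) f x - f x\<bar> \<partial>lborel) = ennreal (\<integral>x. \<bar>mollify (\<rho> n) f x - f x\<bar> \<partial>lborel)"
        using int[of n] f by (intro nn_integral_eq_integral) auto
      ultimately have "(\<integral>x. \<bar>mollify (\<rho> n) f x - f x\<bar> \<partial>lborel) \<le> e / 2" using e by (simp add: ennreal_le_iff)
      then show "norm ((\<integral>x. norm (mollify (\<rho> n) f x - f x) \<partial>lborel) - 0) < e" using e by simp
    qed
  qed
  from tendsto_L1_AE_subseq[OF _ this] int f
  obtain r :: "nat \<Rightarrow> nat" where r: "AE x in lborel. (\<lambda>n. mollify (\<rho> (r n)) f x - f x) \<longlonglongrightarrow> 0" by auto
  show ?thesis
  proof (rule that)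
    show "\<forall>n. C1_supported (R + 1) (mollify (\<rho> (r n)) f) (mollify (\<rho> (r n)) G)" using C1 by simp
    show "AE x in lborel. (\<lambda>n. mollify (\<rho> (r n)) f x) \<longlonglongrightarrow> f x"
      using r by eventually_elim (simp add: LIM_zero_iff)
    show "\<forall>n p b. 1 \<le> p \<longrightarrow> (\<integral>\<^sup>+x. ennreal (\<bar>mollify (\<rho> (r n)) G x \<bullet> b\<bar> powr p) \<partial>lborel) \<le> (\<integral>\<^sup>+x. ennreal (\<bar>G x \<bullet> b\<bar> powr p) \<partial>lborel)"
      by (intro allI impI mollify_Young[OF \<rho>[rule_format] G])
  qed
qed

section \<open>Borel representatives and uniqueness of weak gradients\<close>

lemma lebesgue_borel_representative:
  fixes h :: "'a::euclidean_space \<Rightarrow> 'b::euclidean_space"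
  assumes "h \<in> borel_measurable lebesgue"
  obtains h0 where "h0 \<in> borel_measurable borel" "AE x in lborel. h x = h0 x"
proof -
  have "\<forall>b\<in>Basis. \<exists>g. g \<in> borel_measurable lborel \<and> (AE x in lborel. h x \<bullet> b = g x)"
  proof
    fix b :: 'b assume "b \<in> Basis"
    have "(\<lambda>x. h x \<bullet> b) \<in> borel_measurable lebesgue" using assms by measurable
    from completion_ex_borel_measurable_real[OF this] show "\<exists>g. g \<in> borel_measurable lborel \<and> (AE x in lborel. h x \<bullet> b = g x)"
      by (simp only: Bex_def)
  qed
  from bchoice[OF this] obtain g where g: "\<forall>b\<in>Basis. g b \<in> borel_measurable lborel \<and> (AE x in lborel. h x \<bullet> b = g b x)" ..
  have [measurable]: "g b \<in> borel_measurable borel" if "b \<in> Basis" for b using g that by simp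
  have "AE x in lborel. \<forall>b\<in>Basis. h x \<bullet> b = g b x" using g by (intro AE_finite_allI) auto
  then have "AE x in lborel. h x = (\<Sum>b\<in>Basis. g b x *\<^sub>R b)"
  proof eventually_elim
    case (elim x)
    have "h x = (\<Sum>b\<in>Basis. (h x \<bullet> b) *\<^sub>R b)" by (simp add: euclidean_representation)
    then show ?case using elim by simp
  qed
  moreover have "(\<lambda>x. \<Sum>b\<in>Basis. g b x *\<^sub>R b) \<in> borel_measurable borel" by measurable
  ultimately show ?thesis using that by blast
qed

lemma locally_integrable_measurable:
  fixes h :: "'a::euclidean_space \<Rightarrow> 'b::euclidean_space"
  assumes "locally_integrable h"
  shows "h \<in> borel_measurable lebesgue"
proof (rule borel_measurable_LIMSEQ_metric)
  fix n :: nat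
  have "set_integrable lebesgue (cball 0 (real n)) h" using assms by (simp add: locally_integrable_def)
  then show "(\<lambda>x. indicator (cball 0 (real n)) x *\<^sub>R h x) \<in> borel_measurable lebesgue"
    unfolding set_integrable_def by (rule borel_measurable_integrable)
next
  fix x :: 'a
  obtain n0 where n0: "norm x \<le> real n0" using real_arch_simple by blast
  show "(\<lambda>n. indicator (cball 0 (real n)) x *\<^sub>R h x) \<longlonglongrightarrow> h x"
    using n0 by (intro tendsto_eventually eventually_sequentiallyI[of n0]) auto
qed

lemma AE_lebesgue_iff: "(AE x in lebesgue. P x) \<longleftrightarrow> (AE x in lborel. P x)"
  by (rule AE_completion_iff)

lemma nn_integral_lebesgue_rep:
  assumes "AE x in lborel. u x = v x"
  shows "(\<integral>\<^sup>+x. u x \<partial>lebesgue) = (\<integral>\<^sup>+x. v x \<partial>lborel)"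
proof -
  have "(\<integral>\<^sup>+x. u x \<partial>lebesgue) = (\<integral>\<^sup>+x. u x \<partial>lborel)" by (rule nn_integral_completion)
  also have "\<dots> = (\<integral>\<^sup>+x. v x \<partial>lborel)" using assms by (rule nn_integral_cong_AE)
  finally show ?thesis .
qed

lemma integral_lebesgue_rep:
  fixes u v :: "'a::euclidean_space \<Rightarrow> 'b::euclidean_space"
  assumes u': "u \<in> borel_measurable lebesgue" and v: "v \<in> borel_measurable borel"
    and uv: "AE x in lborel. u x = v x"
  shows "(\<integral>x. u x \<partial>lebesgue) = (\<integral>x. v x \<partial>lborel)" "integrable lebesgue u \<longleftrightarrow> integrable lborel v"
proof -
  have v': "v \<in> borel_measurable lebesgue" using v by (intro measurable_completion) simp
  have uv': "AE x in lebesgue. u x = v x" using uv by (simp add: AE_lebesgue_iff)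
  show "(\<integral>x. u x \<partial>lebesgue) = (\<integral>x. v x \<partial>lborel)"
    using v u' v' uv' by (subst integral_cong_AE[of u lebesgue v]) (auto simp: integral_completion)
  show "integrable lebesgue u \<longleftrightarrow> integrable lborel v"
    using v u' v' uv' by (subst integrable_cong_AE[of u lebesgue v]) (auto simp: integrable_completion)
qed

lemma loc_int_representative:
  fixes h :: "'a::euclidean_space \<Rightarrow> 'b::euclidean_space"
  assumes "locally_integrable h"
  obtains h0 where "loc_int h0" "AE x in lborel. h x = h0 x"
proof -
  note hm = locally_integrable_measurable[OF assms]
  obtain h0 where h0: "h0 \<in> borel_measurable borel" "AE x in lborel. h x = h0 x"
    using lebesgue_borel_representative[OF hm] .
  have "loc_int h0"
    unfolding loc_int_def
  proof (intro conjI allI impI h0(1))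
    fix K :: "'a set" assume K: "compact K"
    then have [measurable]: "K \<in> sets borel" by (intro borel_closed compact_imp_closed)
    have i: "integrable lebesgue (\<lambda>y. indicator K y *\<^sub>R h y)"
      using assms K by (simp add: locally_integrable_def set_integrable_def)
    have "integrable lebesgue (\<lambda>y. indicator K y *\<^sub>R h y) \<longleftrightarrow> integrable lborel (\<lambda>y. indicator K y *\<^sub>R h0 y)"
    proof (rule integral_lebesgue_rep(2))
      show "(\<lambda>y. indicator K y *\<^sub>R h y) \<in> borel_measurable lebesgue" using i by (rule borel_measurable_integrable)
      show "(\<lambda>y. indicator K y *\<^sub>R h0 y) \<in> borel_measurable borel" using h0(1) by measurable
      show "AE y in lborel. indicator K y *\<^sub>R h y = indicator K y *\<^sub>R h0 y" using h0(2) by eventually_elim simp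
    qed
    then show "integrable lborel (\<lambda>y. indicator K y *\<^sub>R h0 y)" using i by simp
  qed
  then show ?thesis using h0(2) by (rule that)
qed

lemma loc_int_test_integrable:
  fixes h :: "'a::euclidean_space \<Rightarrow> real"
  assumes h: "loc_int h" and c: "continuous_on UNIV \<psi>" and s: "\<And>x. B \<le> norm x \<Longrightarrow> \<psi> x = 0"
  shows "integrable lborel (\<lambda>x. h x * \<psi> x)"
proof -
  have [measurable]: "h \<in> borel_measurable borel" "\<psi> \<in> borel_measurable borel"
    using h c by (auto simp: loc_int_def intro: borel_measurable_continuous_onI)
  have "bounded (\<psi> ` cball 0 B)"
    by (intro compact_imp_bounded compact_continuous_image continuous_on_subset[OF c]) auto
  then have "\<exists>M. \<forall>x\<in>cball 0 B. \<bar>\<psi> x\<bar> \<le> M" by (simp add: bounded_iff)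
  then obtain M where M: "\<forall>x\<in>cball 0 B. \<bar>\<psi> x\<bar> \<le> M" ..
  have "integrable lborel (\<lambda>x. M * norm (indicator (cball 0 B) x *\<^sub>R h x))"
    using h by (intro integrable_mult_right integrable_norm) (auto simp: loc_int_def)
  then show ?thesis
  proof (rule Bochner_Integration.integrable_bound)
    show "AE x in lborel. norm (h x * \<psi> x) \<le> norm (M * norm (indicator (cball 0 B) x *\<^sub>R h x))"
    proof (rule AE_I2)
      fix x
      show "norm (h x * \<psi> x) \<le> norm (M * norm (indicator (cball 0 B) x *\<^sub>R h x))"
      proof (cases "x \<in> cball 0 B")
        case True
        have "\<bar>\<psi> x\<bar> * \<bar>h x\<bar> \<le> \<bar>M\<bar> * \<bar>h x\<bar>" using bspec[OF M True] by (intro mult_right_mono) auto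
        then show ?thesis using True by (simp add: abs_mult mult.commute)
      next
        case False then show ?thesis using s[of x] by simp
      qed
    qed
  qed measurable
qed

lemma test_function_support:
  assumes "test_function \<phi>"
  obtains B where "\<forall>x. B \<le> norm x \<longrightarrow> \<phi> x = 0"
proof -
  have "bounded {x. \<phi> x \<noteq> 0}" using assms by (simp add: test_function_def compact_closure)
  then obtain B where B: "\<forall>x\<in>{x. \<phi> x \<noteq> 0}. norm x \<le> B" by (auto simp: bounded_iff)
  have "\<phi> x = 0" if "B + 1 \<le> norm x" for x
  proof (rule ccontr)
    assume "\<phi> x \<noteq> 0"
    then show False using bspec[OF B, of x] that by simp
  qed
  then show ?thesis by (intro that[of "B + 1"]) auto
qed

lemma loc_int_inner: "loc_int G \<Longrightarrow> loc_int (\<lambda>x. G x \<bullet> b)"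
proof -
  assume G: "loc_int G"
  have "integrable lborel (\<lambda>y. indicator K y *\<^sub>R (G y \<bullet> b))" if "compact K" for K
  proof -
    have "integrable lborel (\<lambda>y. indicator K y *\<^sub>R G y)" using G that by (simp add: loc_int_def)
    from integrable_inner_left[OF this, of b] show ?thesis by simp
  qed
  moreover have "(\<lambda>x. G x \<bullet> b) \<in> borel_measurable borel" using G by (auto simp: loc_int_def)
  ultimately show ?thesis by (simp add: loc_int_def)
qed

lemma borel_weak_gradient_transfer:
  assumes f: "loc_int f0" "AE x in lborel. f x = f0 x" "f \<in> borel_measurable lebesgue"
    and g: "loc_int g0" "AE x in lborel. g x = g0 x" "g \<in> borel_measurable lebesgue"
  shows "borel_weak_gradient f0 g0 \<longleftrightarrow>
    (\<forall>\<phi>. test_function \<phi> \<longrightarrow> (\<forall>b\<in>Basis. (\<integral>x. f x * frechet_derivative \<phi> (at x) b \<partial>lebesgue)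
        = - (\<integral>x. (g x \<bullet> b) * \<phi> x \<partial>lebesgue)))"
proof -
  have [measurable]: "f0 \<in> borel_measurable borel" "g0 \<in> borel_measurable borel" using f g by (auto simp: loc_int_def)
  have "(\<integral>x. f x * frechet_derivative \<phi> (at x) b \<partial>lebesgue) = (\<integral>x. f0 x * frechet_derivative \<phi> (at x) b \<partial>lborel)
    \<and> (\<integral>x. (g x \<bullet> b) * \<phi> x \<partial>lebesgue) = (\<integral>x. (g0 x \<bullet> b) * \<phi> x \<partial>lborel)"
    if \<phi>: "test_function \<phi>" and b: "b \<in> Basis" for \<phi> b
  proof -
    have s: "smooth \<phi>" using \<phi> by (simp add: test_function_def)
    have [measurable]: "\<phi> \<in> borel_measurable borel" "(\<lambda>x. frechet_derivative \<phi> (at x) b) \<in> borel_measurable borel"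
      using smooth_continuous[OF s] smooth_partial_continuous[OF s b] by (auto intro: borel_measurable_continuous_onI)
    have l: "\<phi> \<in> borel_measurable lebesgue" "(\<lambda>x. frechet_derivative \<phi> (at x) b) \<in> borel_measurable lebesgue"
      by (intro measurable_completion; simp)+
    have "(\<integral>x. f x * frechet_derivative \<phi> (at x) b \<partial>lebesgue) = (\<integral>x. f0 x * frechet_derivative \<phi> (at x) b \<partial>lborel)"
    proof (rule integral_lebesgue_rep(1))
      show "(\<lambda>x. f x * frechet_derivative \<phi> (at x) b) \<in> borel_measurable lebesgue"
        using f(3) l by (intro borel_measurable_times)
      show "AE x in lborel. f x * frechet_derivative \<phi> (at x) b = f0 x * frechet_derivative \<phi> (at x) b"
        using f(2) by eventually_elim simp
    qed measurable
    moreover have "(\<integral>x. (g x \<bullet> b) * \<phi> x \<partial>lebesgue) = (\<integral>x. (g0 x \<bullet> b) * \<phi> x \<partial>lborel)"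
    proof (rule integral_lebesgue_rep(1))
      show "(\<lambda>x. (g x \<bullet> b) * \<phi> x) \<in> borel_measurable lebesgue"
        using g(3) l by (intro borel_measurable_times borel_measurable_inner) auto
      show "AE x in lborel. (g x \<bullet> b) * \<phi> x = (g0 x \<bullet> b) * \<phi> x"
        using g(2) by eventually_elim simp
    qed measurable
    ultimately show ?thesis ..
  qed
  then show ?thesis unfolding borel_weak_gradient_def by simp
qed

text \<open>The difference of two weak gradients is orthogonal to all test functions.\<close>

lemma borel_weak_gradient_unique:
  fixes f :: "'a::euclidean_space \<Rightarrow> real"
  assumes g: "loc_int g" "borel_weak_gradient f g" and h: "loc_int h" "borel_weak_gradient f h"
  shows "AE x in lborel. g x = h x"
proof -
  have ae: "AE x in lborel. g x \<bullet> b - h x \<bullet> b = 0" if b: "b \<in> Basis" for b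
  proof (rule fundamental_lemma_variations)
    note gb = loc_int_inner[OF g(1), of b] and hb = loc_int_inner[OF h(1), of b]
    show "(\<lambda>x. g x \<bullet> b - h x \<bullet> b) \<in> borel_measurable borel"
      using gb hb by (auto simp: loc_int_def)
    fix a c :: 'a
    have "integrable lborel (\<lambda>x. indicator (cbox a c) x *\<^sub>R (g x \<bullet> b))"
      "integrable lborel (\<lambda>x. indicator (cbox a c) x *\<^sub>R (h x \<bullet> b))"
      using gb hb compact_cbox[of a c] unfolding loc_int_def by blast+
    then have "integrable lborel (\<lambda>x. indicator (box a c) x *\<^sub>R (indicator (cbox a c) x *\<^sub>R (g x \<bullet> b) - indicator (cbox a c) x *\<^sub>R (h x \<bullet> b)))"
      by (intro integrable_mult_indicator[of "box a c", OF _ Bochner_Integration.integrable_diff]) simp_all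
    moreover have "indicator (box a c) x *\<^sub>R (indicator (cbox a c) x *\<^sub>R (g x \<bullet> b) - indicator (cbox a c) x *\<^sub>R (h x \<bullet> b))
       = (g x \<bullet> b - h x \<bullet> b) * indicator (box a c) x" for x
      using box_subset_cbox[of a c] by (auto simp: indicator_def)
    ultimately show "integrable lborel (\<lambda>x. (g x \<bullet> b - h x \<bullet> b) * indicator (box a c) x)" by (simp only:)
  next
    fix \<phi> :: "'a \<Rightarrow> real" assume \<phi>: "test_function \<phi>"
    obtain B where B: "\<forall>x. B \<le> norm x \<longrightarrow> \<phi> x = 0" using test_function_support[OF \<phi>] .
    have c: "continuous_on UNIV \<phi>" using \<phi> by (intro smooth_continuous) (simp add: test_function_def)
    have "integrable lborel (\<lambda>x. (g x \<bullet> b) * \<phi> x)" "integrable lborel (\<lambda>x. (h x \<bullet> b) * \<phi> x)"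
      using B by (auto intro!: loc_int_test_integrable[of _ \<phi> B] loc_int_inner g h c)
    then have "(\<integral>x. (g x \<bullet> b - h x \<bullet> b) * \<phi> x \<partial>lborel) = (\<integral>x. (g x \<bullet> b) * \<phi> x \<partial>lborel) - (\<integral>x. (h x \<bullet> b) * \<phi> x \<partial>lborel)"
      by (simp add: left_diff_distrib)
    also have "(\<integral>x. (g x \<bullet> b) * \<phi> x \<partial>lborel) = (\<integral>x. (h x \<bullet> b) * \<phi> x \<partial>lborel)"
      using g(2)[unfolded borel_weak_gradient_def, rule_format, OF \<phi> b]
        h(2)[unfolded borel_weak_gradient_def, rule_format, OF \<phi> b] by linarith
    finally show "(\<integral>x. (g x \<bullet> b - h x \<bullet> b) * \<phi> x \<partial>lborel) = 0" by simp
  qed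
  have "AE x in lborel. \<forall>b\<in>Basis. g x \<bullet> b - h x \<bullet> b = 0"
    by (rule AE_finite_allI[OF finite_Basis]) (rule ae)
  then show ?thesis
  proof eventually_elim
    case (elim x)
    show ?case
    proof (rule euclidean_eqI)
      fix b :: 'a assume "b \<in> Basis"
      from bspec[OF elim this] show "g x \<bullet> b = h x \<bullet> b" by (rule eq_iff_diff_eq_0[THEN iffD2])
    qed
  qed
qed

text \<open>Borel representatives of a function supported in a ball and of its weak gradient. The chosen weak gradient
  agrees almost everywhere with one in \<open>Lp\<close> by uniqueness and is therefore in \<open>Lp\<close> itself.\<close>

lemma sobolev_borel_data:
  fixes f :: "'a::euclidean_space \<Rightarrow> real"
  assumes f: "f \<in> sobolev_space p" and supp: "supported_in f (ball 0 R)" and p: "1 \<le> p"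
  obtains f0 G where "integrable lborel f0" "\<forall>x. R \<le> norm x \<longrightarrow> f0 x = 0" "AE x in lborel. f x = f0 x"
    "loc_int G" "borel_weak_gradient f0 G" "AE x in lborel. weak_gradient f x = G x"
    "(\<integral>\<^sup>+x. ennreal (norm (G x) powr p) \<partial>lborel) < top"
proof -
  obtain g where fL: "f \<in> Lp_space p" and g: "g \<in> Lp_space p" "has_weak_gradient f g"
    using f by (auto simp: sobolev_space_def)
  have gw: "has_weak_gradient f (weak_gradient f)"
    unfolding weak_gradient_def using g(2) by (rule someI[of "has_weak_gradient f"])
  have l: "locally_integrable f" "locally_integrable g" "locally_integrable (weak_gradient f)"
    using g gw by (auto simp: has_weak_gradient_def)
  note m = l[THEN locally_integrable_measurable]
  obtain f1 where f1: "loc_int f1" "AE x in lborel. f x = f1 x" using loc_int_representative[OF l(1)] .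
  obtain g1 where g1: "loc_int g1" "AE x in lborel. g x = g1 x" using loc_int_representative[OF l(2)] .
  obtain G where G: "loc_int G" "AE x in lborel. weak_gradient f x = G x" using loc_int_representative[OF l(3)] .
  define f0 where "f0 x = indicator (ball 0 R) x *\<^sub>R f1 x" for x
  have [measurable]: "f1 \<in> borel_measurable borel" using f1 by (simp add: loc_int_def)
  have "integrable lborel (\<lambda>x. indicator (ball 0 R) x *\<^sub>R (indicator (cball 0 R) x *\<^sub>R f1 x))"
  proof (rule integrable_mult_indicator)
    show "integrable lborel (\<lambda>x. indicator (cball 0 R) x *\<^sub>R f1 x)"
      using f1(1) compact_cball[of "0::'a" R] unfolding loc_int_def by blast
  qed simp
  moreover have "indicator (ball 0 R) x *\<^sub>R (indicator (cball 0 R) x *\<^sub>R f1 x) = f0 x" for x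
    by (auto simp: f0_def indicator_def)
  ultimately have i0: "integrable lborel f0" by (simp only:)
  have z0: "\<forall>x. R \<le> norm x \<longrightarrow> f0 x = 0" by (simp add: f0_def)
  have "AE x in lborel. x \<notin> ball 0 R \<longrightarrow> f x = 0" using supp by (simp add: supported_in_def AE_lebesgue_iff)
  then have a0: "AE x in lborel. f x = f0 x"
    using f1(2) by eventually_elim (auto simp: f0_def indicator_def)
  have l0: "loc_int f0" unfolding loc_int_def using i0
      borel_measurable_integrable[OF i0]
    by (auto intro!: integrable_mult_indicator borel_closed compact_imp_closed simp del: real_scaleR_def)
  have w: "borel_weak_gradient f0 G" "borel_weak_gradient f0 g1"
    using gw g(2) borel_weak_gradient_transfer[OF l0 a0 m(1) G m(3)] borel_weak_gradient_transfer[OF l0 a0 m(1) g1 m(2)]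
    by (simp_all add: has_weak_gradient_def)
  have "AE x in lborel. G x = g1 x" by (rule borel_weak_gradient_unique[OF G(1) w(1) g1(1) w(2)])
  then have "AE x in lborel. ennreal (norm (g x) powr p) = ennreal (norm (G x) powr p)"
    using g1(2) by eventually_elim simp
  then have "(\<integral>\<^sup>+x. ennreal (norm (g x) powr p) \<partial>lebesgue) = (\<integral>\<^sup>+x. ennreal (norm (G x) powr p) \<partial>lborel)"
    by (rule nn_integral_lebesgue_rep)
  moreover have "(\<integral>\<^sup>+x. ennreal (norm (g x) powr p) \<partial>lebesgue) < top"
  proof (rule ccontr)
    assume "\<not> ?thesis"
    then have "(\<integral>\<^sup>+x. ennreal (norm (g x) powr p) \<partial>lebesgue) = top" by (simp add: not_less top_unique)
    then have "Lp_norm p g = top" using p by (simp add: Lp_norm_def ennpowr_top_pos)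
    then show False using g(1) by (simp add: Lp_space_def)
  qed
  ultimately have "(\<integral>\<^sup>+x. ennreal (norm (G x) powr p) \<partial>lborel) < top" by simp
  then show ?thesis by (rule that[OF i0 z0 a0 G(1) w(1) G(2)])
qed

section \<open>Inequalities for Sobolev functions\<close>

text \<open>Bounds that hold uniformly for \<open>C1\<close> approximations pass to the limit.\<close>

lemma fatou_powr_bound:
  fixes f :: "'a::euclidean_space \<Rightarrow> real"
  assumes lim: "AE x in lborel. (\<lambda>n. F n x) \<longlonglongrightarrow> f x" and [measurable]: "\<And>n. F n \<in> borel_measurable borel"
    and q: "0 < q" and bound: "\<And>n. (\<integral>\<^sup>+x. ennreal (\<bar>F n x\<bar> powr q) \<partial>lborel) \<le> B"
  shows "(\<integral>\<^sup>+x. ennreal (\<bar>f x\<bar> powr q) \<partial>lborel) \<le> B"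
proof -
  have "AE x in lborel. ennreal (\<bar>f x\<bar> powr q) = liminf (\<lambda>n. ennreal (\<bar>F n x\<bar> powr q))"
    using lim
  proof eventually_elim
    case (elim x)
    have "(\<lambda>n. \<bar>F n x\<bar> powr q) \<longlonglongrightarrow> \<bar>f x\<bar> powr q"
      using q by (intro tendsto_powr' tendsto_intros elim) auto
    then have "(\<lambda>n. ennreal (\<bar>F n x\<bar> powr q)) \<longlonglongrightarrow> ennreal (\<bar>f x\<bar> powr q)" by (rule tendsto_ennrealI)
    then show ?case by (intro lim_imp_Liminf[symmetric]) auto
  qed
  then have "(\<integral>\<^sup>+x. ennreal (\<bar>f x\<bar> powr q) \<partial>lborel) = (\<integral>\<^sup>+x. liminf (\<lambda>n. ennreal (\<bar>F n x\<bar> powr q)) \<partial>lborel)"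
    by (rule nn_integral_cong_AE)
  also have "\<dots> \<le> liminf (\<lambda>n. \<integral>\<^sup>+x. ennreal (\<bar>F n x\<bar> powr q) \<partial>lborel)"
    by (rule nn_integral_liminf) measurable
  also have "\<dots> \<le> liminf (\<lambda>n::nat. B)"
    using bound by (intro Liminf_mono always_eventually allI)
  also have "\<dots> = B" by (rule Liminf_const) simp
  finally show ?thesis .
qed

lemma C1_supported_rotate:
  fixes f :: "'a::euclidean_space \<Rightarrow> real" and T :: "'a \<Rightarrow> 'a"
  assumes f: "C1_supported R f g" and T: "orthogonal_transformation T"
  shows "C1_supported R (\<lambda>x. f (T x)) (\<lambda>x. \<Sum>b\<in>Basis. (g (T x) \<bullet> T b) *\<^sub>R b)"
    and "(\<Sum>b\<in>Basis. (g (T x) \<bullet> T b) *\<^sub>R b) \<bullet> c = g (T x) \<bullet> T c"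
proof -
  have lin: "linear T" using T by (rule orthogonal_transformation_linear)
  have cT: "continuous_on UNIV T" using lin by (simp add: linear_continuous_on linear_conv_bounded_linear)
  have inner: "(\<Sum>b\<in>Basis. (g (T x) \<bullet> T b) *\<^sub>R b) \<bullet> c = g (T x) \<bullet> T c" for x c
  proof -
    have "T c = T (\<Sum>b\<in>Basis. (c \<bullet> b) *\<^sub>R b)" by (simp add: euclidean_representation)
    also have "\<dots> = (\<Sum>b\<in>Basis. (c \<bullet> b) *\<^sub>R T b)" using lin by (simp add: linear_sum linear_scale)
    finally show ?thesis by (simp add: inner_sum_left inner_sum_right inner_commute mult.commute)
  qed
  then show "(\<Sum>b\<in>Basis. (g (T x) \<bullet> T b) *\<^sub>R b) \<bullet> c = g (T x) \<bullet> T c" .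
  show "C1_supported R (\<lambda>x. f (T x)) (\<lambda>x. \<Sum>b\<in>Basis. (g (T x) \<bullet> T b) *\<^sub>R b)"
    unfolding C1_supported_def
  proof (intro conjI allI impI)
    show "continuous_on UNIV (\<lambda>x. f (T x))"
      by (rule continuous_on_compose2[OF C1_supportedD(1)[OF f] cT]) simp
    have "continuous_on UNIV (\<lambda>x. g (T x))"
      by (rule continuous_on_compose2[OF C1_supportedD(2)[OF f] cT]) simp
    then show "continuous_on UNIV (\<lambda>x. \<Sum>b\<in>Basis. (g (T x) \<bullet> T b) *\<^sub>R b)" by (intro continuous_intros)
    show "((\<lambda>t. f (T (x + t *\<^sub>R b))) has_real_derivative (\<Sum>b'\<in>Basis. (g (T (x + t *\<^sub>R b)) \<bullet> T b') *\<^sub>R b') \<bullet> b) (at t)" for x b t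
      unfolding inner using C1_supportedD(3)[OF f, of "T x" "T b" t] by (simp add: linear_add[OF lin] linear_scale[OF lin])
    show "f (T x) = 0" if "R \<le> norm x" for x
      using that orthogonal_transformation_norm[OF T, of x] by (intro C1_supportedD(4)[OF f]) simp
  qed
qed

lemma poincare_sobolev:
  fixes f :: "'a::euclidean_space \<Rightarrow> real"
  assumes f: "integrable lborel f" "\<forall>x. R \<le> norm x \<longrightarrow> f x = 0" and G: "loc_int G" "borel_weak_gradient f G"
    and R: "0 < R" and p: "1 \<le> p" and b: "norm b = 1"
  shows "(\<integral>\<^sup>+x. ennreal (\<bar>f x\<bar> powr p) \<partial>lborel) \<le> ennreal ((2 * (R + 1)) powr p) * (\<integral>\<^sup>+x. ennreal (\<bar>G x \<bullet> b\<bar> powr p) \<partial>lborel)"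
proof -
  obtain F H where FH: "\<forall>n. C1_supported (R + 1) (F n) (H n)" "AE x in lborel. (\<lambda>n. F n x) \<longlonglongrightarrow> f x"
    "\<forall>n p b. 1 \<le> p \<longrightarrow> (\<integral>\<^sup>+x. ennreal (\<bar>H n x \<bullet> b\<bar> powr p) \<partial>lborel) \<le> (\<integral>\<^sup>+x. ennreal (\<bar>G x \<bullet> b\<bar> powr p) \<partial>lborel)"
    using C1_approximation[OF f(1) f(2)[rule_format] G] .
  show ?thesis
  proof (rule fatou_powr_bound[OF FH(2)])
    fix n
    note C = FH(1)[rule_format, of n]
    show "F n \<in> borel_measurable borel" by (rule C1_supportedD(5)[OF C])
    have "(\<integral>\<^sup>+x. ennreal (\<bar>F n x\<bar> powr p) \<partial>lborel) \<le> ennreal ((2 * (R + 1)) powr p) * (\<integral>\<^sup>+x. ennreal (\<bar>H n x \<bullet> b\<bar> powr p) \<partial>lborel)"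
      using R by (intro poincare_directional[OF C b p]) simp
    also have "\<dots> \<le> ennreal ((2 * (R + 1)) powr p) * (\<integral>\<^sup>+x. ennreal (\<bar>G x \<bullet> b\<bar> powr p) \<partial>lborel)"
      using FH(3) p by (intro mult_left_mono) auto
    finally show "(\<integral>\<^sup>+x. ennreal (\<bar>F n x\<bar> powr p) \<partial>lborel) \<le> ennreal ((2 * (R + 1)) powr p) * (\<integral>\<^sup>+x. ennreal (\<bar>G x \<bullet> b\<bar> powr p) \<partial>lborel)" .
  qed (use p in auto)
qed

text \<open>Rotate the approximating functions so that the frame \<open>T b\<close> becomes the coordinate frame, apply the
  inequality for \<open>C1\<close> functions, and let the approximation converge. The integral of \<open>|f| powr p\<close> is bounded by
  the Poincare inequality in the direction \<open>T b0\<close>; this requires its exponent to be nonnegative, which is the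
  hypothesis on \<open>1 / p - 1 / q\<close>.\<close>

lemma gagliardo_nirenberg_sobolev:
  fixes f :: "'a::euclidean_space \<Rightarrow> real" and T :: "'a \<Rightarrow> 'a"
  assumes f: "integrable lborel f" "\<forall>x. R \<le> norm x \<longrightarrow> f x = 0" and G: "loc_int G" "borel_weak_gradient f G"
    and R: "0 < R" and N2: "2 \<le> DIM('a)" and p: "1 \<le> p" and pq: "p \<le> q"
    and s: "1 / p - 1 / q \<le> 1 / real DIM('a)"
    and T: "orthogonal_transformation T"
    and l: "\<And>b. b \<in> Basis \<Longrightarrow> (\<integral>\<^sup>+x. ennreal (\<bar>G x \<bullet> T b\<bar> powr p) \<partial>lborel) = ennreal (l b)" "\<And>b. b \<in> Basis \<Longrightarrow> 0 < l b"
    and b0: "b0 \<in> Basis"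
  shows "(\<integral>\<^sup>+x. ennreal (\<bar>f x\<bar> powr q) \<partial>lborel)
    \<le> ennreal (gn_exponent (real DIM('a)) p q powr (real DIM('a) * ((q - p) / p)) *
        ((2 * (R + 1)) powr p * l b0) powr (1 + (1 - real DIM('a) / p) * ((q - p) / p)) * (\<Prod>b\<in>Basis. l b powr (1 / p)) powr ((q - p) / p))"
    (is "_ \<le> ennreal (?C * _ powr ?A * _ powr ?k)")
proof -
  let ?N = "real DIM('a)"
  obtain F H where FH: "\<forall>n. C1_supported (R + 1) (F n) (H n)" "AE x in lborel. (\<lambda>n. F n x) \<longlonglongrightarrow> f x"
    "\<forall>n p b. 1 \<le> p \<longrightarrow> (\<integral>\<^sup>+x. ennreal (\<bar>H n x \<bullet> b\<bar> powr p) \<partial>lborel) \<le> (\<integral>\<^sup>+x. ennreal (\<bar>G x \<bullet> b\<bar> powr p) \<partial>lborel)"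
    using C1_approximation[OF f(1) f(2)[rule_format] G] .
  have k0: "0 \<le> ?k" using p pq by simp
  have A0: "0 \<le> ?A"
  proof -
    have "0 \<le> q / p * (1 - ?N * (1 / p - 1 / q))"
      using s p pq N2 by (intro mult_nonneg_nonneg) (auto simp: field_simps)
    also have "\<dots> = ?A" using p pq by (simp add: field_simps)
    finally show ?thesis .
  qed
  let ?L = "(2 * (R + 1)) powr p * l b0"
  show ?thesis
  proof (rule fatou_powr_bound[OF FH(2)])
    fix n
    note C0 = FH(1)[rule_format, of n]
    show "F n \<in> borel_measurable borel" by (rule C1_supportedD(5)[OF C0])
    note [measurable] = C1_supportedD(5,6)[OF C0] orthogonal_transformation_measurable[OF T]
    define F' where "F' x = F n (T x)" for x
    define H' where "H' x = (\<Sum>b\<in>Basis. (H n (T x) \<bullet> T b) *\<^sub>R b)" for x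
    have C: "C1_supported (R + 1) F' H'"
      using C1_supported_rotate(1)[OF C0 T] by (simp add: F'_def[abs_def] H'_def[abs_def])
    have Hb: "H' x \<bullet> b = H n (T x) \<bullet> T b" for x b
      using C1_supported_rotate(2)[OF C0 T] by (simp add: H'_def)
    have rotF: "(\<integral>\<^sup>+x. ennreal (\<bar>F' x\<bar> powr r) \<partial>lborel) = (\<integral>\<^sup>+x. ennreal (\<bar>F n x\<bar> powr r) \<partial>lborel)" for r
      unfolding F'_def by (rule nn_integral_lborel_orthogonal[OF T]) measurable
    have rotH: "(\<integral>\<^sup>+x. ennreal (\<bar>H' x \<bullet> b\<bar> powr p) \<partial>lborel) = (\<integral>\<^sup>+x. ennreal (\<bar>H n x \<bullet> T b\<bar> powr p) \<partial>lborel)" for b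
      unfolding Hb by (rule nn_integral_lborel_orthogonal[OF T]) measurable
    have HG: "(\<integral>\<^sup>+x. ennreal (\<bar>H' x \<bullet> b\<bar> powr p) \<partial>lborel) \<le> ennreal (l b)" if "b \<in> Basis" for b
      using FH(3)[rule_format, OF p, of n "T b"] l(1)[OF that] by (simp add: rotH)
    obtain Y where Y: "(\<integral>\<^sup>+x. ennreal (\<bar>F' x\<bar> powr p) \<partial>lborel) = ennreal Y" "0 \<le> Y"
      using C1_supported_powr_finite[OF C, of p] p by (cases "\<integral>\<^sup>+x. ennreal (\<bar>F' x\<bar> powr p) \<partial>lborel") auto
    have poi: "ennreal Y \<le> ennreal ((2 * (R + 1)) powr p) * (\<integral>\<^sup>+x. ennreal (\<bar>H' x \<bullet> b\<bar> powr p) \<partial>lborel)" if "b \<in> Basis" for b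
      unfolding Y(1)[symmetric] using R that by (intro poincare_directional[OF C _ p]) auto
    show "(\<integral>\<^sup>+x. ennreal (\<bar>F n x\<bar> powr q) \<partial>lborel) \<le> ennreal (?C * ?L powr ?A * (\<Prod>b\<in>Basis. l b powr (1 / p)) powr ?k)"
    proof (cases "Y = 0")
      case True
      then have "(\<integral>\<^sup>+x. ennreal (\<bar>F n x\<bar> powr p) \<partial>lborel) = 0" using Y by (simp add: rotF)
      then have "AE x in lborel. ennreal (\<bar>F n x\<bar> powr p) = 0" by (subst (asm) nn_integral_0_iff_AE) auto
      then have "AE x in lborel. ennreal (\<bar>F n x\<bar> powr q) = 0" by (auto simp: ennreal_eq_0_iff)
      then have "(\<integral>\<^sup>+x. ennreal (\<bar>F n x\<bar> powr q) \<partial>lborel) = 0" by (subst nn_integral_0_iff_AE) auto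
      then show ?thesis by simp
    next
      case False
      then have Y0: "0 < Y" using Y by simp
      define m where "m b = enn2real (\<integral>\<^sup>+x. ennreal (\<bar>H' x \<bullet> b\<bar> powr p) \<partial>lborel)" for b
      have m: "(\<integral>\<^sup>+x. ennreal (\<bar>H' x \<bullet> b\<bar> powr p) \<partial>lborel) = ennreal (m b)" "0 < m b" "m b \<le> l b" if b: "b \<in> Basis" for b
      proof -
        have fin: "(\<integral>\<^sup>+x. ennreal (\<bar>H' x \<bullet> b\<bar> powr p) \<partial>lborel) < top"
          using HG[OF b] by (rule le_less_trans) simp
        then show e: "(\<integral>\<^sup>+x. ennreal (\<bar>H' x \<bullet> b\<bar> powr p) \<partial>lborel) = ennreal (m b)" by (simp add: m_def)
        have "0 \<le> m b" by (simp add: m_def)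
        moreover have "m b \<noteq> 0" using poi[OF b] Y0 by (auto simp: e)
        ultimately show "0 < m b" by simp
        show "m b \<le> l b" using HG[OF b] l(2)[OF b] by (simp add: e ennreal_le_iff)
      qed
      have YL: "Y \<le> ?L"
      proof -
        have "ennreal Y \<le> ennreal ((2 * (R + 1)) powr p * m b0)"
          using poi[OF b0] m(1)[OF b0] by (simp add: ennreal_mult')
        then have "Y \<le> (2 * (R + 1)) powr p * m b0" using m(2)[OF b0] by (subst (asm) ennreal_le_iff) auto
        also have "\<dots> \<le> ?L" using m(3)[OF b0] by (intro mult_left_mono) auto
        finally show ?thesis .
      qed
      have "(\<integral>\<^sup>+x. ennreal (\<bar>F' x\<bar> powr q) \<partial>lborel) \<le> ennreal (?C * Y powr ?A * (\<Prod>b\<in>Basis. m b powr (1 / p)) powr ?k)"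
        using R by (intro gagliardo_nirenberg_C1[OF C _ N2 p pq s Y(1) Y0 m(1,2)]) auto
      also have "\<dots> \<le> ennreal (?C * ?L powr ?A * (\<Prod>b\<in>Basis. l b powr (1 / p)) powr ?k)"
      proof -
        have "(\<Prod>b\<in>Basis. m b powr (1 / p)) \<le> (\<Prod>b\<in>Basis. l b powr (1 / p))"
        proof (rule prod_mono)
          fix b :: 'a assume b: "b \<in> Basis"
          have "m b powr (1 / p) \<le> l b powr (1 / p)" using m(2,3)[OF b] p by (intro powr_mono2) auto
          then show "0 \<le> m b powr (1 / p) \<and> m b powr (1 / p) \<le> l b powr (1 / p)" by simp
        qed
        then have "(\<Prod>b\<in>Basis. m b powr (1 / p)) powr ?k \<le> (\<Prod>b\<in>Basis. l b powr (1 / p)) powr ?k"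
          by (intro powr_mono2 k0 prod_nonneg) auto
        moreover have "Y powr ?A \<le> ?L powr ?A" using Y0 by (intro powr_mono2 A0 YL) auto
        ultimately show ?thesis by (intro ennreal_leI mult_mono) auto
      qed
      finally show ?thesis by (simp add: rotF)
    qed
  qed (use p pq in auto)
qed

text \<open>For \<open>q \<le> p\<close> this is the Poincare inequality followed by Hoelder's inequality on the ball, with \<open>s = 0\<close>.
  For \<open>p \<le> q\<close> it is the anisotropic Gagliardo--Nirenberg inequality, rewritten in terms of norms. The
  bound holds for every direction \<open>b0\<close> of the frame and is used for the one with the smallest norm.\<close>

lemma norm_bound_geometric:
  assumes N2: "2 \<le> DIM('a::euclidean_space)" and p: "1 \<le> p" and q: "1 \<le> q" and R: "0 < R"
    and s: "q \<le> p \<and> s = 0 \<or> p \<le> q \<and> s = 1 / p - 1 / q" and sN: "real DIM('a) * s \<le> 1"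
  obtains C where "0 < C" "\<forall>(f :: 'a \<Rightarrow> real) G (T :: 'a \<Rightarrow> 'a) (Q :: 'a \<Rightarrow> real) b0. integrable lborel f \<longrightarrow> (\<forall>x. R \<le> norm x \<longrightarrow> f x = 0) \<longrightarrow>
    loc_int G \<longrightarrow> borel_weak_gradient f G \<longrightarrow> orthogonal_transformation T \<longrightarrow>
    (\<forall>b\<in>Basis. (\<integral>\<^sup>+x. ennreal (\<bar>G x \<bullet> T b\<bar> powr p) \<partial>lborel) = ennreal (Q b powr p)) \<longrightarrow> (\<forall>b\<in>Basis. 0 < Q b) \<longrightarrow>
    b0 \<in> Basis \<longrightarrow>
    ennpowr (\<integral>\<^sup>+x. ennreal (\<bar>f x\<bar> powr q) \<partial>lborel) (1 / q)
      \<le> ennreal (C * Q b0 powr (1 - real DIM('a) * s) * (\<Prod>b\<in>Basis. Q b) powr s)"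
proof (cases "q \<le> p \<and> s = 0")
  case False
  then have pq: "p \<le> q" and s_eq: "s = 1 / p - 1 / q" using s by auto
  let ?N = "real DIM('a)"
  have s': "1 / p - 1 / q \<le> 1 / ?N" using sN s_eq N2 by (simp add: field_simps)
  let ?k = "(q - p) / p" let ?A = "1 + (1 - ?N / p) * ((q - p) / p)"
  have kq: "?k / q = s" using p q by (simp add: s_eq field_simps)
  have Aq: "p * (?A / q) = 1 - ?N * s" using p q by (simp add: s_eq field_simps)
  have Aq': "?A / q = (1 - ?N * s) / p" using Aq p by (simp add: field_simps)
  define g where "g = gn_exponent ?N p q powr (?N * ?k)"
  have "1 \<le> gn_exponent ?N p q"
  proof -
    have "p * ?N / (?N - 1) * (?N - 1) / ?N \<le> gn_exponent ?N p q"
      unfolding gn_exponent_def using N2 by (intro divide_right_mono mult_right_mono) auto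
    moreover have "p * ?N / (?N - 1) * (?N - 1) / ?N = p" using N2 by simp
    ultimately show ?thesis using p by simp
  qed
  then have g: "0 < g" by (simp add: g_def)
  define C where "C = g powr (1 / q) * (2 * (R + 1)) powr (1 - ?N * s)"
  have "0 < C" using g R by (simp add: C_def)
  then show ?thesis
  proof (rule that[of C], intro allI impI)
    fix f :: "'a \<Rightarrow> real" and G and T :: "'a \<Rightarrow> 'a" and Q :: "'a \<Rightarrow> real" and b0 :: 'a
    assume h: "integrable lborel f" "\<forall>x. R \<le> norm x \<longrightarrow> f x = 0" "loc_int G" "borel_weak_gradient f G"
      "orthogonal_transformation T"
      and Q: "\<forall>b\<in>Basis. (\<integral>\<^sup>+x. ennreal (\<bar>G x \<bullet> T b\<bar> powr p) \<partial>lborel) = ennreal (Q b powr p)" "\<forall>b\<in>Basis. 0 < Q b"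
      and b0: "b0 \<in> Basis"
    let ?P = "\<Prod>b\<in>Basis. Q b"
    have P: "0 < ?P" using Q(2) by (intro prod_pos) auto
    have Q0: "0 < Q b0" using Q(2) b0 by auto
    have "(\<integral>\<^sup>+x. ennreal (\<bar>f x\<bar> powr q) \<partial>lborel)
      \<le> ennreal (g * ((2 * (R + 1)) powr p * Q b0 powr p) powr ?A * (\<Prod>b\<in>Basis. (Q b powr p) powr (1 / p)) powr ?k)"
      unfolding g_def using Q by (intro gagliardo_nirenberg_sobolev[OF h(1-4) R N2 p pq s' h(5) _ _ b0]) auto
    also have "(\<Prod>b\<in>Basis. (Q b powr p) powr (1 / p)) = ?P"
      using Q(2) p by (intro prod.cong) (auto simp: powr_powr less_imp_le)
    finally have "ennpowr (\<integral>\<^sup>+x. ennreal (\<bar>f x\<bar> powr q) \<partial>lborel) (1 / q)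
      \<le> ennpowr (ennreal (g * ((2 * (R + 1)) powr p * Q b0 powr p) powr ?A * ?P powr ?k)) (1 / q)"
      using q by (intro ennpowr_mono) auto
    also have "\<dots> = ennreal ((g * ((2 * (R + 1)) powr p * Q b0 powr p) powr ?A * ?P powr ?k) powr (1 / q))"
    proof (rule ennpowr_ennreal)
      have "0 < (2 * (R + 1)) powr p * Q b0 powr p"
        using R Q0 by (intro mult_pos_pos) simp_all
      then have "0 < ((2 * (R + 1)) powr p * Q b0 powr p) powr ?A"
        unfolding powr_gt_zero by (rule less_imp_neq[symmetric])
      moreover have "0 < ?P powr ?k" unfolding powr_gt_zero using P by (rule less_imp_neq[symmetric])
      ultimately show "0 < g * ((2 * (R + 1)) powr p * Q b0 powr p) powr ?A * ?P powr ?k"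
        using g by (intro mult_pos_pos)
    qed
    also have "(g * ((2 * (R + 1)) powr p * Q b0 powr p) powr ?A * ?P powr ?k) powr (1 / q)
       = g powr (1 / q) * ((2 * (R + 1)) powr (p * (?A / q)) * Q b0 powr (p * (?A / q))) * ?P powr (?k / q)"
      using g P Q0 R by (simp add: powr_mult powr_powr)
    also have "\<dots> = C * Q b0 powr (1 - ?N * s) * ?P powr s"
      unfolding Aq kq by (simp add: C_def)
    finally show "ennpowr (\<integral>\<^sup>+x. ennreal (\<bar>f x\<bar> powr q) \<partial>lborel) (1 / q) \<le> ennreal (C * Q b0 powr (1 - ?N * s) * ?P powr s)" .
  qed
next
  case True
  then have qp: "q \<le> p" and s0: "s = 0" by auto
  let ?V = "measure lborel (ball (0::'a) R)"
  have V: "emeasure lborel (ball (0::'a) R) = ennreal ?V"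
    using emeasure_lborel_ball_finite[of "0::'a" R] by (intro emeasure_eq_ennreal_measure) auto
  have V0: "0 < ?V" using R content_ball_pos[of R "0::'a"] by simp
  define C where "C = (?V powr (p / q - 1)) powr (1 / p) * (2 * (R + 1))"
  have "0 < C" using V0 R by (simp add: C_def)
  then show ?thesis
  proof (rule that[of C], intro allI impI)
    fix f :: "'a \<Rightarrow> real" and G and T :: "'a \<Rightarrow> 'a" and Q :: "'a \<Rightarrow> real" and b0 :: 'a
    assume h: "integrable lborel f" "\<forall>x. R \<le> norm x \<longrightarrow> f x = 0" "loc_int G" "borel_weak_gradient f G"
      and T: "orthogonal_transformation T"
      and Q: "\<forall>b\<in>Basis. (\<integral>\<^sup>+x. ennreal (\<bar>G x \<bullet> T b\<bar> powr p) \<partial>lborel) = ennreal (Q b powr p)" "\<forall>b\<in>Basis. 0 < Q b"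
      and b0: "b0 \<in> Basis"
    have [measurable]: "f \<in> borel_measurable borel" using borel_measurable_integrable[OF h(1)] by simp
    have Q0: "0 < Q b0" using Q(2) b0 by auto
    have P: "0 < (\<Prod>b\<in>Basis. Q b)" using Q(2) by (intro prod_pos) auto
    define M where "M = density lborel (indicator (ball (0::'a) R) :: 'a \<Rightarrow> ennreal)"
    have [measurable]: "(indicator (ball 0 R) :: 'a \<Rightarrow> ennreal) \<in> borel_measurable borel"
      by (intro borel_measurable_indicator) simp
    have M: "emeasure M (space M) = ennreal ?V" by (simp add: M_def emeasure_density V)
    have onM: "(\<integral>\<^sup>+x. ennreal (\<bar>f x\<bar> powr r) \<partial>M) = (\<integral>\<^sup>+x. ennreal (\<bar>f x\<bar> powr r) \<partial>lborel)" for r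
      unfolding M_def using h(2) by (subst nn_integral_density) (auto intro!: nn_integral_cong simp: indicator_def)
    let ?I = "\<integral>\<^sup>+x. ennreal (\<bar>f x\<bar> powr q) \<partial>lborel"
    have "ennpowr ?I (p / q) = ennpowr (\<integral>\<^sup>+x. ennreal (\<bar>f x\<bar> powr q) \<partial>M) (p / q)" by (simp add: onM)
    also have "\<dots> \<le> ennpowr (emeasure M (space M)) (p / q - 1) * (\<integral>\<^sup>+x. ennpowr (ennreal (\<bar>f x\<bar> powr q)) (p / q) \<partial>M)"
      using qp q p by (intro nn_integral_power_mean) (auto simp: M_def)
    also have "(\<integral>\<^sup>+x. ennpowr (ennreal (\<bar>f x\<bar> powr q)) (p / q) \<partial>M) = (\<integral>\<^sup>+x. ennreal (\<bar>f x\<bar> powr p) \<partial>M)"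
      using p q by (simp add: ennpowr_ennreal_pos powr_powr)
    also have "ennpowr (emeasure M (space M)) (p / q - 1) * (\<integral>\<^sup>+x. ennreal (\<bar>f x\<bar> powr p) \<partial>M)
      \<le> ennpowr (emeasure M (space M)) (p / q - 1) * (ennreal ((2 * (R + 1)) powr p) * (\<integral>\<^sup>+x. ennreal (\<bar>G x \<bullet> T b0\<bar> powr p) \<partial>lborel))"
      unfolding onM using b0 orthogonal_transformation_norm[OF T, of b0]
      by (intro mult_left_mono poincare_sobolev[OF h R p]) auto
    also have "\<dots> = ennreal (?V powr (p / q - 1) * ((2 * (R + 1)) powr p * Q b0 powr p))"
      using Q(1) b0 V0 by (simp add: M ennpowr_ennreal ennreal_mult')
    finally have "ennpowr (ennpowr ?I (p / q)) (1 / p) \<le> ennpowr (ennreal (?V powr (p / q - 1) * ((2 * (R + 1)) powr p * Q b0 powr p))) (1 / p)"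
      using p by (intro ennpowr_mono) auto
    also have "ennpowr (ennpowr ?I (p / q)) (1 / p) = ennpowr ?I (1 / q)"
      using p q by (subst ennpowr_ennpowr) auto
    also have "ennpowr (ennreal (?V powr (p / q - 1) * ((2 * (R + 1)) powr p * Q b0 powr p))) (1 / p) = ennreal (C * Q b0)"
      using V0 R Q0 p by (simp add: ennpowr_ennreal powr_mult powr_powr C_def)
    finally have fin: "ennpowr ?I (1 / q) \<le> ennreal (C * Q b0)" .
    show "ennpowr ?I (1 / q) \<le> ennreal (C * Q b0 powr (1 - real DIM('a) * s) * (\<Prod>b\<in>Basis. Q b) powr s)"
    proof -
      have "(\<Prod>b\<in>Basis. Q b) powr s = 1" using less_imp_neq[OF P, symmetric] by (simp only: s0 powr_zero_eq_one if_False)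
      moreover have "Q b0 powr (1 - real DIM('a) * s) = Q b0" using Q0 by (simp add: s0)
      ultimately show ?thesis using fin by (simp only: mult_1_right)
    qed
  qed
qed

lemma powr_add_superadditive:
  fixes a b :: real assumes "0 \<le> a" "0 \<le> b" "1 \<le> p"
  shows "a powr p + b powr p \<le> (a + b) powr p"
proof -
  have one: "x powr p \<le> x * (a + b) powr (p - 1)" if "0 \<le> x" "x \<le> a + b" for x
  proof (cases "x = 0")
    case False
    then have "x powr p = x * x powr (p - 1)" using that by (simp add: powr_diff)
    also have "\<dots> \<le> x * (a + b) powr (p - 1)" using that assms(3) by (intro mult_left_mono powr_mono2) auto
    finally show ?thesis .
  qed simp
  have "a powr p + b powr p \<le> a * (a + b) powr (p - 1) + b * (a + b) powr (p - 1)"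
    using assms by (intro add_mono one) auto
  also have "\<dots> = (a + b) powr p"
    using assms by (cases "a + b = 0") (auto simp: powr_diff simp flip: add_divide_distrib distrib_right)
  finally show ?thesis .
qed

text \<open>The function \<open>\<xi> \<mapsto> ||G \<bullet> \<xi>||\<close> with the norm of \<open>Lp\<close>. The constant \<open>2\<close> in the triangle inequality spares Minkowski's
  inequality and is harmless, since adapted frames are defined up to constants.\<close>

lemma grad_quasinorm:
  fixes G :: "'a::euclidean_space \<Rightarrow> 'a"
  assumes [measurable]: "G \<in> borel_measurable borel" and p: "1 \<le> p"
    and fin: "(\<integral>\<^sup>+x. ennreal (norm (G x) powr p) \<partial>lborel) < top"
  obtains Q :: "'a \<Rightarrow> real" where "continuous_on UNIV Q" "\<And>t x. Q (t *\<^sub>R x) = \<bar>t\<bar> * Q x"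
    "\<And>x y. Q (x + y) \<le> 2 * (Q x + Q y)" "\<And>x. 0 \<le> Q x"
    "\<And>\<xi>. (\<integral>\<^sup>+x. ennreal (\<bar>G x \<bullet> \<xi>\<bar> powr p) \<partial>lborel) = ennreal (Q \<xi> powr p)"
proof -
  define J where "J \<xi> = (\<integral>x. \<bar>G x \<bullet> \<xi>\<bar> powr p \<partial>lborel)" for \<xi>
  have iG: "integrable lborel (\<lambda>x. norm (G x) powr p)"
    using fin by (intro integrableI_nonneg) auto
  have dom: "\<bar>G x \<bullet> \<xi>\<bar> powr p \<le> B powr p * norm (G x) powr p" if "norm \<xi> \<le> B" for x \<xi> B
  proof -
    have B: "0 \<le> B" using that norm_ge_zero[of \<xi>] by linarith
    have "\<bar>G x \<bullet> \<xi>\<bar> \<le> norm (G x) * norm \<xi>" by (rule Cauchy_Schwarz_ineq2)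
    also have "\<dots> \<le> norm (G x) * B" using that by (intro mult_left_mono) auto
    finally have "\<bar>G x \<bullet> \<xi>\<bar> powr p \<le> (norm (G x) * B) powr p" using p by (intro powr_mono2) auto
    then show ?thesis using B by (simp add: powr_mult mult.commute)
  qed
  have iJ: "integrable lborel (\<lambda>x. \<bar>G x \<bullet> \<xi>\<bar> powr p)" for \<xi>
    by (rule Bochner_Integration.integrable_bound[OF integrable_mult_right[OF iG, of "norm \<xi> powr p"]])
      (use dom[of \<xi> "norm \<xi>"] in auto)
  have J0: "0 \<le> J \<xi>" for \<xi> by (simp add: J_def)
  have nnJ: "(\<integral>\<^sup>+x. ennreal (\<bar>G x \<bullet> \<xi>\<bar> powr p) \<partial>lborel) = ennreal (J \<xi>)" for \<xi>
    unfolding J_def by (intro nn_integral_eq_integral iJ) auto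
  have cJ: "continuous_on UNIV J"
    unfolding continuous_on_sequentially
  proof (intro ballI allI impI)
    fix X :: "nat \<Rightarrow> 'a" and \<xi> assume "(\<forall>n. X n \<in> UNIV) \<and> X \<longlonglongrightarrow> \<xi>"
    then have X: "X \<longlonglongrightarrow> \<xi>" by simp
    obtain B where B: "\<forall>n. norm (X n) \<le> B" using convergent_imp_Bseq[of X] X by (auto simp: convergent_def Bseq_def)
    have "(\<lambda>n. \<integral>x. \<bar>G x \<bullet> X n\<bar> powr p \<partial>lborel) \<longlonglongrightarrow> (\<integral>x. \<bar>G x \<bullet> \<xi>\<bar> powr p \<partial>lborel)"
    proof (rule integral_dominated_convergence[where w = "\<lambda>x. B powr p * norm (G x) powr p"])
      show "integrable lborel (\<lambda>x. B powr p * norm (G x) powr p)" using iG by simp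
      show "AE x in lborel. (\<lambda>n. \<bar>G x \<bullet> X n\<bar> powr p) \<longlonglongrightarrow> \<bar>G x \<bullet> \<xi>\<bar> powr p"
        using p by (intro AE_I2 tendsto_powr' tendsto_intros X) auto
      show "AE x in lborel. norm (\<bar>G x \<bullet> X n\<bar> powr p) \<le> B powr p * norm (G x) powr p" for n
        using dom[OF B[rule_format]] by (intro AE_I2) simp
    qed measurable
    then show "(J \<circ> X) \<longlonglongrightarrow> J \<xi>" by (simp add: J_def o_def)
  qed
  define Q where "Q \<xi> = J \<xi> powr (1 / p)" for \<xi>
  have Qp: "Q \<xi> powr p = J \<xi>" for \<xi> using p J0[of \<xi>] by (simp add: Q_def powr_powr)
  have Q0: "0 \<le> Q \<xi>" for \<xi> by (simp add: Q_def)
  show ?thesis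
  proof (rule that[of Q])
    show "continuous_on UNIV Q"
      unfolding Q_def using p J0 by (intro continuous_on_powr' cJ continuous_on_const) auto
    show "Q (t *\<^sub>R x) = \<bar>t\<bar> * Q x" for t x
    proof -
      have "J (t *\<^sub>R x) = \<bar>t\<bar> powr p * J x"
        unfolding J_def by (simp add: abs_mult powr_mult)
      then show ?thesis using p J0[of x] by (simp add: Q_def powr_mult powr_powr)
    qed
    show "Q (x + y) \<le> 2 * (Q x + Q y)" for x y
    proof -
      have pt: "\<bar>G z \<bullet> (x + y)\<bar> powr p \<le> 2 powr p * (\<bar>G z \<bullet> x\<bar> powr p + \<bar>G z \<bullet> y\<bar> powr p)" for z
      proof -
        let ?a = "\<bar>G z \<bullet> x\<bar>" and ?b = "\<bar>G z \<bullet> y\<bar>"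
        have "\<bar>G z \<bullet> (x + y)\<bar> \<le> ?a + ?b" by (simp add: inner_add_right)
        also have "\<dots> \<le> 2 * max ?a ?b" by auto
        finally have "\<bar>G z \<bullet> (x + y)\<bar> powr p \<le> (2 * max ?a ?b) powr p" using p by (intro powr_mono2) auto
        also have "\<dots> = 2 powr p * max ?a ?b powr p" by (simp add: powr_mult)
        also have "max ?a ?b powr p \<le> ?a powr p + ?b powr p" by (auto simp: max_def)
        finally show ?thesis by simp
      qed
      have "J (x + y) \<le> (\<integral>z. 2 powr p * (\<bar>G z \<bullet> x\<bar> powr p + \<bar>G z \<bullet> y\<bar> powr p) \<partial>lborel)"
        unfolding J_def using iJ pt by (intro integral_mono) auto
      also have "\<dots> = 2 powr p * (J x + J y)" using iJ by (simp add: J_def)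
      also have "\<dots> \<le> 2 powr p * (Q x + Q y) powr p"
        using powr_add_superadditive[OF Q0[of x] Q0[of y] p] by (intro mult_left_mono) (auto simp: Qp)
      also have "\<dots> = (2 * (Q x + Q y)) powr p" using Q0[of x] Q0[of y] by (subst powr_mult) auto
      finally have "Q (x + y) \<le> ((2 * (Q x + Q y)) powr p) powr (1 / p)"
        unfolding Q_def[of "x + y"] using p J0 by (intro powr_mono2) auto
      also have "\<dots> = 2 * (Q x + Q y)" using p Q0[of x] Q0[of y] by (simp add: powr_powr)
      finally show ?thesis .
    qed
    show "(\<integral>\<^sup>+x. ennreal (\<bar>G x \<bullet> \<xi>\<bar> powr p) \<partial>lborel) = ennreal (Q \<xi> powr p)" for \<xi>
      by (simp add: nnJ Qp)
  qed (rule Q0)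
qed

section \<open>Sufficiency of the conditions on the exponent\<close>

text \<open>On a logarithmic scale all terms are linear. The largest of the numbers \<open>Q b\<close> is at most the product
  divided by the smallest one to the power \<open>N - 1\<close>; after inserting this, the coefficient of the logarithm of the smallest number
  is nonnegative by the condition on \<open>\<theta>\<close>, and the smallest number is at most the geometric mean.\<close>

lemma geometric_interpolation:
  fixes Q :: "'i \<Rightarrow> real"
  assumes I: "finite I" "card I = N" and Q: "\<And>b. b \<in> I \<Longrightarrow> 0 < Q b"
    and b0: "b0 \<in> I" "\<And>b. b \<in> I \<Longrightarrow> Q b0 \<le> Q b" and bM: "bM \<in> I"
    and C: "0 < C1" "0 < C2" and \<theta>: "0 \<le> \<theta>" "\<theta> \<le> 1"
    and crit: "\<theta> * real N * (1 - s) \<le> 1 - real N * s"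
  shows "(C1 * Q b0 powr (1 - real N * s) * (\<Prod>b\<in>I. Q b) powr s) powr (1 - \<theta>) * (C2 * Q bM) powr \<theta>
    \<le> C1 powr (1 - \<theta>) * C2 powr \<theta> * (\<Prod>b\<in>I. Q b) powr (1 / real N)"
proof -
  have P: "0 < (\<Prod>b\<in>I. Q b)" using Q by (intro prod_pos) auto
  define n where "n = real N"
  have n: "1 \<le> n" using I b0(1) by (auto simp: n_def card_gt_0_iff Suc_le_eq)
  define \<mu> where "\<mu> = ln (Q b0)"
  define S where "S = (\<Sum>b\<in>I. ln (Q b))"
  have lnP: "ln (\<Prod>b\<in>I. Q b) = S" unfolding S_def using Q I by (intro ln_prod) (auto dest: Q)
  have ge: "\<mu> \<le> ln (Q b)" if "b \<in> I" for b unfolding \<mu>_def using Q[OF b0(1)] Q[OF that] b0(2)[OF that] by simp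
  have "(\<Sum>b\<in>I. \<mu>) \<le> S" unfolding S_def by (intro sum_mono ge)
  then have S1: "n * \<mu> \<le> S" by (simp add: I n_def)
  have "S = ln (Q bM) + (\<Sum>b\<in>I - {bM}. ln (Q b))" unfolding S_def using I bM by (intro sum.remove) auto
  moreover have "(\<Sum>b\<in>I - {bM}. \<mu>) \<le> (\<Sum>b\<in>I - {bM}. ln (Q b))" by (intro sum_mono ge) auto
  moreover have "(\<Sum>b\<in>I - {bM}. \<mu>) = (n - 1) * \<mu>"
    using I bM n by (simp add: card_Diff_singleton n_def of_nat_diff)
  ultimately have S2: "ln (Q bM) \<le> S - (n - 1) * \<mu>" by linarith
  \<comment> \<open>The slack in the condition on \<open>\<theta>\<close>.\<close>
  define e where "e = 1 - n * s - \<theta> * n * (1 - s)"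
  have e: "0 \<le> e" using crit by (simp add: e_def n_def)
  have "(1 - \<theta>) * ((1 - n * s) * \<mu> + s * S) + \<theta> * ln (Q bM) \<le> (1 - \<theta>) * ((1 - n * s) * \<mu> + s * S) + \<theta> * (S - (n - 1) * \<mu>)"
    using S2 \<theta> by (intro add_left_mono mult_left_mono) auto
  also have "\<dots> = (e * n * \<mu> + n * ((1 - \<theta>) * s + \<theta>) * S) / n"
    using n by (simp add: e_def field_simps)
  also have "\<dots> \<le> (e * S + n * ((1 - \<theta>) * s + \<theta>) * S) / n"
    using n mult_left_mono[OF S1 e] by (intro divide_right_mono add_right_mono) (auto simp: mult.assoc)
  also have "\<dots> = S / n" by (simp add: e_def algebra_simps)
  finally have main: "(1 - \<theta>) * ((1 - n * s) * \<mu> + s * S) + \<theta> * ln (Q bM) \<le> S / n" .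
  let ?X = "C1 * Q b0 powr (1 - n * s) * (\<Prod>b\<in>I. Q b) powr s"
  have pp: "0 < x powr y" if "0 < x" for x y :: real using that by simp
  have X: "0 < ?X" by (intro mult_pos_pos C pp Q b0 P)
  have Y: "0 < C2 * Q bM" by (intro mult_pos_pos C Q bM)
  have Z: "0 < C1 powr (1 - \<theta>) * C2 powr \<theta> * (\<Prod>b\<in>I. Q b) powr (1 / n)" by (intro mult_pos_pos pp C P)
  have lp: "ln (x powr y) = y * ln x" if "0 < x" for x y :: real using that by (simp add: ln_powr)
  have "ln (?X powr (1 - \<theta>) * (C2 * Q bM) powr \<theta>) = (1 - \<theta>) * ln ?X + \<theta> * ln (C2 * Q bM)"
    using pp[OF X] pp[OF Y] by (simp only: ln_mult_pos lp[OF X] lp[OF Y])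
  also have "ln ?X = ln C1 + (1 - n * s) * \<mu> + s * S"
    using pp[OF Q[OF b0(1)]] pp[OF P] C(1) Q[OF b0(1)] P
    by (simp only: ln_mult_pos mult_pos_pos lp lnP \<mu>_def)
  also have "ln (C2 * Q bM) = ln C2 + ln (Q bM)" using C(2) Q[OF bM] by (rule ln_mult_pos)
  also have "(1 - \<theta>) * (ln C1 + (1 - n * s) * \<mu> + s * S) + \<theta> * (ln C2 + ln (Q bM)) \<le> (1 - \<theta>) * ln C1 + \<theta> * ln C2 + S / n"
    using main by (simp add: distrib_left)
  also have "\<dots> = ln (C1 powr (1 - \<theta>) * C2 powr \<theta> * (\<Prod>b\<in>I. Q b) powr (1 / n))"
    using pp[OF C(1)] pp[OF C(2)] pp[OF P] C P by (simp only: ln_mult_pos mult_pos_pos lp lnP) simp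
  finally have "ln (?X powr (1 - \<theta>) * (C2 * Q bM) powr \<theta>) \<le> ln (C1 powr (1 - \<theta>) * C2 powr \<theta> * (\<Prod>b\<in>I. Q b) powr (1 / n))" .
  then have "?X powr (1 - \<theta>) * (C2 * Q bM) powr \<theta> \<le> C1 powr (1 - \<theta>) * C2 powr \<theta> * (\<Prod>b\<in>I. Q b) powr (1 / n)"
    using Z mult_pos_pos[OF pp[OF X, of "1 - \<theta>"] pp[OF Y, of \<theta>]] by (subst (asm) ln_le_cancel_iff) auto
  then show ?thesis by (simp only: n_def)
qed

lemma grad_norm_le_max:
  fixes G :: "'a::euclidean_space \<Rightarrow> 'a" and T :: "'a \<Rightarrow> 'a"
  assumes [measurable]: "G \<in> borel_measurable borel" and p: "1 \<le> p" and T: "orthogonal_transformation T"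
    and Q: "\<And>b. b \<in> Basis \<Longrightarrow> (\<integral>\<^sup>+x. ennreal (\<bar>G x \<bullet> T b\<bar> powr p) \<partial>lborel) = ennreal (Q b powr p)"
    and M: "\<And>b. b \<in> Basis \<Longrightarrow> Q b \<le> M" "\<And>b. b \<in> Basis \<Longrightarrow> 0 < Q b"
  shows "(\<integral>\<^sup>+x. ennreal (norm (G x) powr p) \<partial>lborel) \<le> ennreal ((real DIM('a) ^ 2 * M) powr p)"
proof -
  let ?N = "real DIM('a)"
  have N1: "1 \<le> ?N" by (simp add: Suc_leI)
  obtain b1 :: 'a where b1: "b1 \<in> Basis" using nonempty_Basis by blast
  have M0: "0 < M" using M[OF b1] by linarith
  have pt: "ennreal (norm (G x) powr p) \<le> ennreal (?N powr p) * (\<Sum>b\<in>Basis. ennreal (\<bar>G x \<bullet> T b\<bar> powr p))" for x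
  proof -
    obtain z where z: "G x = T z" using orthogonal_transformation_surj[OF T] by auto
    have "norm (G x) = norm z" using orthogonal_transformation_norm[OF T] z by simp
    also have "\<dots> \<le> (\<Sum>b\<in>Basis. \<bar>z \<bullet> b\<bar>)" by (rule norm_le_l1)
    also have "\<dots> = (\<Sum>b\<in>Basis. \<bar>G x \<bullet> T b\<bar>)" using T by (simp add: z orthogonal_transformation_def)
    finally have "norm (G x) powr p \<le> (\<Sum>b\<in>Basis. \<bar>G x \<bullet> T b\<bar>) powr p" using p by (intro powr_mono2) auto
    also have "\<dots> \<le> ?N powr p * (\<Sum>b\<in>Basis. \<bar>G x \<bullet> T b\<bar> powr p)" using p by (intro sum_powr_le) auto
    finally have "ennreal (norm (G x) powr p) \<le> ennreal (?N powr p * (\<Sum>b\<in>Basis. \<bar>G x \<bullet> T b\<bar> powr p))" by (rule ennreal_leI)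
    also have "\<dots> = ennreal (?N powr p) * (\<Sum>b\<in>Basis. ennreal (\<bar>G x \<bullet> T b\<bar> powr p))"
      by (simp add: ennreal_mult' sum_nonneg)
    finally show ?thesis .
  qed
  have "(\<integral>\<^sup>+x. ennreal (norm (G x) powr p) \<partial>lborel) \<le> (\<integral>\<^sup>+x. ennreal (?N powr p) * (\<Sum>b\<in>Basis. ennreal (\<bar>G x \<bullet> T b\<bar> powr p)) \<partial>lborel)"
    by (intro nn_integral_mono pt)
  also have "\<dots> = ennreal (?N powr p) * (\<integral>\<^sup>+x. (\<Sum>b\<in>Basis. ennreal (\<bar>G x \<bullet> T b\<bar> powr p)) \<partial>lborel)"
    by (rule nn_integral_cmult) measurable
  also have "(\<integral>\<^sup>+x. (\<Sum>b\<in>Basis. ennreal (\<bar>G x \<bullet> T b\<bar> powr p)) \<partial>lborel) = (\<Sum>b\<in>Basis. \<integral>\<^sup>+x. ennreal (\<bar>G x \<bullet> T b\<bar> powr p) \<partial>lborel)"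
    by (rule nn_integral_sum) measurable
  also have "ennreal (?N powr p) * (\<Sum>b\<in>Basis. \<integral>\<^sup>+x. ennreal (\<bar>G x \<bullet> T b\<bar> powr p) \<partial>lborel)
      \<le> ennreal (?N powr p) * (\<Sum>b\<in>(Basis::'a set). ennreal (M powr p))"
    using M p by (intro mult_left_mono sum_mono) (auto simp: Q less_imp_le intro!: ennreal_leI powr_mono2)
  also have "\<dots> = ennreal (?N powr p * (?N * M powr p))"
    by (simp add: ennreal_of_nat_eq_real_of_nat flip: ennreal_mult')
  also have "\<dots> \<le> ennreal ((?N ^ 2 * M) powr p)"
  proof (rule ennreal_leI)
    have "?N powr 1 \<le> ?N powr p" using N1 p by (intro powr_mono) auto
    then have "?N powr p * (?N * M powr p) \<le> ?N powr p * (?N powr p * M powr p)"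
      using N1 by (intro mult_left_mono mult_right_mono) auto
    also have "\<dots> = (?N ^ 2 * M) powr p" using M0 by (simp add: powr_mult power2_eq_square)
    finally show "?N powr p * (?N * M powr p) \<le> (?N ^ 2 * M) powr p" .
  qed
  finally show ?thesis .
qed

text \<open>If \<open>f\<close> is not zero then all directional norms are positive, by the Poincare inequality, and an adapted frame
  gives bounds for both norms on the left and for the energy on the right in terms of the directional
  norms along the frame. For \<open>f = 0\<close> the left side vanishes because \<open>\<theta> < 1\<close>. The two cases for \<open>s\<close> overlap when
  \<open>p = q\<close>, where both give \<open>s = 0\<close>.\<close>

theorem affine_inequality_holds:
  fixes p q R \<theta> s :: real
  assumes N2: "2 \<le> DIM('a::euclidean_space)" and p: "1 \<le> p" and q: "1 \<le> q" and R: "0 < R"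
    and s: "q \<le> p \<and> s = 0 \<or> p \<le> q \<and> s = 1 / p - 1 / q" and sN: "real DIM('a) * s \<le> 1"
    and \<theta>: "0 \<le> \<theta>" "\<theta> < 1" and crit: "\<theta> * real DIM('a) * (1 - s) \<le> 1 - real DIM('a) * s"
  shows "\<exists>K\<ge>0. \<forall>f :: 'a \<Rightarrow> real. f \<in> sobolev_space p \<longrightarrow> supported_in f (ball 0 R) \<longrightarrow>
    ennpowr (Lp_norm q f) (1 - \<theta>) * ennpowr (Lp_norm p (weak_gradient f)) \<theta> \<le> ennreal K * affine_energy p f"
proof -
  let ?N = "real DIM('a)"
  obtain C where C: "0 < C" "\<forall>(f :: 'a \<Rightarrow> real) G (T :: 'a \<Rightarrow> 'a) (Q :: 'a \<Rightarrow> real) b0. integrable lborel f \<longrightarrow> (\<forall>x. R \<le> norm x \<longrightarrow> f x = 0) \<longrightarrow>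
    loc_int G \<longrightarrow> borel_weak_gradient f G \<longrightarrow> orthogonal_transformation T \<longrightarrow>
    (\<forall>b\<in>Basis. (\<integral>\<^sup>+x. ennreal (\<bar>G x \<bullet> T b\<bar> powr p) \<partial>lborel) = ennreal (Q b powr p)) \<longrightarrow> (\<forall>b\<in>Basis. 0 < Q b) \<longrightarrow>
    b0 \<in> Basis \<longrightarrow>
    ennpowr (\<integral>\<^sup>+x. ennreal (\<bar>f x\<bar> powr q) \<partial>lborel) (1 / q)
      \<le> ennreal (C * Q b0 powr (1 - ?N * s) * (\<Prod>b\<in>Basis. Q b) powr s)"
    by (rule norm_bound_geometric[OF N2 p q R s sN])
  obtain c where c: "0 < c" "\<And>(f :: 'a \<Rightarrow> real) Q (T :: 'a \<Rightarrow> 'a).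
    \<lbrakk>\<And>\<xi>. \<xi> \<noteq> 0 \<Longrightarrow> grad_energy p (weak_gradient f) \<xi> = ennreal (Q \<xi> powr p); \<And>\<xi>. \<xi> \<noteq> 0 \<Longrightarrow> 0 < Q \<xi>;
     orthogonal_transformation T; \<And>b x. b \<in> Basis \<Longrightarrow> Q (T b) * \<bar>x \<bullet> T b\<bar> \<le> 4 ^ DIM('a) * Q x\<rbrakk> \<Longrightarrow>
     ennreal (c * (\<Prod>b\<in>Basis. Q (T b)) powr (1 / ?N)) \<le> affine_energy p f"
    using affine_energy_ge[OF N2 p] by blast
  define C3 where "C3 = C powr (1 - \<theta>) * (?N ^ 2) powr \<theta>"
  have C3: "0 \<le> C3" by (simp add: C3_def)
  show ?thesis
  proof (intro exI[of _ "C3 / c"] conjI allI impI)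
    show "0 \<le> C3 / c" using C3 c(1) by simp
    fix f :: "'a \<Rightarrow> real" assume f: "f \<in> sobolev_space p" "supported_in f (ball 0 R)"
    obtain f0 G where d: "integrable lborel f0" "\<forall>x. R \<le> norm x \<longrightarrow> f0 x = 0" "AE x in lborel. f x = f0 x"
      "loc_int G" "borel_weak_gradient f0 G" "AE x in lborel. weak_gradient f x = G x"
      "(\<integral>\<^sup>+x. ennreal (norm (G x) powr p) \<partial>lborel) < top"
      by (rule sobolev_borel_data[OF f p])
    have Gm[measurable]: "G \<in> borel_measurable borel" using d(4) by (simp add: loc_int_def)
    have [measurable]: "f0 \<in> borel_measurable borel" using borel_measurable_integrable[OF d(1)] by simp
    have Lf: "Lp_norm q f = ennpowr (\<integral>\<^sup>+x. ennreal (\<bar>f0 x\<bar> powr q) \<partial>lborel) (1 / q)"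
    proof -
      have "AE x in lborel. ennreal (norm (f x) powr q) = ennreal (\<bar>f0 x\<bar> powr q)"
        using d(3) by eventually_elim simp
      from nn_integral_lebesgue_rep[OF this] show ?thesis by (simp only: Lp_norm_def)
    qed
    have LG: "Lp_norm p (weak_gradient f) = ennpowr (\<integral>\<^sup>+x. ennreal (norm (G x) powr p) \<partial>lborel) (1 / p)"
    proof -
      have "AE x in lborel. ennreal (norm (weak_gradient f x) powr p) = ennreal (norm (G x) powr p)"
        using d(6) by eventually_elim simp
      from nn_integral_lebesgue_rep[OF this] show ?thesis by (simp only: Lp_norm_def)
    qed
    have gE: "grad_energy p (weak_gradient f) \<xi> = (\<integral>\<^sup>+x. ennreal (\<bar>G x \<bullet> \<xi>\<bar> powr p) \<partial>lborel)" for \<xi>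
      unfolding grad_energy_def by (rule nn_integral_lebesgue_rep, use d(6) in eventually_elim) simp
    show "ennpowr (Lp_norm q f) (1 - \<theta>) * ennpowr (Lp_norm p (weak_gradient f)) \<theta> \<le> ennreal (C3 / c) * affine_energy p f"
    proof (cases "(\<integral>\<^sup>+x. ennreal (\<bar>f0 x\<bar> powr p) \<partial>lborel) = 0")
      case True
      then have "AE x in lborel. ennreal (\<bar>f0 x\<bar> powr p) = 0" by (subst (asm) nn_integral_0_iff_AE) auto
      then have "AE x in lborel. ennreal (\<bar>f0 x\<bar> powr q) = 0" by (auto simp: ennreal_eq_0_iff)
      then have "(\<integral>\<^sup>+x. ennreal (\<bar>f0 x\<bar> powr q) \<partial>lborel) = 0" by (subst nn_integral_0_iff_AE) auto
      then have "ennpowr (Lp_norm q f) (1 - \<theta>) = 0" using q \<theta> by (simp add: Lf ennpowr_0_pos)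
      then show ?thesis by simp
    next
      case False
      obtain Q :: "'a \<Rightarrow> real" where Q: "continuous_on UNIV Q" "\<And>t x. Q (t *\<^sub>R x) = \<bar>t\<bar> * Q x"
        "\<And>x y. Q (x + y) \<le> 2 * (Q x + Q y)" "\<And>x. 0 \<le> Q x"
        "\<And>\<xi>. (\<integral>\<^sup>+x. ennreal (\<bar>G x \<bullet> \<xi>\<bar> powr p) \<partial>lborel) = ennreal (Q \<xi> powr p)"
        using grad_quasinorm[OF Gm p d(7)] by blast
      have pos: "0 < Q \<xi>" if "\<xi> \<noteq> 0" for \<xi>
      proof -
        have "Q (sgn \<xi>) \<noteq> 0"
        proof
          assume z: "Q (sgn \<xi>) = 0"
          have "(\<integral>\<^sup>+x. ennreal (\<bar>f0 x\<bar> powr p) \<partial>lborel) \<le> ennreal ((2 * (R + 1)) powr p) * (\<integral>\<^sup>+x. ennreal (\<bar>G x \<bullet> sgn \<xi>\<bar> powr p) \<partial>lborel)"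
            using that by (intro poincare_sobolev[OF d(1,2,4,5) R p]) (simp add: norm_sgn)
          then show False using False p by (simp add: Q(5) z)
        qed
        moreover have "Q (sgn \<xi>) = Q \<xi> / norm \<xi>" by (simp add: sgn_div_norm Q(2) divide_inverse_commute)
        ultimately show ?thesis using Q(4)[of \<xi>] by (auto simp: less_le)
      qed
      obtain T :: "'a \<Rightarrow> 'a" where T: "orthogonal_transformation T" "\<And>b x. b \<in> Basis \<Longrightarrow> Q (T b) * \<bar>x \<bullet> T b\<bar> \<le> 4 ^ DIM('a) * Q x"
        using exists_adapted_rotation[OF Q(1-4)] by blast
      have posT: "0 < Q (T b)" if "b \<in> Basis" for b
        using that orthogonal_transformation_norm[OF T(1), of b] by (intro pos) force
      obtain b0 where b0: "b0 \<in> Basis" "\<And>b. b \<in> Basis \<Longrightarrow> Q (T b0) \<le> Q (T b)"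
        using ex_is_arg_min_if_finite[OF finite_Basis nonempty_Basis, of "\<lambda>b. Q (T b)"] by (auto simp: is_arg_min_linorder)
      obtain bM where bM: "bM \<in> Basis" "\<And>b. b \<in> Basis \<Longrightarrow> - Q (T bM) \<le> - Q (T b)"
        using ex_is_arg_min_if_finite[OF finite_Basis nonempty_Basis, of "\<lambda>b. - Q (T b)"] by (auto simp: is_arg_min_linorder)
      let ?P = "\<Prod>b\<in>Basis. Q (T b)"
      have P: "0 < ?P" using posT by (intro prod_pos) auto
      have F: "Lp_norm q f \<le> ennreal (C * Q (T b0) powr (1 - ?N * s) * ?P powr s)"
        unfolding Lf by (intro C(2)[rule_format, of f0 G T "\<lambda>b. Q (T b)" b0] d T b0 posT Q(5)) (use d(2) in auto)
      have D: "Lp_norm p (weak_gradient f) \<le> ennreal (?N ^ 2 * Q (T bM))"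
      proof -
        have "(\<integral>\<^sup>+x. ennreal (norm (G x) powr p) \<partial>lborel) \<le> ennreal ((?N ^ 2 * Q (T bM)) powr p)"
          using bM by (intro grad_norm_le_max[OF Gm p T(1) Q(5) _ posT]) auto
        then have "Lp_norm p (weak_gradient f) \<le> ennpowr (ennreal ((?N ^ 2 * Q (T bM)) powr p)) (1 / p)"
          unfolding LG using p by (intro ennpowr_mono) auto
        also have "\<dots> = ennreal (?N ^ 2 * Q (T bM))"
          using posT[OF bM(1)] p by (simp add: ennpowr_ennreal_pos powr_powr)
        finally show ?thesis .
      qed
      have "ennpowr (Lp_norm q f) (1 - \<theta>) * ennpowr (Lp_norm p (weak_gradient f)) \<theta>
        \<le> ennpowr (ennreal (C * Q (T b0) powr (1 - ?N * s) * ?P powr s)) (1 - \<theta>) * ennpowr (ennreal (?N ^ 2 * Q (T bM))) \<theta>"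
        using \<theta> by (intro mult_mono ennpowr_mono F D) auto
      also have "\<dots> = ennreal ((C * Q (T b0) powr (1 - ?N * s) * ?P powr s) powr (1 - \<theta>) * (?N ^ 2 * Q (T bM)) powr \<theta>)"
      proof -
        have "0 < ?N ^ 2 * Q (T bM)" using posT[OF bM(1)] by simp
        moreover have "0 < C * Q (T b0) powr (1 - ?N * s) * ?P powr s"
          using C(1) P posT[OF b0(1)] by (intro mult_pos_pos) (simp_all add: less_imp_neq[symmetric])
        ultimately show ?thesis by (simp only: ennpowr_ennreal ennreal_mult'[OF powr_ge_zero])
      qed
      also have "\<dots> \<le> ennreal (C3 * ?P powr (1 / ?N))"
        unfolding C3_def
        by (intro ennreal_leI geometric_interpolation[of Basis "DIM('a)" "\<lambda>b. Q (T b)" b0 bM])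
          (use posT b0 bM C(1) \<theta> crit in auto)
      also have "\<dots> = ennreal (C3 / c) * ennreal (c * ?P powr (1 / ?N))"
        using c(1) C3 by (simp flip: ennreal_mult')
      also have "\<dots> \<le> ennreal (C3 / c) * affine_energy p f"
        using pos T by (intro mult_left_mono c(2)[of f Q T]) (auto simp: gE Q(5))
      finally show ?thesis .
    qed
  qed
qed

section \<open>Weak gradients of smooth functions\<close>

text \<open>Near \<open>x\<close> the function vanishes, hence so do its derivatives along lines.\<close>

lemma C1_gradient_support:
  fixes f :: "'a::euclidean_space \<Rightarrow> real"
  assumes f: "C1_supported R f g" and x: "R < norm x"
  shows "g x = 0"
proof (rule euclidean_eqI)
  fix b :: 'a assume "b \<in> Basis"
  have d: "((\<lambda>t. f (x + t *\<^sub>R b)) has_real_derivative g (x + 0 *\<^sub>R b) \<bullet> b) (at 0)"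
    by (rule C1_supportedD(3)[OF f])
  have "open {t::real. R < norm (x + t *\<^sub>R b)}" by (intro open_Collect_less continuous_intros)
  from eventually_nhds_in_open[OF this, of 0]
  have "eventually (\<lambda>t. R < norm (x + t *\<^sub>R b)) (nhds 0)" using x by simp
  then have ev: "eventually (\<lambda>t. f (x + t *\<^sub>R b) = 0) (nhds 0)"
    by eventually_elim (use C1_supportedD(4)[OF f] in auto)
  then have "((\<lambda>t. f (x + t *\<^sub>R b)) has_real_derivative 0) (at 0)"
    by (subst DERIV_cong_ev[OF refl ev refl]) simp
  from DERIV_unique[OF d this] show "g x \<bullet> b = 0 \<bullet> b" by simp
qed

lemma continuous_loc_int:
  fixes h :: "'a::euclidean_space \<Rightarrow> 'b::euclidean_space"
  assumes "continuous_on UNIV h" shows "loc_int h"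
  unfolding loc_int_def
  using assms by (auto intro!: borel_measurable_continuous_onI borel_integrable_compact continuous_on_subset[OF assms] simp del: real_scaleR_def)

text \<open>Integration by parts: the integral of the difference quotients of \<open>f * \<phi>\<close> in the direction \<open>b\<close> vanishes by
  translation invariance, and the difference quotients converge boundedly to the derivative of
  the product.\<close>

lemma C1_borel_weak_gradient:
  fixes f :: "'a::euclidean_space \<Rightarrow> real"
  assumes f: "C1_supported R f g"
  shows "borel_weak_gradient f g"
  unfolding borel_weak_gradient_def
proof (intro allI impI ballI)
  fix \<phi> :: "'a \<Rightarrow> real" and b :: 'a assume \<phi>: "test_function \<phi>" and b: "b \<in> Basis"
  have sm: "smooth \<phi>" using \<phi> by (simp add: test_function_def)
  let ?D = "\<lambda>x. frechet_derivative \<phi> (at x) b"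
  define h where "h x = f x * \<phi> x" for x
  define k where "k x = f x * ?D x + (g x \<bullet> b) * \<phi> x" for x
  note cf = C1_supportedD(1)[OF f] and cg = C1_supportedD(2)[OF f]
  have ch: "continuous_on UNIV h" unfolding h_def by (intro continuous_intros cf smooth_continuous sm)
  have ck: "continuous_on UNIV k"
    unfolding k_def by (intro continuous_intros cf cg smooth_continuous sm smooth_partial_continuous b)
  have [measurable]: "h \<in> borel_measurable borel" "k \<in> borel_measurable borel"
    using ch ck by (auto intro: borel_measurable_continuous_onI)
  have h0: "h x = 0" if "R \<le> norm x" for x using C1_supportedD(4)[OF f that] by (simp add: h_def)
  have k0: "k x = 0" if "R < norm x" for x
    using C1_supportedD(4)[OF f, of x] C1_gradient_support[OF f that] that by (simp add: k_def)
  have ih: "integrable lborel h" using h0 by (intro compact_support_integrable[OF ch, of R]) auto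
  have der: "((\<lambda>t. h (x + t *\<^sub>R b)) has_real_derivative k (x + t *\<^sub>R b)) (at t)" for x t
  proof -
    have "((\<lambda>t. x + t *\<^sub>R b) has_derivative (\<lambda>s. s *\<^sub>R b)) (at t)" by (auto intro!: derivative_eq_intros)
    from has_derivative_compose[OF this smooth_has_derivative[OF sm]]
    have "((\<lambda>t. \<phi> (x + t *\<^sub>R b)) has_derivative (\<lambda>s. \<Sum>c\<in>Basis. ((s *\<^sub>R b) \<bullet> c) * frechet_derivative \<phi> (at (x + t *\<^sub>R b)) c)) (at t)" .
    moreover have "(\<Sum>c\<in>Basis. ((s *\<^sub>R b) \<bullet> c) * frechet_derivative \<phi> (at (x + t *\<^sub>R b)) c) = ?D (x + t *\<^sub>R b) * s" for s
    proof -
      have "(\<Sum>c\<in>Basis. ((s *\<^sub>R b) \<bullet> c) * frechet_derivative \<phi> (at (x + t *\<^sub>R b)) c) = (\<Sum>c\<in>Basis. if c = b then ?D (x + t *\<^sub>R b) * s else 0)"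
        using b by (intro sum.cong) (auto simp: inner_Basis)
      then show ?thesis using b by simp
    qed
    ultimately have "((\<lambda>t. \<phi> (x + t *\<^sub>R b)) has_real_derivative ?D (x + t *\<^sub>R b)) (at t)"
      by (simp add: has_field_derivative_def)
    from DERIV_mult[OF C1_supportedD(3)[OF f, of x b t] this] show ?thesis
      by (simp add: h_def k_def algebra_simps)
  qed
  have "bounded (k ` cball 0 R)"
    by (intro compact_imp_bounded compact_continuous_image continuous_on_subset[OF ck]) auto
  then have "\<exists>M. \<forall>x\<in>cball 0 R. \<bar>k x\<bar> \<le> M" by (simp add: bounded_iff)
  then obtain M where "\<forall>x\<in>cball 0 R. \<bar>k x\<bar> \<le> M" ..
  then have M: "\<forall>x\<in>cball 0 R. \<bar>k x\<bar> \<le> M" .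
  have kM: "\<bar>k x\<bar> \<le> max M 0" for x
  proof (cases "x \<in> cball 0 R")
    case True from bspec[OF M True] show ?thesis by linarith
  next
    case False then have "k x = 0" by (intro k0) simp
    then show ?thesis by simp
  qed
  \<comment> \<open>Step sizes of the difference quotients.\<close>
  let ?s = "\<lambda>n. inverse (real (Suc n))"
  have "(\<lambda>n. \<integral>x. (h (x + ?s n *\<^sub>R b) - h x) / ?s n \<partial>lborel) \<longlonglongrightarrow> (\<integral>x. k x \<partial>lborel)"
  proof (rule integral_dominated_convergence[where w = "\<lambda>x. max M 0 * indicator (cball 0 (R + 1)) x"])
    have "integrable lborel (indicator (cball (0::'a) (R + 1)) :: 'a \<Rightarrow> real)"
      using emeasure_lborel_cball_finite[of "0::'a" "R + 1"] by simp
    then show "integrable lborel (\<lambda>x. max M 0 * indicator (cball (0::'a) (R + 1)) x)" by (rule integrable_mult_right)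
    show "AE x in lborel. (\<lambda>n. (h (x + ?s n *\<^sub>R b) - h x) / ?s n) \<longlonglongrightarrow> k x"
    proof (rule AE_I2)
      fix x
      have "((\<lambda>t. (h (x + (0 + t) *\<^sub>R b) - h (x + 0 *\<^sub>R b)) / t) \<longlongrightarrow> k (x + 0 *\<^sub>R b)) (at 0)"
        using der[of x 0] unfolding DERIV_def .
      then have lim: "((\<lambda>t. (h (x + t *\<^sub>R b) - h x) / t) \<longlongrightarrow> k x) (at 0)" by simp
      show "(\<lambda>n. (h (x + ?s n *\<^sub>R b) - h x) / ?s n) \<longlonglongrightarrow> k x"
        using lim[unfolded tendsto_at_iff_sequentially, rule_format, of ?s] LIMSEQ_inverse_real_of_nat
        by (simp add: o_def)
    qed
    show "AE x in lborel. norm ((h (x + ?s n *\<^sub>R b) - h x) / ?s n) \<le> max M 0 * indicator (cball 0 (R + 1)) x" for n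
    proof (rule AE_I2)
      fix x
      have s: "0 < ?s n" "?s n \<le> 1" by (auto simp: inverse_le_1_iff)
      show "norm ((h (x + ?s n *\<^sub>R b) - h x) / ?s n) \<le> max M 0 * indicator (cball 0 (R + 1)) x"
      proof (cases "x \<in> cball 0 (R + 1)")
        case True
        obtain z where "h (x + ?s n *\<^sub>R b) - h (x + 0 *\<^sub>R b) = (?s n - 0) * k (x + z *\<^sub>R b)"
          using MVT2[of 0 "?s n" "\<lambda>t. h (x + t *\<^sub>R b)" "\<lambda>t. k (x + t *\<^sub>R b)"] s(1) der by blast
        then have "(h (x + ?s n *\<^sub>R b) - h x) / ?s n = k (x + z *\<^sub>R b)" using s(1) by simp
        then have "norm ((h (x + ?s n *\<^sub>R b) - h x) / ?s n) \<le> max M 0" using kM by (simp only: real_norm_def)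
        then show ?thesis using True by simp
      next
        case False
        then have "R + 1 < norm x" by simp
        moreover have "norm x \<le> norm (x + ?s n *\<^sub>R b) + norm (?s n *\<^sub>R b)"
          using norm_triangle_ineq4[of "x + ?s n *\<^sub>R b" "?s n *\<^sub>R b"] by simp
        moreover have "norm (?s n *\<^sub>R b) \<le> 1" using b s(2) by simp
        ultimately have "h (x + ?s n *\<^sub>R b) = 0" "h x = 0" by (auto intro!: h0)
        then show ?thesis by simp
      qed
    qed
  qed measurable
  moreover have "(\<integral>x. (h (x + ?s n *\<^sub>R b) - h x) / ?s n \<partial>lborel) = 0" for n
    using ih lborel_shift_integrable[OF ih, of "?s n *\<^sub>R b"] by simp
  ultimately have kz: "(\<integral>x. k x \<partial>lborel) = 0" by (simp only:) (simp add: LIMSEQ_const_iff)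
  have "integrable lborel (\<lambda>x. f x * ?D x)"
  proof (rule compact_support_integrable[where R = R])
    show "continuous_on UNIV (\<lambda>x. f x * ?D x)" by (intro continuous_intros cf smooth_partial_continuous sm b)
  qed (use C1_supportedD(4)[OF f] in simp)
  moreover have "integrable lborel (\<lambda>x. (g x \<bullet> b) * \<phi> x)"
  proof (rule compact_support_integrable[where R = R])
    show "continuous_on UNIV (\<lambda>x. (g x \<bullet> b) * \<phi> x)" by (intro continuous_intros cg smooth_continuous sm)
  qed (use C1_gradient_support[OF f] in simp)
  ultimately have "(\<integral>x. k x \<partial>lborel) = (\<integral>x. f x * ?D x \<partial>lborel) + (\<integral>x. (g x \<bullet> b) * \<phi> x \<partial>lborel)"
    by (simp add: k_def)
  then show "(\<integral>x. f x * ?D x \<partial>lborel) = - (\<integral>x. (g x \<bullet> b) * \<phi> x \<partial>lborel)" using kz by simp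
qed

lemma loc_int_locally_integrable:
  fixes h :: "'a::euclidean_space \<Rightarrow> 'b::euclidean_space"
  assumes h: "loc_int h" shows "locally_integrable h" "h \<in> borel_measurable lebesgue"
proof -
  have hm[measurable]: "h \<in> borel_measurable borel" using h by (simp add: loc_int_def)
  show "h \<in> borel_measurable lebesgue" by (intro measurable_completion) simp
  show "locally_integrable h"
    unfolding locally_integrable_def set_integrable_def
  proof (intro allI impI)
    fix K :: "'a set" assume K: "compact K"
    then have [measurable]: "K \<in> sets borel" by (intro borel_closed compact_imp_closed)
    have "integrable lborel (\<lambda>x. indicator K x *\<^sub>R h x)" using h K by (simp add: loc_int_def)
    moreover have "(\<lambda>x. indicator K x *\<^sub>R h x) \<in> borel_measurable lborel" by measurable
    ultimately show "integrable lebesgue (\<lambda>x. indicator K x *\<^sub>R h x)" by (subst integrable_completion)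
  qed
qed

text \<open>For such functions the weak gradient, which is fixed only up to null sets, is the classical one.\<close>

lemma C1_sobolev:
  fixes f :: "'a::euclidean_space \<Rightarrow> real"
  assumes f: "C1_supported R f g" and p: "1 \<le> p"
  shows "f \<in> sobolev_space p" "supported_in f (ball 0 R)" "AE x in lborel. weak_gradient f x = g x"
proof -
  have lf: "loc_int f" and lg: "loc_int g" using C1_supportedD(1,2)[OF f] by (auto intro: continuous_loc_int)
  note Lf = loc_int_locally_integrable[OF lf] and Lg = loc_int_locally_integrable[OF lg]
  have w: "has_weak_gradient f g"
    unfolding has_weak_gradient_def
    using Lf(1) Lg(1) C1_borel_weak_gradient[OF f] borel_weak_gradient_transfer[OF lf _ Lf(2) lg _ Lg(2)] by simp
  show "supported_in f (ball 0 R)"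
    unfolding supported_in_def using C1_supportedD(4)[OF f] by (intro AE_I2) auto
  have fin: "(\<integral>\<^sup>+x. ennreal (norm (u x) powr p) \<partial>lebesgue) < top"
    if u: "continuous_on UNIV u" "\<And>x. R < norm x \<Longrightarrow> u x = 0" for u :: "'a \<Rightarrow> 'c::euclidean_space"
    unfolding nn_integral_completion using p by (intro compact_support_powr_finite[OF u]) auto
  have "f \<in> Lp_space p"
    using Lf(2) fin[of f] C1_supportedD(1,4)[OF f] p by (auto simp: Lp_space_def Lp_norm_def intro!: ennpowr_less_top)
  moreover have "g \<in> Lp_space p"
    using Lg(2) fin[of g] C1_supportedD(2)[OF f] C1_gradient_support[OF f] p by (auto simp: Lp_space_def Lp_norm_def intro!: ennpowr_less_top)
  ultimately show "f \<in> sobolev_space p" using w by (auto simp: sobolev_space_def)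
  have gw: "has_weak_gradient f (weak_gradient f)"
    unfolding weak_gradient_def using w by (rule someI[of "has_weak_gradient f"])
  then have l: "locally_integrable (weak_gradient f)" by (simp add: has_weak_gradient_def)
  obtain G where G: "loc_int G" "AE x in lborel. weak_gradient f x = G x" using loc_int_representative[OF l] .
  have "borel_weak_gradient f G"
    using gw borel_weak_gradient_transfer[OF lf _ Lf(2) G locally_integrable_measurable[OF l]] by (simp add: has_weak_gradient_def)
  from borel_weak_gradient_unique[OF G(1) this lg C1_borel_weak_gradient[OF f]]
  show "AE x in lborel. weak_gradient f x = g x" using G(2) by eventually_elim simp
qed

section \<open>Oscillating test functions\<close>

text \<open>Positive exactly on the open interval from \<open>- 1\<close> to \<open>1\<close>.\<close>

definition bump :: "real \<Rightarrow> real" where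
  "bump t = flat_exp (1 + t) * flat_exp (1 - t)"

lemma bump_facts:
  shows "smooth_line bump" "0 \<le> bump t" "bump t \<noteq> 0 \<longleftrightarrow> \<bar>t\<bar> < 1"
proof -
  have "smooth_line (\<lambda>t. flat_exp (1 * t + 1) * flat_exp (-1 * t + 1))"
    by (intro smooth_line_mult smooth_line_affine smooth_line_flat_exp)
  then show "smooth_line bump" by (simp add: bump_def[abs_def] add.commute[of _ 1])
  show "0 \<le> bump t" by (simp add: bump_def flat_exp_bounds)
  show "bump t \<noteq> 0 \<longleftrightarrow> \<bar>t\<bar> < 1" by (auto simp: bump_def flat_exp_bounds(3))
qed

lemma continuous_powr_integral_pos:
  fixes h :: "real \<Rightarrow> real"
  assumes c: "continuous_on UNIV h" and z: "\<And>t. 1 \<le> \<bar>t\<bar> \<Longrightarrow> h t = 0" and nz: "h t0 \<noteq> 0" and r: "0 < r"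
  obtains A where "0 < A" "(\<integral>\<^sup>+t. ennreal (\<bar>h t\<bar> powr r) \<partial>lborel) = ennreal A"
proof -
  have [measurable]: "h \<in> borel_measurable borel" using c by (rule borel_measurable_continuous_onI)
  have "(\<integral>\<^sup>+t. ennreal (\<bar>h t\<bar> powr r) \<partial>lborel) < top"
    using compact_support_powr_finite[OF c _ r, of 1] z by simp
  then obtain A where A: "(\<integral>\<^sup>+t. ennreal (\<bar>h t\<bar> powr r) \<partial>lborel) = ennreal A" "0 \<le> A"
    by (cases "\<integral>\<^sup>+t. ennreal (\<bar>h t\<bar> powr r) \<partial>lborel") auto
  have "A \<noteq> 0"
  proof
    assume "A = 0"
    then have "(\<integral>\<^sup>+t. ennreal (\<bar>h t\<bar> powr r) \<partial>lborel) = 0" using A by simp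
    then have "AE t in lborel. ennreal (\<bar>h t\<bar> powr r) = 0" by (subst (asm) nn_integral_0_iff_AE) auto
    then have "AE t in lborel. t \<in> {t. h t = 0}" by eventually_elim (simp add: ennreal_eq_0_iff)
    then have "AE t in lebesgue. t \<in> {t. h t = 0}" by (simp only: AE_lebesgue_iff)
    moreover have "closed {t. h t = 0}" using c by (intro closed_Collect_eq) auto
    ultimately have "t0 \<in> {t. h t = 0}" by (intro mem_closed_if_AE_lebesgue)
    then show False using nz by simp
  qed
  then show ?thesis using that[of A] A by simp
qed

lemma abs_sum_single_powr:
  fixes h :: "'i \<Rightarrow> real"
  assumes J: "finite J" and one: "\<And>i j. i \<in> J \<Longrightarrow> j \<in> J \<Longrightarrow> h i \<noteq> 0 \<Longrightarrow> h j \<noteq> 0 \<Longrightarrow> i = j"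
  shows "\<bar>\<Sum>j\<in>J. h j\<bar> powr r = (\<Sum>j\<in>J. \<bar>h j\<bar> powr r)"
proof (cases "\<exists>i\<in>J. h i \<noteq> 0")
  case True
  then obtain i where i: "i \<in> J" "h i \<noteq> 0" by auto
  have z: "h j = 0" if "j \<in> J" "j \<noteq> i" for j using one[OF that(1) i(1) _ i(2)] that by auto
  have "(\<Sum>j\<in>J. h j) = h i + (\<Sum>j\<in>J - {i}. h j)" "(\<Sum>j\<in>J. \<bar>h j\<bar> powr r) = \<bar>h i\<bar> powr r + (\<Sum>j\<in>J - {i}. \<bar>h j\<bar> powr r)"
    using J i(1) by (auto intro: sum.remove)
  then show ?thesis using z by simp
next
  case False then show ?thesis by simp
qed

text \<open>A row of \<open>m\<close> disjoint copies of a function supported in the interval from \<open>- 1\<close> to \<open>1\<close>, each of width of order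
  \<open>1 / \<kappa>\<close>.\<close>

definition train :: "(real \<Rightarrow> real) \<Rightarrow> real \<Rightarrow> nat \<Rightarrow> real \<Rightarrow> real" where
  "train h \<kappa> m t = (\<Sum>j<m. h (\<kappa> * t - 2 * real j))"

text \<open>The copies have disjoint supports, so that the power of the sum is the sum of the powers.\<close>

lemma bump_train_integral:
  fixes h :: "real \<Rightarrow> real"
  assumes c: "continuous_on UNIV h" and z: "\<And>t. 1 \<le> \<bar>t\<bar> \<Longrightarrow> h t = 0" and k: "0 < \<kappa>" and r: "0 < r"
  shows "(\<integral>\<^sup>+t. ennreal (\<bar>train h \<kappa> m t\<bar> powr r) \<partial>lborel)
    = ennreal (real m / \<kappa>) * (\<integral>\<^sup>+t. ennreal (\<bar>h t\<bar> powr r) \<partial>lborel)"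
proof -
  have [measurable]: "h \<in> borel_measurable borel" using c by (rule borel_measurable_continuous_onI)
  let ?I = "\<integral>\<^sup>+t. ennreal (\<bar>h t\<bar> powr r) \<partial>lborel"
  have one: "(\<integral>\<^sup>+t. ennreal (\<bar>h (\<kappa> * t - 2 * real j)\<bar> powr r) \<partial>lborel) = ennreal (1 / \<kappa>) * ?I" for j
  proof -
    have "?I = ennreal \<bar>\<kappa>\<bar> * (\<integral>\<^sup>+t. ennreal (\<bar>h (- 2 * real j + \<kappa> * t)\<bar> powr r) \<partial>lborel)"
      using k by (intro nn_integral_real_affine) auto
    then have "ennreal (1 / \<kappa>) * ?I = ennreal (1 / \<kappa>) * (ennreal \<kappa> * (\<integral>\<^sup>+t. ennreal (\<bar>h (\<kappa> * t - 2 * real j)\<bar> powr r) \<partial>lborel))"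
      using k by (simp add: algebra_simps)
    also have "\<dots> = (\<integral>\<^sup>+t. ennreal (\<bar>h (\<kappa> * t - 2 * real j)\<bar> powr r) \<partial>lborel)"
      using k by (simp add: mult.assoc[symmetric] flip: ennreal_mult')
    finally show ?thesis by simp
  qed
  have "\<bar>\<Sum>j<m. h (\<kappa> * t - 2 * real j)\<bar> powr r = (\<Sum>j<m. \<bar>h (\<kappa> * t - 2 * real j)\<bar> powr r)" for t
  proof (rule abs_sum_single_powr)
    fix i j assume "h (\<kappa> * t - 2 * real i) \<noteq> 0" "h (\<kappa> * t - 2 * real j) \<noteq> 0"
    then have "\<bar>\<kappa> * t - 2 * real i\<bar> < 1" "\<bar>\<kappa> * t - 2 * real j\<bar> < 1" using z by (meson not_le)+
    then have "\<bar>real i - real j\<bar> < 1" by linarith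
    then show "i = j" by linarith
  qed simp
  then have "(\<integral>\<^sup>+t. ennreal (\<bar>\<Sum>j<m. h (\<kappa> * t - 2 * real j)\<bar> powr r) \<partial>lborel)
     = (\<integral>\<^sup>+t. (\<Sum>j<m. ennreal (\<bar>h (\<kappa> * t - 2 * real j)\<bar> powr r)) \<partial>lborel)" by simp
  also have "\<dots> = (\<Sum>j<m. \<integral>\<^sup>+t. ennreal (\<bar>h (\<kappa> * t - 2 * real j)\<bar> powr r) \<partial>lborel)"
    by (rule nn_integral_sum) measurable
  also have "\<dots> = of_nat m * (ennreal (1 / \<kappa>) * ?I)" by (simp only: one sum_constant card_lessThan)
  also have "\<dots> = ennreal (real m / \<kappa>) * ?I"
    using k by (simp add: ennreal_of_nat_eq_real_of_nat mult.assoc[symmetric] flip: ennreal_mult')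
  finally show ?thesis unfolding train_def .
qed

text \<open>The derivative vanishes off the interval where the bump is positive because the bump, which is nonnegative, has
  a minimum there. It is not identically zero, since otherwise the bump would be constant.\<close>

lemma bump_derivative:
  obtains \<eta> where "\<And>t. (bump has_real_derivative \<eta> t) (at t)" "continuous_on UNIV \<eta>"
    "\<And>t. 1 \<le> \<bar>t\<bar> \<Longrightarrow> \<eta> t = 0" "\<exists>t. \<eta> t \<noteq> 0"
proof -
  obtain F d where F: "bump \<in> F" "\<forall>v\<in>F. d v \<in> F" "\<forall>v\<in>F. \<forall>x. (v has_real_derivative d v x) (at x)"
    using bump_facts(1) by (rule smooth_lineE)
  have der: "(bump has_real_derivative d bump t) (at t)" for t using F(3)[THEN bspec, OF F(1)] by (rule spec)
  have dF: "d bump \<in> F" using F(2) F(1) by (rule bspec)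
  have "\<forall>x. (d bump has_real_derivative d (d bump) x) (at x)" using F(3) dF by (rule bspec)
  then have cont: "continuous_on UNIV (d bump)"
    by (auto intro!: continuous_at_imp_continuous_on DERIV_isCont)
  have zero: "d bump t = 0" if "1 \<le> \<bar>t\<bar>" for t
  proof -
    have "bump t = 0" using bump_facts(3)[of t] that by auto
    then show ?thesis
      using DERIV_local_min[OF der[of t], of 1] bump_facts(2) by simp
  qed
  have "\<exists>t. d bump t \<noteq> 0"
  proof (rule ccontr)
    assume "\<nexists>t. d bump t \<noteq> 0"
    then have "(bump has_real_derivative 0) (at t)" for t using der[of t] by simp
    then have "bump 0 = bump 1" by (intro DERIV_isconst_all) auto
    then show False using bump_facts(3)[of 0] bump_facts(3)[of 1] by simp
  qed
  from that[OF der cont zero this] show ?thesis .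
qed

lemma train_continuous: "continuous_on UNIV h \<Longrightarrow> continuous_on UNIV (train h \<kappa> m)"
  unfolding train_def[abs_def]
  by (rule continuous_on_sum, erule continuous_on_compose2[of UNIV h], intro continuous_intros, simp)

lemma train_derivative:
  assumes "\<And>t. (h has_real_derivative h' t) (at t)"
  shows "(train h \<kappa> m has_real_derivative \<kappa> * train h' \<kappa> m t) (at t)"
proof -
  have "((\<lambda>t. h (\<kappa> * t - 2 * real j)) has_real_derivative h' (\<kappa> * t - 2 * real j) * \<kappa>) (at t)" for j
    by (rule DERIV_chain2[OF assms]) (auto intro!: derivative_eq_intros)
  then have "((\<lambda>t. \<Sum>j<m. h (\<kappa> * t - 2 * real j)) has_real_derivative (\<Sum>j<m. h' (\<kappa> * t - 2 * real j) * \<kappa>)) (at t)"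
    by (intro DERIV_sum)
  then show ?thesis unfolding train_def[abs_def] sum_distrib_left by (simp only: mult.commute[of \<kappa>])
qed

lemma train_support:
  assumes "\<And>t. 1 \<le> \<bar>t\<bar> \<Longrightarrow> h t = 0" and t: "train h \<kappa> m t \<noteq> 0" and k: "0 < \<kappa>"
  shows "\<bar>t\<bar> < 2 * real m / \<kappa>"
proof -
  have "\<exists>j<m. h (\<kappa> * t - 2 * real j) \<noteq> 0"
    using t unfolding train_def by (metis lessThan_iff sum.neutral)
  then obtain j where j: "j < m" "h (\<kappa> * t - 2 * real j) \<noteq> 0" by auto
  then have "\<bar>\<kappa> * t - 2 * real j\<bar> < 1" using assms(1) by (meson not_le)
  moreover have "real j + 1 \<le> real m" using j(1) by simp
  ultimately have "\<bar>\<kappa> * t\<bar> < 2 * real m" by linarith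
  then show ?thesis using k by (simp add: abs_mult pos_less_divide_eq mult.commute)
qed

text \<open>The components of the gradient are again products of functions of one coordinate, so that their
  norms can be computed exactly.\<close>

lemma product_function_C1:
  fixes u u' :: "'a::euclidean_space \<Rightarrow> real \<Rightarrow> real"
  assumes der: "\<And>b t. b \<in> Basis \<Longrightarrow> (u b has_real_derivative u' b t) (at t)"
    and c': "\<And>b. b \<in> Basis \<Longrightarrow> continuous_on UNIV (u' b)"
    and supp: "\<And>b t. b \<in> Basis \<Longrightarrow> u b t \<noteq> 0 \<Longrightarrow> \<bar>t\<bar> < r"
  shows "C1_supported (real DIM('a) * r) (\<lambda>x. \<Prod>b\<in>Basis. u b (x \<bullet> b))
    (\<lambda>x. \<Sum>b\<in>Basis. (\<Prod>c\<in>Basis. (u(b := u' b)) c (x \<bullet> c)) *\<^sub>R b)"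
proof -
  let ?f = "\<lambda>x. \<Prod>b\<in>Basis. u b (x \<bullet> b)" and ?g = "\<lambda>x. \<Sum>b\<in>Basis. (\<Prod>c\<in>Basis. (u(b := u' b)) c (x \<bullet> c)) *\<^sub>R b"
  have c: "continuous_on UNIV (u b)" if "b \<in> Basis" for b
    using der[OF that] by (auto intro!: continuous_at_imp_continuous_on DERIV_isCont)
  have cc: "continuous_on UNIV ((u(b := u' b)) c)" if "b \<in> Basis" "c \<in> Basis" for b c
    using c[OF that(2)] c'[OF that(1)] by (cases "c = b") simp_all
  have "continuous_on UNIV ?f"
    by (rule continuous_on_prod, rule continuous_on_compose2[OF c]) (auto intro: continuous_intros)
  moreover have "continuous_on UNIV ?g"
    by (rule continuous_on_sum, rule continuous_on_scaleR, rule continuous_on_prod, rule continuous_on_compose2[OF cc])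
      (auto intro: continuous_intros simp del: fun_upd_apply)
  moreover have "((\<lambda>t. ?f (x + t *\<^sub>R b)) has_real_derivative ?g (x + t *\<^sub>R b) \<bullet> b) (at t)" for x b :: 'a and t
  proof -
    have l: "((\<lambda>t. x + t *\<^sub>R b) has_derivative (\<lambda>s. s *\<^sub>R b)) (at t)" by (auto intro!: derivative_eq_intros)
    have "((\<lambda>x. ?f x) has_derivative
        (\<lambda>y. \<Sum>c\<in>Basis. (y \<bullet> c) * (\<Prod>d\<in>Basis. (u(c := u' c)) d ((x + t *\<^sub>R b) \<bullet> d)))) (at (x + t *\<^sub>R b))"
      by (rule has_derivative_product_function[OF der])
    from has_derivative_compose[OF l this]
    show ?thesis
      unfolding has_field_derivative_def
      by (rule has_derivative_eq_rhs)
        (simp add: fun_eq_iff inner_sum_left inner_sum_right sum_distrib_left inner_commute[of b] mult_ac del: fun_upd_apply)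
  qed
  moreover have "?f x = 0" if x: "real DIM('a) * r \<le> norm x" for x
  proof (rule ccontr)
    assume "?f x \<noteq> 0"
    then have "u b (x \<bullet> b) \<noteq> 0" if "b \<in> Basis" for b using that by (simp add: prod_zero_iff)
    then have "\<bar>x \<bullet> b\<bar> < r" if "b \<in> Basis" for b using supp[OF that] that by simp
    then have "(\<Sum>b\<in>Basis. \<bar>x \<bullet> b\<bar>) < (\<Sum>b\<in>(Basis::'a set). r)" by (intro sum_strict_mono) auto
    then show False using x norm_le_l1[of x] by simp
  qed
  ultimately show ?thesis unfolding C1_supported_def by (intro conjI allI impI)
qed

lemma C1_Lp_norms:
  fixes f :: "'a::euclidean_space \<Rightarrow> real"
  assumes f: "C1_supported R f g" and p: "1 \<le> p"
  shows "Lp_norm q f = ennpowr (\<integral>\<^sup>+x. ennreal (\<bar>f x\<bar> powr q) \<partial>lborel) (1 / q)"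
    "grad_energy p (weak_gradient f) \<xi> = (\<integral>\<^sup>+x. ennreal (\<bar>g x \<bullet> \<xi>\<bar> powr p) \<partial>lborel)"
    "Lp_norm p (weak_gradient f) = ennpowr (\<integral>\<^sup>+x. ennreal (norm (g x) powr p) \<partial>lborel) (1 / p)"
proof -
  have ae: "AE x in lebesgue. weak_gradient f x = g x"
    using C1_sobolev(3)[OF f p] by (rule AE_lebesgue_iff[THEN iffD2])
  show "Lp_norm q f = ennpowr (\<integral>\<^sup>+x. ennreal (\<bar>f x\<bar> powr q) \<partial>lborel) (1 / q)"
    by (simp add: Lp_norm_def nn_integral_completion)
  have "grad_energy p (weak_gradient f) \<xi> = (\<integral>\<^sup>+x. ennreal (\<bar>g x \<bullet> \<xi>\<bar> powr p) \<partial>lebesgue)"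
    unfolding grad_energy_def by (rule nn_integral_cong_AE) (use ae in eventually_elim, simp)
  then show "grad_energy p (weak_gradient f) \<xi> = (\<integral>\<^sup>+x. ennreal (\<bar>g x \<bullet> \<xi>\<bar> powr p) \<partial>lborel)"
    by (simp only: nn_integral_completion)
  have "(\<integral>\<^sup>+x. ennreal (norm (weak_gradient f x) powr p) \<partial>lebesgue) = (\<integral>\<^sup>+x. ennreal (norm (g x) powr p) \<partial>lebesgue)"
    by (rule nn_integral_cong_AE) (use ae in eventually_elim, simp)
  then show "Lp_norm p (weak_gradient f) = ennpowr (\<integral>\<^sup>+x. ennreal (norm (g x) powr p) \<partial>lborel) (1 / p)"
    by (simp only: Lp_norm_def nn_integral_completion)
qed

lemma nn_integral_product_powr:
  fixes v :: "'a::euclidean_space \<Rightarrow> real \<Rightarrow> real"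
  assumes c: "\<And>b. b \<in> Basis \<Longrightarrow> continuous_on UNIV (v b)"
  shows "(\<integral>\<^sup>+x. ennreal (\<bar>\<Prod>b\<in>Basis. v b (x \<bullet> b)\<bar> powr r) \<partial>lborel)
    = (\<Prod>b\<in>Basis. \<integral>\<^sup>+t. ennreal (\<bar>v b t\<bar> powr r) \<partial>lborel)"
proof -
  have m: "(\<lambda>t. ennreal (\<bar>v b t\<bar> powr r)) \<in> borel_measurable borel" if "b \<in> Basis" for b
  proof -
    have [measurable]: "v b \<in> borel_measurable borel" using c[OF that] by (rule borel_measurable_continuous_onI)
    show ?thesis by measurable
  qed
  have "ennreal (\<bar>\<Prod>b\<in>Basis. v b (x \<bullet> b)\<bar> powr r) = (\<Prod>b\<in>Basis. ennreal (\<bar>v b (x \<bullet> b)\<bar> powr r))" for x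
    by (simp add: abs_prod prod_powr_distrib prod_ennreal)
  then show ?thesis using nn_integral_lborel_prod[OF m] by simp
qed

text \<open>The function is a product of bumps of unit width in the coordinate directions other than \<open>b0\<close> and of \<open>m\<close> bumps of
  width \<open>1 / k\<close> in the direction \<open>b0\<close>, scaled to fit into the ball. With \<open>r = m / k\<close>, the integral of
  \<open>|f| powr q\<close> is of order \<open>r\<close>, and so are those of the \<open>p\<close>-th powers of the partial derivatives in directions other than \<open>b0\<close>,
  whereas the one in the direction \<open>b0\<close> is larger by the factor \<open>k powr p\<close>. For directions \<open>\<xi>\<close> with
  \<open>|\<xi> \<bullet> b0| \<le> 1 / k\<close> this factor is compensated, so that \<open>affine_energy_le\<close> applies with \<open>\<delta> = 1 / k\<close>.\<close>

lemma bump_train_function: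
  fixes b0 :: "'a::euclidean_space" and p q R :: real
  assumes N2: "2 \<le> DIM('a)" and p: "1 \<le> p" and q: "1 \<le> q" and R: "0 < R" and b0: "b0 \<in> Basis"
  obtains A P C where "0 < A" "0 < P" "0 < C"
    "\<And>m k. \<lbrakk>1 \<le> m; m \<le> k\<rbrakk> \<Longrightarrow> \<exists>f :: 'a \<Rightarrow> real. f \<in> sobolev_space p \<and> supported_in f (ball 0 R) \<and>
       Lp_norm q f = ennreal (A * (real m / real k) powr (1 / q)) \<and>
       ennreal (P * (real m / real k) powr (1 / p) * real k) \<le> Lp_norm p (weak_gradient f) \<and>
       affine_energy p f \<le> ennreal (C * (real m / real k) powr (1 / p) * real k powr (1 / real DIM('a)))"
proof -
  let ?N = "real DIM('a)"
  have N: "0 < ?N" by simp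
  have p0: "0 < p" and q0: "0 < q" using p q by auto
  obtain \<eta> where \<eta>: "\<And>t. (bump has_real_derivative \<eta> t) (at t)" "continuous_on UNIV \<eta>"
    "\<And>t. 1 \<le> \<bar>t\<bar> \<Longrightarrow> \<eta> t = 0" "\<exists>t. \<eta> t \<noteq> 0" by (rule bump_derivative) blast
  obtain t1 where t1: "\<eta> t1 \<noteq> 0" using \<eta>(4) ..
  have bc: "continuous_on UNIV bump" using bump_facts(1) by (rule smooth_line_continuous)
  have bz: "bump t = 0" if "1 \<le> \<bar>t\<bar>" for t using bump_facts(3)[of t] that by auto
  have b1: "bump 0 \<noteq> 0" using bump_facts(3)[of 0] by simp
  obtain Iq where Iq: "0 < Iq" "(\<integral>\<^sup>+t. ennreal (\<bar>bump t\<bar> powr q) \<partial>lborel) = ennreal Iq"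
    using continuous_powr_integral_pos[OF bc bz b1 q0] .
  obtain Ip where Ip: "0 < Ip" "(\<integral>\<^sup>+t. ennreal (\<bar>bump t\<bar> powr p) \<partial>lborel) = ennreal Ip"
    using continuous_powr_integral_pos[OF bc bz b1 p0] .
  obtain Jp where Jp: "0 < Jp" "(\<integral>\<^sup>+t. ennreal (\<bar>\<eta> t\<bar> powr p) \<partial>lborel) = ennreal Jp"
    using continuous_powr_integral_pos[OF \<eta>(2,3) t1 p0] .
  obtain C where C: "0 < C" "\<And>(f :: 'a \<Rightarrow> real) \<delta> \<Lambda>.
    \<lbrakk>0 < \<delta>; \<delta> \<le> 1; 0 < \<Lambda>;
     \<And>\<xi>. norm \<xi> = 1 \<Longrightarrow> \<bar>\<xi> \<bullet> b0\<bar> \<le> \<delta> \<Longrightarrow> grad_energy p (weak_gradient f) \<xi> \<le> ennreal (\<Lambda> powr p)\<rbrakk> \<Longrightarrow>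
     affine_energy p f \<le> ennreal (C * \<Lambda> * \<delta> powr (- 1 / ?N))"
    by (rule affine_energy_le[OF N2 p b0]) blast
  \<comment> \<open>Supports reach at most \<open>2 * a\<close> in each coordinate, and the norm is at most the sum of the \<open>N\<close> coordinates.\<close>
  define a where "a = R / (2 * ?N)"
  have a: "0 < a" using R by (simp add: a_def)
  define S where "S = a ^ DIM('a) * Ip ^ (DIM('a) - 1) * Jp / a powr p"
  define A where "A = (a ^ DIM('a) * Iq ^ DIM('a)) powr (1 / q)"
  define D where "D = (?N powr p * ?N * S) powr (1 / p)"
  have S: "0 < S" using a Ip Jp by (simp add: S_def)
  have A: "0 < A" using a Iq by (simp add: A_def)
  have D: "0 < D" using S N by (simp add: D_def)
  show ?thesis
  proof (rule that[OF A, of "S powr (1 / p)" "C * D"])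
    show "0 < S powr (1 / p)" "0 < C * D" using S C D by auto
    fix m k :: nat assume mk: "1 \<le> m" "m \<le> k"
    define \<tau> where "\<tau> b = (if b = b0 then real k / a else 1 / a)" for b :: 'a
    define \<mu> where "\<mu> b = (if b = b0 then m else 1)" for b :: 'a
    define u where "u b = train bump (\<tau> b) (\<mu> b)" for b
    define u' where "u' b t = \<tau> b * train \<eta> (\<tau> b) (\<mu> b) t" for b t
    define f where "f x = (\<Prod>b\<in>Basis. u b (x \<bullet> b))" for x
    define g where "g x = (\<Sum>b\<in>Basis. (\<Prod>c\<in>Basis. (u(b := u' b)) c (x \<bullet> c)) *\<^sub>R b)" for x
    \<comment> \<open>The fraction of the length occupied by the bumps in the direction \<open>b0\<close>.\<close>
    define r where "r = real m / real k"
    have k: "0 < real k" and r: "0 < r" using mk by (auto simp: r_def)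
    have r1: "r \<le> 1" using mk by (simp add: r_def)
    have \<tau>: "0 < \<tau> b" for b using k a by (simp add: \<tau>_def)
    have \<mu>\<tau>: "real (\<mu> b) / \<tau> b = (if b = b0 then a * r else a)" for b
      using a k by (simp add: \<mu>_def \<tau>_def r_def)
    have "C1_supported (?N * (2 * a)) (\<lambda>x. \<Prod>b\<in>Basis. u b (x \<bullet> b))
      (\<lambda>x. \<Sum>b\<in>Basis. (\<Prod>c\<in>Basis. (u(b := u' b)) c (x \<bullet> c)) *\<^sub>R b)"
    proof (rule product_function_C1)
      fix b :: 'a and t
      show "(u b has_real_derivative u' b t) (at t)"
        unfolding u_def u'_def by (rule train_derivative[OF \<eta>(1)])
      show "continuous_on UNIV (u' b)"
        unfolding u'_def[abs_def] by (intro continuous_on_mult_left train_continuous \<eta>(2))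
      assume "u b t \<noteq> 0"
      then have "\<bar>t\<bar> < 2 * (real (\<mu> b) / \<tau> b)"
        using train_support[where h = bump and \<kappa> = "\<tau> b" and m = "\<mu> b" and t = t] bz \<tau>[of b] by (simp add: u_def)
      also have "\<dots> \<le> 2 * a" using a r1 by (simp add: \<mu>\<tau> mult_left_le)
      finally show "\<bar>t\<bar> < 2 * a" .
    qed
    moreover have "?N * (2 * a) = R" using N by (simp add: a_def)
    ultimately have f: "C1_supported R f g" unfolding f_def[abs_def] g_def[abs_def] by simp
    have uc: "continuous_on UNIV (u b)" for b unfolding u_def by (rule train_continuous[OF bc])
    have u'c: "continuous_on UNIV (u' b)" for b
      unfolding u'_def[abs_def] by (intro continuous_on_mult_left train_continuous \<eta>(2))
    have ti: "(\<integral>\<^sup>+t. ennreal (\<bar>train h (\<tau> b) (\<mu> b) t\<bar> powr s) \<partial>lborel) = ennreal ((if b = b0 then a * r else a) * I)"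
      if "continuous_on UNIV h" "\<And>t. 1 \<le> \<bar>t\<bar> \<Longrightarrow> h t = 0" "0 < s" "(\<integral>\<^sup>+t. ennreal (\<bar>h t\<bar> powr s) \<partial>lborel) = ennreal I"
      for h :: "real \<Rightarrow> real" and b s I
    proof -
      have "(\<integral>\<^sup>+t. ennreal (\<bar>train h (\<tau> b) (\<mu> b) t\<bar> powr s) \<partial>lborel) = ennreal (real (\<mu> b) / \<tau> b) * ennreal I"
        unfolding that(4)[symmetric] using that(1-2) \<tau> that(3) by (rule bump_train_integral)
      also have "\<dots> = ennreal ((if b = b0 then a * r else a) * I)"
        unfolding \<mu>\<tau> using a r by (intro ennreal_mult'[symmetric]) auto
      finally show ?thesis .
    qed
    have up: "(\<integral>\<^sup>+t. ennreal (\<bar>u b t\<bar> powr p) \<partial>lborel) = ennreal ((if b = b0 then a * r else a) * Ip)" for b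
      unfolding u_def by (rule ti[OF bc bz p0 Ip(2)])
    have uq: "(\<integral>\<^sup>+t. ennreal (\<bar>u b t\<bar> powr q) \<partial>lborel) = ennreal ((if b = b0 then a * r else a) * Iq)" for b
      unfolding u_def by (rule ti[OF bc bz q0 Iq(2)])
    have u'p: "(\<integral>\<^sup>+t. ennreal (\<bar>u' b t\<bar> powr p) \<partial>lborel)
        = ennreal (\<tau> b powr p * ((if b = b0 then a * r else a) * Jp))" for b
    proof -
      have [measurable]: "train \<eta> (\<tau> b) (\<mu> b) \<in> borel_measurable borel"
        by (intro borel_measurable_continuous_onI train_continuous \<eta>(2))
      have "(\<integral>\<^sup>+t. ennreal (\<bar>u' b t\<bar> powr p) \<partial>lborel)
          = (\<integral>\<^sup>+t. ennreal (\<tau> b powr p) * ennreal (\<bar>train \<eta> (\<tau> b) (\<mu> b) t\<bar> powr p) \<partial>lborel)"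
        using \<tau>[of b] by (intro nn_integral_cong) (simp add: u'_def abs_mult powr_mult ennreal_mult')
      also have "\<dots> = ennreal (\<tau> b powr p) * (\<integral>\<^sup>+t. ennreal (\<bar>train \<eta> (\<tau> b) (\<mu> b) t\<bar> powr p) \<partial>lborel)"
        by (rule nn_integral_cmult) measurable
      also have "(\<integral>\<^sup>+t. ennreal (\<bar>train \<eta> (\<tau> b) (\<mu> b) t\<bar> powr p) \<partial>lborel) = ennreal ((if b = b0 then a * r else a) * Jp)"
        by (rule ti[OF \<eta>(2,3) p0 Jp(2)])
      finally show ?thesis by (simp flip: ennreal_mult')
    qed
    have prod_if: "(\<Prod>b\<in>(Basis::'a set). (if b = b0 then a * r else a) * z) = a ^ DIM('a) * r * z ^ DIM('a)" for z
    proof -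
      have "(\<Prod>b\<in>(Basis::'a set). (if b = b0 then a * r else a) * z) = (\<Prod>b\<in>(Basis::'a set). (a * z) * (if b = b0 then r else 1))"
        by (intro prod.cong) auto
      then show ?thesis using b0 by (simp add: prod.distrib power_mult_distrib)
    qed
    have "(\<integral>\<^sup>+x. ennreal (\<bar>f x\<bar> powr q) \<partial>lborel) = (\<Prod>b\<in>(Basis::'a set). ennreal ((if b = b0 then a * r else a) * Iq))"
      unfolding f_def nn_integral_product_powr[OF uc] by (simp only: uq)
    also have "\<dots> = ennreal (a ^ DIM('a) * r * Iq ^ DIM('a))"
      using a r Iq(1) by (subst prod_ennreal) (auto simp only: prod_if, auto)
    finally have fq: "Lp_norm q f = ennreal ((a ^ DIM('a) * r * Iq ^ DIM('a)) powr (1 / q))"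
      unfolding C1_Lp_norms(1)[OF f p] using a r Iq(1) q0 by (simp add: ennpowr_ennreal)
    have gb: "g x \<bullet> b = (\<Prod>c\<in>Basis. (u(b := u' b)) c (x \<bullet> c))" if "b \<in> Basis" for x b
      unfolding g_def using that by (simp add: inner_sum_left inner_Basis if_distrib[where f = "\<lambda>y. _ * y"] cong: if_cong del: fun_upd_apply)
    have gint: "(\<integral>\<^sup>+x. ennreal (\<bar>g x \<bullet> b\<bar> powr p) \<partial>lborel) = ennreal ((a * \<tau> b) powr p * (r * S))" if b: "b \<in> Basis" for b
    proof -
      have cc: "continuous_on UNIV ((u(b := u' b)) c)" for c using uc[of c] u'c[of b] by (cases "c = b") auto
      have "(\<integral>\<^sup>+x. ennreal (\<bar>g x \<bullet> b\<bar> powr p) \<partial>lborel) = (\<Prod>c\<in>Basis. \<integral>\<^sup>+t. ennreal (\<bar>(u(b := u' b)) c t\<bar> powr p) \<partial>lborel)"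
        unfolding gb[OF b] by (rule nn_integral_product_powr[OF cc])
      also have "\<dots> = (\<Prod>c\<in>(Basis::'a set). ennreal ((if c = b0 then a * r else a) * Ip * (if c = b then \<tau> b powr p * Jp / Ip else 1)))"
      proof (rule prod.cong)
        fix c :: 'a
        show "(\<integral>\<^sup>+t. ennreal (\<bar>(u(b := u' b)) c t\<bar> powr p) \<partial>lborel)
            = ennreal ((if c = b0 then a * r else a) * Ip * (if c = b then \<tau> b powr p * Jp / Ip else 1))"
          using up[of c] u'p[of b] Ip(1) by (cases "c = b") (simp_all add: mult_ac)
      qed simp
      also have "\<dots> = ennreal ((\<Prod>c\<in>(Basis::'a set). (if c = b0 then a * r else a) * Ip) * (\<Prod>c\<in>Basis. if c = b then \<tau> b powr p * Jp / Ip else 1))"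
        using a r Ip(1) Jp(1) by (subst prod_ennreal) (auto simp: prod.distrib)
      also have "(\<Prod>c\<in>Basis. if c = b then \<tau> b powr p * Jp / Ip else 1) = \<tau> b powr p * Jp / Ip" using b by simp
      also have "Ip ^ DIM('a) = Ip * Ip ^ (DIM('a) - 1)" using N2 by (simp flip: power_Suc)
      then have "(\<Prod>c\<in>(Basis::'a set). (if c = b0 then a * r else a) * Ip) * (\<tau> b powr p * Jp / Ip) = (a * \<tau> b) powr p * (r * S)"
        unfolding prod_if S_def using a Ip(1) \<tau>[of b] by (simp add: powr_mult field_simps)
      finally show ?thesis .
    qed
    have a\<tau>: "a * \<tau> b = (if b = b0 then real k else 1)" for b using a by (simp add: \<tau>_def)
    have gm[measurable]: "g \<in> borel_measurable borel" by (rule C1_supportedD(6)[OF f])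
    have "ennreal (S powr (1 / p) * r powr (1 / p) * real k) = ennpowr (\<integral>\<^sup>+x. ennreal (\<bar>g x \<bullet> b0\<bar> powr p) \<partial>lborel) (1 / p)"
      unfolding gint[OF b0] a\<tau> using k r S p0 by (simp add: ennpowr_ennreal powr_mult powr_powr mult_ac)
    also have "\<dots> \<le> Lp_norm p (weak_gradient f)"
      unfolding C1_Lp_norms(3)[OF f p]
      using b0 p0 by (intro ennpowr_mono nn_integral_mono ennreal_leI powr_mono2) (auto simp: Basis_le_norm)
    finally have lower: "ennreal (S powr (1 / p) * r powr (1 / p) * real k) \<le> Lp_norm p (weak_gradient f)" .
    have "affine_energy p f \<le> ennreal (C * (D * r powr (1 / p)) * (1 / real k) powr (- 1 / ?N))"
    proof (rule C(2))
      show "0 < 1 / real k" "1 / real k \<le> 1" "0 < D * r powr (1 / p)" using mk D r by auto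
      fix \<xi> :: 'a assume \<xi>: "norm \<xi> = 1" "\<bar>\<xi> \<bullet> b0\<bar> \<le> 1 / real k"
      have pt: "\<bar>g x \<bullet> \<xi>\<bar> powr p \<le> (\<Sum>b\<in>Basis. (?N powr p * \<bar>\<xi> \<bullet> b\<bar> powr p) * \<bar>g x \<bullet> b\<bar> powr p)" for x
      proof -
        have "g x \<bullet> \<xi> = (\<Sum>b\<in>Basis. (g x \<bullet> b) * (\<xi> \<bullet> b))" by (rule euclidean_inner)
        then have "\<bar>g x \<bullet> \<xi>\<bar> \<le> (\<Sum>b\<in>Basis. \<bar>\<xi> \<bullet> b\<bar> * \<bar>g x \<bullet> b\<bar>)"
          using sum_abs[of "\<lambda>b. (g x \<bullet> b) * (\<xi> \<bullet> b)" Basis] by (simp add: abs_mult mult.commute)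
        then have "\<bar>g x \<bullet> \<xi>\<bar> powr p \<le> (\<Sum>b\<in>Basis. \<bar>\<xi> \<bullet> b\<bar> * \<bar>g x \<bullet> b\<bar>) powr p"
          using p0 by (intro powr_mono2) auto
        also have "\<dots> \<le> ?N powr p * (\<Sum>b\<in>Basis. (\<bar>\<xi> \<bullet> b\<bar> * \<bar>g x \<bullet> b\<bar>) powr p)"
          using p0 by (intro sum_powr_le) auto
        finally show ?thesis by (simp add: powr_mult sum_distrib_left mult.assoc)
      qed
      have "grad_energy p (weak_gradient f) \<xi> \<le> (\<integral>\<^sup>+x. (\<Sum>b\<in>Basis. ennreal (?N powr p * \<bar>\<xi> \<bullet> b\<bar> powr p) * ennreal (\<bar>g x \<bullet> b\<bar> powr p)) \<partial>lborel)"
        unfolding C1_Lp_norms(2)[OF f p]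
      proof (rule nn_integral_mono)
        fix x
        have "(\<Sum>b\<in>Basis. ennreal (?N powr p * \<bar>\<xi> \<bullet> b\<bar> powr p) * ennreal (\<bar>g x \<bullet> b\<bar> powr p))
            = ennreal (\<Sum>b\<in>Basis. (?N powr p * \<bar>\<xi> \<bullet> b\<bar> powr p) * \<bar>g x \<bullet> b\<bar> powr p)"
          by (simp only: sum_ennreal[symmetric] ennreal_mult' powr_ge_zero mult_nonneg_nonneg)
        then show "ennreal (\<bar>g x \<bullet> \<xi>\<bar> powr p) \<le> (\<Sum>b\<in>Basis. ennreal (?N powr p * \<bar>\<xi> \<bullet> b\<bar> powr p) * ennreal (\<bar>g x \<bullet> b\<bar> powr p))"
          using ennreal_leI[OF pt[of x]] by simp
      qed
      also have "\<dots> = (\<Sum>b\<in>Basis. \<integral>\<^sup>+x. ennreal (?N powr p * \<bar>\<xi> \<bullet> b\<bar> powr p) * ennreal (\<bar>g x \<bullet> b\<bar> powr p) \<partial>lborel)"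
        by (rule nn_integral_sum) measurable
      also have "\<dots> \<le> (\<Sum>b\<in>(Basis::'a set). ennreal (?N powr p * (r * S)))"
      proof (rule sum_mono)
        fix b :: 'a assume b: "b \<in> Basis"
        have "\<bar>\<xi> \<bullet> b\<bar> powr p * (a * \<tau> b) powr p = (\<bar>\<xi> \<bullet> b\<bar> * (a * \<tau> b)) powr p" using \<tau>[of b] a by (simp add: powr_mult)
        also have "\<dots> \<le> 1 powr p"
          using \<xi> k p0 Basis_le_norm[OF b, of \<xi>] by (intro powr_mono2) (auto simp: a\<tau> field_simps)
        finally have "\<bar>\<xi> \<bullet> b\<bar> powr p * (a * \<tau> b) powr p \<le> 1" by simp
        then have le: "?N powr p * (r * S) * (\<bar>\<xi> \<bullet> b\<bar> powr p * (a * \<tau> b) powr p) \<le> ?N powr p * (r * S) * 1"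
          using r S by (intro mult_left_mono) auto
        have "(\<integral>\<^sup>+x. ennreal (?N powr p * \<bar>\<xi> \<bullet> b\<bar> powr p) * ennreal (\<bar>g x \<bullet> b\<bar> powr p) \<partial>lborel)
           = ennreal (?N powr p * \<bar>\<xi> \<bullet> b\<bar> powr p) * (\<integral>\<^sup>+x. ennreal (\<bar>g x \<bullet> b\<bar> powr p) \<partial>lborel)"
          by (rule nn_integral_cmult) measurable
        also have "\<dots> = ennreal (?N powr p * (r * S) * (\<bar>\<xi> \<bullet> b\<bar> powr p * (a * \<tau> b) powr p))"
          unfolding gint[OF b] by (subst ennreal_mult'[symmetric]) (auto simp: mult_ac)
        also have "\<dots> \<le> ennreal (?N powr p * (r * S))" using ennreal_leI[OF le] by simp
        finally show "(\<integral>\<^sup>+x. ennreal (?N powr p * \<bar>\<xi> \<bullet> b\<bar> powr p) * ennreal (\<bar>g x \<bullet> b\<bar> powr p) \<partial>lborel)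
          \<le> ennreal (?N powr p * (r * S))" .
      qed
      also have "\<dots> = ennreal (\<Sum>b\<in>(Basis::'a set). ?N powr p * (r * S))"
        using r S by (intro sum_ennreal) auto
      also have "(\<Sum>b\<in>(Basis::'a set). ?N powr p * (r * S)) = (D * r powr (1 / p)) powr p"
        using r S p0 N by (simp add: D_def powr_mult powr_powr)
      finally show "grad_energy p (weak_gradient f) \<xi> \<le> ennreal ((D * r powr (1 / p)) powr p)" .
    qed
    also have "(1 / real k) powr (- 1 / ?N) = real k powr (1 / ?N)"
      using k by (simp add: powr_divide powr_minus_divide)
    finally have upper: "affine_energy p f \<le> ennreal (C * D * r powr (1 / p) * real k powr (1 / ?N))"
      by (simp add: mult_ac)
    have "(a ^ DIM('a) * r * Iq ^ DIM('a)) powr (1 / q) = A * r powr (1 / q)"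
      using a r Iq(1) by (simp add: A_def powr_mult)
    then show "\<exists>f :: 'a \<Rightarrow> real. f \<in> sobolev_space p \<and> supported_in f (ball 0 R) \<and>
       Lp_norm q f = ennreal (A * (real m / real k) powr (1 / q)) \<and>
       ennreal (S powr (1 / p) * (real m / real k) powr (1 / p) * real k) \<le> Lp_norm p (weak_gradient f) \<and>
       affine_energy p f \<le> ennreal (C * D * (real m / real k) powr (1 / p) * real k powr (1 / real DIM('a)))"
      using fq lower upper C1_sobolev(1,2)[OF f p] unfolding r_def[symmetric]
      by (intro exI[of _ f]) (simp only: simp_thms)
  qed
qed

section \<open>Necessity of the conditions on the exponent\<close>

lemma powr_growth_le:
  fixes \<alpha> \<beta> K :: real
  assumes "\<And>k::nat. 1 \<le> k \<Longrightarrow> real k powr \<alpha> \<le> K * real k powr \<beta>"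
  shows "\<alpha> \<le> \<beta>"
proof (rule ccontr)
  assume "\<not> \<alpha> \<le> \<beta>"
  then have d: "0 < \<alpha> - \<beta>" by simp
  obtain k :: nat where k: "max 1 (\<bar>K\<bar> + 1) powr (1 / (\<alpha> - \<beta>)) < real k" using reals_Archimedean2 by blast
  have "1 \<le> max 1 (\<bar>K\<bar> + 1) powr (1 / (\<alpha> - \<beta>))" using d by (intro ge_one_powr_ge_zero) auto
  then have k1: "1 \<le> k" using k by linarith
  have "\<bar>K\<bar> + 1 \<le> (max 1 (\<bar>K\<bar> + 1) powr (1 / (\<alpha> - \<beta>))) powr (\<alpha> - \<beta>)" using d by (simp add: powr_powr)
  also have "\<dots> \<le> real k powr (\<alpha> - \<beta>)" using k d by (intro powr_mono2) auto
  also have "\<dots> = real k powr \<alpha> / real k powr \<beta>" by (rule powr_diff)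
  also have "\<dots> \<le> K" using assms[OF k1] k1 by (simp add: divide_le_eq)
  finally show False by linarith
qed

text \<open>With \<open>m = k\<close> (oscillation in the whole ball) the inequality for the test functions says that
  \<open>k powr \<theta>\<close> is at most a multiple of \<open>k powr (1 / N)\<close>; with \<open>m = 1\<close> (concentration in a thin layer) it compares the
  powers of \<open>k\<close> with exponents \<open>\<theta> - (1 - \<theta>) / q - \<theta> / p\<close> and \<open>1 / N - 1 / p\<close>. Both hold for all \<open>k\<close>.\<close>

lemma affine_inequality_necessary:
  fixes p q R \<theta> K :: real
  assumes N2: "2 \<le> DIM('a::euclidean_space)" and p: "1 \<le> p" and q: "1 \<le> q" and R: "0 < R"
    and \<theta>: "0 \<le> \<theta>" "\<theta> \<le> 1" and K: "0 \<le> K"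
    and ineq: "\<And>f :: 'a \<Rightarrow> real. f \<in> sobolev_space p \<Longrightarrow> supported_in f (ball 0 R) \<Longrightarrow>
      ennpowr (Lp_norm q f) (1 - \<theta>) * ennpowr (Lp_norm p (weak_gradient f)) \<theta> \<le> ennreal K * affine_energy p f"
  shows "\<theta> \<le> 1 / real DIM('a)" "\<theta> * (1 + 1 / q - 1 / p) \<le> 1 / real DIM('a) + 1 / q - 1 / p"
proof -
  let ?n = "1 / real DIM('a)"
  obtain b0 :: 'a where b0: "b0 \<in> Basis" using nonempty_Basis by blast
  obtain A P C where APC: "0 < A" "0 < P" "0 < C" and
    ex: "\<And>m k. \<lbrakk>1 \<le> m; m \<le> k\<rbrakk> \<Longrightarrow> \<exists>f :: 'a \<Rightarrow> real. f \<in> sobolev_space p \<and> supported_in f (ball 0 R) \<and>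
       Lp_norm q f = ennreal (A * (real m / real k) powr (1 / q)) \<and>
       ennreal (P * (real m / real k) powr (1 / p) * real k) \<le> Lp_norm p (weak_gradient f) \<and>
       affine_energy p f \<le> ennreal (C * (real m / real k) powr (1 / p) * real k powr (1 / real DIM('a)))"
    by (rule bump_train_function[OF N2 p q R b0]) blast
  define K' where "K' = K * C / (A powr (1 - \<theta>) * P powr \<theta>)"
  have main: "(real m / real k) powr ((1 - \<theta>) / q) * ((real m / real k) powr (\<theta> / p) * real k powr \<theta>)
      \<le> K' * ((real m / real k) powr (1 / p) * real k powr ?n)" if mk: "1 \<le> m" "m \<le> k" for m k :: nat
  proof -
    define r where "r = real m / real k"
    have r: "0 < r" and k: "0 < real k" using mk by (auto simp: r_def)
    obtain f :: "'a \<Rightarrow> real" where f: "f \<in> sobolev_space p \<and> supported_in f (ball 0 R) \<and>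
       Lp_norm q f = ennreal (A * r powr (1 / q)) \<and>
       ennreal (P * r powr (1 / p) * real k) \<le> Lp_norm p (weak_gradient f) \<and>
       affine_energy p f \<le> ennreal (C * r powr (1 / p) * real k powr ?n)"
      using ex[OF mk] unfolding r_def[symmetric] ..
    then have f1: "f \<in> sobolev_space p" "supported_in f (ball 0 R)" "Lp_norm q f = ennreal (A * r powr (1 / q))"
       "ennreal (P * r powr (1 / p) * real k) \<le> Lp_norm p (weak_gradient f)"
       "affine_energy p f \<le> ennreal (C * r powr (1 / p) * real k powr ?n)" by auto
    have "ennreal ((A * r powr (1 / q)) powr (1 - \<theta>) * (P * r powr (1 / p) * real k) powr \<theta>)
        = ennpowr (Lp_norm q f) (1 - \<theta>) * ennpowr (ennreal (P * r powr (1 / p) * real k)) \<theta>"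
      unfolding f1(3) using APC r k by (subst (1 2) ennpowr_ennreal) (auto simp flip: ennreal_mult')
    also have "\<dots> \<le> ennpowr (Lp_norm q f) (1 - \<theta>) * ennpowr (Lp_norm p (weak_gradient f)) \<theta>"
      using f1(4) \<theta> by (intro mult_left_mono ennpowr_mono) auto
    also have "\<dots> \<le> ennreal K * affine_energy p f" by (rule ineq[OF f1(1,2)])
    also have "\<dots> \<le> ennreal K * ennreal (C * r powr (1 / p) * real k powr ?n)" by (intro mult_left_mono f1(5)) auto
    also have "\<dots> = ennreal (K * (C * r powr (1 / p) * real k powr ?n))" using K by (simp add: ennreal_mult')
    finally have "(A * r powr (1 / q)) powr (1 - \<theta>) * (P * r powr (1 / p) * real k) powr \<theta> \<le> K * (C * r powr (1 / p) * real k powr ?n)"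
      using K APC by (subst (asm) ennreal_le_iff) auto
    then have "(A powr (1 - \<theta>) * P powr \<theta>) * (r powr ((1 - \<theta>) / q) * (r powr (\<theta> / p) * real k powr \<theta>)) \<le> K * C * (r powr (1 / p) * real k powr ?n)"
      using APC r k by (simp add: powr_mult powr_powr mult_ac)
    moreover have "0 < A powr (1 - \<theta>) * P powr \<theta>" using APC by simp
    ultimately have "r powr ((1 - \<theta>) / q) * (r powr (\<theta> / p) * real k powr \<theta>) \<le> K' * (r powr (1 / p) * real k powr ?n)"
      unfolding K'_def by (simp add: field_simps)
    then show ?thesis unfolding r_def .
  qed
  show "\<theta> \<le> ?n"
  proof (rule powr_growth_le)
    fix k :: nat assume "1 \<le> k"
    then show "real k powr \<theta> \<le> K' * real k powr ?n" using main[of k k] by simp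
  qed
  have "\<theta> - (1 - \<theta>) / q - \<theta> / p \<le> ?n - 1 / p"
  proof (rule powr_growth_le)
    fix k :: nat assume k: "1 \<le> k"
    have e: "(1 / real k) powr e = real k powr - e" for e using k by (simp add: powr_divide powr_minus_divide)
    show "real k powr (\<theta> - (1 - \<theta>) / q - \<theta> / p) \<le> K' * real k powr (?n - 1 / p)"
      using main[of 1 k] k by (simp add: e algebra_simps flip: powr_add)
  qed
  then show "\<theta> * (1 + 1 / q - 1 / p) \<le> ?n + 1 / q - 1 / p" by (simp add: diff_divide_distrib algebra_simps)
qed

section \<open>The sharp range of the exponent\<close>

text \<open>Necessity provides two conditions on \<open>\<theta>\<close>, one for each part. For \<open>p \<le> q\<close>, put \<open>s = 1 / p - 1 / q\<close>, so that
  the bound on \<open>\<theta>\<close> is \<open>(1 / N - s) / (1 - s)\<close>. As \<open>1 - s\<close> is positive, the existence of an admissible \<open>\<theta> \<ge> 0\<close> forces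
  \<open>N * s \<le> 1\<close>, and the bound is smaller than one; these are the remaining hypotheses of
  \<open>affine_inequality_holds\<close>.\<close>

theorem theorem1p9:
  fixes p q R \<theta> :: real
  assumes "CARD('n::finite) \<ge> 2" "1 \<le> p" "1 \<le> q" "0 < R" "0 \<le> \<theta>" "\<theta> \<le> 1"
  shows
    "(q \<le> p \<longrightarrow>
       ((\<exists>K::real. 0 \<le> K \<and>
          (\<forall>f :: real ^ 'n \<Rightarrow> real. f \<in> sobolev_space p \<longrightarrow> supported_in f (ball 0 R) \<longrightarrow>
             ennpowr (Lp_norm q f) (1 - \<theta>) * ennpowr (Lp_norm p (weak_gradient f)) \<theta>
               \<le> ennreal K * affine_energy p f))
        \<longleftrightarrow> \<theta> \<le> 1 / real CARD('n)))
     \<and>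
     (p \<le> q \<longrightarrow>
       ((\<exists>K::real. 0 \<le> K \<and>
          (\<forall>f :: real ^ 'n \<Rightarrow> real. f \<in> sobolev_space p \<longrightarrow> supported_in f (ball 0 R) \<longrightarrow>
             ennpowr (Lp_norm q f) (1 - \<theta>) * ennpowr (Lp_norm p (weak_gradient f)) \<theta>
               \<le> ennreal K * affine_energy p f))
        \<longleftrightarrow> 0 \<le> \<theta> \<and> \<theta> \<le> (1 / real CARD('n) + 1 / q - 1 / p) / (1 + 1 / q - 1 / p)))"
proof -
  note pq = assms(2,3) and \<theta> = assms(5,6)
  have N2: "2 \<le> DIM(real ^ 'n)" and N: "real DIM(real ^ 'n) = real CARD('n)" "2 \<le> real CARD('n)" "0 < real CARD('n)"
    using assms(1) by auto
  let ?K = "\<exists>K::real. 0 \<le> K \<and>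
          (\<forall>f :: real ^ 'n \<Rightarrow> real. f \<in> sobolev_space p \<longrightarrow> supported_in f (ball 0 R) \<longrightarrow>
             ennpowr (Lp_norm q f) (1 - \<theta>) * ennpowr (Lp_norm p (weak_gradient f)) \<theta>
               \<le> ennreal K * affine_energy p f)"
  have necessary: "\<theta> \<le> 1 / real CARD('n) \<and> \<theta> * (1 + 1 / q - 1 / p) \<le> 1 / real CARD('n) + 1 / q - 1 / p" if ?K
  proof -
    from that obtain K where K: "0 \<le> K" "\<forall>f :: real ^ 'n \<Rightarrow> real. f \<in> sobolev_space p \<longrightarrow> supported_in f (ball 0 R) \<longrightarrow>
             ennpowr (Lp_norm q f) (1 - \<theta>) * ennpowr (Lp_norm p (weak_gradient f)) \<theta>
               \<le> ennreal K * affine_energy p f" by (elim exE conjE)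
    show ?thesis
      using affine_inequality_necessary[OF N2 pq assms(4) \<theta> K(1) K(2)[rule_format]] unfolding N(1) by (rule conjI)
  qed
  have sufficient: ?K if "q \<le> p \<and> s = 0 \<or> p \<le> q \<and> s = 1 / p - 1 / q" "real CARD('n) * s \<le> 1"
    "\<theta> < 1" "\<theta> * real CARD('n) * (1 - s) \<le> 1 - real CARD('n) * s" for s
    using that by (intro affine_inequality_holds[OF N2 pq assms(4), of s] \<theta>(1)) (simp_all only: N(1))
  show ?thesis
  proof (intro conjI impI iffI)
    show "\<theta> \<le> 1 / real CARD('n)" if ?K using necessary[OF that] by simp
    show ?K if "q \<le> p" "\<theta> \<le> 1 / real CARD('n)"
    proof -
      have "\<theta> * real CARD('n) \<le> 1" using that(2) N(3) by (simp add: pos_le_divide_eq)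
      moreover have "1 / real CARD('n) < 1" using N(2) by simp
      then have "\<theta> < 1" using that(2) by linarith
      ultimately show ?thesis using that(1) by (intro sufficient[of 0]) simp_all
    qed
    assume "p \<le> q"
    define s where "s = 1 / p - 1 / q"
    have "0 < 1 / q" "1 / p \<le> 1" using pq by auto
    then have s: "0 < 1 - s" unfolding s_def by linarith
    have "\<theta> \<le> (1 / real CARD('n) + 1 / q - 1 / p) / (1 + 1 / q - 1 / p) \<longleftrightarrow> \<theta> \<le> (1 / real CARD('n) - s) / (1 - s)"
      by (simp add: s_def algebra_simps)
    also have "\<dots> \<longleftrightarrow> \<theta> * (1 - s) \<le> 1 / real CARD('n) - s" using s by (simp add: pos_le_divide_eq)
    finally have crit: "\<theta> \<le> (1 / real CARD('n) + 1 / q - 1 / p) / (1 + 1 / q - 1 / p) \<longleftrightarrow> \<theta> * (1 - s) \<le> 1 / real CARD('n) - s" .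
    show "0 \<le> \<theta>" by (rule \<theta>(1))
    show "\<theta> \<le> (1 / real CARD('n) + 1 / q - 1 / p) / (1 + 1 / q - 1 / p)" if ?K
      unfolding crit using necessary[OF that] by (simp add: s_def algebra_simps)
    show ?K if "0 \<le> \<theta> \<and> \<theta> \<le> (1 / real CARD('n) + 1 / q - 1 / p) / (1 + 1 / q - 1 / p)"
    proof (rule sufficient)
      have c: "\<theta> * (1 - s) \<le> 1 / real CARD('n) - s" using that crit by simp
      show "q \<le> p \<and> s = 0 \<or> p \<le> q \<and> s = 1 / p - 1 / q" using \<open>p \<le> q\<close> by (simp add: s_def)
      have "real CARD('n) * (\<theta> * (1 - s)) \<le> real CARD('n) * (1 / real CARD('n) - s)"
        using c by (rule mult_left_mono) simp
      then show c': "\<theta> * real CARD('n) * (1 - s) \<le> 1 - real CARD('n) * s"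
        using N(3) by (simp add: algebra_simps)
      have "0 \<le> \<theta> * real CARD('n) * (1 - s)" using \<theta>(1) s by (intro mult_nonneg_nonneg) auto
      then show "real CARD('n) * s \<le> 1" using c' by linarith
      have "1 / real CARD('n) < 1" using N(2) by simp
      then have "1 / real CARD('n) - s < 1 * (1 - s)" by simp
      with c have "\<theta> * (1 - s) < 1 * (1 - s)" by (rule order.strict_trans1)
      then show "\<theta> < 1" using s by (simp only: mult_less_cancel_right_pos)
    qed
  qed
qed

end
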